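(* In the setting of the context, for each $v\in H^1(\Omega)$ and $w_h\in\mathcal V^0$ there holds $$|J_h(v,w_h)|\le\sqrt{\tau h}\,\|\beta\|_{W^{1,\infty}}\,\|v\|_{H^1(\Omega)}\,|w_h|_\beta .$$
   Context: **Geometry.** Let $L>0$, $0<x_0<L$, $0<\gamma<\pi/2$ with $(L-x_0)\tan\gamma<L$, and $\Omega=\{(x,y)\in(0,L)^2:\ y>(x-x_0)\tan\gamma\}$: a square from which a ramp of angle $\gamma$ is cut out; the ramp is the part of $\partial\Omega$ on the line $y=(x-x_0)\tan\gamma$. **Mesh.** The square is divided into a Cartesian background mesh of square cells $\widehat E$ of side length $h$; $\mathcal T_h$ is the set of all non-degenerate $E=\widehat E\cap\Omega$. The faces of a cell are its edges; $\mathcal F_i$ = interior faces (shared by two cells), $\mathcal F_b$ = faces on $\partial\Omega$, $\mathcal F=\mathcal F_i\cup\mathcal F_b$. $n_E$ is the outer unit normal of $E$; $|E|$ area, $|e|$ length. **Velocity.** $\beta:\overline\Omega\to\mathbb R^2$ is Lipschitz continuous, $\nabla\cdot\beta=0$, $\beta\cdot n=0$ along the ramp, $\beta$ does not vanish on the ramp, and the sign of $\beta\cdot n$ is constant along each face of the mesh. $\|\beta\|_{W^{1,\infty}}$ is the usual norm, with $\|\beta\|_{W^{1,\infty}}\ge\|\beta\|_\infty=\max_x|\beta(x)|_2$. **Stabilized cut cells.** A triangular cut cell $E\in\mathcal T_h$ has a hypotenuse $e_{bdy}$ on the ramp, one inflow face $e_{in}=e_{in}(E)$ ($\beta\cdot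 n_E<0$) with neighbor $E_{in}$, and one outflow face $e_{out}=e_{out}(E)$ ($\beta\cdot n_E>0$) with neighbor $E_{out}$. $\mathcal I$ is the set of triangular cut cells with $\max(|e_{in}|,|e_{out}|)<\tfrac12h$; for $E\in\mathcal I$, $e_{in},e_{out}\notin\mathcal F_b$. $\mathcal F_{\setminus io}$ = faces that are neither $e_{in}$ nor $e_{out}$ of cells in $\mathcal I$. With a fixed $\tau>0$, the capacity is $\alpha_E=\min\big(\frac{|E|}{\tau h\int_{e_{in}}|\beta\cdot n|},1\big)$. **Spaces, means, jumps.** $\mathcal V^0$ = functions in $L^2(\Omega)$ constant on each $E\in\mathcal T_h$; $\mathcal V^0_*=H^1(\Omega)+\mathcal V^0$. For $v\in\mathcal V^0_*$, a cell $E$ and a face $e\subset\partial E$, the $\beta$-weighted mean $\bar v_{E,e}\in\mathbb R$ is defined by $\bar v_{E,e}\int_e|\beta\cdot n|\,ds=\int_e|\beta\cdot n|\,\mathrm{tr}(v|_E)\,ds$ (irrelevant, say $0$, where $\beta\cdot n\equiv0$ on $e$). On an interior face $e$ between $E_1,E_2$: $[\![\bar v]\!]=\bar v_{E_1,e}n_{E_1}+\bar v_{E_2,e}n_{E_2}$; on a boundary face of $E$: $[\![\bar v]\!]=\bar v_{E,e}n_E$. $[\![\bar v]\!]^2=[\![\bar v]\!]\cdot[\![\bar v]\!]$. For $E\in\mathcal I$: $\bar v_{in}=\bar v_{E_{in},e_{in}}$, $\bar v_{out}=\bar v_{E_{out},e_{out}}$. **Stabilization term.** For $v\in\mathcal V^0_*$,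 $w_h\in\mathcal V^0$, $$J_h(v,w_h)=\sum_{E\in\mathcal I}(1-\alpha_E)\int_{e_{out}(E)}(\bar v_{in}-\bar v_{E,e_{out}})\,\beta\cdot[\![\bar w_h]\!]\,ds.$$ **Seminorm.** For $v\in\mathcal V^0_*$, $$|v|_\beta^2=\sum_{e\in\mathcal F_{\setminus io}}\int_e|\beta\cdot n|[\![\bar v]\!]^2+\sum_{E\in\mathcal I}\Big(\alpha_E\sum_{e\in\{e_{in}(E),e_{out}(E)\}}\int_e|\beta\cdot n|[\![\bar v]\!]^2+(1-\alpha_E)\int_{e_{out}(E)}|\beta\cdot n|(\bar v_{out}-\bar v_{in})^2\Big).$$ *)

theory Defs
  imports "HOL-Analysis.Analysis" "HOL-Probability.Essential_Supremum"
begin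

type_synonym plane = "real \<times> real"

definition pderiv_dir :: "plane \<Rightarrow> (plane \<Rightarrow> real) \<Rightarrow> plane \<Rightarrow> real" where
  "pderiv_dir b \<phi> x = frechet_derivative \<phi> (at x) b"

text \<open>Functions of class \<open>C\<^sup>\<infinity>\<close> on the whole plane: all iterated partial
  derivatives exist and are again (Frechet) differentiable, hence continuous.\<close>

definition smooth :: "(plane \<Rightarrow> real) \<Rightarrow> bool" where
  "smooth \<phi> \<longleftrightarrow> (\<exists>S. \<phi> \<in> S \<and>
     (\<forall>g\<in>S. (\<forall>x. g differentiable (at x)) \<and> (\<forall>b\<in>Basis. pderiv_dir b g \<in> S)))"

definition test_function :: "plane set \<Rightarrow> (plane \<Rightarrow> real) \<Rightarrow> bool" where
  "test_function U \<psi> \<longleftrightarrow>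
     smooth \<psi> \<and> compact (closure {x. \<psi> x \<noteq> 0}) \<and> closure {x. \<psi> x \<noteq> 0} \<subseteq> U"

definition locally_integrable ::
    "plane set \<Rightarrow> (plane \<Rightarrow> 'b::euclidean_space) \<Rightarrow> bool" where
  "locally_integrable U f \<longleftrightarrow> (\<forall>K. compact K \<and> K \<subseteq> U \<longrightarrow> integrable (lebesgue_on K) f)"

definition square_integrable :: "'a measure \<Rightarrow> ('a \<Rightarrow> real) \<Rightarrow> bool" where
  "square_integrable M f \<longleftrightarrow> f \<in> borel_measurable M \<and> integrable M (\<lambda>x. (f x)\<^sup>2)"

definition has_weak_pderiv ::
    "plane set \<Rightarrow> plane \<Rightarrow> (plane \<Rightarrow> 'b::euclidean_space) \<Rightarrow> (plane \<Rightarrow> 'b) \<Rightarrow> bool" where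
  "has_weak_pderiv U b f g \<longleftrightarrow>
     locally_integrable U f \<and> locally_integrable U g \<and>
     (\<forall>\<psi>. test_function U \<psi> \<longrightarrow>
        (LINT x|lebesgue_on U. pderiv_dir b \<psi> x *\<^sub>R f x)
          = - (LINT x|lebesgue_on U. \<psi> x *\<^sub>R g x))"

text \<open>Determined up to null sets.\<close>

definition weak_pderiv ::
    "plane set \<Rightarrow> plane \<Rightarrow> (plane \<Rightarrow> 'b::euclidean_space) \<Rightarrow> plane \<Rightarrow> 'b" where
  "weak_pderiv U b f = (SOME g. has_weak_pderiv U b f g)"

definition has_weak_divergence ::
    "plane set \<Rightarrow> (plane \<Rightarrow> plane) \<Rightarrow> (plane \<Rightarrow> real) \<Rightarrow> bool" where
  "has_weak_divergence U F d \<longleftrightarrow>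
     locally_integrable U F \<and> locally_integrable U d \<and>
     (\<forall>\<psi>. test_function U \<psi> \<longrightarrow>
        (LINT x|lebesgue_on U. (\<Sum>b\<in>Basis. pderiv_dir b \<psi> x * (F x \<bullet> b)))
          = - (LINT x|lebesgue_on U. \<psi> x * d x))"

text \<open>Elements of Lebesgue and Sobolev spaces are represented by functions on the whole plane;
  only their values almost everywhere in \<open>U\<close> matter.\<close>

definition H1 :: "plane set \<Rightarrow> (plane \<Rightarrow> real) set" where
  "H1 U = {v. square_integrable (lebesgue_on U) v \<and>
     (\<forall>b\<in>Basis. (\<exists>g. has_weak_pderiv U b v g) \<and>
        square_integrable (lebesgue_on U) (weak_pderiv U b v))}"

definition H1_norm :: "plane set \<Rightarrow> (plane \<Rightarrow> real) \<Rightarrow> real" where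
  "H1_norm U v = sqrt ((LINT x|lebesgue_on U. (v x)\<^sup>2)
     + (\<Sum>b\<in>Basis. LINT x|lebesgue_on U. (weak_pderiv U b v x)\<^sup>2))"

text \<open>The \<open>W\<^sup>1\<^sup>,\<^sup>\<infinity>\<close> norm in the convention: maximum of the \<open>L\<^sup>\<infinity>\<close> norms of the
  function and of its first order partial derivatives, with the Euclidean norm on values.
  It is only meant for fields that are continuous up to the boundary.\<close>

definition W1inf_norm :: "plane set \<Rightarrow> (plane \<Rightarrow> plane) \<Rightarrow> real" where
  "W1inf_norm U F = max (SUP x\<in>closure U. norm (F x))
     (MAX b\<in>Basis. real_of_ereal
        (esssup (lebesgue_on U) (\<lambda>x. ereal (norm (weak_pderiv U b F x)))))"

definition segment_measure :: "plane \<Rightarrow> plane \<Rightarrow> plane measure" where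
  "segment_measure a b = scale_measure (ennreal (dist a b))
     (distr (restrict_space lborel {0..1}) (restrict_space borel (closed_segment a b))
        (linepath a b))"

text \<open>Arc length measure on a set that is a segment; it does not depend on the order in which
  the end points are chosen.\<close>

definition arc_measure :: "plane set \<Rightarrow> plane measure" where
  "arc_measure e = (let p = (SOME p. e = closed_segment (fst p) (snd p))
     in segment_measure (fst p) (snd p))"

definition face_length :: "plane set \<Rightarrow> real" where
  "face_length e = measure (arc_measure e) e"

text \<open>The trace operator \<open>H\<^sup>1(E) \<rightarrow> L\<^sup>2(e)\<close> is the continuous extension of the restriction
  map on smooth functions.\<close>

definition has_trace ::
    "plane set \<Rightarrow> plane set \<Rightarrow> (plane \<Rightarrow> real) \<Rightarrow> (plane \<Rightarrow> real) \<Rightarrow> bool" where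
  "has_trace E e v t \<longleftrightarrow>
     v \<in> H1 E \<and> square_integrable (arc_measure e) t \<and>
     (\<exists>\<phi> :: nat \<Rightarrow> plane \<Rightarrow> real. (\<forall>n. smooth (\<phi> n)) \<and>
        (\<lambda>n. H1_norm E (\<lambda>x. \<phi> n x - v x)) \<longlonglongrightarrow> 0 \<and>
        (\<lambda>n. LINT x|arc_measure e. (\<phi> n x - t x)\<^sup>2) \<longlonglongrightarrow> 0)"

definition face_trace :: "plane set \<Rightarrow> plane set \<Rightarrow> (plane \<Rightarrow> real) \<Rightarrow> plane \<Rightarrow> real" where
  "face_trace E e v = (SOME t. has_trace E e v t)"

definition ramp_domain :: "real \<Rightarrow> real \<Rightarrow> real \<Rightarrow> plane set" where
  "ramp_domain L x0 \<gamma> =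
     {(x, y). 0 < x \<and> x < L \<and> 0 < y \<and> y < L \<and> y > (x - x0) * tan \<gamma>}"

definition ramp :: "real \<Rightarrow> real \<Rightarrow> real \<Rightarrow> plane set" where
  "ramp L x0 \<gamma> = {(x, y) \<in> frontier (ramp_domain L x0 \<gamma>). y = (x - x0) * tan \<gamma>}"

definition background_cell :: "real \<Rightarrow> nat \<Rightarrow> nat \<Rightarrow> plane set" where
  "background_cell h i j =
     box (real i * h, real j * h) (real (Suc i) * h, real (Suc j) * h)"

text \<open>Background cells and mesh cells are taken to be open. A cell is degenerate if it has zero
  area.\<close>

definition cut_mesh :: "plane set \<Rightarrow> real \<Rightarrow> nat \<Rightarrow> plane set set" where
  "cut_mesh \<Omega> h N = {E. \<exists>i<N. \<exists>j<N. E = background_cell h i j \<inter> \<Omega> \<and> measure lebesgue E > 0}"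

text \<open>Mesh cells are convex, so their closures are polytopes and the polytope edges are the
  sides of the polygon.\<close>

definition cell_faces :: "plane set \<Rightarrow> plane set set" where
  "cell_faces E = {e. e edge_of (closure E)}"

definition interior_faces :: "plane set set \<Rightarrow> plane set set" where
  "interior_faces T = {e. \<exists>E1\<in>T. \<exists>E2\<in>T. E1 \<noteq> E2 \<and> e \<in> cell_faces E1 \<and> e \<in> cell_faces E2}"

definition boundary_faces :: "plane set \<Rightarrow> plane set set \<Rightarrow> plane set set" where
  "boundary_faces \<Omega> T = {e. (\<exists>E\<in>T. e \<in> cell_faces E) \<and> e \<subseteq> frontier \<Omega>}"

definition mesh_faces :: "plane set \<Rightarrow> plane set set \<Rightarrow> plane set set" where
  "mesh_faces \<Omega> T = interior_faces T \<union> boundary_faces \<Omega> T"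

text \<open>For a convex cell this is the outer unit normal on its face \<open>e\<close>.\<close>

definition outer_normal :: "plane set \<Rightarrow> plane set \<Rightarrow> plane" where
  "outer_normal E e = (THE n. norm n = 1 \<and>
     (\<forall>x\<in>e. \<forall>y\<in>e. n \<bullet> (y - x) = 0) \<and> (\<forall>x\<in>e. \<forall>y\<in>E. n \<bullet> (y - x) < 0))"

definition neighbor :: "plane set set \<Rightarrow> plane set \<Rightarrow> plane set \<Rightarrow> plane set" where
  "neighbor T E e = (THE E'. E' \<in> T \<and> E' \<noteq> E \<and> e \<in> cell_faces E')"

text \<open>On a face, the sign of the normal velocity is read on the relative interior: it may vanish
  at the end points.\<close>

definition inflow_face :: "(plane \<Rightarrow> plane) \<Rightarrow> plane set \<Rightarrow> plane set" where
  "inflow_face \<beta> E =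
     (THE e. e \<in> cell_faces E \<and> (\<forall>x\<in>rel_interior e. \<beta> x \<bullet> outer_normal E e < 0))"

definition outflow_face :: "(plane \<Rightarrow> plane) \<Rightarrow> plane set \<Rightarrow> plane set" where
  "outflow_face \<beta> E =
     (THE e. e \<in> cell_faces E \<and> (\<forall>x\<in>rel_interior e. \<beta> x \<bullet> outer_normal E e > 0))"

text \<open>A mesh cell can be a triangle only if it is cut by the ramp.\<close>

definition stab_cells :: "plane set set \<Rightarrow> real \<Rightarrow> (plane \<Rightarrow> plane) \<Rightarrow> plane set set" where
  "stab_cells T h \<beta> = {E \<in> T. 2 simplex (closure E) \<and>
     max (face_length (inflow_face \<beta> E)) (face_length (outflow_face \<beta> E)) < h / 2}"

definition non_io_faces ::
    "plane set \<Rightarrow> plane set set \<Rightarrow> real \<Rightarrow> (plane \<Rightarrow> plane) \<Rightarrow> plane set set" where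
  "non_io_faces \<Omega> T h \<beta> = mesh_faces \<Omega> T
     - (inflow_face \<beta> ` stab_cells T h \<beta> \<union> outflow_face \<beta> ` stab_cells T h \<beta>)"

definition flux :: "(plane \<Rightarrow> plane) \<Rightarrow> plane set \<Rightarrow> plane set \<Rightarrow> real" where
  "flux \<beta> E e = (LINT x|arc_measure e. \<bar>\<beta> x \<bullet> outer_normal E e\<bar>)"

definition capacity :: "real \<Rightarrow> real \<Rightarrow> (plane \<Rightarrow> plane) \<Rightarrow> plane set \<Rightarrow> real" where
  "capacity \<tau> h \<beta> E = min (measure lebesgue E / (\<tau> * h * flux \<beta> E (inflow_face \<beta> E))) 1"

definition piecewise_constant :: "plane set \<Rightarrow> plane set set \<Rightarrow> (plane \<Rightarrow> real) set" where
  "piecewise_constant \<Omega> T = {w. square_integrable (lebesgue_on \<Omega>) w \<and>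
     (\<forall>E\<in>T. \<exists>c. AE x in lebesgue_on E. w x = c)}"

text \<open>Division by zero gives the value 0 on faces without flux.\<close>

definition weighted_mean ::
    "(plane \<Rightarrow> plane) \<Rightarrow> (plane \<Rightarrow> real) \<Rightarrow> plane set \<Rightarrow> plane set \<Rightarrow> real" where
  "weighted_mean \<beta> v E e =
     (LINT x|arc_measure e. \<bar>\<beta> x \<bullet> outer_normal E e\<bar> * face_trace E e v x) / flux \<beta> E e"

text \<open>The sum has two terms on an interior face and one term on a boundary face.\<close>

definition jump ::
    "plane set set \<Rightarrow> (plane \<Rightarrow> plane) \<Rightarrow> (plane \<Rightarrow> real) \<Rightarrow> plane set \<Rightarrow> plane" where
  "jump T \<beta> v e =
     (\<Sum>E | E \<in> T \<and> e \<in> cell_faces E. weighted_mean \<beta> v E e *\<^sub>R outer_normal E e)"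

definition mean_in ::
    "plane set set \<Rightarrow> (plane \<Rightarrow> plane) \<Rightarrow> (plane \<Rightarrow> real) \<Rightarrow> plane set \<Rightarrow> real" where
  "mean_in T \<beta> v E =
     weighted_mean \<beta> v (neighbor T E (inflow_face \<beta> E)) (inflow_face \<beta> E)"

definition mean_out ::
    "plane set set \<Rightarrow> (plane \<Rightarrow> plane) \<Rightarrow> (plane \<Rightarrow> real) \<Rightarrow> plane set \<Rightarrow> real" where
  "mean_out T \<beta> v E =
     weighted_mean \<beta> v (neighbor T E (outflow_face \<beta> E)) (outflow_face \<beta> E)"

definition stabilization ::
    "plane set set \<Rightarrow> real \<Rightarrow> real \<Rightarrow> (plane \<Rightarrow> plane) \<Rightarrow> (plane \<Rightarrow> real) \<Rightarrow> (plane \<Rightarrow> real) \<Rightarrow> real"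
  where
  "stabilization T h \<tau> \<beta> v w =
     (\<Sum>E\<in>stab_cells T h \<beta>. (1 - capacity \<tau> h \<beta> E) *
        (LINT x|arc_measure (outflow_face \<beta> E).
           (mean_in T \<beta> v E - weighted_mean \<beta> v E (outflow_face \<beta> E))
             * (\<beta> x \<bullet> jump T \<beta> w (outflow_face \<beta> E))))"

text \<open>In the integral of \<open>\<bar>\<beta> \<bullet> n\<bar>\<close> over a face the orientation of the normal is irrelevant, so
  any cell with that face may supply it.\<close>

definition face_flux :: "plane set set \<Rightarrow> (plane \<Rightarrow> plane) \<Rightarrow> plane set \<Rightarrow> real" where
  "face_flux T \<beta> e = flux \<beta> (SOME E. E \<in> T \<and> e \<in> cell_faces E) e"

definition beta_seminorm ::
    "plane set \<Rightarrow> plane set set \<Rightarrow> real \<Rightarrow> real \<Rightarrow> (plane \<Rightarrow> plane) \<Rightarrow> (plane \<Rightarrow> real) \<Rightarrow> real" where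
  "beta_seminorm \<Omega> T h \<tau> \<beta> v = sqrt (
     (\<Sum>e\<in>non_io_faces \<Omega> T h \<beta>. face_flux T \<beta> e * (jump T \<beta> v e \<bullet> jump T \<beta> v e)) +
     (\<Sum>E\<in>stab_cells T h \<beta>.
        capacity \<tau> h \<beta> E *
          (\<Sum>e\<in>{inflow_face \<beta> E, outflow_face \<beta> E}.
             flux \<beta> E e * (jump T \<beta> v e \<bullet> jump T \<beta> v e)) +
        (1 - capacity \<tau> h \<beta> E) * flux \<beta> E (outflow_face \<beta> E)
          * (mean_out T \<beta> v E - mean_in T \<beta> v E)\<^sup>2))"

end

theory Submission
  imports Defs "HOL-Computational_Algebra.Polynomial" "HOL-Real_Asymp.Real_Asymp"
begin

text \<open>
  On a triangular cut cell \<open>E\<close> the field \<open>\<beta>\<close> is divergence free and tangential to the hypotenuse, so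
  inflow and outflow carry the same flux \<open>F\<close>, and the divergence theorem for \<open>v \<beta>\<close> gives
  \<open>F (v\<^sub>o\<^sub>u\<^sub>t - v\<^sub>i\<^sub>n) = \<integral>\<^sub>E \<beta> \<bullet> \<nabla>v\<close>, where \<open>v\<^sub>o\<^sub>u\<^sub>t\<close> and \<open>v\<^sub>i\<^sub>n\<close> are the weighted means on the two legs.
  By Cauchy-Schwarz the right-hand side is at most \<open>\<bar>E\<bar>\<^sup>1\<^sup>/\<^sup>2 sup \<bar>\<beta>\<bar>\<close> times the norm of \<open>\<nabla>v\<close> on \<open>E\<close>. Only cells with
  capacity \<open>\<alpha> < 1\<close> contribute, and there \<open>\<bar>E\<bar> = \<alpha> \<tau> h F\<close>; a discrete Cauchy-Schwarz inequality over the
  cells then yields the factors \<open>sqrt (\<tau> h)\<close> and \<open>sqrt (\<alpha> F) \<bar>jump w\<bar>\<close>.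

  The traces of \<open>v\<close> on a leg taken from \<open>E\<close> and from the neighbouring cell coincide, because both are limits
  of the same smooth approximations of \<open>v\<close>, which are dense in \<open>H\<^sup>1\<close> of the convex domain.
\<close>

section \<open>Smooth functions and test functions\<close>

text \<open>What shapes the proof is the low regularity at the ramp. The hypothesis on the
  divergence of \<open>\<beta>\<close> speaks only of test functions supported in
  \<open>\<Omega>\<close>, while the hypotenuse of a cut cell lies on the boundary. The identity on
  \<open>E\<close> is therefore obtained with cutoffs that vanish near the hypotenuse and have
  gradients of size n there; Lipschitz continuity and tangency make the normal velocity at most a
  constant times the distance to the ramp, and this cancels the factor n. A second obstacle is that
  traces are picked by a choice operator from approximating sequences. They become accessible
  through an inequality bounding the restriction of a smooth function to a leg by its
  \<open>H1_norm\<close> on an adjacent cell. That inequality is itself an instance of the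
  divergence theorem on the triangle, applied to the square of the function times a field radial
  from a vertex, and is carried to the neighbouring cell by reflection. Since the flow may enter
  through either leg, the estimate for one triangle leaves open on which side of each leg the trace
  is taken, and one statement serves both directions.\<close>

lemma Basis_plane: "(Basis :: plane set) = {(1, 0), (0, 1)}"
  by (auto simp: Basis_prod_def)

lemma sum_Basis_plane:
  fixes f :: "plane \<Rightarrow> 'a::ab_group_add"
  shows "(\<Sum>b\<in>Basis. f b) = f (1, 0) + f (0, 1)"
  by (simp add: Basis_plane)

lemma pderiv_dir_eqI: "(f has_derivative f') (at x) \<Longrightarrow> pderiv_dir b f x = f' b"
  unfolding pderiv_dir_def by (simp add: frechet_derivative_at[symmetric])

text \<open>\<open>smooth\<close> asks for some set that is closed under partial derivatives, and an
  invariant \<open>P\<close> supplies one. Smoothness of a function is thus shown by placing it in a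
  family stable under differentiation.\<close>

lemma smooth_coinduct:
  assumes "P f"
    and "\<And>g x. P g \<Longrightarrow> g differentiable (at x)"
    and "\<And>g b. P g \<Longrightarrow> b \<in> Basis \<Longrightarrow> P (pderiv_dir b g)"
  shows "smooth f"
  unfolding smooth_def by (rule exI[of _ "Collect P"]) (use assms in auto)

lemma smooth_differentiable: "smooth f \<Longrightarrow> f differentiable (at x)"
  unfolding smooth_def by blast

lemma smooth_pderiv_dir: "smooth f \<Longrightarrow> b \<in> Basis \<Longrightarrow> smooth (pderiv_dir b f)"
  unfolding smooth_def by blast

lemma smooth_has_derivative:
  assumes "smooth f"
  shows "(f has_derivative (\<lambda>k. \<Sum>b\<in>Basis. (k \<bullet> b) * pderiv_dir b f x)) (at x)"
proof -
  have d: "(f has_derivative frechet_derivative f (at x)) (at x)"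
    using smooth_differentiable[OF assms] frechet_derivative_works by blast
  then interpret bounded_linear "frechet_derivative f (at x)"
    by (rule has_derivative_bounded_linear)
  have "frechet_derivative f (at x) k = (\<Sum>b\<in>Basis. (k \<bullet> b) * pderiv_dir b f x)" for k
  proof -
    have "frechet_derivative f (at x) k = frechet_derivative f (at x) (\<Sum>b\<in>Basis. (k \<bullet> b) *\<^sub>R b)"
      by (simp add: euclidean_representation)
    then show ?thesis by (simp add: sum scaleR pderiv_dir_def)
  qed
  then have "frechet_derivative f (at x) = (\<lambda>k. \<Sum>b\<in>Basis. (k \<bullet> b) * pderiv_dir b f x)" by (rule ext)
  with d show ?thesis by simp
qed

lemma smooth_continuous_on: "smooth f \<Longrightarrow> continuous_on S f"
  using smooth_differentiable by (metis differentiable_imp_continuous_within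
      continuous_at_imp_continuous_on)

lemma smooth_borel_measurable: "smooth f \<Longrightarrow> f \<in> borel_measurable borel"
  by (intro borel_measurable_continuous_onI smooth_continuous_on)

lemma pderiv_dir_const [simp]: "pderiv_dir b (\<lambda>_. c) = (\<lambda>_. 0)"
  by (rule ext, subst pderiv_dir_eqI[OF has_derivative_const]) simp

lemma smooth_const [simp]: "smooth (\<lambda>_. c)"
  by (rule smooth_coinduct[of "\<lambda>f. \<exists>c. f = (\<lambda>_. c)"]) auto

lemma pderiv_dir_mult:
  assumes "smooth f" "smooth g"
  shows "pderiv_dir b (\<lambda>x. f x * g x) x = f x * pderiv_dir b g x + pderiv_dir b f x * g x"
  using smooth_differentiable[OF assms(1)] smooth_differentiable[OF assms(2)]
  unfolding frechet_derivative_works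
  by (subst pderiv_dir_eqI[OF has_derivative_mult]) (auto simp: pderiv_dir_def)

text \<open>A derivative of a product is a sum of two products, so products alone are not an
  invariant for the coinduction. Finite sums of products of smooth functions are.\<close>

inductive sum_of_products :: "(plane \<Rightarrow> real) \<Rightarrow> bool" where
  product: "smooth f \<Longrightarrow> smooth g \<Longrightarrow> sum_of_products (\<lambda>x. f x * g x)"
| sum: "sum_of_products f \<Longrightarrow> sum_of_products g \<Longrightarrow> sum_of_products (\<lambda>x. f x + g x)"

lemma sum_of_products_differentiable: "sum_of_products f \<Longrightarrow> f differentiable (at x)"
  by (induction rule: sum_of_products.induct)
     (auto intro!: differentiable_mult differentiable_add intro: smooth_differentiable)

lemma sum_of_products_pderiv_dir:
  "sum_of_products f \<Longrightarrow> b \<in> Basis \<Longrightarrow> sum_of_products (pderiv_dir b f)"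
proof (induction rule: sum_of_products.induct)
  case (product f g)
  have "sum_of_products (\<lambda>x. f x * pderiv_dir b g x + pderiv_dir b f x * g x)"
    using product by (intro sum_of_products.intros smooth_pderiv_dir)
  then show ?case using pderiv_dir_mult[OF product(1,2), of b] by presburger
next
  case (sum f g)
  have "pderiv_dir b (\<lambda>x. f x + g x) = (\<lambda>x. pderiv_dir b f x + pderiv_dir b g x)"
    using sum_of_products_differentiable[OF sum(1)] sum_of_products_differentiable[OF sum(2)]
    unfolding frechet_derivative_works
    by (intro ext, subst pderiv_dir_eqI[OF has_derivative_add]) (auto simp: pderiv_dir_def)
  then show ?case using sum by (auto intro: sum_of_products.sum)
qed

lemma smooth_sum_of_products: "sum_of_products f \<Longrightarrow> smooth f"
  by (rule smooth_coinduct[of sum_of_products])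
     (auto intro: sum_of_products_differentiable sum_of_products_pderiv_dir)

lemma smooth_mult: "smooth f \<Longrightarrow> smooth g \<Longrightarrow> smooth (\<lambda>x. f x * g x)"
  by (rule smooth_sum_of_products) (rule product)

lemma smooth_add: "smooth f \<Longrightarrow> smooth g \<Longrightarrow> smooth (\<lambda>x. f x + g x)"
  using smooth_sum_of_products[OF sum[OF product product], of f "\<lambda>_. 1" g "\<lambda>_. 1"] by simp

lemma smooth_cmult: "smooth f \<Longrightarrow> smooth (\<lambda>x. c * f x)"
  by (rule smooth_mult) auto

lemma smooth_diff: "smooth f \<Longrightarrow> smooth g \<Longrightarrow> smooth (\<lambda>x. f x - g x)"
  using smooth_add[of f "\<lambda>x. (-1) * g x"] smooth_cmult[of g "-1"] by simp

lemma smooth_power2: "smooth f \<Longrightarrow> smooth (\<lambda>x. (f x)\<^sup>2)"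
  unfolding power2_eq_square by (rule smooth_mult)

lemma pderiv_dir_affine: "pderiv_dir b (\<lambda>z. c + l \<bullet> z) = (\<lambda>_. l \<bullet> b)"
  by (rule ext, rule pderiv_dir_eqI) (auto intro!: derivative_eq_intros)

lemma smooth_affine: "smooth (\<lambda>z. c + l \<bullet> z)"
proof (rule smooth_coinduct[of "\<lambda>f. \<exists>c l. f = (\<lambda>z. c + l \<bullet> z)"])
  fix g :: "plane \<Rightarrow> real" and b assume "\<exists>c l. g = (\<lambda>z. c + l \<bullet> z)"
  then obtain c l where g: "g = (\<lambda>z. c + l \<bullet> z)" by blast
  then have "pderiv_dir b g = (\<lambda>z. l \<bullet> b + 0 \<bullet> z)" by (simp add: pderiv_dir_affine)
  then show "\<exists>c l. pderiv_dir b g = (\<lambda>z. c + l \<bullet> z)" by blast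
next
  show "\<exists>c' l'. (\<lambda>z. c + l \<bullet> z) = (\<lambda>z. c' + l' \<bullet> z)" by blast
qed (auto intro!: derivative_intros)

text \<open>Diagonal maps cover every change of variables below: dilations (\<open>r = s\<close>),
  the point reflection inside a convolution (\<open>r = s = -1\<close>), and mirror images in a leg
  of a triangle (one entry negative).\<close>

definition diag :: "real \<Rightarrow> real \<Rightarrow> plane \<Rightarrow> plane" where
  "diag r s z = (r * fst z, s * snd z)"

lemma bounded_linear_diag: "bounded_linear (diag r s)"
  unfolding diag_def by (intro bounded_linear_Pair bounded_linear_const_mult bounded_linear_fst bounded_linear_snd)

lemma pderiv_dir_compose_diag:
  assumes "smooth f" "b \<in> Basis"
  shows "pderiv_dir b (\<lambda>z. f (c + diag r s z)) z = (diag r s b \<bullet> b) * pderiv_dir b f (c + diag r s z)"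
proof -
  have "((\<lambda>z. f (c + diag r s z)) has_derivative
      (\<lambda>k. \<Sum>b\<in>Basis. (diag r s k \<bullet> b) * pderiv_dir b f (c + diag r s z))) (at z)"
    by (rule has_derivative_compose[where g=f, OF _ smooth_has_derivative[OF assms(1)]])
       (auto intro!: derivative_eq_intros bounded_linear.has_derivative[OF bounded_linear_diag])
  from pderiv_dir_eqI[OF this, of b] assms(2) show ?thesis
    by (auto simp: Basis_plane diag_def)
qed

lemma smooth_compose_diag:
  assumes "smooth f" shows "smooth (\<lambda>z. f (c + diag r s z))"
proof -
  have diff: "(\<lambda>z. f (c + diag r s z)) differentiable (at x)" if "smooth f" for f x
    using differentiable_chain_at[OF differentiable_add[OF differentiable_const
        bounded_linear_imp_differentiable[OF bounded_linear_diag]] smooth_differentiable[OF that]]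
    by (simp add: o_def)
  show ?thesis
  \<comment> \<open>The invariant carries a scalar \<open>k\<close> because every differentiation
    produces another factor \<open>r\<close> or \<open>s\<close>.\<close>
  proof (rule smooth_coinduct[of "\<lambda>g. \<exists>f k. smooth f \<and> g = (\<lambda>z. k * f (c + diag r s z))"])
    have "smooth f \<and> (\<lambda>z. f (c + diag r s z)) = (\<lambda>z. 1 * f (c + diag r s z))" using assms by simp
    then show "\<exists>g k. smooth g \<and> (\<lambda>z. f (c + diag r s z)) = (\<lambda>z. k * g (c + diag r s z))" by metis
  next
    fix g :: "plane \<Rightarrow> real" and x assume "\<exists>f k. smooth f \<and> g = (\<lambda>z. k * f (c + diag r s z))"
    then obtain f k where f: "smooth f" "g = (\<lambda>z. k * f (c + diag r s z))" by blast
    from diff[OF f(1)] show "g differentiable (at x)" unfolding f by (intro derivative_intros)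
  next
    fix g :: "plane \<Rightarrow> real" and b :: plane
    assume "\<exists>f k. smooth f \<and> g = (\<lambda>z. k * f (c + diag r s z))" and b: "b \<in> Basis"
    then obtain f k where f: "smooth f" "g = (\<lambda>z. k * f (c + diag r s z))" by blast
    have "((\<lambda>z. f (c + diag r s z)) has_derivative frechet_derivative (\<lambda>z. f (c + diag r s z)) (at z)) (at z)" for z
      using diff[OF f(1)] frechet_derivative_works by blast
    from has_derivative_mult_right[OF this, of k]
    have "pderiv_dir b g z = k * pderiv_dir b (\<lambda>z. f (c + diag r s z)) z" for z
      unfolding f(2) by (subst pderiv_dir_eqI) (auto simp: pderiv_dir_def)
    then have "pderiv_dir b g z = (k * (diag r s b \<bullet> b)) * pderiv_dir b f (c + diag r s z)" for z
      using pderiv_dir_compose_diag[OF f(1) b] by simp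
    then have "pderiv_dir b g = (\<lambda>z. (k * (diag r s b \<bullet> b)) * pderiv_dir b f (c + diag r s z))" by (rule ext)
    then show "\<exists>f k. smooth f \<and> pderiv_dir b g = (\<lambda>z. k * f (c + diag r s z))"
      using smooth_pderiv_dir[OF f(1) b] by metis
  qed
qed

text \<open>The functions \<open>p(1/x) e\<^sup>-\<^sup>1\<^sup>/\<^sup>x\<close>, with \<open>p\<close> a polynomial, are closed under
  differentiation, so \<open>e\<^sup>-\<^sup>1\<^sup>/\<^sup>x\<close> is smooth by coinduction.\<close>

definition flat_exp :: "real poly \<Rightarrow> real \<Rightarrow> real" where
  "flat_exp p x = (if x > 0 then poly p (1 / x) * exp (- (1 / x)) else 0)"

lemma poly_times_exp_minus_tendsto_0: "((\<lambda>y::real. poly p y * exp (- y)) \<longlongrightarrow> 0) at_top"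
proof -
  have "((\<lambda>y. \<Sum>i\<le>degree p. coeff p i * (y ^ i / exp y)) \<longlongrightarrow> (\<Sum>i\<le>degree p. coeff p i * 0)) at_top"
    by (intro tendsto_intros tendsto_power_div_exp_0)
  moreover have "(\<Sum>i\<le>degree p. coeff p i * (y ^ i / exp y)) = poly p y * exp (- y)" for y
    by (simp add: poly_altdef sum_distrib_right exp_minus divide_inverse mult.assoc)
  ultimately show ?thesis by simp
qed

lemma flat_exp_tendsto_0: "(flat_exp p \<longlongrightarrow> 0) (at 0)"
proof -
  have "((\<lambda>x. poly p (1 / x) * exp (- (1 / x))) \<longlongrightarrow> 0) (at_right 0)"
    using filterlim_compose[OF poly_times_exp_minus_tendsto_0 filterlim_inverse_at_top_right, of p]
    by (simp add: inverse_eq_divide)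
  then have "(flat_exp p \<longlongrightarrow> 0) (at_right 0)"
    by (rule Lim_transform_eventually) (auto simp: flat_exp_def eventually_at_filter)
  moreover have "(flat_exp p \<longlongrightarrow> 0) (at_left 0)"
    by (rule Lim_transform_eventually[OF tendsto_const])
       (auto simp: flat_exp_def eventually_at_filter)
  ultimately show ?thesis by (simp add: filterlim_split_at)
qed

text \<open>For y = 1/x the derivative of p(y) exp(-y) with respect to x is y^2 (p - p')(y) exp(-y);
  this is the new polynomial.\<close>

definition flat_exp_step :: "real poly \<Rightarrow> real poly" where
  "flat_exp_step p = [:0, 0, 1:] * (p - pderiv p)"

lemma flat_exp_has_derivative: "(flat_exp p has_real_derivative flat_exp (flat_exp_step p) x) (at x)"
proof -
  consider "x > 0" | "x < 0" | "x = 0" by linarith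
  then show ?thesis
  proof cases
    case 1
    have "((\<lambda>x. poly p (1 / x) * exp (- (1 / x))) has_real_derivative flat_exp (flat_exp_step p) x) (at x)"
      using 1 by (auto intro!: derivative_eq_intros simp: flat_exp_def flat_exp_step_def field_simps power2_eq_square)
    then show ?thesis
      by (rule has_field_derivative_transform_within_open[of _ _ _ "{0<..}"])
         (use 1 in \<open>auto simp: flat_exp_def\<close>)
  next
    case 2
    have "((\<lambda>x. 0) has_real_derivative flat_exp (flat_exp_step p) x) (at x)"
      using 2 by (auto simp: flat_exp_def)
    then show ?thesis
      by (rule has_field_derivative_transform_within_open[of _ _ _ "{..<0}"])
         (use 2 in \<open>auto simp: flat_exp_def\<close>)
  next
    case 3
    \<comment> \<open>The difference quotient at 0 belongs to the same family, with p replaced by y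
      p(y), so its limit is already known.\<close>
    have "flat_exp p (0 + h) / h = flat_exp (pCons 0 p) h" for h by (auto simp: flat_exp_def)
    then have "((\<lambda>h. (flat_exp p (0 + h) - flat_exp p 0) / h) \<longlongrightarrow> 0) (at 0)"
      using flat_exp_tendsto_0[of "pCons 0 p"] by (simp add: flat_exp_def[of _ 0])
    then show ?thesis using 3 by (simp add: DERIV_def flat_exp_def[of _ 0])
  qed
qed

lemma smooth_flat_exp: "smooth (\<lambda>z. flat_exp p (c + l \<bullet> z))"
proof (rule smooth_coinduct[of "\<lambda>f. \<exists>p. f = (\<lambda>z. flat_exp p (c + l \<bullet> z))"])
  show "\<exists>q. (\<lambda>z. flat_exp p (c + l \<bullet> z)) = (\<lambda>z. flat_exp q (c + l \<bullet> z))" by blast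
next
  have d: "((\<lambda>z. flat_exp p (c + l \<bullet> z)) has_derivative (\<lambda>k. flat_exp (flat_exp_step p) (c + l \<bullet> x) * (l \<bullet> k))) (at x)" for p x
    by (rule has_derivative_compose[of "\<lambda>z. c + l \<bullet> z" "\<lambda>k. l \<bullet> k", OF _ flat_exp_has_derivative[unfolded has_field_derivative_def]])
       (auto intro!: derivative_eq_intros)
  then show "\<exists>p. f = (\<lambda>z. flat_exp p (c + l \<bullet> z)) \<Longrightarrow> f differentiable (at x)" for f x
    unfolding differentiable_def by blast
  show "\<exists>q. pderiv_dir b f = (\<lambda>z. flat_exp q (c + l \<bullet> z))" if "\<exists>p. f = (\<lambda>z. flat_exp p (c + l \<bullet> z))" for f b
  proof -
    from that obtain p where f: "f = (\<lambda>z. flat_exp p (c + l \<bullet> z))" by blast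
    have "pderiv_dir b f z = flat_exp (smult (l \<bullet> b) (flat_exp_step p)) (c + l \<bullet> z)" for z
      unfolding f pderiv_dir_eqI[OF d] by (simp add: flat_exp_def)
    then show ?thesis by blast
  qed
qed

lemma pderiv_dir_flat_exp: "pderiv_dir b (\<lambda>z. flat_exp p (c + l \<bullet> z)) z = (l \<bullet> b) * flat_exp (flat_exp_step p) (c + l \<bullet> z)"
proof -
  have "((\<lambda>z. flat_exp p (c + l \<bullet> z)) has_derivative (\<lambda>k. flat_exp (flat_exp_step p) (c + l \<bullet> z) * (l \<bullet> k))) (at z)"
    by (rule has_derivative_compose[of "\<lambda>z. c + l \<bullet> z" "\<lambda>k. l \<bullet> k", OF _ flat_exp_has_derivative[unfolded has_field_derivative_def]])
       (auto intro!: derivative_eq_intros)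
  from pderiv_dir_eqI[OF this, of b] show ?thesis by simp
qed

lemma flat_exp_1: "0 \<le> flat_exp 1 x" "flat_exp 1 x \<le> 1" "flat_exp 1 x > 0 \<longleftrightarrow> x > 0" "x \<le> 0 \<Longrightarrow> flat_exp 1 x = 0"
  by (auto simp: flat_exp_def)

lemma flat_exp_1_scaled_tendsto: "(\<lambda>n. flat_exp 1 (real n * x)) \<longlonglongrightarrow> (if x > 0 then 1 else 0)"
proof (cases "x > 0")
  case True
  have "(\<lambda>n. exp (- (inverse (real n) / x))) \<longlonglongrightarrow> exp (- (0 / x))"
    using True by (intro tendsto_intros lim_inverse_n) auto
  moreover have "\<forall>\<^sub>F n in sequentially. exp (- (inverse (real n) / x)) = flat_exp 1 (real n * x)"
    using eventually_gt_at_top[of 0] by eventually_elim (use True in \<open>auto simp: flat_exp_def field_simps\<close>)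
  ultimately show ?thesis using True by (auto dest: Lim_transform_eventually)
qed (auto simp: flat_exp_def zero_less_mult_iff)

text \<open>Raising \<open>k\<close> sharpens the edges while the support stays the same box. One
  formula therefore serves as test function, as approximation of the indicator of the box, and for
  \<open>k = 1\<close> as mollifier kernel.\<close>

definition box_bump :: "real \<Rightarrow> plane \<Rightarrow> plane \<Rightarrow> plane \<Rightarrow> real" where
  "box_bump k a b z = flat_exp 1 (k * (fst z - fst a)) * flat_exp 1 (k * (fst b - fst z))
     * flat_exp 1 (k * (snd z - snd a)) * flat_exp 1 (k * (snd b - snd z))"

lemma smooth_box_bump: "smooth (box_bump k a b)"
proof -
  have "smooth (\<lambda>z. flat_exp 1 (- k * fst a + (k, 0) \<bullet> z) * flat_exp 1 (k * fst b + (- k, 0) \<bullet> z)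
    * flat_exp 1 (- k * snd a + (0, k) \<bullet> z) * flat_exp 1 (k * snd b + (0, - k) \<bullet> z))"
    by (intro smooth_mult smooth_flat_exp)
  moreover have "box_bump k a b = (\<lambda>z. flat_exp 1 (- k * fst a + (k, 0) \<bullet> z) * flat_exp 1 (k * fst b + (- k, 0) \<bullet> z)
    * flat_exp 1 (- k * snd a + (0, k) \<bullet> z) * flat_exp 1 (k * snd b + (0, - k) \<bullet> z))"
    by (auto simp: box_bump_def inner_prod_def algebra_simps)
  ultimately show ?thesis by simp
qed

lemma box_plane: "z \<in> box a b \<longleftrightarrow> fst a < fst z \<and> fst z < fst b \<and> snd a < snd z \<and> snd z < snd (b::plane)"
  by (auto simp: box_def Basis_plane inner_prod_def)

lemma box_bump_bounds: "0 \<le> box_bump k a b z" "box_bump k a b z \<le> 1"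
  unfolding box_bump_def by (intro mult_nonneg_nonneg mult_le_one flat_exp_1)+

lemma box_bump_pos_iff: "k > 0 \<Longrightarrow> box_bump k a b z \<noteq> 0 \<longleftrightarrow> z \<in> box a b"
  unfolding box_bump_def box_plane
  by (auto simp: flat_exp_def zero_less_mult_iff)

lemma box_bump_tendsto: "(\<lambda>n. box_bump (real n) a b z) \<longlonglongrightarrow> indicator (box a b) z"
proof -
  have "(\<lambda>n. box_bump (real n) a b z) \<longlonglongrightarrow> (if fst z - fst a > 0 then 1 else 0) * (if fst b - fst z > 0 then 1 else 0)
     * (if snd z - snd a > 0 then 1 else 0) * (if snd b - snd z > 0 then 1 else 0)"
    unfolding box_bump_def by (intro tendsto_intros flat_exp_1_scaled_tendsto)
  moreover have "(if fst z - fst a > 0 then 1 else 0) * (if fst b - fst z > 0 then 1 else 0)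
     * (if snd z - snd a > 0 then 1 else 0) * (if snd b - snd z > 0 then 1 else 0) = (indicator (box a b) z :: real)"
    by (auto simp: indicator_def box_plane)
  ultimately show ?thesis by simp
qed

section \<open>Test functions: closure properties and vanishing integrals of derivatives\<close>

lemma test_function_smooth: "test_function U \<psi> \<Longrightarrow> smooth \<psi>"
  by (simp add: test_function_def)

lemma test_functionI:
  assumes "smooth \<psi>" "compact K" "K \<subseteq> U" "\<And>x. \<psi> x \<noteq> 0 \<Longrightarrow> x \<in> K"
  shows "test_function U \<psi>"
proof -
  have "closure {x. \<psi> x \<noteq> 0} \<subseteq> K"
    using assms by (intro closure_minimal compact_imp_closed) auto
  then show ?thesis using assms unfolding test_function_def
    by (auto intro: compact_closure[THEN iffD2] bounded_subset[OF compact_imp_bounded] closure_subset)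
qed

lemma test_function_box_bump: "cbox a b \<subseteq> U \<Longrightarrow> k > 0 \<Longrightarrow> test_function U (box_bump k a b)"
  using box_bump_pos_iff[of k a b] box_subset_cbox[of a b]
  by (intro test_functionI[of _ "cbox a b"] smooth_box_bump) auto

lemma pderiv_dir_zero_outside:
  assumes "x \<notin> closure {x. \<psi> x \<noteq> 0}"
  shows "pderiv_dir b \<psi> x = 0"
proof -
  have "((\<lambda>_. 0) has_derivative (\<lambda>_. 0)) (at x)" by simp
  then have "(\<psi> has_derivative (\<lambda>_. 0)) (at x)"
    by (rule has_derivative_transform_within_open[of _ _ _ _ "- closure {x. \<psi> x \<noteq> 0}"])
       (use assms closure_subset[of "{x. \<psi> x \<noteq> 0}"] in auto)
  then show ?thesis by (rule pderiv_dir_eqI)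
qed

lemma test_function_pderiv_dir:
  assumes "test_function U \<psi>" "b \<in> Basis"
  shows "test_function U (pderiv_dir b \<psi>)"
  using assms pderiv_dir_zero_outside[of _ \<psi> b]
  by (intro test_functionI[of _ "closure {x. \<psi> x \<noteq> 0}"])
     (auto simp: test_function_def intro: smooth_pderiv_dir)

lemma test_function_mult:
  assumes "test_function U \<psi>" "smooth \<phi>"
  shows "test_function U (\<lambda>x. \<phi> x * \<psi> x)"
  using assms closure_subset[of "{x. \<psi> x \<noteq> 0}"]
  by (intro test_functionI[of _ "closure {x. \<psi> x \<noteq> 0}"])
     (auto simp: test_function_def intro: smooth_mult)

lemma test_function_mono: "test_function U \<psi> \<Longrightarrow> U \<subseteq> V \<Longrightarrow> test_function V \<psi>"
  by (auto simp: test_function_def)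

lemma test_function_zero: "test_function U \<psi> \<Longrightarrow> x \<notin> U \<Longrightarrow> \<psi> x = 0"
  using closure_subset[of "{x. \<psi> x \<noteq> 0}"] by (auto simp: test_function_def)

lemma test_function_bounded:
  assumes "test_function U \<psi>"
  obtains B where "\<And>x. \<bar>\<psi> x\<bar> \<le> B"
proof -
  let ?K = "closure {x. \<psi> x \<noteq> 0}"
  have "compact (\<psi> ` ?K)"
    using assms by (intro compact_continuous_image smooth_continuous_on) (auto simp: test_function_def)
  then obtain B where B: "\<And>y. y \<in> \<psi> ` ?K \<Longrightarrow> norm y \<le> B"
    using compact_imp_bounded bounded_iff by metis
  have "\<bar>\<psi> x\<bar> \<le> max B 0" for x
  proof (cases "x \<in> ?K")
    case True then show ?thesis using B by force
  next
    case False then have "\<psi> x = 0" using closure_subset[of "{x. \<psi> x \<noteq> 0}"] by auto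
    then show ?thesis by simp
  qed
  then show thesis using that by blast
qed

lemma smooth_lebesgue_measurable: "smooth f \<Longrightarrow> f \<in> borel_measurable lebesgue"
  using measurable_completion[of f lborel borel] smooth_borel_measurable by auto

lemma test_function_integrable_lborel:
  assumes "test_function U \<psi>" shows "integrable lborel \<psi>"
proof -
  let ?K = "closure {x. \<psi> x \<noteq> 0}"
  have "integrable lborel (\<lambda>x. indicator ?K x *\<^sub>R \<psi> x)"
    using assms by (intro borel_integrable_compact smooth_continuous_on) (auto simp: test_function_def)
  moreover have "(\<lambda>x. indicator ?K x *\<^sub>R \<psi> x) = \<psi>"
    using closure_subset[of "{x. \<psi> x \<noteq> 0}"] by (auto simp: indicator_def fun_eq_iff)
  ultimately show ?thesis by simp
qed

lemma integral_deriv_eq_0: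
  fixes g g' :: "real \<Rightarrow> real"
  assumes "\<And>x. (g has_real_derivative g' x) (at x)" "continuous_on UNIV g'"
    and "\<And>x. \<bar>x\<bar> \<ge> R \<Longrightarrow> g x = 0" "\<And>x. \<bar>x\<bar> \<ge> R \<Longrightarrow> g' x = 0"
  shows "(LINT x|lborel. g' x) = 0"
proof -
  have "(LINT x|lborel. indicator {-\<bar>R\<bar>..\<bar>R\<bar>} x *\<^sub>R g' x) = g \<bar>R\<bar> - g (-\<bar>R\<bar>)"
    using assms by (intro integral_FTC_atLeastAtMost)
      (auto simp: has_real_derivative_iff_has_vector_derivative intro: continuous_on_subset has_vector_derivative_at_within)
  moreover have "indicator {-\<bar>R\<bar>..\<bar>R\<bar>} x *\<^sub>R g' x = g' x" for x
    using assms(4)[of x] by (cases "\<bar>x\<bar> \<ge> R") (auto simp: indicator_def)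
  then have "(\<lambda>x. indicator {-\<bar>R\<bar>..\<bar>R\<bar>} x *\<^sub>R g' x) = g'" by (rule ext)
  ultimately show ?thesis using assms(3)[of "\<bar>R\<bar>"] assms(3)[of "-\<bar>R\<bar>"] by simp
qed

lemma has_real_derivative_along_axis:
  assumes "smooth \<psi>"
  shows "((\<lambda>x. \<psi> (x, y)) has_real_derivative pderiv_dir (1, 0) \<psi> (x, y)) (at x)"
    and "((\<lambda>y. \<psi> (x, y)) has_real_derivative pderiv_dir (0, 1) \<psi> (x, y)) (at y)"
proof -
  have "((\<lambda>x. \<psi> (x, y)) has_derivative (\<lambda>k. \<Sum>b\<in>Basis. ((k, 0) \<bullet> b) * pderiv_dir b \<psi> (x, y))) (at x)"
    by (rule has_derivative_compose[of "\<lambda>x. (x, y)" "\<lambda>k. (k, 0)", OF _ smooth_has_derivative[OF assms]])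
       (auto intro!: derivative_eq_intros)
  then show "((\<lambda>x. \<psi> (x, y)) has_real_derivative pderiv_dir (1, 0) \<psi> (x, y)) (at x)"
    by (rule has_derivative_imp_has_field_derivative) (simp add: sum_Basis_plane)
  have "((\<lambda>y. \<psi> (x, y)) has_derivative (\<lambda>k. \<Sum>b\<in>Basis. ((0, k) \<bullet> b) * pderiv_dir b \<psi> (x, y))) (at y)"
    by (rule has_derivative_compose[of "\<lambda>y. (x, y)" "\<lambda>k. (0, k)", OF _ smooth_has_derivative[OF assms]])
       (auto intro!: derivative_eq_intros)
  then show "((\<lambda>y. \<psi> (x, y)) has_real_derivative pderiv_dir (0, 1) \<psi> (x, y)) (at y)"
    by (rule has_derivative_imp_has_field_derivative) (simp add: sum_Basis_plane)
qed

lemma test_function_vanishes_far: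
  assumes "test_function U \<psi>"
  obtains R where "\<And>x. norm x \<ge> R \<Longrightarrow> \<psi> x = 0"
proof -
  have "bounded {x. \<psi> x \<noteq> 0}"
    using assms unfolding test_function_def by (metis bounded_subset closure_subset compact_imp_bounded)
  then obtain R where "\<And>x. \<psi> x \<noteq> 0 \<Longrightarrow> norm x < R" unfolding bounded_pos_less by auto
  then show thesis using that by (metis not_le)
qed

text \<open>Fubini, with the inner integral along the axis \<open>b\<close> evaluated by the
  fundamental theorem. Applied to a product it is integration by parts.\<close>

lemma integral_pderiv_dir_eq_0:
  assumes "test_function U \<psi>" "b \<in> Basis"
  shows "(LINT x|lborel. pderiv_dir b \<psi> x) = 0"
proof -
  have sm: "smooth \<psi>" using assms(1) by (rule test_function_smooth)
  obtain R where R: "\<And>x. norm x \<ge> R \<Longrightarrow> \<psi> x = 0" using test_function_vanishes_far[OF assms(1)] by blast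
  obtain R' where R': "\<And>x. norm x \<ge> R' \<Longrightarrow> pderiv_dir b \<psi> x = 0"
    using test_function_vanishes_far[OF test_function_pderiv_dir[OF assms]] by blast
  have le: "\<bar>x\<bar> \<le> norm (x, y)" "\<bar>y\<bar> \<le> norm (x, y)" for x y :: real
    using norm_fst_le[of x y] norm_snd_le[of y x] by auto
  have z: "\<psi> (x, y) = 0" "pderiv_dir b \<psi> (x, y) = 0" if "max R R' \<le> \<bar>x\<bar> \<or> max R R' \<le> \<bar>y\<bar>" for x y
    using R[of "(x, y)"] R'[of "(x, y)"] le(1)[of x y] le(2)[of y x] that by linarith+
  have int: "integrable (lborel \<Otimes>\<^sub>M lborel) (pderiv_dir b \<psi>)"
    using test_function_integrable_lborel[OF test_function_pderiv_dir[OF assms]] by (simp add: lborel_prod)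
  have cont: "continuous_on UNIV (pderiv_dir b \<psi>)"
    using assms sm by (intro smooth_continuous_on smooth_pderiv_dir)
  have "b = (1, 0) \<or> b = (0, 1)" using assms by (auto simp: Basis_plane)
  then show ?thesis
  proof
    assume b: "b = (1, 0)"
    have "(LINT x|lborel. pderiv_dir b \<psi> (x, y)) = 0" for y
    proof (rule integral_deriv_eq_0[where g="\<lambda>x. \<psi> (x, y)" and R="max R R'"])
      show "continuous_on UNIV (\<lambda>x. pderiv_dir b \<psi> (x, y))"
        by (intro continuous_on_compose2[OF cont] continuous_intros) auto
    qed (use has_real_derivative_along_axis[OF sm] b z in auto)
    moreover have "(LINT y|lborel. LINT x|lborel. pderiv_dir b \<psi> (x, y)) = integral\<^sup>L (lborel \<Otimes>\<^sub>M lborel) (pderiv_dir b \<psi>)"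
      using lborel_pair.integral_snd[of "\<lambda>x y. pderiv_dir b \<psi> (x, y)"] int by simp
    ultimately show ?thesis by (simp add: lborel_prod)
  next
    assume b: "b = (0, 1)"
    have "(LINT y|lborel. pderiv_dir b \<psi> (x, y)) = 0" for x
    proof (rule integral_deriv_eq_0[where g="\<lambda>y. \<psi> (x, y)" and R="max R R'"])
      show "continuous_on UNIV (\<lambda>y. pderiv_dir b \<psi> (x, y))"
        by (intro continuous_on_compose2[OF cont] continuous_intros) auto
    qed (use has_real_derivative_along_axis[OF sm] b z in auto)
    then show ?thesis using lborel_pair.integral_fst'[OF int] by (simp add: lborel_prod)
  qed
qed

section \<open>Weak derivatives\<close>

lemma integral_lebesgue_on_supported:
  fixes f :: "'a::euclidean_space \<Rightarrow> 'b::{banach, second_countable_topology}"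
  assumes "E \<in> sets lebesgue" "U \<in> sets lebesgue" "E \<subseteq> U" "\<And>x. x \<in> U \<Longrightarrow> x \<notin> E \<Longrightarrow> f x = 0"
  shows "(LINT x|lebesgue_on U. f x) = (LINT x|lebesgue_on E. f x)"
proof -
  have "indicator U x *\<^sub>R f x = indicator E x *\<^sub>R f x" for x
    using assms by (auto simp: indicator_def)
  then have "(\<lambda>x. indicator U x *\<^sub>R f x) = (\<lambda>x. indicator E x *\<^sub>R f x)" by (rule ext)
  then show ?thesis using assms(1,2) by (simp only: integral_restrict_space sets.Int_space_eq2)
qed

lemma integral_lebesgue_on_UNIV_borel:
  fixes f :: "'a::euclidean_space \<Rightarrow> 'b::{banach, second_countable_topology}"
  assumes "U \<in> sets lebesgue" "\<And>x. x \<notin> U \<Longrightarrow> f x = 0" "f \<in> borel_measurable borel"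
  shows "(LINT x|lebesgue_on U. f x) = (LINT x|lborel. f x)"
  using integral_lebesgue_on_supported[of U UNIV f] assms integral_completion[of f lborel]
  by (auto simp: lebesgue_on_UNIV_eq)

text \<open>Local integrability gives control on compact subsets only; the support of
  \<open>\<psi>\<close> is one of them, and \<open>\<psi>\<close> is bounded there.\<close>

lemma integrable_test_function_mult:
  assumes U: "open U" and \<psi>: "test_function U \<psi>" and g: "locally_integrable U g"
  shows "integrable (lebesgue_on U) (\<lambda>x. \<psi> x *\<^sub>R g x)"
proof -
  let ?K = "closure {x. \<psi> x \<noteq> 0}"
  have K: "compact ?K" "?K \<subseteq> U" and sm: "smooth \<psi>" using \<psi> by (auto simp: test_function_def)
  obtain B where B: "\<And>x. \<bar>\<psi> x\<bar> \<le> B" using test_function_bounded[OF \<psi>] by blast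
  have "integrable (lebesgue_on ?K) g" using g K by (auto simp: locally_integrable_def)
  then have "integrable lebesgue (\<lambda>x. indicator ?K x *\<^sub>R g x)" by (subst (asm) integrable_restrict_space) auto
  then have "integrable lebesgue (\<lambda>x. B *\<^sub>R (indicator ?K x *\<^sub>R g x))" by (rule integrable_scaleR_right)
  moreover have "(\<lambda>x. \<psi> x *\<^sub>R (indicator ?K x *\<^sub>R g x)) \<in> borel_measurable lebesgue"
    using borel_measurable_integrable[OF \<open>integrable lebesgue (\<lambda>x. indicator ?K x *\<^sub>R g x)\<close>]
      smooth_lebesgue_measurable[OF sm]
    by (rule borel_measurable_scaleR[rotated])
  moreover have "norm (\<psi> x *\<^sub>R (indicator ?K x *\<^sub>R g x)) \<le> norm (B *\<^sub>R (indicator ?K x *\<^sub>R g x))" for x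
    using B[of x] by (auto simp: indicator_def abs_mult intro!: mult_right_mono)
  ultimately have "integrable lebesgue (\<lambda>x. \<psi> x *\<^sub>R (indicator ?K x *\<^sub>R g x))"
    using Bochner_Integration.integrable_bound[OF _ _ AE_I2] by blast
  moreover have "\<psi> x *\<^sub>R (indicator ?K x *\<^sub>R g x) = indicator U x *\<^sub>R \<psi> x *\<^sub>R g x" for x
    using K(2) closure_subset[of "{x. \<psi> x \<noteq> 0}"] by (auto simp: indicator_def)
  then have "(\<lambda>x. \<psi> x *\<^sub>R (indicator ?K x *\<^sub>R g x)) = (\<lambda>x. indicator U x *\<^sub>R \<psi> x *\<^sub>R g x)" by (rule ext)
  ultimately show ?thesis using U by (simp only: integrable_restrict_space sets.Int_space_eq2 lebesgue_openin borel_open sets_completionI_sets sets_lborel)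
qed

lemma integrable_lebesgue_on_subset:
  fixes f :: "'a::euclidean_space \<Rightarrow> 'b::{banach, second_countable_topology}"
  assumes f: "integrable (lebesgue_on U) f" and "E \<in> sets lebesgue" "U \<in> sets lebesgue" "E \<subseteq> U"
  shows "integrable (lebesgue_on E) f"
proof -
  have "integrable lebesgue (\<lambda>x. indicator U x *\<^sub>R f x)"
    using f assms(3) by (subst (asm) integrable_restrict_space) auto
  then have "integrable lebesgue (\<lambda>x. indicator E x *\<^sub>R (indicator U x *\<^sub>R f x))"
    by (rule integrable_mult_indicator[OF assms(2)])
  moreover have "indicator E x *\<^sub>R (indicator U x *\<^sub>R f x) = indicator E x *\<^sub>R f x" for x
    using assms(4) by (auto simp: indicator_def)
  ultimately show ?thesis using assms(2)
    by (subst integrable_restrict_space) (auto simp del: scaleR_scaleR)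
qed

lemma locally_integrable_continuous:
  assumes "continuous_on U f" shows "locally_integrable U f"
  unfolding locally_integrable_def
proof (intro allI impI)
  fix K assume K: "compact K \<and> K \<subseteq> U"
  then have "integrable lborel (\<lambda>x. indicator K x *\<^sub>R f x)"
    using assms by (intro borel_integrable_compact) (auto intro: continuous_on_subset)
  then have "integrable lebesgue (\<lambda>x. indicator K x *\<^sub>R f x)" 
    by (subst integrable_completion) auto
  moreover have "K \<in> sets lebesgue" using K by (simp add: compact_imp_closed)
  ultimately show "integrable (lebesgue_on K) f" by (subst integrable_restrict_space) auto
qed

text \<open>The product of \<open>\<phi>\<close> with a test function is a test function on the
  whole plane, so the integral of its derivative vanishes even though \<open>\<phi>\<close> itself
  need not be integrable.\<close>

lemma has_weak_pderiv_smooth: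
  assumes U: "open U" and \<phi>: "smooth \<phi>" and b: "b \<in> Basis"
  shows "has_weak_pderiv U b \<phi> (pderiv_dir b \<phi>)"
  unfolding has_weak_pderiv_def
proof (intro conjI allI impI locally_integrable_continuous smooth_continuous_on smooth_pderiv_dir \<phi> b)
  fix \<psi> assume \<psi>: "test_function U \<psi>"
  note p = test_function_pderiv_dir[OF \<psi> b]
  have "(LINT x|lborel. pderiv_dir b (\<lambda>x. \<phi> x * \<psi> x) x) = 0"
    by (rule integral_pderiv_dir_eq_0[OF test_function_mult[OF \<psi> \<phi>] b])
  also have "pderiv_dir b (\<lambda>x. \<phi> x * \<psi> x) = (\<lambda>x. \<phi> x * pderiv_dir b \<psi> x + pderiv_dir b \<phi> x * \<psi> x)"
    using pderiv_dir_mult[OF \<phi> test_function_smooth[OF \<psi>]] by blast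
  also have "(LINT x|lborel. \<phi> x * pderiv_dir b \<psi> x + pderiv_dir b \<phi> x * \<psi> x)
    = (LINT x|lborel. \<phi> x * pderiv_dir b \<psi> x) + (LINT x|lborel. pderiv_dir b \<phi> x * \<psi> x)"
    by (rule Bochner_Integration.integral_add[OF
        test_function_integrable_lborel[OF test_function_mult[OF p \<phi>]]
        test_function_integrable_lborel[OF test_function_mult[OF \<psi> smooth_pderiv_dir[OF \<phi> b]]]])
  finally have *: "(LINT x|lborel. \<phi> x * pderiv_dir b \<psi> x) = - (LINT x|lborel. pderiv_dir b \<phi> x * \<psi> x)" by simp
  have "(LINT x|lebesgue_on U. \<phi> x * pderiv_dir b \<psi> x) = (LINT x|lborel. \<phi> x * pderiv_dir b \<psi> x)"
    using U p test_function_zero[OF p] smooth_borel_measurable[OF smooth_mult[OF \<phi> test_function_smooth[OF p]]]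
    by (intro integral_lebesgue_on_UNIV_borel) auto
  moreover have "(LINT x|lebesgue_on U. pderiv_dir b \<phi> x * \<psi> x) = (LINT x|lborel. pderiv_dir b \<phi> x * \<psi> x)"
    using U test_function_zero[OF \<psi>]
      smooth_borel_measurable[OF smooth_mult[OF smooth_pderiv_dir[OF \<phi> b] test_function_smooth[OF \<psi>]]]
    by (intro integral_lebesgue_on_UNIV_borel) auto
  ultimately show "(LINT x|lebesgue_on U. pderiv_dir b \<psi> x *\<^sub>R \<phi> x) = - (LINT x|lebesgue_on U. \<psi> x *\<^sub>R pderiv_dir b \<phi> x)"
    using * by (simp add: mult.commute)
qed

lemma locally_integrable_diff:
  "locally_integrable U f \<Longrightarrow> locally_integrable U g \<Longrightarrow> locally_integrable U (\<lambda>x. f x - g x)"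
  unfolding locally_integrable_def by auto

lemma has_weak_pderiv_diff:
  assumes U: "open U" and f: "has_weak_pderiv U b f f'" and g: "has_weak_pderiv U b g g'" and b: "b \<in> Basis"
  shows "has_weak_pderiv U b (\<lambda>x. f x - g x) (\<lambda>x. f' x - g' x)"
  unfolding has_weak_pderiv_def
proof (intro conjI allI impI locally_integrable_diff)
  show "locally_integrable U f" "locally_integrable U g" "locally_integrable U f'" "locally_integrable U g'"
    using f g by (auto simp: has_weak_pderiv_def)
  note l = this
  fix \<psi> assume \<psi>: "test_function U \<psi>"
  note p = test_function_pderiv_dir[OF \<psi> b]
  show "(LINT x|lebesgue_on U. pderiv_dir b \<psi> x *\<^sub>R (f x - g x)) = - (LINT x|lebesgue_on U. \<psi> x *\<^sub>R (f' x - g' x))"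
    using f g \<psi> integrable_test_function_mult[OF U \<psi> l(3)] integrable_test_function_mult[OF U \<psi> l(4)]
      integrable_test_function_mult[OF U p l(1)] integrable_test_function_mult[OF U p l(2)]
    by (simp add: scaleR_diff_right has_weak_pderiv_def Bochner_Integration.integral_diff)
qed

lemma has_weak_pderiv_subset:
  assumes "open U" "open E" "E \<subseteq> U" "has_weak_pderiv U b f g" "b \<in> Basis"
  shows "has_weak_pderiv E b f g"
  unfolding has_weak_pderiv_def
proof (intro conjI allI impI)
  show "locally_integrable E f" "locally_integrable E g"
    using assms unfolding has_weak_pderiv_def locally_integrable_def by blast+
  fix \<psi> assume \<psi>: "test_function E \<psi>"
  note p = test_function_pderiv_dir[OF \<psi> \<open>b \<in> Basis\<close>]
  have "(LINT x|lebesgue_on U. pderiv_dir b \<psi> x *\<^sub>R f x) = (LINT x|lebesgue_on E. pderiv_dir b \<psi> x *\<^sub>R f x)"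
    using assms test_function_zero[OF p] by (intro integral_lebesgue_on_supported) auto
  moreover have "(LINT x|lebesgue_on U. \<psi> x *\<^sub>R g x) = (LINT x|lebesgue_on E. \<psi> x *\<^sub>R g x)"
    using assms test_function_zero[OF \<psi>] by (intro integral_lebesgue_on_supported) auto
  ultimately show "(LINT x|lebesgue_on E. pderiv_dir b \<psi> x *\<^sub>R f x) = - (LINT x|lebesgue_on E. \<psi> x *\<^sub>R g x)"
    using assms test_function_mono[OF \<psi> assms(3)] unfolding has_weak_pderiv_def by metis
qed

text \<open>Lebesgue differentiation: almost everywhere \<open>f\<close> is the limit of its
  averages over small squares, and these are zero. Countably many closed boxes exhaust
  \<open>U\<close>.\<close>

lemma integral_box_eq_0_imp_AE:
  fixes f :: "plane \<Rightarrow> real"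
  assumes U: "open U" and int: "\<And>a b. cbox a b \<subseteq> U \<Longrightarrow> integrable (lebesgue_on (cbox a b)) f"
    and 0: "\<And>a b. cbox a b \<subseteq> U \<Longrightarrow> integral (cbox a b) f = 0"
  shows "AE x in lebesgue_on U. f x = 0"
proof -
  have "\<exists>N. negligible N \<and> (\<forall>x\<in>box a b - N. f x = 0)" if ab: "cbox a b \<subseteq> U" for a b
  proof -
    \<comment> \<open>The differentiation theorem expects integrability on every box of the plane,
      hence the extension by zero.\<close>
    let ?g = "\<lambda>x. if x \<in> cbox a b then f x else 0"
    have "f integrable_on cbox a b" by (rule integrable_on_lebesgue_on[OF int[OF ab]]) simp
    then have g: "?g integrable_on cbox c d" for c d
      by (metis integrable_restrict_UNIV integrable_on_subcbox subset_UNIV)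
    obtain N where N: "negligible N"
       "\<And>x e. \<lbrakk>x \<notin> N; 0 < e\<rbrakk> \<Longrightarrow> \<exists>d>0. \<forall>h. 0 < h \<and> h < d \<longrightarrow>
             norm(integral (cbox x (x + h *\<^sub>R One)) ?g /\<^sub>R h ^ DIM(plane) - ?g x) < e"
      using integrable_ccontinuous_explicit[of ?g] g by blast
    have "f x = 0" if x: "x \<in> box a b - N" for x
    proof (rule ccontr)
      assume nz: "f x \<noteq> 0"
      have gx: "?g x = f x" using x box_subset_cbox by auto
      have "\<bar>f x\<bar> > 0" using nz by simp
      then obtain d where d: "d > 0" "\<And>h. 0 < h \<Longrightarrow> h < d \<Longrightarrow>
             norm(integral (cbox x (x + h *\<^sub>R One)) ?g /\<^sub>R h ^ DIM(plane) - ?g x) < \<bar>f x\<bar>"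
        using N(2)[of x "\<bar>f x\<bar>"] x by blast
      \<comment> \<open>Halving keeps \<open>h\<close> strictly below \<open>d\<close> and keeps the
        square with lower left corner \<open>x\<close> inside the box.\<close>
      define h where "h = min (d / 2) (min ((fst b - fst x) / 2) ((snd b - snd x) / 2))"
      have h: "0 < h" "h < d" "h < fst b - fst x" "h < snd b - snd x"
        using d(1) x by (auto simp: h_def box_plane min_def)
      have sub: "cbox x (x + h *\<^sub>R One) \<subseteq> cbox a b"
        using h x by (auto simp: mem_box sum_Basis_plane Basis_plane inner_prod_def)
      then have "integral (cbox x (x + h *\<^sub>R One)) ?g = integral (cbox x (x + h *\<^sub>R One)) f"
        by (intro integral_cong) auto
      also have "\<dots> = 0" using sub ab by (intro 0) blast
      finally have "norm (?g x) < \<bar>f x\<bar>" using d(2)[OF h(1,2)] by simp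
      then show False using gx by simp
    qed
    then show ?thesis using N(1) by blast
  qed
  then have "\<forall>a b. \<exists>N. cbox a b \<subseteq> U \<longrightarrow> negligible N \<and> (\<forall>x\<in>box a b - N. f x = 0)" by blast
  then obtain N where N: "\<And>a b. cbox a b \<subseteq> U \<Longrightarrow> negligible (N a b) \<and> (\<forall>x\<in>box a b - N a b. f x = 0)"
    by metis
  obtain D where D: "countable D" "D \<subseteq> Pow U" "\<And>X. X \<in> D \<Longrightarrow> \<exists>a b. X = cbox a b" "\<Union>D = U"
    using open_countable_Union_open_cbox[OF U] by metis
  have "\<forall>X\<in>D. \<exists>a b. X = cbox a b" using D(3) by blast
  then obtain lo hi where lh: "\<And>X. X \<in> D \<Longrightarrow> X = cbox (lo X) (hi X)" by metis
  \<comment> \<open>The boundaries of the boxes join the exceptional set because vanishing was shown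
    only in their interiors.\<close>
  define M where "M = (\<Union>X\<in>D. N (lo X) (hi X) \<union> (cbox (lo X) (hi X) - box (lo X) (hi X)))"
  have "negligible (N (lo X) (hi X) \<union> (cbox (lo X) (hi X) - box (lo X) (hi X)))" if "X \<in> D" for X
  proof (rule negligible_Un)
    have "cbox (lo X) (hi X) \<subseteq> U" using lh[OF that] D(2) that by blast
    then show "negligible (N (lo X) (hi X))" using N by blast
  qed (rule negligible_frontier_interval)
  then have "negligible M" unfolding M_def
    using D(1) by (intro negligible_countable_Union) auto
  then have "M \<in> null_sets lebesgue" by (simp add: negligible_iff_null_sets)
  moreover have "f x = 0" if x: "x \<in> U" "x \<notin> M" for x
  proof -
    obtain X where X: "X \<in> D" "x \<in> X" using x(1) D(4) by (metis UnionE)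
    then have "x \<in> box (lo X) (hi X)" "x \<notin> N (lo X) (hi X)" using that lh[OF X(1)] by (auto simp: M_def)
    moreover have "cbox (lo X) (hi X) \<subseteq> U" using lh[OF X(1)] D(2) X(1) by blast
    ultimately show ?thesis using N by blast
  qed
  ultimately have "AE x in lebesgue. x \<in> U \<longrightarrow> f x = 0"
    by (auto intro!: AE_I'[of M])
  then show ?thesis using U by (subst AE_restrict_space_iff) auto
qed

text \<open>The fundamental lemma of the calculus of variations. Box bumps tend boundedly to the
  indicator of a box, so by dominated convergence all integrals of \<open>g\<close> over boxes
  vanish.\<close>

lemma test_functions_separate:
  fixes g :: "plane \<Rightarrow> real"
  assumes U: "open U" and g: "locally_integrable U g"
    and 0: "\<And>\<psi>. test_function U \<psi> \<Longrightarrow> (LINT x|lebesgue_on U. \<psi> x * g x) = 0"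
  shows "AE x in lebesgue_on U. g x = 0"
proof (rule integral_box_eq_0_imp_AE[OF U])
  fix a b assume ab: "cbox a b \<subseteq> U"
  show int: "integrable (lebesgue_on (cbox a b)) g" using g ab by (auto simp: locally_integrable_def)
  have int': "integrable lebesgue (\<lambda>x. indicator (cbox a b) x * g x)"
    using int by (subst (asm) integrable_restrict_space) auto
  have nz: "box_bump (real (Suc n)) a b x = 0" if "x \<notin> cbox a b" for x n
    using box_bump_pos_iff[of "real (Suc n)" a b x] that box_subset_cbox[of a b] by auto
  have "(\<lambda>n. LINT x|lebesgue. box_bump (real (Suc n)) a b x * (indicator (cbox a b) x * g x))
     \<longlonglongrightarrow> (LINT x|lebesgue. indicator (box a b) x * (indicator (cbox a b) x * g x))"
  proof (rule integral_dominated_convergence[where w="\<lambda>x. \<bar>indicator (cbox a b) x * g x\<bar>"])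
    show "(\<lambda>x. box_bump (real (Suc n)) a b x * (indicator (cbox a b) x * g x)) \<in> borel_measurable lebesgue" for n
      using borel_measurable_integrable[OF int'] smooth_lebesgue_measurable[OF smooth_box_bump]
      by (rule borel_measurable_times[rotated])
    show "(\<lambda>x. indicator (box a b) x * (indicator (cbox a b) x * g x)) \<in> borel_measurable lebesgue"
      by (rule borel_measurable_times[OF borel_measurable_indicator borel_measurable_integrable[OF int']]) simp
    show "AE x in lebesgue. (\<lambda>n. box_bump (real (Suc n)) a b x * (indicator (cbox a b) x * g x))
       \<longlonglongrightarrow> indicator (box a b) x * (indicator (cbox a b) x * g x)"
      by (intro AE_I2 tendsto_intros LIMSEQ_Suc box_bump_tendsto)
    show "AE x in lebesgue. norm (box_bump (real (Suc n)) a b x * (indicator (cbox a b) x * g x))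
       \<le> \<bar>indicator (cbox a b) x * g x\<bar>" for n
      by (intro AE_I2) (simp add: abs_mult box_bump_bounds mult_left_le_one_le)
  qed (use int' in auto)
  moreover have "(LINT x|lebesgue. box_bump (real (Suc n)) a b x * (indicator (cbox a b) x * g x)) = 0" for n
  proof -
    have "(LINT x|lebesgue. box_bump (real (Suc n)) a b x * (indicator (cbox a b) x * g x))
      = (LINT x|lebesgue_on U. box_bump (real (Suc n)) a b x * g x)"
      using U ab nz by (subst integral_restrict_space)
        (auto intro!: Bochner_Integration.integral_cong simp: indicator_def)
    also have "\<dots> = 0" using ab by (intro 0 test_function_box_bump) auto
    finally show ?thesis .
  qed
  ultimately have "(LINT x|lebesgue. indicator (box a b) x * (indicator (cbox a b) x * g x)) = 0"
    using LIMSEQ_unique[OF tendsto_const] by fastforce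
  also have "(\<lambda>x. indicator (box a b) x * (indicator (cbox a b) x * g x)) = (\<lambda>x. indicator (box a b) x *\<^sub>R g x)"
    using box_subset_cbox[of a b] by (auto simp: indicator_def fun_eq_iff)
  finally have "(LINT x|lebesgue_on (box a b). g x) = 0"
    by (subst integral_restrict_space) auto
  moreover have "integrable (lebesgue_on (box a b)) g"
    by (rule integrable_lebesgue_on_subset[OF int]) (auto simp: box_subset_cbox)
  ultimately have "integral (box a b) g = 0" using lebesgue_integral_eq_integral by fastforce
  then show "integral (cbox a b) g = 0" by (simp add: integral_open_interval)
qed

text \<open>\<open>weak_pderiv\<close> is picked by choice. Uniqueness almost everywhere lets any
  explicitly known weak derivative stand in for the chosen one.\<close>

lemma has_weak_pderiv_unique:
  fixes g1 g2 :: "plane \<Rightarrow> real"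
  assumes U: "open U" and 1: "has_weak_pderiv U b f g1" and 2: "has_weak_pderiv U b f g2"
  shows "AE x in lebesgue_on U. g1 x = g2 x"
proof -
  have "AE x in lebesgue_on U. g1 x - g2 x = 0"
  proof (rule test_functions_separate[OF U])
    show l: "locally_integrable U (\<lambda>x. g1 x - g2 x)" using 1 2
      by (auto simp: has_weak_pderiv_def intro: locally_integrable_diff)
    fix \<psi> assume \<psi>: "test_function U \<psi>"
    have "(LINT x|lebesgue_on U. \<psi> x *\<^sub>R g1 x) = (LINT x|lebesgue_on U. \<psi> x *\<^sub>R g2 x)"
      using 1 2 \<psi> unfolding has_weak_pderiv_def by (metis neg_equal_iff_equal)
    then show "(LINT x|lebesgue_on U. \<psi> x * (g1 x - g2 x)) = 0"
      using integrable_test_function_mult[OF U \<psi>, of g1] integrable_test_function_mult[OF U \<psi>, of g2] 1 2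
      by (simp add: right_diff_distrib has_weak_pderiv_def)
  qed
  then show ?thesis by simp
qed

lemma has_weak_pderiv_weak_pderiv:
  "has_weak_pderiv U b f g \<Longrightarrow> has_weak_pderiv U b f (weak_pderiv U b f)"
  unfolding weak_pderiv_def by (rule someI[where P="\<lambda>g. has_weak_pderiv U b f g"])

text \<open>Rests on completeness of Lebesgue measure. It makes the representative chosen by
  \<open>weak_pderiv\<close> measurable on all of \<open>U\<close>.\<close>

lemma borel_measurable_lebesgue_on_AE:
  fixes f g :: "'a::euclidean_space \<Rightarrow> 'b::euclidean_space"
  assumes U: "U \<in> sets lebesgue" and f: "f \<in> borel_measurable (lebesgue_on U)"
    and eq: "AE x in lebesgue_on U. f x = g x"
  shows "g \<in> borel_measurable (lebesgue_on U)"
proof -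
  have "(\<lambda>x. indicator U x *\<^sub>R f x) \<in> borel_measurable lebesgue"
    using f U by (subst (asm) borel_measurable_restrict_space_iff) auto
  moreover have "AE x in lebesgue. indicator U x *\<^sub>R f x = indicator U x *\<^sub>R g x"
    using eq U by (subst (asm) AE_restrict_space_iff) (auto simp: indicator_def elim!: eventually_mono)
  ultimately have "(\<lambda>x. indicator U x *\<^sub>R g x) \<in> borel_measurable lebesgue"
    by (rule borel_measurable_AE)
  then show ?thesis using U by (subst borel_measurable_restrict_space_iff) auto
qed

section \<open>Square-integrable functions and Sobolev functions\<close>

lemma square_integrable_mult:
  assumes "square_integrable M f" "square_integrable M g"
  shows "integrable M (\<lambda>x. f x * g x)"
proof (rule Bochner_Integration.integrable_bound[OF Bochner_Integration.integrable_add])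
  show "integrable M (\<lambda>x. (f x)\<^sup>2)" "integrable M (\<lambda>x. (g x)\<^sup>2)" "(\<lambda>x. f x * g x) \<in> borel_measurable M"
    using assms by (auto simp: square_integrable_def)
  have "\<bar>f x * g x\<bar> \<le> (f x)\<^sup>2 + (g x)\<^sup>2" for x
  proof -
    have "2 * (\<bar>f x\<bar> * \<bar>g x\<bar>) \<le> (f x)\<^sup>2 + (g x)\<^sup>2"
      using sum_squares_bound[of "\<bar>f x\<bar>" "\<bar>g x\<bar>"] by (simp add: mult.assoc)
    moreover have "0 \<le> \<bar>f x\<bar> * \<bar>g x\<bar>" by simp
    ultimately show ?thesis unfolding abs_mult by linarith
  qed
  then show "AE x in M. norm (f x * g x) \<le> norm ((f x)\<^sup>2 + (g x)\<^sup>2)"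
    by (intro AE_I2) simp
qed

lemma square_integrable_cmult:
  "square_integrable M f \<Longrightarrow> square_integrable M (\<lambda>x. c * f x)"
  by (auto simp: square_integrable_def power_mult_distrib)

lemma square_integrable_add:
  assumes "square_integrable M f" "square_integrable M g"
  shows "square_integrable M (\<lambda>x. f x + g x)"
  using assms square_integrable_mult[OF assms]
  by (auto simp: square_integrable_def power2_sum mult.assoc)

lemma square_integrable_diff:
  assumes "square_integrable M f" "square_integrable M g"
  shows "square_integrable M (\<lambda>x. f x - g x)"
  using square_integrable_add[OF assms(1) square_integrable_cmult[OF assms(2), of "-1"]] by simp

lemma square_integrable_cong_AE:
  assumes "square_integrable M f" "g \<in> borel_measurable M" "AE x in M. f x = g x"
  shows "square_integrable M g" "(LINT x|M. (g x)\<^sup>2) = (LINT x|M. (f x)\<^sup>2)"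
proof -
  have f: "f \<in> borel_measurable M" "integrable M (\<lambda>x. (f x)\<^sup>2)"
    using assms(1) by (auto simp: square_integrable_def)
  have ae: "AE x in M. (f x)\<^sup>2 = (g x)\<^sup>2" using assms(3) by eventually_elim simp
  show "square_integrable M g" unfolding square_integrable_def
    using integrable_cong_AE_imp[OF f(2) _ ae] assms(2) by auto
  show "(LINT x|M. (g x)\<^sup>2) = (LINT x|M. (f x)\<^sup>2)"
    using f(1) assms(2) ae by (intro integral_cong_AE) auto
qed

text \<open>The quadratic form (s, t) -> integral of (s f + t g)^2 is nonnegative; evaluating it at
  one well chosen point replaces the discriminant argument.\<close>

lemma square_integral_Cauchy_Schwarz:
  assumes f: "square_integrable M f" and g: "square_integrable M g"
  shows "\<bar>LINT x|M. f x * g x\<bar> \<le> sqrt (LINT x|M. (f x)\<^sup>2) * sqrt (LINT x|M. (g x)\<^sup>2)"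
proof -
  let ?A = "LINT x|M. (f x)\<^sup>2" and ?B = "LINT x|M. (g x)\<^sup>2" and ?C = "LINT x|M. f x * g x"
  have fg: "integrable M (\<lambda>x. f x * g x)" by (rule square_integrable_mult[OF f g])
  have ints: "integrable M (\<lambda>x. (f x)\<^sup>2)" "integrable M (\<lambda>x. (g x)\<^sup>2)"
    using f g by (auto simp: square_integrable_def)
  have q: "0 \<le> s\<^sup>2 * ?A + 2 * s * t * ?C + t\<^sup>2 * ?B" for s t
  proof -
    have "0 \<le> (LINT x|M. (s * f x + t * g x)\<^sup>2)" by simp
    also have "(\<lambda>x. (s * f x + t * g x)\<^sup>2) = (\<lambda>x. s\<^sup>2 * (f x)\<^sup>2 + (2 * s * t) * (f x * g x) + t\<^sup>2 * (g x)\<^sup>2)"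
      by (auto simp: power2_eq_square algebra_simps)
    also have "(LINT x|M. \<dots> x) = s\<^sup>2 * ?A + (2 * s * t) * ?C + t\<^sup>2 * ?B"
      using ints fg by simp
    finally show ?thesis by simp
  qed
  have "?C\<^sup>2 \<le> ?A * ?B"
  proof (cases "?A = 0")
    case True
    have "?C = 0"
    proof (rule ccontr)
      assume "?C \<noteq> 0"
      \<comment> \<open>With vanishing \<open>?A\<close> the form is affine in s, and at this s it
        equals -1.\<close>
      then show False using q[of "- (?B + 1) / (2 * ?C)" 1] True by (simp add: field_simps)
    qed
    then show ?thesis using True by simp
  next
    case False
    then have A: "?A > 0" using Bochner_Integration.integral_nonneg[of M "\<lambda>x. (f x)\<^sup>2"] by (simp add: less_le)
    \<comment> \<open>The point s = \<open>?C\<close>, t = - \<open>?A\<close> is, up to scaling,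
      the minimiser of the form for fixed t.\<close>
    have "0 \<le> ?A * (?A * ?B - ?C\<^sup>2)"
      using q[of "?C" "- ?A"] by (simp add: power2_eq_square algebra_simps)
    then show ?thesis using A by (simp add: zero_le_mult_iff)
  qed
  then have "sqrt (?C\<^sup>2) \<le> sqrt (?A * ?B)" by (rule real_sqrt_le_mono)
  then show ?thesis by (simp add: real_sqrt_mult)
qed

lemma H1_has_weak_pderiv: "v \<in> H1 U \<Longrightarrow> b \<in> Basis \<Longrightarrow> has_weak_pderiv U b v (weak_pderiv U b v)"
  unfolding H1_def by (auto intro: has_weak_pderiv_weak_pderiv)

lemma weak_pderiv_AE_eq:
  fixes g :: "plane \<Rightarrow> real"
  assumes "open U" "has_weak_pderiv U b f g"
  shows "AE x in lebesgue_on U. g x = weak_pderiv U b f x"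
  by (rule has_weak_pderiv_unique[OF assms has_weak_pderiv_weak_pderiv[OF assms(2)]])

lemma square_integrable_weak_pderiv:
  assumes "open U" "has_weak_pderiv U b f g" "square_integrable (lebesgue_on U) g"
  shows "square_integrable (lebesgue_on U) (weak_pderiv U b f)"
    and "(LINT x|lebesgue_on U. (weak_pderiv U b f x)\<^sup>2) = (LINT x|lebesgue_on U. (g x)\<^sup>2)"
proof -
  note ae = weak_pderiv_AE_eq[OF assms(1,2)]
  have m: "weak_pderiv U b f \<in> borel_measurable (lebesgue_on U)"
    by (rule borel_measurable_lebesgue_on_AE[OF _ _ ae]) (use assms(1,3) in \<open>simp_all add: square_integrable_def\<close>)
  show "square_integrable (lebesgue_on U) (weak_pderiv U b f)"
    "(LINT x|lebesgue_on U. (weak_pderiv U b f x)\<^sup>2) = (LINT x|lebesgue_on U. (g x)\<^sup>2)"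
    by (rule square_integrable_cong_AE[OF assms(3) m ae])+
qed

lemma H1_I:
  assumes "open U" "square_integrable (lebesgue_on U) f"
    and "\<And>b. b \<in> Basis \<Longrightarrow> has_weak_pderiv U b f (g b)"
    and "\<And>b. b \<in> Basis \<Longrightarrow> square_integrable (lebesgue_on U) (g b)"
  shows "f \<in> H1 U"
  using assms(2) assms(3) square_integrable_weak_pderiv(1)[OF assms(1) assms(3) assms(4)] unfolding H1_def by auto

text \<open>Replaces the chosen derivatives in the definition of the norm by known ones; every
  concrete norm computation below passes through this.\<close>

lemma H1_norm_eq:
  assumes "open U" 
    and "\<And>b. b \<in> Basis \<Longrightarrow> has_weak_pderiv U b f (g b)"
    and "\<And>b. b \<in> Basis \<Longrightarrow> square_integrable (lebesgue_on U) (g b)"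
  shows "H1_norm U f = sqrt ((LINT x|lebesgue_on U. (f x)\<^sup>2) + (\<Sum>b\<in>Basis. LINT x|lebesgue_on U. (g b x)\<^sup>2))"
  unfolding H1_norm_def
  using square_integrable_weak_pderiv(2)[OF assms(1) assms(2) assms(3)] by (simp cong: sum.cong)

lemma H1_square_integrable:
  "v \<in> H1 U \<Longrightarrow> square_integrable (lebesgue_on U) v"
  "v \<in> H1 U \<Longrightarrow> b \<in> Basis \<Longrightarrow> square_integrable (lebesgue_on U) (weak_pderiv U b v)"
  unfolding H1_def by auto

lemma H1_diff:
  assumes "open U" "f \<in> H1 U" "g \<in> H1 U"
  shows "(\<lambda>x. f x - g x) \<in> H1 U"
proof (rule H1_I[where g="\<lambda>b x. weak_pderiv U b f x - weak_pderiv U b g x"])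
qed (intro square_integrable_diff has_weak_pderiv_diff H1_has_weak_pderiv H1_square_integrable assms | assumption)+

lemma H1_norm_diff:
  assumes "open U" "f \<in> H1 U" "g \<in> H1 U"
  shows "H1_norm U (\<lambda>x. f x - g x) = sqrt ((LINT x|lebesgue_on U. (f x - g x)\<^sup>2)
    + (\<Sum>b\<in>Basis. LINT x|lebesgue_on U. (weak_pderiv U b f x - weak_pderiv U b g x)\<^sup>2))"
  using assms
  by (intro H1_norm_eq square_integrable_diff has_weak_pderiv_diff H1_has_weak_pderiv H1_square_integrable)

section \<open>Restriction to open subsets, and smooth functions as Sobolev functions\<close>

lemma square_integrable_subset:
  assumes "square_integrable (lebesgue_on U) f" "U \<in> sets lebesgue" "E \<in> sets lebesgue" "E \<subseteq> U"
  shows "square_integrable (lebesgue_on E) f"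
  using assms integrable_lebesgue_on_subset[of U "\<lambda>x. (f x)\<^sup>2" E]
  unfolding square_integrable_def by (auto intro: measurable_restrict_mono)

lemma H1_subset:
  assumes "open U" "open E" "E \<subseteq> U" "f \<in> H1 U"
  shows "f \<in> H1 E"
proof (rule H1_I[where g="\<lambda>b. weak_pderiv U b f"])
  have m: "U \<in> sets lebesgue" "E \<in> sets lebesgue" using assms by auto
  show "square_integrable (lebesgue_on E) f"
    by (rule square_integrable_subset[OF H1_square_integrable(1)[OF assms(4)] m assms(3)])
  fix b :: plane assume b: "b \<in> Basis"
  show "square_integrable (lebesgue_on E) (weak_pderiv U b f)"
    by (rule square_integrable_subset[OF H1_square_integrable(2)[OF assms(4) b] m assms(3)])
  show "has_weak_pderiv E b f (weak_pderiv U b f)"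
    by (rule has_weak_pderiv_subset[OF assms(1-3) H1_has_weak_pderiv[OF assms(4) b] b])
qed (fact assms)

lemma integral_subset_mono:
  fixes f :: "'a::euclidean_space \<Rightarrow> real"
  assumes "integrable (lebesgue_on U) f" "U \<in> sets lebesgue" "E \<in> sets lebesgue" "E \<subseteq> U" "\<And>x. x \<in> U \<Longrightarrow> 0 \<le> f x"
  shows "(LINT x|lebesgue_on E. f x) \<le> (LINT x|lebesgue_on U. f x)"
  using assms integrable_lebesgue_on_subset[OF assms(1), of E]
  by (subst (1 2) integral_restrict_space)
     (auto intro!: integral_mono simp: integrable_restrict_space indicator_def)

lemma H1_norm_subset:
  assumes "open U" "open E" "E \<subseteq> U" "f \<in> H1 U"
  shows "H1_norm E f = sqrt ((LINT x|lebesgue_on E. (f x)\<^sup>2) + (\<Sum>b\<in>Basis. LINT x|lebesgue_on E. (weak_pderiv U b f x)\<^sup>2))"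
  using assms
  by (intro H1_norm_eq has_weak_pderiv_subset[of U E]
     square_integrable_subset[of U _ E] H1_has_weak_pderiv H1_square_integrable) auto

lemma H1_norm_subset_le:
  assumes "open U" "open E" "E \<subseteq> U" "f \<in> H1 U"
  shows "H1_norm E f \<le> H1_norm U f"
proof -
  have le: "(LINT x|lebesgue_on E. (g x)\<^sup>2) \<le> (LINT x|lebesgue_on U. (g x)\<^sup>2)"
    if "square_integrable (lebesgue_on U) g" for g
    using that assms by (intro integral_subset_mono) (auto simp: square_integrable_def)
  show ?thesis unfolding H1_norm_subset[OF assms] H1_norm_def[of U]
    by (intro real_sqrt_le_mono add_mono sum_mono le H1_square_integrable[OF assms(4)])
qed

lemma H1_norm_nonneg: "0 \<le> H1_norm U f"
  unfolding H1_norm_def by (intro real_sqrt_ge_zero add_nonneg_nonneg sum_nonneg) auto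

lemma square_integrable_continuous:
  fixes f :: "plane \<Rightarrow> real"
  assumes "continuous_on (closure U) f" "bounded U" "U \<in> sets lebesgue"
  shows "square_integrable (lebesgue_on U) f"
proof -
  have K: "compact (closure U)" using assms(2) by (simp add: compact_closure)
  have "f \<in> borel_measurable (lebesgue_on U)"
    using continuous_imp_measurable_on_sets_lebesgue[OF continuous_on_subset[OF assms(1) closure_subset] assms(3)] .
  moreover have "integrable (lebesgue_on U) (\<lambda>x. (f x)\<^sup>2)"
  proof (rule integrable_lebesgue_on_subset[of "closure U"])
    have "locally_integrable (closure U) (\<lambda>x. (f x)\<^sup>2)"
      by (intro locally_integrable_continuous continuous_intros assms)
    then show "integrable (lebesgue_on (closure U)) (\<lambda>x. (f x)\<^sup>2)"
      using K by (auto simp: locally_integrable_def)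
  qed (use assms closure_subset in auto)
  ultimately show ?thesis by (simp add: square_integrable_def)
qed

lemma smooth_H1:
  assumes "open U" "bounded U" "smooth \<phi>"
  shows "\<phi> \<in> H1 U"
  using assms by (intro H1_I[where g="\<lambda>b. pderiv_dir b \<phi>"] square_integrable_continuous
      has_weak_pderiv_smooth smooth_continuous_on smooth_pderiv_dir) auto

lemma H1_norm_smooth:
  assumes "open U" "bounded U" "smooth \<phi>"
  shows "H1_norm U \<phi> = sqrt ((LINT x|lebesgue_on U. (\<phi> x)\<^sup>2) + (\<Sum>b\<in>Basis. LINT x|lebesgue_on U. (pderiv_dir b \<phi> x)\<^sup>2))"
  using assms by (intro H1_norm_eq square_integrable_continuous
      has_weak_pderiv_smooth smooth_continuous_on smooth_pderiv_dir) auto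

lemma lborel_integral_translate:
  fixes f :: "'a::euclidean_space \<Rightarrow> real"
  assumes "f \<in> borel_measurable borel"
  shows "(LINT y|lborel. f (c + y)) = (LINT y|lborel. f y)"
  using integral_distr[of "(+) c" lborel borel f] assms by (simp add: lborel_distr_plus)

lemma lborel_nn_integral_affine:
  fixes f :: "'a::euclidean_space \<Rightarrow> ennreal"
  assumes "f \<in> borel_measurable borel" "c \<noteq> 0"
  shows "(\<integral>\<^sup>+y. f y \<partial>lborel) = ennreal (\<bar>c\<bar> ^ DIM('a)) * (\<integral>\<^sup>+y. f (t + c *\<^sub>R y) \<partial>lborel)"
  using assms
  by (subst lborel_affine[OF assms(2), of t]) (simp add: nn_integral_density nn_integral_distr nn_integral_cmult)

lemma abs_fst_le_norm: "\<bar>fst (z::plane)\<bar> \<le> norm z" and abs_snd_le_norm: "\<bar>snd z\<bar> \<le> norm z"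
  using norm_fst_le[of "fst z" "snd z"] norm_snd_le[of "snd z" "fst z"] by auto

lemma smooth_Lipschitz:
  assumes "smooth f" "\<And>x. \<bar>pderiv_dir (1, 0) f x\<bar> \<le> A" "\<And>x. \<bar>pderiv_dir (0, 1) f x\<bar> \<le> B"
  shows "\<bar>f x - f y\<bar> \<le> (A + B) * norm (x - y)"
proof -
  have "norm (f x - f y) \<le> (A + B) * norm (x - y)"
  proof (rule differentiable_bound[of UNIV])
    fix z :: plane
    show "(f has_derivative (\<lambda>k. \<Sum>b\<in>Basis. (k \<bullet> b) * pderiv_dir b f z)) (at z)"
      by (rule smooth_has_derivative[OF assms(1)])
    show "onorm (\<lambda>k. \<Sum>b\<in>Basis. (k \<bullet> b) * pderiv_dir b f z) \<le> A + B"
    proof (rule onorm_le)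
      fix k :: plane
      have "\<bar>fst k * pderiv_dir (1, 0) f z\<bar> \<le> norm k * A"
        unfolding abs_mult using assms(2)[of z] by (intro mult_mono abs_fst_le_norm) auto
      moreover have "\<bar>snd k * pderiv_dir (0, 1) f z\<bar> \<le> norm k * B"
        unfolding abs_mult using assms(3)[of z] by (intro mult_mono abs_snd_le_norm) auto
      ultimately show "norm (\<Sum>b\<in>Basis. (k \<bullet> b) * pderiv_dir b f z) \<le> (A + B) * norm k"
        by (simp add: sum_Basis_plane inner_prod_def algebra_simps)
    qed
  qed auto
  then show ?thesis by simp
qed

section \<open>Mollification\<close>

definition convolution :: "(plane \<Rightarrow> real) \<Rightarrow> (plane \<Rightarrow> real) \<Rightarrow> plane \<Rightarrow> real" where
  "convolution u \<psi> z = (LINT y|lborel. u y * \<psi> (z - y))"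

lemma integrable_mult_bounded:
  assumes "integrable M u" "\<psi> \<in> borel_measurable M" "\<And>x. \<bar>\<psi> x\<bar> \<le> (B::real)"
  shows "integrable M (\<lambda>x. u x * \<psi> x)"
proof (rule Bochner_Integration.integrable_bound[of _ "\<lambda>x. B * u x"])
  show "AE x in M. norm (u x * \<psi> x) \<le> norm (B * u x)"
  proof (rule AE_I2)
    fix x
    have "\<bar>\<psi> x\<bar> * \<bar>u x\<bar> \<le> \<bar>B\<bar> * \<bar>u x\<bar>" using assms(3)[of x] by (intro mult_right_mono) auto
    then show "norm (u x * \<psi> x) \<le> norm (B * u x)" by (simp add: abs_mult mult.commute)
  qed
qed (use assms in auto)

lemma test_function_reflect_measurable:
  "test_function U \<psi> \<Longrightarrow> (\<lambda>y. \<psi> (z - y)) \<in> borel_measurable borel"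
  by (intro borel_measurable_continuous_onI continuous_on_compose2[OF smooth_continuous_on[OF test_function_smooth]])
     (auto intro!: continuous_intros)

text \<open>Differentiation under the integral sign. The remainder quotient \<open>q\<close> of
  \<open>\<psi>\<close> tends to zero pointwise and is bounded uniformly, so a multiple of the
  absolute value of \<open>u\<close> is an integrable majorant.\<close>

lemma convolution_has_derivative:
  assumes u: "integrable lborel u" and \<psi>: "test_function UNIV \<psi>"
  shows "(convolution u \<psi> has_derivative
    (\<lambda>k. \<Sum>b\<in>Basis. (k \<bullet> b) * convolution u (pderiv_dir b \<psi>) z)) (at z)"
  unfolding has_derivative_at
proof
  show "bounded_linear (\<lambda>k. \<Sum>b\<in>Basis. (k \<bullet> b) * convolution u (pderiv_dir b \<psi>) z)"
    by (intro bounded_linear_sum bounded_linear_mult_const bounded_linear_inner_left)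
  have p: "test_function UNIV (pderiv_dir b \<psi>)" if "b \<in> Basis" for b
    using test_function_pderiv_dir[OF \<psi> that] .
  have p1: "test_function UNIV (pderiv_dir (1,0) \<psi>)" and p2: "test_function UNIV (pderiv_dir (0,1) \<psi>)"
    by (rule p, simp add: Basis_plane)+
  have sm: "smooth \<psi>" using \<psi> by (rule test_function_smooth)
  obtain B0 where B0: "\<And>x. \<bar>\<psi> x\<bar> \<le> B0" using test_function_bounded[OF \<psi>] by blast
  obtain B1 where B1: "\<And>x. \<bar>pderiv_dir (1,0) \<psi> x\<bar> \<le> B1" using test_function_bounded[OF p1] by blast
  obtain B2 where B2: "\<And>x. \<bar>pderiv_dir (0,1) \<psi> x\<bar> \<le> B2" using test_function_bounded[OF p2] by blast
  note lip = smooth_Lipschitz[OF sm B1 B2]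
  define q where "q k y = (\<psi> (z + k - y) - \<psi> (z - y)
      - (fst k * pderiv_dir (1,0) \<psi> (z - y) + snd k * pderiv_dir (0,1) \<psi> (z - y))) / norm k" for k y
  have q_meas: "q k \<in> borel_measurable lborel" for k
    unfolding q_def
    using test_function_reflect_measurable[OF \<psi>] test_function_reflect_measurable[OF p1] test_function_reflect_measurable[OF p2]
    by measurable
  have int: "integrable lborel (\<lambda>y. u y * \<psi> (w - y))" for w
    using u B0 test_function_reflect_measurable[OF \<psi>] by (intro integrable_mult_bounded[of _ _ _ B0]) auto
  have int1: "integrable lborel (\<lambda>y. u y * pderiv_dir (1,0) \<psi> (w - y))" for w
    using u B1 test_function_reflect_measurable[OF p1] by (intro integrable_mult_bounded[of _ _ _ B1]) auto
  have int2: "integrable lborel (\<lambda>y. u y * pderiv_dir (0,1) \<psi> (w - y))" for w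
    using u B2 test_function_reflect_measurable[OF p2] by (intro integrable_mult_bounded[of _ _ _ B2]) auto
  \<comment> \<open>One copy of \<open>B1 + B2\<close> bounds the difference quotient through the
    Lipschitz estimate, the other bounds the linear part.\<close>
  have q_bound: "\<bar>q k y\<bar> \<le> 2 * (B1 + B2)" for k y
  proof (cases "k = 0")
    case True
    then show ?thesis using B1[of z] B2[of z] by (simp add: q_def)
  next
    case False
    have "\<bar>fst k * pderiv_dir (1,0) \<psi> (z - y)\<bar> \<le> norm k * B1"
      unfolding abs_mult using B1[of "z - y"] by (intro mult_mono abs_fst_le_norm) auto
    moreover have "\<bar>snd k * pderiv_dir (0,1) \<psi> (z - y)\<bar> \<le> norm k * B2"
      unfolding abs_mult using B2[of "z - y"] by (intro mult_mono abs_snd_le_norm) auto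
    moreover have "\<bar>\<psi> (z + k - y) - \<psi> (z - y)\<bar> \<le> (B1 + B2) * norm k"
      using lip[of "z + k - y" "z - y"] by (simp add: algebra_simps)
    ultimately have "\<bar>\<psi> (z + k - y) - \<psi> (z - y) - (fst k * pderiv_dir (1,0) \<psi> (z - y) + snd k * pderiv_dir (0,1) \<psi> (z - y))\<bar>
       \<le> 2 * (B1 + B2) * norm k"
      by (simp add: algebra_simps)
    then show ?thesis using False unfolding q_def by (simp add: divide_le_eq)
  qed
  have q_lim: "((\<lambda>k. q k y) \<longlongrightarrow> 0) (at 0)" for y
  proof -
    have "(\<lambda>k. norm (\<psi> (z - y + k) - \<psi> (z - y) - (\<Sum>b\<in>Basis. (k \<bullet> b) * pderiv_dir b \<psi> (z - y))) / norm k) \<midarrow>0\<rightarrow> 0"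
      using smooth_has_derivative[OF sm, of "z - y"] unfolding has_derivative_at by blast
    moreover have "norm (\<psi> (z - y + k) - \<psi> (z - y) - (\<Sum>b\<in>Basis. (k \<bullet> b) * pderiv_dir b \<psi> (z - y))) / norm k = norm (q k y)" for k
      by (simp add: q_def sum_Basis_plane inner_prod_def algebra_simps)
    ultimately have "(\<lambda>k. norm (q k y)) \<midarrow>0\<rightarrow> 0" by (simp only:)
    then show ?thesis by (rule tendsto_norm_zero_cancel)
  qed
  have rep: "(convolution u \<psi> (z + k) - convolution u \<psi> z - (\<Sum>b\<in>Basis. (k \<bullet> b) * convolution u (pderiv_dir b \<psi>) z)) / norm k
     = (LINT y|lborel. u y * q k y)" for k
  proof -
    have eq: "u y * q k y = (u y * \<psi> (z + k - y) - u y * \<psi> (z - y)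
      - (fst k * (u y * pderiv_dir (1,0) \<psi> (z - y)) + snd k * (u y * pderiv_dir (0,1) \<psi> (z - y)))) / norm k" for y
      by (simp add: q_def algebra_simps)
    have "(LINT y|lborel. u y * q k y) = ((LINT y|lborel. u y * \<psi> (z + k - y)) - (LINT y|lborel. u y * \<psi> (z - y))
      - (fst k * (LINT y|lborel. u y * pderiv_dir (1,0) \<psi> (z - y)) + snd k * (LINT y|lborel. u y * pderiv_dir (0,1) \<psi> (z - y)))) / norm k"
      unfolding eq using int int1 int2 by simp
    then show ?thesis by (simp add: convolution_def sum_Basis_plane inner_prod_def)
  qed
  have "((\<lambda>k. LINT y|lborel. u y * q k y) \<longlongrightarrow> 0) (at 0)"
    unfolding tendsto_at_iff_sequentially
  \<comment> \<open>Dominated convergence is available for sequences only, so the limit at 0 is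
    tested along an arbitrary null sequence.\<close>
  proof (intro allI impI)
    fix X :: "nat \<Rightarrow> plane" assume X: "\<forall>i. X i \<in> UNIV - {0}" "X \<longlonglongrightarrow> 0"
    have "(\<lambda>i. LINT y|lborel. u y * q (X i) y) \<longlonglongrightarrow> (LINT y|lborel. u y * 0)"
    proof (rule integral_dominated_convergence[where w="\<lambda>y. 2 * (B1 + B2) * \<bar>u y\<bar>"])
      show "AE y in lborel. (\<lambda>i. u y * q (X i) y) \<longlonglongrightarrow> u y * 0"
      proof (intro AE_I2 tendsto_intros)
        fix y
        show "(\<lambda>i. q (X i) y) \<longlonglongrightarrow> 0"
          using q_lim[of y] X unfolding tendsto_at_iff_sequentially by (auto simp: o_def)
      qed
      show "AE y in lborel. norm (u y * q (X i) y) \<le> 2 * (B1 + B2) * \<bar>u y\<bar>" for i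
        using mult_right_mono[OF q_bound abs_ge_zero] by (intro AE_I2) (simp add: abs_mult mult.commute)
    qed (use u q_meas in auto)
    then show "((\<lambda>k. LINT y|lborel. u y * q k y) \<circ> X) \<longlonglongrightarrow> 0" by (simp add: o_def)
  qed
  then have "((\<lambda>k. norm (LINT y|lborel. u y * q k y)) \<longlongrightarrow> 0) (at 0)" by (rule tendsto_norm_zero)
  then show "(\<lambda>k. norm (convolution u \<psi> (z + k) - convolution u \<psi> z - (\<Sum>b\<in>Basis. (k \<bullet> b) * convolution u (pderiv_dir b \<psi>) z)) / norm k) \<midarrow>0\<rightarrow> 0"
    unfolding rep[symmetric] by simp
qed

lemma pderiv_dir_convolution:
  assumes "integrable lborel u" "test_function UNIV \<psi>" "b \<in> Basis"
  shows "pderiv_dir b (convolution u \<psi>) z = convolution u (pderiv_dir b \<psi>) z"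
proof -
  have "pderiv_dir b (convolution u \<psi>) z = (\<Sum>b'\<in>Basis. (b \<bullet> b') * convolution u (pderiv_dir b' \<psi>) z)"
    by (rule pderiv_dir_eqI[OF convolution_has_derivative[OF assms(1,2)]])
  also have "\<dots> = convolution u (pderiv_dir b \<psi>) z"
    using assms(3) by (auto simp: Basis_plane)
  finally show ?thesis .
qed

lemma smooth_convolution:
  assumes "integrable lborel u" "test_function UNIV \<psi>"
  shows "smooth (convolution u \<psi>)"
proof (rule smooth_coinduct[of "\<lambda>f. \<exists>\<psi>. test_function UNIV \<psi> \<and> f = convolution u \<psi>"])
  show "\<exists>\<psi>'. test_function UNIV \<psi>' \<and> convolution u \<psi> = convolution u \<psi>'" using assms by blast
  show "f differentiable at x" if "\<exists>\<psi>. test_function UNIV \<psi> \<and> f = convolution u \<psi>" for f x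
    using that convolution_has_derivative[OF assms(1)] unfolding differentiable_def by blast
  show "\<exists>\<psi>. test_function UNIV \<psi> \<and> pderiv_dir b f = convolution u \<psi>"
    if f: "\<exists>\<psi>. test_function UNIV \<psi> \<and> f = convolution u \<psi>" and b: "b \<in> Basis" for f b
  proof -
    obtain \<psi> where \<psi>: "test_function UNIV \<psi>" "f = convolution u \<psi>" using f by blast
    have "pderiv_dir b f = convolution u (pderiv_dir b \<psi>)"
      unfolding \<psi>(2) by (rule ext, rule pderiv_dir_convolution[OF assms(1) \<psi>(1) b])
    then show ?thesis using test_function_pderiv_dir[OF \<psi>(1) b] by blast
  qed
qed

text \<open>The kernel lives on a square of half-width \<open>\<delta>\<close>, not on a disc.
  Estimates in the Euclidean norm therefore meet the radius \<open>2 * \<delta>\<close>.\<close>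

definition mollifier :: "real \<Rightarrow> plane \<Rightarrow> real" where
  "mollifier \<delta> w = box_bump 1 (-\<delta>, -\<delta>) (\<delta>, \<delta>) w / (LINT y|lborel. box_bump 1 (-\<delta>, -\<delta>) (\<delta>, \<delta>) y)"

lemma integral_box_bump_pos:
  assumes "\<delta> > 0" shows "(LINT y|lborel. box_bump 1 (-\<delta>, -\<delta>) (\<delta>, \<delta>) y) > 0"
proof -
  let ?f = "box_bump 1 (-\<delta>, -\<delta>) (\<delta>, \<delta>)"
  have int: "integrable lborel ?f"
    by (rule test_function_integrable_lborel[OF test_function_box_bump[OF subset_UNIV]]) simp
  have "(LINT y|lborel. ?f y) \<noteq> 0"
  proof
    assume "(LINT y|lborel. ?f y) = 0"
    then have "AE y in lborel. ?f y = 0"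
      using integral_nonneg_eq_0_iff_AE[OF int] by (simp add: box_bump_bounds)
    then have "AE y in lborel. y \<notin> box (-\<delta>, -\<delta>) (\<delta>, \<delta>)"
      by eventually_elim (metis box_bump_pos_iff zero_less_one)
    then have "emeasure lborel (box (-\<delta>, -\<delta>) (\<delta>, \<delta>) :: plane set) = 0"
      by (subst (asm) AE_iff_measurable[of "box (-\<delta>, -\<delta>) (\<delta>, \<delta>)"]) auto
    moreover have "emeasure lborel (box (-\<delta>, -\<delta>) (\<delta>, \<delta>) :: plane set) = ennreal ((2 * \<delta>) * (2 * \<delta>))"
      using assms by (subst emeasure_lborel_box) (auto simp: Basis_plane inner_prod_def)
    ultimately show False using assms by simp
  qed
  moreover have "(LINT y|lborel. ?f y) \<ge> 0" by (simp add: box_bump_bounds)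
  ultimately show ?thesis by linarith
qed

lemma test_function_mollifier: "test_function UNIV (mollifier \<delta>)"
proof -
  have "test_function UNIV (\<lambda>w. 1 / (LINT y|lborel. box_bump 1 (-\<delta>, -\<delta>) (\<delta>, \<delta>) y) * box_bump 1 (-\<delta>, -\<delta>) (\<delta>, \<delta>) w)"
    by (intro test_function_mult[OF test_function_box_bump] smooth_const) auto
  then show ?thesis unfolding mollifier_def by simp
qed

lemma mollifier_nonneg: "0 \<le> mollifier \<delta> w"
  unfolding mollifier_def by (simp add: box_bump_bounds)

lemma mollifier_support: "mollifier \<delta> w \<noteq> 0 \<Longrightarrow> \<bar>fst w\<bar> < \<delta> \<and> \<bar>snd w\<bar> < \<delta>"
  using box_bump_pos_iff[of 1 "(-\<delta>, -\<delta>)" "(\<delta>, \<delta>)" w] by (auto simp: mollifier_def box_plane)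

lemma mollifier_even: "mollifier \<delta> (- w) = mollifier \<delta> w"
  unfolding mollifier_def box_bump_def by (simp add: add.commute)

lemma integral_mollifier: "\<delta> > 0 \<Longrightarrow> (LINT y|lborel. mollifier \<delta> y) = 1"
  using integral_box_bump_pos[of \<delta>] unfolding mollifier_def by simp

lemma mollifier_measurable [measurable]: "mollifier \<delta> \<in> borel_measurable borel"
  using test_function_smooth[OF test_function_mollifier] by (rule smooth_borel_measurable)

lemma mollifier_shift: "mollifier \<delta> (z - y) = mollifier \<delta> (- z + y)"
  using mollifier_even[of \<delta> "z - y"] by simp

lemma integral_mollifier_shift:
  assumes "\<delta> > 0" shows "(LINT y|lborel. mollifier \<delta> (z - y)) = 1" "integrable lborel (\<lambda>y. mollifier \<delta> (z - y))"
proof -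
  show *: "(LINT y|lborel. mollifier \<delta> (z - y)) = 1"
    unfolding mollifier_shift using lborel_integral_translate[OF mollifier_measurable, of \<delta> "- z"] integral_mollifier[OF assms]
    by (simp only:)
  show "integrable lborel (\<lambda>y. mollifier \<delta> (z - y))"
    using * not_integrable_integral_eq by fastforce
qed

lemma nn_integral_mollifier_shift:
  assumes "\<delta> > 0" shows "(\<integral>\<^sup>+z. ennreal (mollifier \<delta> (z - y)) \<partial>lborel) = 1"
proof -
  have "(\<integral>\<^sup>+z. ennreal (mollifier \<delta> (z - y)) \<partial>lborel) = (\<integral>\<^sup>+z. ennreal (mollifier \<delta> (y - z)) \<partial>lborel)"
    using mollifier_even by (metis minus_diff_eq)
  also have "\<dots> = ennreal (LINT z|lborel. mollifier \<delta> (y - z))"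
    by (rule nn_integral_eq_integral[OF integral_mollifier_shift(2)[OF assms]]) (simp add: mollifier_nonneg)
  finally show ?thesis using integral_mollifier_shift(1)[OF assms] by simp
qed

lemma convolution_integrable:
  assumes "\<delta> > 0" and u: "u \<in> borel_measurable borel" "integrable lborel (\<lambda>y. (u y)\<^sup>2)"
  shows "integrable lborel (\<lambda>y. (u y)\<^sup>2 * mollifier \<delta> (z - y))"
    and "integrable lborel (\<lambda>y. u y * mollifier \<delta> (z - y))"
proof -
  obtain B where B: "\<And>x. \<bar>mollifier \<delta> x\<bar> \<le> B" using test_function_bounded[OF test_function_mollifier] by blast
  show i: "integrable lborel (\<lambda>y. (u y)\<^sup>2 * mollifier \<delta> (z - y))"
    by (rule integrable_mult_bounded[OF u(2) _ B]) measurable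
  show "integrable lborel (\<lambda>y. u y * mollifier \<delta> (z - y))"
  proof (rule Bochner_Integration.integrable_bound[OF Bochner_Integration.integrable_add[OF i integral_mollifier_shift(2)[OF assms(1), of z]]])
    show "(\<lambda>y. u y * mollifier \<delta> (z - y)) \<in> borel_measurable lborel" using u by measurable
    \<comment> \<open>Square integrability suffices: the kernel is a probability density, so the
      summand 1 is integrable against it.\<close>
    have "\<bar>t\<bar> \<le> t\<^sup>2 + 1" for t :: real
      using sum_squares_bound[of "\<bar>t\<bar>" 1] by simp
    then have "\<bar>u y\<bar> * mollifier \<delta> (z - y) \<le> ((u y)\<^sup>2 + 1) * mollifier \<delta> (z - y)" for y
      by (rule mult_right_mono[OF _ mollifier_nonneg])
    then show "AE y in lborel. norm (u y * mollifier \<delta> (z - y)) \<le> norm ((u y)\<^sup>2 * mollifier \<delta> (z - y) + mollifier \<delta> (z - y))"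
      by (intro AE_I2) (simp add: abs_mult mollifier_nonneg distrib_right)
  qed
qed

text \<open>The variance of \<open>u\<close> under the probability density \<open>?K\<close> is
  nonnegative; expanding it around the mean \<open>m\<close> gives the claim.\<close>

lemma convolution_Jensen:
  assumes "\<delta> > 0" and u: "u \<in> borel_measurable borel" "integrable lborel (\<lambda>y. (u y)\<^sup>2)"
  shows "(convolution u (mollifier \<delta>) z)\<^sup>2 \<le> (LINT y|lborel. (u y)\<^sup>2 * mollifier \<delta> (z - y))"
proof -
  let ?K = "\<lambda>y. mollifier \<delta> (z - y)"
  define m where "m = convolution u (mollifier \<delta>) z"
  note i = convolution_integrable[OF assms, of z] integral_mollifier_shift[OF assms(1), of z]
  have "0 \<le> (LINT y|lborel. (u y - m)\<^sup>2 * ?K y)"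
    by (intro Bochner_Integration.integral_nonneg mult_nonneg_nonneg mollifier_nonneg) auto
  also have "(\<lambda>y. (u y - m)\<^sup>2 * ?K y) = (\<lambda>y. (u y)\<^sup>2 * ?K y - (2 * m) * (u y * ?K y) + m\<^sup>2 * ?K y)"
    by (simp add: power2_eq_square algebra_simps)
  also have "(LINT y|lborel. \<dots> y) = (LINT y|lborel. (u y)\<^sup>2 * ?K y) - (2 * m) * m + m\<^sup>2 * 1"
    using i unfolding m_def convolution_def by simp
  finally show ?thesis unfolding m_def by (simp add: power2_eq_square)
qed

lemma convolution_measurable:
  assumes "u \<in> borel_measurable borel"
  shows "convolution u (mollifier \<delta>) \<in> borel_measurable borel"
proof -
  have [measurable]: "u \<in> borel_measurable lborel" using assms by simp
  have "(\<lambda>z. LINT y|lborel. u y * mollifier \<delta> (z - y)) \<in> borel_measurable lborel" by measurable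
  then show ?thesis unfolding convolution_def by simp
qed

text \<open>Young's inequality in the form that averaging contracts the L2 norm: Jensen pointwise
  and Tonelli. Nonnegative integrals avoid an integrability proof for the convolution.\<close>

lemma nn_integral_convolution_le:
  assumes "\<delta> > 0" and u: "u \<in> borel_measurable borel" "integrable lborel (\<lambda>y. (u y)\<^sup>2)"
  shows "(\<integral>\<^sup>+z. ennreal ((convolution u (mollifier \<delta>) z)\<^sup>2) \<partial>lborel) \<le> (\<integral>\<^sup>+y. ennreal ((u y)\<^sup>2) \<partial>lborel)"
proof -
  have [measurable]: "u \<in> borel_measurable lborel" using u by simp
  have "(\<integral>\<^sup>+z. ennreal ((convolution u (mollifier \<delta>) z)\<^sup>2) \<partial>lborel)
      \<le> (\<integral>\<^sup>+z. \<integral>\<^sup>+y. ennreal ((u y)\<^sup>2 * mollifier \<delta> (z - y)) \<partial>lborel \<partial>lborel)"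
  proof (rule nn_integral_mono)
    fix z
    have "ennreal ((convolution u (mollifier \<delta>) z)\<^sup>2) \<le> ennreal (LINT y|lborel. (u y)\<^sup>2 * mollifier \<delta> (z - y))"
      by (rule ennreal_leI[OF convolution_Jensen[OF assms]])
    also have "\<dots> = (\<integral>\<^sup>+y. ennreal ((u y)\<^sup>2 * mollifier \<delta> (z - y)) \<partial>lborel)"
      by (rule nn_integral_eq_integral[symmetric, OF convolution_integrable(1)[OF assms]]) (simp add: mollifier_nonneg)
    finally show "ennreal ((convolution u (mollifier \<delta>) z)\<^sup>2) \<le> (\<integral>\<^sup>+y. ennreal ((u y)\<^sup>2 * mollifier \<delta> (z - y)) \<partial>lborel)" .
  qed
  also have "\<dots> = (\<integral>\<^sup>+y. \<integral>\<^sup>+z. ennreal ((u y)\<^sup>2 * mollifier \<delta> (z - y)) \<partial>lborel \<partial>lborel)"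
    by (rule lborel_pair.Fubini') measurable
  also have "\<dots> = (\<integral>\<^sup>+y. ennreal ((u y)\<^sup>2) * (\<integral>\<^sup>+z. ennreal (mollifier \<delta> (z - y)) \<partial>lborel) \<partial>lborel)"
    by (simp add: ennreal_mult mollifier_nonneg nn_integral_cmult)
  also have "\<dots> = (\<integral>\<^sup>+y. ennreal ((u y)\<^sup>2) \<partial>lborel)"
    by (simp add: nn_integral_mollifier_shift[OF assms(1)])
  finally show ?thesis .
qed

text \<open>A weighted average of values within \<open>e\<close> of \<open>c\<close> stays within
  \<open>e\<close> of \<open>c\<close>. Uniform continuity turns this into uniform convergence of
  mollifications.\<close>

lemma convolution_near:
  assumes "\<delta> > 0" and u: "u \<in> borel_measurable borel" "integrable lborel (\<lambda>y. (u y)\<^sup>2)"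
    and near: "\<And>y. \<bar>fst (z - y)\<bar> < \<delta> \<Longrightarrow> \<bar>snd (z - y)\<bar> < \<delta> \<Longrightarrow> \<bar>u y - c\<bar> \<le> e"
  shows "\<bar>convolution u (mollifier \<delta>) z - c\<bar> \<le> e"
proof -
  let ?K = "\<lambda>y. mollifier \<delta> (z - y)"
  note i = convolution_integrable[OF assms(1-3), of z] integral_mollifier_shift[OF assms(1), of z]
  have le: "\<bar>(u y - c) * ?K y\<bar> \<le> e * ?K y" for y
  proof (cases "?K y = 0")
    case False
    then have "\<bar>u y - c\<bar> \<le> e" using mollifier_support[OF False] near by auto
    then show ?thesis by (simp add: abs_mult mollifier_nonneg mult_right_mono)
  qed simp
  have "convolution u (mollifier \<delta>) z - c = (LINT y|lborel. u y * ?K y - c * ?K y)"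
    using i unfolding convolution_def by simp
  also have "\<dots> = (LINT y|lborel. (u y - c) * ?K y)" by (simp add: left_diff_distrib)
  also have "\<bar>\<dots>\<bar> \<le> (LINT y|lborel. \<bar>(u y - c) * ?K y\<bar>)" by (rule integral_abs_bound)
  also have "\<dots> \<le> (LINT y|lborel. e * ?K y)"
  proof (rule integral_mono)
    have "integrable lborel (\<lambda>y. u y * ?K y - c * ?K y)" using i by auto
    then show "integrable lborel (\<lambda>y. \<bar>(u y - c) * ?K y\<bar>)" by (simp add: left_diff_distrib)
  qed (use i le in auto)
  also have "\<dots> = e" using i by simp
  finally show ?thesis .
qed

section \<open>Convergence of dilated mollifications in L2\<close>

lemma norm_plane_le: "norm (z::plane) \<le> \<bar>fst z\<bar> + \<bar>snd z\<bar>"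
  using norm_Pair_le[of "fst z" "snd z"] by simp

lemma tendsto_0_if_eventually_le_eps:
  fixes f :: "nat \<Rightarrow> ennreal"
  assumes "\<And>e::real. e > 0 \<Longrightarrow> \<forall>\<^sub>F n in sequentially. f n \<le> ennreal e"
  shows "f \<longlonglongrightarrow> 0"
proof (rule order_tendstoI)
  fix a :: ennreal assume "0 < a"
  then obtain e where e: "e > 0" "ennreal e < a"
    by (metis ennreal_less_zero_iff dense ennreal_cases less_ennreal.abs_eq ennreal_enn2real less_top_ennreal order.strict_trans top.not_eq_extremum)
  from assms[OF e(1)] show "\<forall>\<^sub>F n in sequentially. f n < a"
    by eventually_elim (use e in auto)
qed simp

lemma abs_diff_truncate_le: "\<bar>t - max (- M) (min M t)\<bar> \<le> \<bar>t::real\<bar>" if "M \<ge> 0"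
  using that by (auto simp: max_def min_def)

text \<open>Truncation at height \<open>M\<close> makes the function bounded; a bounded measurable
  function is an almost everywhere limit of continuous ones. Those come without a common bound or a
  common support, so they are truncated again and multiplied by the cutoff \<open>\<theta>\<close>,
  which equals 1 on the ball of radius \<open>R\<close>. This provides the majorant for dominated
  convergence.\<close>

lemma L2_approx_continuous:
  fixes u :: "plane \<Rightarrow> real"
  assumes u: "u \<in> borel_measurable borel" "integrable lborel (\<lambda>y. (u y)\<^sup>2)"
    and R: "\<And>x. norm x > R \<Longrightarrow> u x = 0" and e: "e > 0"
  obtains g where "continuous_on UNIV g" "integrable lborel (\<lambda>y. (g y)\<^sup>2)"
    "integrable lborel (\<lambda>y. (u y - g y)\<^sup>2)" "(LINT y|lborel. (u y - g y)\<^sup>2) < e"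
proof -
  have [measurable]: "u \<in> borel_measurable borel" by (fact u)
  define c where "c M t = max (- M) (min M t)" for M t :: real
  have [measurable]: "c M \<in> borel_measurable borel" for M unfolding c_def by measurable
  have "(\<lambda>n. LINT y|lborel. (u y - c (real n) (u y))\<^sup>2) \<longlonglongrightarrow> (LINT y|(lborel :: plane measure). 0)"
  proof (rule integral_dominated_convergence[where w="\<lambda>y. (u y)\<^sup>2"])
    have "(\<lambda>n. (u y - c (real n) (u y))\<^sup>2) \<longlonglongrightarrow> 0" for y
    proof -
      obtain N where N: "\<bar>u y\<bar> \<le> real N" using real_arch_simple by blast
      have "(u y - c (real n) (u y))\<^sup>2 = 0" if "n \<ge> N" for n
        using N that by (auto simp: c_def max_def min_def)
      then have "\<forall>\<^sub>F n in sequentially. 0 = (u y - c (real n) (u y))\<^sup>2"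
        by (auto simp: eventually_sequentially intro!: exI[of _ N])
      then show ?thesis by (rule Lim_transform_eventually[OF tendsto_const])
    qed
    then show "AE y in lborel. (\<lambda>n. (u y - c (real n) (u y))\<^sup>2) \<longlonglongrightarrow> 0" by simp
    show "AE y in lborel. norm ((u y - c (real n) (u y))\<^sup>2) \<le> (u y)\<^sup>2" for n
      using abs_diff_truncate_le[of "real n"] by (simp add: c_def abs_le_square_iff[symmetric])
  qed (use u in measurable)
  then have "\<forall>\<^sub>F n in sequentially. (LINT y|lborel. (u y - c (real n) (u y))\<^sup>2) < e / 4"
    using e by (intro order_tendstoD(2)) auto
  then obtain M where M: "(LINT y|lborel. (u y - c (real M) (u y))\<^sup>2) < e / 4"
    by (auto simp: eventually_sequentially)
  define v where "v y = c (real M) (u y)" for y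
  have [measurable]: "v \<in> borel_measurable borel" unfolding v_def by measurable
  have vM: "\<bar>v y\<bar> \<le> real M" for y by (auto simp: v_def c_def)
  have vR: "v x = 0" if "norm x > R" for x using R[OF that] by (auto simp: v_def c_def)
  have "v \<in> borel_measurable lebesgue" by (intro measurable_completion) simp
  then have "v measurable_on UNIV" by (rule lebesgue_measurable_imp_measurable_on_real) simp
  then obtain N g where N: "negligible N" and g: "\<And>n. continuous_on UNIV (g n)"
    and lim: "\<And>x. x \<notin> N \<Longrightarrow> (\<lambda>n. g n x) \<longlonglongrightarrow> v x"
    unfolding measurable_on_def by auto
  define \<theta> where "\<theta> x = max 0 (min 1 (R + 1 - norm x))" for x :: plane
  define k where "k n x = c (real M) (g n x) * \<theta> x" for n x
  have k_cont: "continuous_on UNIV (k n)" for n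
    unfolding k_def \<theta>_def c_def by (intro continuous_intros g)
  have [measurable]: "k n \<in> borel_measurable borel" for n
    using k_cont by (rule borel_measurable_continuous_onI)
  have k_bound: "\<bar>k n x\<bar> \<le> real M * indicator (cball 0 (R + 1)) x" for n x
  proof (cases "norm x \<le> R + 1")
    case True
    have "\<bar>k n x\<bar> \<le> real M * 1" unfolding k_def abs_mult
      by (intro mult_mono) (auto simp: c_def \<theta>_def)
    then show ?thesis using True by simp
  qed (simp add: k_def \<theta>_def)
  have "integrable lborel (indicator (cball 0 (R + 1)) :: plane \<Rightarrow> real)"
    using emeasure_bounded_finite[of "cball (0::plane) (R + 1)"] by (intro integrable_real_indicator) auto
  then have int_ind: "integrable lborel (\<lambda>x. C * indicator (cball (0::plane) (R + 1)) x)" for C :: real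
    by simp
  have k_sq: "(k n x)\<^sup>2 \<le> (real M)\<^sup>2 * indicator (cball 0 (R + 1)) x" for n x
    using power_mono[OF k_bound[of n x] abs_ge_zero, of 2] by (auto simp: indicator_def split: if_splits)
  have vk_sq: "(v x - k n x)\<^sup>2 \<le> (2 * real M)\<^sup>2 * indicator (cball 0 (R + 1)) x" for n x
  proof (cases "norm x \<le> R + 1")
    case True
    have "\<bar>v x - k n x\<bar> \<le> 2 * real M" using vM[of x] k_bound[of n x] True by simp
    then have "(v x - k n x)\<^sup>2 \<le> (2 * real M)\<^sup>2" by (rule power2_le_iff_abs_le[THEN iffD2, rotated]) simp
    then show ?thesis using True by simp
  next
    case False
    then show ?thesis using vR[of x] k_bound[of n x] by simp
  qed
  have "(\<lambda>n. LINT y|lborel. (v y - k n y)\<^sup>2) \<longlonglongrightarrow> (LINT y|(lborel :: plane measure). 0)"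
  proof (rule integral_dominated_convergence[where w="\<lambda>x. (2 * real M)\<^sup>2 * indicator (cball 0 (R + 1)) x"])
    have "(\<lambda>n. (v x - k n x)\<^sup>2) \<longlonglongrightarrow> 0" if "x \<notin> N" for x
    proof -
      have "(\<lambda>n. (v x - k n x)\<^sup>2) \<longlonglongrightarrow> (v x - c (real M) (v x) * \<theta> x)\<^sup>2"
        unfolding k_def c_def by (intro tendsto_intros lim that)
      moreover have "c (real M) (v x) * \<theta> x = v x"
        using vM[of x] vR[of x] by (cases "norm x > R") (auto simp: c_def \<theta>_def)
      ultimately show ?thesis by simp
    qed
    moreover have "N \<in> null_sets lebesgue" using N by (simp add: negligible_iff_null_sets)
    ultimately have "AE x in lebesgue. (\<lambda>n. (v x - k n x)\<^sup>2) \<longlonglongrightarrow> 0"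
      by (auto intro!: AE_I'[of N])
    then show "AE x in lborel. (\<lambda>n. (v x - k n x)\<^sup>2) \<longlonglongrightarrow> 0" by (simp add: AE_completion_iff)
    show "AE x in lborel. norm ((v x - k n x)\<^sup>2) \<le> (2 * real M)\<^sup>2 * indicator (cball 0 (R + 1)) x" for n
      using vk_sq by simp
  qed (use int_ind in measurable)
  then have "\<forall>\<^sub>F n in sequentially. (LINT y|lborel. (v y - k n y)\<^sup>2) < e / 4"
    using e by (intro order_tendstoD(2)) auto
  then obtain n where n: "(LINT y|lborel. (v y - k n y)\<^sup>2) < e / 4"
    by (auto simp: eventually_sequentially)
  have i1: "integrable lborel (\<lambda>y. (u y - v y)\<^sup>2)"
    using abs_diff_truncate_le[of "real M"] unfolding v_def
    by (intro Bochner_Integration.integrable_bound[OF u(2)]) (auto simp: c_def abs_le_square_iff[symmetric])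
  have i2: "integrable lborel (\<lambda>y. (v y - k n y)\<^sup>2)"
    using vk_sq[of _ n] by (intro Bochner_Integration.integrable_bound[OF int_ind[of "(2 * real M)\<^sup>2"]]) auto
  have le: "(u y - k n y)\<^sup>2 \<le> 2 * (u y - v y)\<^sup>2 + 2 * (v y - k n y)\<^sup>2" for y
    using sum_squares_bound[of "u y - v y" "v y - k n y"] power2_sum[of "u y - v y" "v y - k n y"] by simp
  have i3: "integrable lborel (\<lambda>y. (u y - k n y)\<^sup>2)"
  proof (rule Bochner_Integration.integrable_bound)
    show "integrable lborel (\<lambda>y. 2 * (u y - v y)\<^sup>2 + 2 * (v y - k n y)\<^sup>2)" using i1 i2 by simp
    show "AE y in lborel. norm ((u y - k n y)\<^sup>2) \<le> norm (2 * (u y - v y)\<^sup>2 + 2 * (v y - k n y)\<^sup>2)"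
      using le by (intro AE_I2) (simp add: order_trans[OF _ abs_ge_self])
  qed measurable
  show thesis
  proof (rule that[OF k_cont[of n] _ i3])
    show "integrable lborel (\<lambda>y. (k n y)\<^sup>2)"
      using k_sq[of n] by (intro Bochner_Integration.integrable_bound[OF int_ind[of "(real M)\<^sup>2"]]) auto
    have "(LINT y|lborel. (u y - k n y)\<^sup>2) \<le> (LINT y|lborel. 2 * (u y - v y)\<^sup>2 + 2 * (v y - k n y)\<^sup>2)"
      using i1 i2 i3 le by (intro integral_mono) auto
    also have "\<dots> = 2 * (LINT y|lborel. (u y - v y)\<^sup>2) + 2 * (LINT y|lborel. (v y - k n y)\<^sup>2)"
      using i1 i2 by simp
    also have "\<dots> < e" using n M unfolding v_def by linarith
    finally show "(LINT y|lborel. (u y - k n y)\<^sup>2) < e" .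
  qed
qed

text \<open>The usual density argument: the operators \<open>T\<close> are bounded in L2 uniformly
  in \<open>n\<close>, and for continuous functions they converge uniformly on \<open>U\<close>.
  Dilation ratio and kernel width are tied to the same 1/(n + 2), which is what later keeps the
  kernel inside a convex domain.\<close>

lemma dilation_mollify_tendsto:
  fixes u :: "plane \<Rightarrow> real" and p :: plane and r :: real and U :: "plane set"
  defines "lam \<equiv> \<lambda>n. 1 - 1 / (real n + 2)"
  defines "T \<equiv> \<lambda>u n x. convolution u (mollifier (r / (real n + 2))) (p + lam n *\<^sub>R (x - p))"
  assumes u: "u \<in> borel_measurable borel" "integrable lborel (\<lambda>y. (u y)\<^sup>2)"
    and R: "\<And>x. norm x > R \<Longrightarrow> u x = 0" and U: "U \<in> sets borel" "U \<subseteq> cball 0 R" and r: "r > 0"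
  shows "(\<lambda>n. \<integral>\<^sup>+x\<in>U. ennreal ((T u n x - u x)\<^sup>2) \<partial>lborel) \<longlonglongrightarrow> 0"
proof (rule tendsto_0_if_eventually_le_eps)
  fix e :: real assume e: "e > 0"
  \<comment> \<open>The error is split as (a + b + c)^2 <= 3 a^2 + 3 b^2 + 3 c^2. The three parts
    cost 4e/30, e/30 and e/30 before the factor 3, together 18e/30.\<close>
  obtain g where g: "continuous_on UNIV g" "integrable lborel (\<lambda>y. (g y)\<^sup>2)"
    "integrable lborel (\<lambda>y. (u y - g y)\<^sup>2)" "(LINT y|lborel. (u y - g y)\<^sup>2) < e / 30"
    by (rule L2_approx_continuous[OF u R, where e="e / 30"]) (use e in auto)
  have [measurable]: "u \<in> borel_measurable borel" "g \<in> borel_measurable borel" "U \<in> sets borel"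
    using u g(1) U by (auto intro: borel_measurable_continuous_onI)
  have ug_meas: "(\<lambda>y. u y - g y) \<in> borel_measurable borel" by measurable
  have N_ug: "(\<integral>\<^sup>+y. ennreal ((u y - g y)\<^sup>2) \<partial>lborel) \<le> ennreal (e / 30)"
    using nn_integral_eq_integral[OF g(3)] g(4) by (simp add: ennreal_leI)
  have [measurable]: "T w n \<in> borel_measurable borel" if "w \<in> borel_measurable borel" for w n
    unfolding T_def using convolution_measurable[OF that] by measurable
  have l: "lam n \<ge> 1/2" "lam n \<le> 1" for n by (auto simp: lam_def field_simps)
  have \<delta>: "r / (real n + 2) > 0" for n using r by simp
  have T_diff: "T u n x = T (\<lambda>y. u y - g y) n x + T g n x" for n x
    using convolution_integrable(2)[OF \<delta>[of n] u] convolution_integrable(2)[OF \<delta>[of n] \<open>g \<in> _\<close> g(2)]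
    by (simp add: T_def convolution_def left_diff_distrib)
  have T_bound: "(\<integral>\<^sup>+x. ennreal ((T (\<lambda>y. u y - g y) n x)\<^sup>2) \<partial>lborel) \<le> ennreal (4 * e / 30)" for n
  proof -
    let ?F = "\<lambda>z. ennreal ((convolution (\<lambda>y. u y - g y) (mollifier (r / (real n + 2))) z)\<^sup>2)"
    have F: "?F \<in> borel_measurable borel" using convolution_measurable[OF ug_meas] by measurable
    have eq: "(\<integral>\<^sup>+z. ?F z \<partial>lborel) = ennreal ((lam n)\<^sup>2) * (\<integral>\<^sup>+x. ?F ((p - lam n *\<^sub>R p) + lam n *\<^sub>R x) \<partial>lborel)"
      using lborel_nn_integral_affine[OF F, of "lam n" "p - lam n *\<^sub>R p"] l[of n] by (simp add: power2_eq_square)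
    have "(\<integral>\<^sup>+x. ennreal ((T (\<lambda>y. u y - g y) n x)\<^sup>2) \<partial>lborel) = (\<integral>\<^sup>+x. ?F ((p - lam n *\<^sub>R p) + lam n *\<^sub>R x) \<partial>lborel)"
      by (simp add: T_def scaleR_diff_right add.commute add_diff_eq diff_add_eq)
    also have "\<dots> \<le> ennreal 4 * (ennreal ((lam n)\<^sup>2) * (\<integral>\<^sup>+x. ?F ((p - lam n *\<^sub>R p) + lam n *\<^sub>R x) \<partial>lborel))"
    proof -
      \<comment> \<open>The dilation changes area by the square of \<open>lam n\<close>, which is at
        least 1/4; this is the origin of the factor 4.\<close>
      have "1 \<le> 4 * (lam n)\<^sup>2" using power_mono[of "1/2" "lam n" 2] l[of n] by (simp add: power2_eq_square)
      then have "ennreal 1 \<le> ennreal (4 * (lam n)\<^sup>2)" by (rule ennreal_leI)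
      then have "1 \<le> ennreal 4 * ennreal ((lam n)\<^sup>2)"
        by (metis ennreal_1 ennreal_mult' zero_le_numeral)
      from mult_right_mono[OF this] show ?thesis by (simp add: mult.assoc)
    qed
    also have "\<dots> \<le> ennreal 4 * ennreal (e / 30)"
      unfolding eq[symmetric] using nn_integral_convolution_le[OF \<delta>[of n] ug_meas g(3)] N_ug
      by (intro mult_left_mono order_trans[OF _ N_ug]) auto
    also have "\<dots> = ennreal (4 * e / 30)"
      by (subst ennreal_mult'[symmetric]) (use e in auto)
    finally show ?thesis .
  qed
  \<comment> \<open>Large enough to hold \<open>U\<close> and all points that dilation and kernel
    can reach from \<open>U\<close>.\<close>
  define K where "K = cball (0::plane) (2 * \<bar>R\<bar> + norm p + 2 * r)"
  have "uniformly_continuous_on K g"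
    unfolding K_def by (intro compact_uniformly_continuous continuous_on_subset[OF g(1)]) auto
  define V where "V = measure lborel U"
  have V: "emeasure lborel U = ennreal V" "V \<ge> 0"
    using emeasure_eq_ennreal_measure[of lborel U] emeasure_bounded_finite[OF bounded_subset[OF bounded_cball U(2)]]
    by (auto simp: V_def)
  \<comment> \<open>Uniform accuracy whose square, integrated over \<open>U\<close>, costs at most
    e/30; adding 1 to \<open>V\<close> avoids division by zero.\<close>
  define s where "s = sqrt (e / (30 * (V + 1)))"
  have s: "s > 0" "s\<^sup>2 * V \<le> e / 30"
  proof -
    show "s > 0" using e V by (simp add: s_def)
    have "s\<^sup>2 * V = (e / 30) * (V / (V + 1))" using e V by (simp add: s_def)
    also have "\<dots> \<le> (e / 30) * 1" using e V by (intro mult_left_mono) auto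
    finally show "s\<^sup>2 * V \<le> e / 30" by simp
  qed
  obtain d where d: "d > 0" "\<And>x y. x \<in> K \<Longrightarrow> y \<in> K \<Longrightarrow> norm (y - x) < d \<Longrightarrow> \<bar>g y - g x\<bar> < s"
    using \<open>uniformly_continuous_on K g\<close> s(1) unfolding uniformly_continuous_on_def dist_norm real_norm_def by metis
  \<comment> \<open>Dilation moves a point by at most (|p| + |R|) / (n + 2) and the kernel by less
    than 2 r / (n + 2), so \<open>C / (real n + 2)\<close> bounds the total displacement.\<close>
  define C where "C = \<bar>R\<bar> + norm p + 2 * r"
  have "(\<lambda>n. C / (real n + 2)) \<longlonglongrightarrow> 0" by real_asymp
  then have "\<forall>\<^sub>F n in sequentially. C / (real n + 2) < d" using d(1) by (rule order_tendstoD(2))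
  then show "\<forall>\<^sub>F n in sequentially. (\<integral>\<^sup>+x\<in>U. ennreal ((T u n x - u x)\<^sup>2) \<partial>lborel) \<le> ennreal e"
  proof eventually_elim
    fix n assume n: "C / (real n + 2) < d"
    define \<epsilon> where "\<epsilon> = 1 / (real n + 2)"
    have \<epsilon>: "0 < \<epsilon>" "\<epsilon> \<le> 1" "C * \<epsilon> < d" "r / (real n + 2) = r * \<epsilon>" "lam n = 1 - \<epsilon>"
      using n by (auto simp: \<epsilon>_def lam_def)
    have Tg: "\<bar>T g n x - g x\<bar> \<le> s" if x: "x \<in> U" for x
      unfolding T_def
    proof (rule convolution_near[OF \<delta> \<open>g \<in> _\<close> g(2)])
      fix y let ?z = "p + lam n *\<^sub>R (x - p)"
      assume y: "\<bar>fst (?z - y)\<bar> < r / (real n + 2)" "\<bar>snd (?z - y)\<bar> < r / (real n + 2)"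
      have xR: "norm x \<le> \<bar>R\<bar>" using subsetD[OF U(2) x] by simp
      have "norm (?z - y) \<le> \<bar>fst (?z - y)\<bar> + \<bar>snd (?z - y)\<bar>" by (rule norm_plane_le)
      then have 1: "norm (?z - y) < 2 * r * \<epsilon>" using y \<epsilon>(4) by simp
      have "?z - x = \<epsilon> *\<^sub>R (p - x)" unfolding \<epsilon>(5) by (simp add: algebra_simps)
      then have 2: "norm (?z - x) = \<epsilon> * norm (p - x)" using \<epsilon>(1) by simp
      have "norm (p - x) \<le> norm p + \<bar>R\<bar>" using norm_triangle_ineq4[of p x] xR by simp
      then have "norm (?z - x) \<le> \<epsilon> * (norm p + \<bar>R\<bar>)" unfolding 2 using \<epsilon>(1) by simp
      moreover have "norm (y - x) \<le> norm (?z - x) + norm (?z - y)"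
        using norm_triangle_ineq4[of "?z - x" "?z - y"] by (simp add: algebra_simps)
      ultimately have lt: "norm (y - x) < C * \<epsilon>" using 1 by (simp add: C_def algebra_simps)
      have "C * \<epsilon> \<le> C" using \<epsilon> r by (simp add: C_def mult_left_le)
      then have "norm y \<le> \<bar>R\<bar> + C" using norm_triangle_ineq[of "y - x" x] xR lt by simp
      moreover have "norm x \<le> 2 * \<bar>R\<bar> + norm p + 2 * r"
        using xR r norm_ge_zero[of p] abs_ge_zero[of R] by linarith
      ultimately have "y \<in> K" "x \<in> K"
        unfolding K_def C_def mem_cball_0 by linarith+
      then show "\<bar>g y - g x\<bar> \<le> s" using d(2)[of x y] lt \<epsilon>(3) by fastforce
    qed
    have le: "(T u n x - u x)\<^sup>2 \<le> 3 * (T (\<lambda>y. u y - g y) n x)\<^sup>2 + 3 * s\<^sup>2 + 3 * (u x - g x)\<^sup>2" if "x \<in> U" for x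
    proof -
      have sq: "(a + b + c)\<^sup>2 \<le> 3 * a\<^sup>2 + 3 * b\<^sup>2 + 3 * c\<^sup>2" for a b c :: real
        using sum_squares_bound[of a b] sum_squares_bound[of b c] sum_squares_bound[of a c]
        by (simp add: power2_eq_square algebra_simps)
      have "(T u n x - u x)\<^sup>2 = (T (\<lambda>y. u y - g y) n x + (T g n x - g x) + (- (u x - g x)))\<^sup>2"
        unfolding T_diff by (simp add: algebra_simps)
      also have "\<dots> \<le> 3 * (T (\<lambda>y. u y - g y) n x)\<^sup>2 + 3 * (T g n x - g x)\<^sup>2 + 3 * (- (u x - g x))\<^sup>2"
        by (rule sq)
      also have "(T g n x - g x)\<^sup>2 \<le> s\<^sup>2" using Tg[OF that] s(1) by (simp add: abs_le_square_iff[symmetric])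
      finally show ?thesis by (simp add: power2_commute)
    qed
    have "(\<integral>\<^sup>+x\<in>U. ennreal ((T u n x - u x)\<^sup>2) \<partial>lborel)
      \<le> (\<integral>\<^sup>+x. 3 * ennreal ((T (\<lambda>y. u y - g y) n x)\<^sup>2) + ennreal (3 * s\<^sup>2) * indicator U x + 3 * ennreal ((u x - g x)\<^sup>2) \<partial>lborel)"
    proof (rule nn_integral_mono)
      fix x
      show "ennreal ((T u n x - u x)\<^sup>2) * indicator U x
        \<le> 3 * ennreal ((T (\<lambda>y. u y - g y) n x)\<^sup>2) + ennreal (3 * s\<^sup>2) * indicator U x + 3 * ennreal ((u x - g x)\<^sup>2)"
      proof (cases "x \<in> U")
        case True
        have eq: "ennreal (3 * A + 3 * s\<^sup>2 + 3 * B) = 3 * ennreal A + ennreal (3 * s\<^sup>2) + 3 * ennreal B"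
          if "A \<ge> 0" "B \<ge> 0" for A B :: real
          using that ennreal_mult'[of 3 A] ennreal_mult'[of 3 B] by simp
        show ?thesis using True ennreal_leI[OF le[OF True]] unfolding eq[OF zero_le_power2 zero_le_power2]
          by (simp only: indicator_simps mult_1_right)
      qed simp
    qed
    also have "\<dots> = 3 * (\<integral>\<^sup>+x. ennreal ((T (\<lambda>y. u y - g y) n x)\<^sup>2) \<partial>lborel) + ennreal (3 * s\<^sup>2) * emeasure lborel U
        + 3 * (\<integral>\<^sup>+x. ennreal ((u x - g x)\<^sup>2) \<partial>lborel)"
      using ug_meas by (simp add: nn_integral_add nn_integral_cmult)
    also have "\<dots> \<le> 3 * ennreal (4 * e / 30) + ennreal (3 * s\<^sup>2) * ennreal V + 3 * ennreal (e / 30)"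
      unfolding V(1) using T_bound[of n] N_ug by (intro add_mono mult_left_mono) auto
    also have "\<dots> = ennreal (3 * (4 * e / 30) + 3 * s\<^sup>2 * V + 3 * (e / 30))"
    proof -
      have "ennreal (3 * (4 * e / 30) + 3 * s\<^sup>2 * V + 3 * (e / 30))
        = ennreal (3 * (4 * e / 30)) + ennreal (3 * s\<^sup>2 * V) + ennreal (3 * (e / 30))"
        using e V(2) by (subst ennreal_plus[symmetric], simp, simp)+ simp
      also have "\<dots> = 3 * ennreal (4 * e / 30) + ennreal (3 * s\<^sup>2) * ennreal V + 3 * ennreal (e / 30)"
        using ennreal_mult'[of 3 "4 * e / 30"] ennreal_mult'[of 3 "e / 30"] ennreal_mult'[of "3 * s\<^sup>2" V]
        by (simp only: ennreal_numeral zero_le_numeral simp_thms) simp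
      finally show ?thesis by simp
    qed
    also have "\<dots> \<le> ennreal e" using s(2) e by (intro ennreal_leI) (simp add: field_simps)
    finally show "(\<integral>\<^sup>+x\<in>U. ennreal ((T u n x - u x)\<^sup>2) \<partial>lborel) \<le> ennreal e" .
  qed
qed

section \<open>Density of smooth functions\<close>

text \<open>Convolution and Tonelli are carried out with Borel functions on the whole plane, whereas
  Sobolev functions are measurable only with respect to the completion and carry meaningless values
  off \<open>U\<close>.\<close>

lemma L2_borel_representative:
  fixes f :: "plane \<Rightarrow> real"
  assumes U: "open U" and f: "square_integrable (lebesgue_on U) f"
  obtains u where "u \<in> borel_measurable borel" "\<And>x. x \<notin> U \<Longrightarrow> u x = 0"
    "AE x in lebesgue_on U. f x = u x" "integrable lborel (\<lambda>x. (u x)\<^sup>2)"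
proof -
  have [measurable]: "U \<in> sets borel" using U by simp
  have Ul: "U \<in> sets lebesgue" using U by simp
  have "(\<lambda>x. indicator U x *\<^sub>R f x) \<in> borel_measurable lebesgue"
    using f Ul by (subst borel_measurable_restrict_space_iff[symmetric]) (auto simp: square_integrable_def)
  then obtain g where [measurable]: "g \<in> borel_measurable lborel" and ae: "AE x in lborel. indicator U x *\<^sub>R f x = g x"
    using completion_ex_borel_measurable_real by blast
  define u where "u x = indicator U x * g x" for x
  have u: "u \<in> borel_measurable borel" using \<open>g \<in> _\<close> unfolding u_def by measurable
  have ae': "AE x in lebesgue. indicator U x *\<^sub>R f x = u x"
    unfolding AE_completion_iff using ae by eventually_elim (auto simp: u_def indicator_def)
  show thesis
  proof (rule that[OF u])
    show "u x = 0" if "x \<notin> U" for x using that by (simp add: u_def)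
    show "AE x in lebesgue_on U. f x = u x"
      using ae' Ul by (subst AE_restrict_space_iff) (auto elim!: eventually_mono simp: u_def)
    have "integrable lebesgue (\<lambda>x. indicator U x *\<^sub>R (f x)\<^sup>2)"
      using f Ul by (subst integrable_restrict_space[symmetric]) (auto simp: square_integrable_def)
    then have "integrable lebesgue (\<lambda>x. (u x)\<^sup>2)"
    proof (rule integrable_cong_AE_imp)
      show "(\<lambda>x. (u x)\<^sup>2) \<in> borel_measurable lebesgue" using u by (intro measurable_completion) simp
      show "AE x in lebesgue. indicator U x *\<^sub>R (f x)\<^sup>2 = (u x)\<^sup>2"
        using ae' by eventually_elim (auto simp: indicator_def u_def split: if_splits)
    qed
    then show "integrable lborel (\<lambda>x. (u x)\<^sup>2)" using u by (simp add: integrable_completion)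
  qed
qed

lemma integral_representative:
  fixes f u k :: "plane \<Rightarrow> real"
  assumes U: "open U" and f: "f \<in> borel_measurable (lebesgue_on U)"
    and u: "u \<in> borel_measurable borel" "\<And>x. x \<notin> U \<Longrightarrow> u x = 0" "AE x in lebesgue_on U. f x = u x"
    and k: "k \<in> borel_measurable borel"
  shows "(LINT y|lborel. u y * k y) = (LINT y|lebesgue_on U. f y * k y)"
proof -
  have Ul: "U \<in> sets lebesgue" using U by simp
  have ku: "(\<lambda>y. u y * k y) \<in> borel_measurable borel" using u k by measurable
  have kl: "k \<in> borel_measurable (lebesgue_on U)"
    using measurable_completion[of k lborel borel] k by (auto intro: measurable_restrict_space1)
  have ul: "u \<in> borel_measurable (lebesgue_on U)"
    using measurable_completion[of u lborel borel] u by (auto intro: measurable_restrict_space1)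
  have "(LINT y|lborel. u y * k y) = (LINT y|lebesgue_on U. u y * k y)"
    using integral_lebesgue_on_UNIV_borel[OF Ul _ ku] u(2) by simp
  also have "\<dots> = (LINT y|lebesgue_on U. f y * k y)"
  proof (rule integral_cong_AE)
    show "AE y in lebesgue_on U. u y * k y = f y * k y" using u(3) by eventually_elim simp
  qed (use kl ul f in auto)
  finally show ?thesis .
qed

text \<open>A point of the support is a convex combination, with weights l and 1 - l, of
  \<open>x\<close> and a point of the ball of radius \<open>2 * r\<close> around \<open>p\<close>.
  Convexity keeps it in \<open>U\<close>, however close \<open>x\<close> is to the boundary.\<close>

lemma test_function_reflected_mollifier:
  assumes "open U" "convex U" "x \<in> U" "cball p (2 * r) \<subseteq> U" "r > 0" "0 < l" "l < 1"
  shows "test_function U (\<lambda>y. mollifier (r * (1 - l)) (p + l *\<^sub>R (x - p) - y))"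
proof (rule test_functionI)
  let ?z = "p + l *\<^sub>R (x - p)" and ?d = "r * (1 - l)"
  let ?K = "cbox (fst ?z - ?d, snd ?z - ?d) (fst ?z + ?d, snd ?z + ?d)"
  have "smooth (\<lambda>y. mollifier ?d (?z + diag (-1) (-1) y))"
    by (intro smooth_compose_diag test_function_smooth[OF test_function_mollifier])
  moreover have "?z + diag (-1) (-1) y = ?z - y" for y by (simp add: diag_def prod_eq_iff)
  ultimately show "smooth (\<lambda>y. mollifier ?d (?z - y))" by simp
  show "compact ?K" by (rule compact_cbox)
  show "y \<in> ?K" if "mollifier ?d (?z - y) \<noteq> 0" for y
    using mollifier_support[OF that] by (auto simp: mem_box Basis_plane inner_prod_def abs_less_iff)
  show "?K \<subseteq> U"
  proof
    fix y assume "y \<in> ?K"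
    then have y: "\<bar>fst (?z - y)\<bar> \<le> ?d" "\<bar>snd (?z - y)\<bar> \<le> ?d"
      by (auto simp: mem_box Basis_plane inner_prod_def abs_le_iff)
    \<comment> \<open>Chosen so that \<open>y\<close> equals
      \<open>(1 - l) *\<^sub>R (p - w) + l *\<^sub>R x\<close>.\<close>
    define w where "w = (1 / (1 - l)) *\<^sub>R (?z - y)"
    have "norm (?z - y) \<le> 2 * r * (1 - l)" using norm_plane_le[of "?z - y"] y by (simp add: algebra_simps)
    moreover have "norm w = norm (?z - y) / (1 - l)" using assms(7) unfolding w_def norm_scaleR by simp
    ultimately have "norm w \<le> 2 * r" using assms(7) by (simp add: pos_divide_le_eq)
    then have "p - w \<in> cball p (2 * r)" by (simp add: dist_norm)
    then have "p - w \<in> U" using assms(4) by blast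
    then have "(1 - l) *\<^sub>R (p - w) + l *\<^sub>R x \<in> U"
      using assms by (intro convexD) auto
    moreover have "(1 - l) *\<^sub>R (p - w) = (1 - l) *\<^sub>R p - (?z - y)"
      using assms(7) by (simp add: w_def scaleR_diff_right)
    ultimately show "y \<in> U" by (simp add: algebra_simps)
  qed
qed

lemma power2_sum_le: "(a + b)\<^sup>2 \<le> 2 * a\<^sup>2 + 2 * (b::real)\<^sup>2"
  using zero_le_power2[of "a - b"] by (simp add: power2_eq_square algebra_simps)

text \<open>Dilating towards an interior point \<open>p\<close> before mollifying keeps the support of the mollifier
  inside the convex set \<open>U\<close>, so no extension of \<open>v\<close> across the boundary is needed.\<close>

theorem smooth_dense_H1:
  fixes v :: "plane \<Rightarrow> real"
  assumes U: "open U" "convex U" "bounded U" "U \<noteq> {}" and v: "v \<in> H1 U"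
  shows "\<exists>\<phi>. (\<forall>n. smooth (\<phi> n)) \<and> (\<lambda>n. H1_norm U (\<lambda>x. \<phi> n x - v x)) \<longlonglongrightarrow> 0"
proof -
  obtain p where p: "p \<in> U" using U by blast
  then obtain r0 where r0: "r0 > 0" "cball p r0 \<subseteq> U" using U(1) open_contains_cball by blast
  define r where "r = r0 / 2"
  have r: "r > 0" "cball p (2 * r) \<subseteq> U" using r0 by (auto simp: r_def)
  obtain R where R: "U \<subseteq> cball 0 R" using U(3) unfolding bounded_iff by (auto simp: subset_iff)
  have Ul: "U \<in> sets lebesgue" "U \<in> sets borel" using U by auto
  define l where "l n = 1 - 1 / (real n + 2)" for n
  have l: "0 < l n" "l n < 1" "r / (real n + 2) = r * (1 - l n)" for n by (auto simp: l_def field_simps)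
  define T where "T u n x = convolution u (mollifier (r / (real n + 2))) (p + l n *\<^sub>R (x - p))" for u n x
  obtain u0 where u0: "u0 \<in> borel_measurable borel" "\<And>x. x \<notin> U \<Longrightarrow> u0 x = 0"
    "AE x in lebesgue_on U. v x = u0 x" "integrable lborel (\<lambda>x. (u0 x)\<^sup>2)"
    using L2_borel_representative[OF U(1) H1_square_integrable(1)[OF v]] by blast
  define P where "P b w \<longleftrightarrow> w \<in> borel_measurable borel \<and> (\<forall>x. x \<notin> U \<longrightarrow> w x = 0) \<and>
    (AE x in lebesgue_on U. weak_pderiv U b v x = w x) \<and> integrable lborel (\<lambda>x. (w x)\<^sup>2)" for b and w :: "plane \<Rightarrow> real"
  have "\<exists>w. P b w" if b: "b \<in> Basis" for b
  proof -
    obtain w where "w \<in> borel_measurable borel" "\<And>x. x \<notin> U \<Longrightarrow> w x = 0"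
      "AE x in lebesgue_on U. weak_pderiv U b v x = w x" "integrable lborel (\<lambda>x. (w x)\<^sup>2)"
      using L2_borel_representative[OF U(1) H1_square_integrable(2)[OF v b]] by blast
    then show ?thesis unfolding P_def by blast
  qed
  then obtain u where Pu: "\<And>b. b \<in> Basis \<Longrightarrow> P b (u b)" by metis
  have u: "u b \<in> borel_measurable borel" "\<And>x. x \<notin> U \<Longrightarrow> u b x = 0"
    "AE x in lebesgue_on U. weak_pderiv U b v x = u b x" "integrable lborel (\<lambda>x. (u b x)\<^sup>2)" if "b \<in> Basis" for b
    using Pu[OF that] unfolding P_def by blast+
  have u0_int: "integrable lborel u0"
  proof (rule Bochner_Integration.integrable_bound[OF Bochner_Integration.integrable_add[OF u0(4)]])
    show "integrable lborel (indicator U :: plane \<Rightarrow> real)"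
      using emeasure_bounded_finite[OF U(3)] Ul by (intro integrable_real_indicator) auto
    have "\<bar>t\<bar> \<le> t\<^sup>2 + 1" for t :: real
      using sum_squares_bound[of "\<bar>t\<bar>" 1] by simp
    then have "\<bar>u0 x\<bar> \<le> (u0 x)\<^sup>2 + indicator U x" for x using u0(2)[of x] by (cases "x \<in> U") auto
    then show "AE x in lborel. norm (u0 x) \<le> norm ((u0 x)\<^sup>2 + indicator U x)" by simp
  qed (use u0 in simp)
  define \<phi> where "\<phi> n x = T u0 n x" for n x
  have A: "p + l n *\<^sub>R (x - p) = (p - l n *\<^sub>R p) + diag (l n) (l n) x" for n x
    by (simp add: diag_def prod_eq_iff algebra_simps)
  note K = test_function_mollifier
  have sm_T: "smooth (T w n)" if "integrable lborel w" for w n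
    unfolding T_def A by (intro smooth_compose_diag smooth_convolution[OF that K])
  have smooth: "smooth (\<phi> n)" for n unfolding \<phi>_def using sm_T[OF u0_int] .
  \<comment> \<open>Differentiation commutes with the smoothing up to the chain rule factor
    \<open>l n\<close>: the reflected kernel is a test function in \<open>U\<close>, so the
    derivative can be moved from the kernel onto \<open>v\<close>.\<close>
  have grad: "pderiv_dir b (\<phi> n) x = l n * T (u b) n x" if b: "b \<in> Basis" and x: "x \<in> U" for b n x
  proof -
    let ?K = "mollifier (r / (real n + 2))" and ?z = "p + l n *\<^sub>R (x - p)"
    have bb: "b \<bullet> b = 1" using b by simp
    have "pderiv_dir b (\<phi> n) x = l n * pderiv_dir b (convolution u0 ?K) ?z"
      using pderiv_dir_compose_diag[OF smooth_convolution[OF u0_int K] b] bb b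
      unfolding \<phi>_def T_def A by (auto simp: diag_def Basis_plane)
    also have "pderiv_dir b (convolution u0 ?K) ?z = convolution u0 (pderiv_dir b ?K) ?z"
      by (rule pderiv_dir_convolution[OF u0_int K b])
    also have "\<dots> = (LINT y|lebesgue_on U. v y * pderiv_dir b ?K (?z - y))"
      unfolding convolution_def
      by (rule integral_representative[OF U(1) _ u0(1-3) test_function_reflect_measurable[OF test_function_pderiv_dir[OF K b]]])
        (use H1_square_integrable(1)[OF v] in \<open>auto simp: square_integrable_def\<close>)
    also have "\<dots> = (LINT y|lebesgue_on U. weak_pderiv U b v y * ?K (?z - y))"
    proof -
      define \<psi> where "\<psi> y = ?K (?z - y)" for y
      have "\<psi> = (\<lambda>y. mollifier (r * (1 - l n)) (p + l n *\<^sub>R (x - p) - y))"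
        by (simp add: \<psi>_def l(3) fun_eq_iff)
      then have \<psi>: "test_function U \<psi>"
        using test_function_reflected_mollifier[OF U(1,2) x r(2,1) l(1,2)] by simp
      have R: "\<psi> = (\<lambda>y. ?K (?z + diag (-1) (-1) y))"
        unfolding \<psi>_def by (intro ext arg_cong[of _ _ ?K]) (simp add: diag_def prod_eq_iff)
      \<comment> \<open>The sign from the reflection cancels the sign in the definition of the weak
        derivative.\<close>
      have d: "pderiv_dir b \<psi> y = - pderiv_dir b ?K (?z - y)" for y
      proof -
        have "?z + diag (-1) (-1) y = ?z - y" by (simp add: diag_def prod_eq_iff)
        moreover have "diag (-1) (-1) b \<bullet> b = -1" using b by (auto simp: diag_def Basis_plane)
        ultimately show ?thesis unfolding R pderiv_dir_compose_diag[OF test_function_smooth[OF K] b] by simp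
      qed
      have "(LINT y|lebesgue_on U. pderiv_dir b \<psi> y *\<^sub>R v y) = - (LINT y|lebesgue_on U. \<psi> y *\<^sub>R weak_pderiv U b v y)"
        using H1_has_weak_pderiv[OF v b] \<psi> unfolding has_weak_pderiv_def by blast
      then show ?thesis unfolding d by (simp add: \<psi>_def mult.commute)
    qed
    also have "\<dots> = convolution (u b) ?K ?z"
      unfolding convolution_def
      by (rule integral_representative[symmetric, OF U(1) _ u(1-3)[OF b] test_function_reflect_measurable[OF K]])
        (use H1_square_integrable(2)[OF v b] in \<open>auto simp: square_integrable_def\<close>)
    finally show ?thesis by (simp add: T_def)
  qed
  have T_lim: "(\<lambda>n. LINT x|lebesgue_on U. (T w n x - f x)\<^sup>2) \<longlonglongrightarrow> 0"
    and T_sq: "\<And>n. square_integrable (lebesgue_on U) (T w n)"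
    if w: "w \<in> borel_measurable borel" "\<And>x. x \<notin> U \<Longrightarrow> w x = 0"
      "AE x in lebesgue_on U. f x = w x" "integrable lborel (\<lambda>x. (w x)\<^sup>2)" and f: "square_integrable (lebesgue_on U) f" for w f
  proof -
    have far: "norm x > R \<Longrightarrow> w x = 0" for x using R w(2) by (metis linorder_not_less mem_cball_0 subsetD)
    have [measurable]: "T w n \<in> borel_measurable borel" for n
      unfolding T_def using convolution_measurable[OF w(1)] by measurable
    have nn: "(\<lambda>n. \<integral>\<^sup>+x\<in>U. ennreal ((T w n x - w x)\<^sup>2) \<partial>lborel) \<longlonglongrightarrow> 0"
      using dilation_mollify_tendsto[OF w(1,4) far Ul(2) R r(1), of p] unfolding T_def l_def by simp
    have [measurable]: "w \<in> borel_measurable borel" "U \<in> sets borel" using w Ul by auto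
    have ml: "T w n \<in> borel_measurable (lebesgue_on U)" "w \<in> borel_measurable (lebesgue_on U)" for n
      using measurable_completion[of "T w n" lborel borel] measurable_completion[of w lborel borel]
      by (auto intro!: measurable_restrict_space1)
    have eq: "(LINT x|lebesgue_on U. (T w n x - f x)\<^sup>2) = enn2real (\<integral>\<^sup>+x\<in>U. ennreal ((T w n x - w x)\<^sup>2) \<partial>lborel)" for n
    proof -
      have "(LINT x|lebesgue_on U. (T w n x - f x)\<^sup>2) = (LINT x|lebesgue_on U. (T w n x - w x)\<^sup>2)"
        using w(3) ml f by (intro integral_cong_AE) (auto simp: square_integrable_def elim!: eventually_mono)
      also have "\<dots> = enn2real (\<integral>\<^sup>+x. ennreal ((T w n x - w x)\<^sup>2) \<partial>lebesgue_on U)"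
        using ml by (intro integral_eq_nn_integral) auto
      also have "(\<integral>\<^sup>+x. ennreal ((T w n x - w x)\<^sup>2) \<partial>lebesgue_on U) = (\<integral>\<^sup>+x\<in>U. ennreal ((T w n x - w x)\<^sup>2) \<partial>lborel)"
        using Ul by (subst nn_integral_restrict_space) (auto simp: nn_integral_completion)
      finally show ?thesis .
    qed
    show "(\<lambda>n. LINT x|lebesgue_on U. (T w n x - f x)\<^sup>2) \<longlonglongrightarrow> 0"
      unfolding eq using tendsto_enn2real[OF nn[folded ennreal_0]] by simp
    have w_int: "integrable lborel w"
    proof (rule Bochner_Integration.integrable_bound[OF Bochner_Integration.integrable_add[OF w(4)]])
      show "integrable lborel (indicator U :: plane \<Rightarrow> real)"
        using emeasure_bounded_finite[OF U(3)] Ul by (intro integrable_real_indicator) auto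
      have "\<bar>t\<bar> \<le> t\<^sup>2 + 1" for t :: real
        using sum_squares_bound[of "\<bar>t\<bar>" 1] by simp
      then have "\<bar>w x\<bar> \<le> (w x)\<^sup>2 + indicator U x" for x using w(2)[of x] by (cases "x \<in> U") auto
      then show "AE x in lborel. norm (w x) \<le> norm ((w x)\<^sup>2 + indicator U x)" by simp
    qed (use w in simp)
    show "\<And>n. square_integrable (lebesgue_on U) (T w n)"
      using sm_T[OF w_int] U(3) Ul by (intro square_integrable_continuous smooth_continuous_on)
  qed
  have lim_l: "l \<longlonglongrightarrow> 1" unfolding l_def by real_asymp
  have grad_lim: "(\<lambda>n. LINT x|lebesgue_on U. (pderiv_dir b (\<phi> n) x - weak_pderiv U b v x)\<^sup>2) \<longlonglongrightarrow> 0" if b: "b \<in> Basis" for b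
  proof (rule tendsto_sandwich[where f="\<lambda>_. 0"])
    let ?g = "weak_pderiv U b v"
    note g = H1_square_integrable(2)[OF v b]
    note Tb = T_lim[OF u[OF b] g] T_sq[OF u[OF b] g]
    \<comment> \<open>Bound from writing the error as \<open>l n\<close> times the error of the
      mollified derivative, minus \<open>(1 - l n)\<close> times the derivative itself. The second
      part vanishes because the ratios tend to 1.\<close>
    let ?B = "\<lambda>n. 2 * (LINT x|lebesgue_on U. (T (u b) n x - ?g x)\<^sup>2) + 2 * (1 - l n)\<^sup>2 * (LINT x|lebesgue_on U. (?g x)\<^sup>2)"
    have "?B \<longlonglongrightarrow> 2 * 0 + 2 * (1 - 1)\<^sup>2 * (LINT x|lebesgue_on U. (?g x)\<^sup>2)"
      by (intro tendsto_intros Tb lim_l)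
    then show "?B \<longlonglongrightarrow> 0" by simp
    show "\<forall>\<^sub>F n in sequentially. (LINT x|lebesgue_on U. (pderiv_dir b (\<phi> n) x - ?g x)\<^sup>2) \<le> ?B n"
    proof (rule always_eventually, rule allI)
      fix n
      have sq: "square_integrable (lebesgue_on U) (\<lambda>x. pderiv_dir b (\<phi> n) x - ?g x)"
        by (intro square_integrable_diff[OF square_integrable_continuous g] smooth_continuous_on smooth_pderiv_dir smooth b U(3) Ul)
      have sq2: "square_integrable (lebesgue_on U) (\<lambda>x. T (u b) n x - ?g x)"
        using Tb(2) g by (rule square_integrable_diff)
      have "(LINT x|lebesgue_on U. (pderiv_dir b (\<phi> n) x - ?g x)\<^sup>2)
         \<le> (LINT x|lebesgue_on U. 2 * (T (u b) n x - ?g x)\<^sup>2 + 2 * (1 - l n)\<^sup>2 * (?g x)\<^sup>2)"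
      proof (rule integral_mono)
        fix x assume "x \<in> space (lebesgue_on U)"
        then have x: "x \<in> U" by (simp add: space_restrict_space)
        have "pderiv_dir b (\<phi> n) x - ?g x = l n * (T (u b) n x - ?g x) + (- ((1 - l n) * ?g x))"
          unfolding grad[OF b x] by (simp add: algebra_simps)
        then have "(pderiv_dir b (\<phi> n) x - ?g x)\<^sup>2 \<le> 2 * (l n * (T (u b) n x - ?g x))\<^sup>2 + 2 * ((1 - l n) * ?g x)\<^sup>2"
          using power2_sum_le[of "l n * (T (u b) n x - ?g x)" "- ((1 - l n) * ?g x)"]
          by (simp only: power2_minus)
        moreover have "(l n * (T (u b) n x - ?g x))\<^sup>2 \<le> (T (u b) n x - ?g x)\<^sup>2"
          using l[of n] unfolding power_mult_distrib by (intro mult_left_le_one_le) (auto simp: power_le_one)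
        ultimately show "(pderiv_dir b (\<phi> n) x - ?g x)\<^sup>2 \<le> 2 * (T (u b) n x - ?g x)\<^sup>2 + 2 * (1 - l n)\<^sup>2 * (?g x)\<^sup>2"
          by (simp add: power_mult_distrib)
      qed (use sq sq2 g in \<open>auto simp: square_integrable_def\<close>)
      also have "\<dots> = ?B n" using sq2 g by (simp add: square_integrable_def)
      finally show "(LINT x|lebesgue_on U. (pderiv_dir b (\<phi> n) x - ?g x)\<^sup>2) \<le> ?B n" .
    qed
  qed auto
  have "(\<lambda>n. sqrt ((LINT x|lebesgue_on U. (\<phi> n x - v x)\<^sup>2) + (\<Sum>b\<in>Basis. LINT x|lebesgue_on U. (pderiv_dir b (\<phi> n) x - weak_pderiv U b v x)\<^sup>2)))
     \<longlonglongrightarrow> sqrt (0 + (\<Sum>b\<in>(Basis :: plane set). 0))"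
    unfolding \<phi>_def[abs_def]
    by (intro tendsto_intros T_lim[OF u0 H1_square_integrable(1)[OF v]] grad_lim[unfolded \<phi>_def[abs_def]])
  moreover have "H1_norm U (\<lambda>x. \<phi> n x - v x) = sqrt ((LINT x|lebesgue_on U. (\<phi> n x - v x)\<^sup>2)
     + (\<Sum>b\<in>Basis. LINT x|lebesgue_on U. (pderiv_dir b (\<phi> n) x - weak_pderiv U b v x)\<^sup>2))" for n
  proof (rule H1_norm_eq[OF U(1)])
    fix b :: plane assume b: "b \<in> Basis"
    show "has_weak_pderiv U b (\<lambda>x. \<phi> n x - v x) (\<lambda>x. pderiv_dir b (\<phi> n) x - weak_pderiv U b v x)"
      by (rule has_weak_pderiv_diff[OF U(1) has_weak_pderiv_smooth[OF U(1) smooth b] H1_has_weak_pderiv[OF v b] b])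
    show "square_integrable (lebesgue_on U) (\<lambda>x. pderiv_dir b (\<phi> n) x - weak_pderiv U b v x)"
      by (intro square_integrable_diff[OF square_integrable_continuous H1_square_integrable(2)[OF v b]]
          smooth_continuous_on smooth_pderiv_dir smooth b U(3) Ul)
  qed
  ultimately show ?thesis using smooth by (intro exI[of _ \<phi>]) simp
qed

section \<open>Traces\<close>

text \<open>Increments are at most sqrt G times 2^-n, so the tail after n is at most twice that;
  squaring gives the factor 4. Keeping the difference of powers in \<open>far\<close> makes the
  induction exact.\<close>

lemma geometric_increments_convergent:
  fixes a :: "nat \<Rightarrow> real"
  assumes G: "\<And>n. 4 ^ n * (a (Suc n) - a n)\<^sup>2 \<le> G"
  shows "convergent a" "(a n - lim a)\<^sup>2 \<le> 4 * G * (1/4) ^ n"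
proof -
  have G0: "G \<ge> 0" using order_trans[OF _ G[of 0]] by simp
  have step: "\<bar>a (Suc n) - a n\<bar> \<le> sqrt G * (1/2) ^ n" for n
  proof -
    have "(a (Suc n) - a n)\<^sup>2 \<le> G * (1/4) ^ n" using G[of n] by (simp add: field_simps power_divide)
    then have "sqrt ((a (Suc n) - a n)\<^sup>2) \<le> sqrt (G * (1/4) ^ n)" by (rule real_sqrt_le_mono)
    also have "sqrt (G * (1/4) ^ n) = sqrt G * sqrt (1/4) ^ n" by (simp add: real_sqrt_mult real_sqrt_power)
    also have "sqrt (1/4) = (1/2 :: real)" by (rule real_sqrt_unique) (simp_all add: power2_eq_square)
    finally show ?thesis by simp
  qed
  have far: "\<bar>a (n + k) - a n\<bar> \<le> 2 * sqrt G * ((1/2) ^ n - (1/2) ^ (n + k))" for n k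
  proof (induction k)
    case (Suc k)
    have "\<bar>a (n + Suc k) - a n\<bar> \<le> \<bar>a (Suc (n + k)) - a (n + k)\<bar> + \<bar>a (n + k) - a n\<bar>" by simp
    also have "\<dots> \<le> sqrt G * (1/2) ^ (n + k) + 2 * sqrt G * ((1/2) ^ n - (1/2) ^ (n + k))"
      using step[of "n + k"] Suc.IH by (rule add_mono)
    also have "\<dots> = 2 * sqrt G * ((1/2) ^ n - (1/2) ^ (n + Suc k))" by (simp add: algebra_simps)
    finally show ?case .
  qed simp
  have far': "\<bar>a m - a n\<bar> \<le> 2 * sqrt G * (1/2) ^ n" if "m \<ge> n" for m n
  proof -
    have "\<bar>a m - a n\<bar> \<le> 2 * sqrt G * ((1/2) ^ n - (1/2) ^ m)" using far[of n "m - n"] that by simp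
    also have "\<dots> \<le> 2 * sqrt G * (1/2) ^ n" using G0 by (intro mult_left_mono) auto
    finally show ?thesis .
  qed
  have lim0: "(\<lambda>n. 2 * sqrt G * (1/2) ^ n) \<longlonglongrightarrow> 0"
    by (intro tendsto_mult_right_zero LIMSEQ_power_zero) simp
  have "Cauchy a"
  proof (rule metric_CauchyI)
    fix e :: real assume "e > 0"
    then have "\<forall>\<^sub>F n in sequentially. 2 * sqrt G * (1/2) ^ n < e / 2" using order_tendstoD(2)[OF lim0, of "e / 2"] by simp
    then obtain N where N: "2 * sqrt G * (1/2) ^ N < e / 2" by (auto simp: eventually_sequentially)
    have "dist (a m) (a n) < e" if "m \<ge> N" "n \<ge> N" for m n
      using far'[OF that(1)] far'[OF that(2)] N unfolding dist_real_def by linarith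
    then show "\<exists>M. \<forall>m\<ge>M. \<forall>n\<ge>M. dist (a m) (a n) < e" by blast
  qed
  then show conv: "convergent a" by (rule Cauchy_convergent)
  then have "a \<longlonglongrightarrow> lim a" by (rule convergent_LIMSEQ_iff[THEN iffD1])
  then have "(\<lambda>m. \<bar>a m - a n\<bar>) \<longlonglongrightarrow> \<bar>lim a - a n\<bar>" by (intro tendsto_intros)
  then have "\<bar>lim a - a n\<bar> \<le> 2 * sqrt G * (1/2) ^ n"
    by (rule LIMSEQ_le_const2) (use far' in blast)
  then have "(lim a - a n)\<^sup>2 \<le> (2 * sqrt G * (1/2) ^ n)\<^sup>2"
    using G0 by (intro power2_le_iff_abs_le[THEN iffD2]) auto
  also have "\<dots> = 4 * G * ((1/2) ^ n * (1/2) ^ n)"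
    using G0 by (simp add: power_mult_distrib power2_eq_square[of "(1/2) ^ n"])
  also have "(1/2) ^ n * (1/2) ^ n = (1/4 :: real) ^ n" by (simp add: power_mult_distrib[symmetric])
  finally show "(a n - lim a)\<^sup>2 \<le> 4 * G * (1/4) ^ n" by (simp add: power2_commute)
qed

lemma ennreal_le_suminf: "f n \<le> suminf (f :: nat \<Rightarrow> ennreal)"
  using sum_le_suminf[of f "{n}"] by (simp add: summableI)

text \<open>The weights \<open>4\<^sup>n\<close> make the sum of the squared increments an integrable majorant that also
  controls \<open>(F\<^sub>n - t)\<^sup>2\<close> by \<open>4\<^sup>-\<^sup>n\<close>; this gives completeness over an arbitrary measure.\<close>

lemma L2_complete:
  fixes F :: "nat \<Rightarrow> 'a \<Rightarrow> real"
  assumes F: "\<And>n. square_integrable M (F n)"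
    and fast: "\<And>n. (LINT x|M. (F (Suc n) x - F n x)\<^sup>2) \<le> (1/8) ^ n"
  shows "\<exists>t. square_integrable M t \<and> (\<lambda>n. LINT x|M. (F n x - t x)\<^sup>2) \<longlonglongrightarrow> 0"
proof -
  have [measurable]: "F n \<in> borel_measurable M" for n using F[of n] by (simp add: square_integrable_def)
  have d: "integrable M (\<lambda>x. (F (Suc n) x - F n x)\<^sup>2)" for n
    using square_integrable_diff[OF F F] by (simp add: square_integrable_def)
  define H where "H x = (\<Sum>n. ennreal (4 ^ n * (F (Suc n) x - F n x)\<^sup>2))" for x
  have [measurable]: "H \<in> borel_measurable M" unfolding H_def by measurable
  have "(\<integral>\<^sup>+x. H x \<partial>M) = (\<Sum>n. \<integral>\<^sup>+x. ennreal (4 ^ n * (F (Suc n) x - F n x)\<^sup>2) \<partial>M)"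
    unfolding H_def by (rule nn_integral_suminf) measurable
  \<comment> \<open>The assumed rate 8^-n against the weight 4^n leaves the summable 2^-n.\<close>
  also have "\<dots> \<le> (\<Sum>n. ennreal ((1/2) ^ n))"
  proof (rule suminf_le)
    fix n
    have "(\<integral>\<^sup>+x. ennreal (4 ^ n * (F (Suc n) x - F n x)\<^sup>2) \<partial>M) = ennreal (LINT x|M. 4 ^ n * (F (Suc n) x - F n x)\<^sup>2)"
      using d by (intro nn_integral_eq_integral) auto
    also have "\<dots> \<le> ennreal (4 ^ n * (1/8) ^ n)"
      using fast[of n] by (intro ennreal_leI) simp
    also have "4 ^ n * (1/8) ^ n = (1/2 :: real) ^ n" by (simp add: power_mult_distrib[symmetric])
    finally show "(\<integral>\<^sup>+x. ennreal (4 ^ n * (F (Suc n) x - F n x)\<^sup>2) \<partial>M) \<le> ennreal ((1/2) ^ n)" .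
  qed auto
  also have "\<dots> = ennreal (\<Sum>n. (1/2) ^ n)"
    by (rule suminf_ennreal2) (auto intro: summable_geometric)
  finally have H_fin: "(\<integral>\<^sup>+x. H x \<partial>M) < \<infinity>" by (simp add: le_less_trans)
  then have H_AE: "AE x in M. H x \<noteq> \<infinity>" by (intro nn_integral_PInf_AE) auto
  define G where "G x = enn2real (H x)" for x
  have G_int: "integrable M G"
    unfolding G_def using H_fin H_AE
    by (intro integrableI_nonneg) (auto intro!: le_less_trans[OF nn_integral_mono, of _ _ H] simp: ennreal_enn2real_if)
  have G_bound: "AE x in M. \<forall>n. 4 ^ n * (F (Suc n) x - F n x)\<^sup>2 \<le> G x"
    using H_AE
  proof eventually_elim
    fix x assume Hx: "H x \<noteq> \<infinity>"
    show "\<forall>n. 4 ^ n * (F (Suc n) x - F n x)\<^sup>2 \<le> G x"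
    proof
      fix n
      have "ennreal (4 ^ n * (F (Suc n) x - F n x)\<^sup>2) \<le> H x"
        unfolding H_def by (rule ennreal_le_suminf)
      then have "enn2real (ennreal (4 ^ n * (F (Suc n) x - F n x)\<^sup>2)) \<le> G x"
        unfolding G_def using Hx by (intro enn2real_mono) (auto simp: less_top)
      then show "4 ^ n * (F (Suc n) x - F n x)\<^sup>2 \<le> G x" by simp
    qed
  qed
  \<comment> \<open>Where the sequence diverges, \<open>lim\<close> has an arbitrary value. That
    happens only on a null set, and measurability of \<open>t\<close> holds regardless.\<close>
  define t where "t x = lim (\<lambda>n. F n x)" for x
  have [measurable]: "t \<in> borel_measurable M" unfolding t_def by measurable
  have near: "AE x in M. (F n x - t x)\<^sup>2 \<le> 4 * (1/4) ^ n * G x" for n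
    using G_bound
  proof eventually_elim
    fix x assume "\<forall>n. 4 ^ n * (F (Suc n) x - F n x)\<^sup>2 \<le> G x"
    then show "(F n x - t x)\<^sup>2 \<le> 4 * (1/4) ^ n * G x"
      using geometric_increments_convergent(2)[of "\<lambda>n. F n x" "G x" n] by (simp add: t_def algebra_simps)
  qed
  have diff: "integrable M (\<lambda>x. (F n x - t x)\<^sup>2)" for n
  proof (rule Bochner_Integration.integrable_bound)
    show "integrable M (\<lambda>x. 4 * (1/4) ^ n * G x)" using G_int by simp
    show "AE x in M. norm ((F n x - t x)\<^sup>2) \<le> norm (4 * (1/4) ^ n * G x)"
      using near[of n] by eventually_elim (simp add: order_trans[OF _ abs_ge_self])
  qed measurable
  then have "square_integrable M (\<lambda>x. F 0 x - t x)" unfolding square_integrable_def by simp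
  from square_integrable_diff[OF F[of 0] this] have "square_integrable M t" by simp
  moreover have "(\<lambda>n. LINT x|M. (F n x - t x)\<^sup>2) \<longlonglongrightarrow> 0"
  proof (rule tendsto_sandwich[where f="\<lambda>_. 0"])
    show "\<forall>\<^sub>F n in sequentially. (LINT x|M. (F n x - t x)\<^sup>2) \<le> 4 * (1/4) ^ n * (LINT x|M. G x)"
    proof (rule always_eventually, rule allI)
      fix n
      have "(LINT x|M. (F n x - t x)\<^sup>2) \<le> (LINT x|M. 4 * (1/4) ^ n * G x)"
        using diff G_int near[of n] by (intro integral_mono_AE) auto
      then show "(LINT x|M. (F n x - t x)\<^sup>2) \<le> 4 * (1/4) ^ n * (LINT x|M. G x)" by simp
    qed
    show "(\<lambda>n. 4 * (1/4) ^ n * (LINT x|M. G x)) \<longlonglongrightarrow> 0"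
      by (intro tendsto_mult_left_zero tendsto_mult_right_zero LIMSEQ_power_zero) simp
  qed auto
  ultimately show ?thesis by blast
qed

text \<open>A triangle inequality through \<open>v\<close>; the squared form with constant 2 follows
  pointwise and is enough for limits.\<close>

lemma H1_norm_power2_diff_le:
  assumes U: "open U" and "f \<in> H1 U" "g \<in> H1 U" "v \<in> H1 U"
  shows "(H1_norm U (\<lambda>x. f x - g x))\<^sup>2 \<le> 2 * (H1_norm U (\<lambda>x. f x - v x))\<^sup>2 + 2 * (H1_norm U (\<lambda>x. g x - v x))\<^sup>2"
proof -
  have le: "(LINT x|lebesgue_on U. (f x - g x)\<^sup>2) \<le> 2 * (LINT x|lebesgue_on U. (f x - v x)\<^sup>2) + 2 * (LINT x|lebesgue_on U. (g x - v x)\<^sup>2)"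
    if "square_integrable (lebesgue_on U) f" "square_integrable (lebesgue_on U) g" "square_integrable (lebesgue_on U) v" for f g v
  proof -
    note sq = square_integrable_diff[OF that(1,2)] square_integrable_diff[OF that(1,3)] square_integrable_diff[OF that(2,3)]
    have "(f x - g x)\<^sup>2 \<le> 2 * (f x - v x)\<^sup>2 + 2 * (g x - v x)\<^sup>2" for x
      using power2_sum_le[of "f x - v x" "- (g x - v x)"] by (simp only: power2_minus) (simp add: algebra_simps)
    then have "(LINT x|lebesgue_on U. (f x - g x)\<^sup>2) \<le> (LINT x|lebesgue_on U. 2 * (f x - v x)\<^sup>2 + 2 * (g x - v x)\<^sup>2)"
      using sq by (intro integral_mono) (auto simp: square_integrable_def)
    then show ?thesis using sq by (simp add: square_integrable_def)
  qed
  have H: "(H1_norm U (\<lambda>x. f x - g x))\<^sup>2 = (LINT x|lebesgue_on U. (f x - g x)\<^sup>2)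
    + (\<Sum>b\<in>Basis. LINT x|lebesgue_on U. (weak_pderiv U b f x - weak_pderiv U b g x)\<^sup>2)"
    if "f \<in> H1 U" "g \<in> H1 U" for f g
    unfolding H1_norm_diff[OF U that] by (intro real_sqrt_pow2 add_nonneg_nonneg sum_nonneg) auto
  have "(\<Sum>b\<in>Basis. LINT x|lebesgue_on U. (weak_pderiv U b f x - weak_pderiv U b g x)\<^sup>2)
    \<le> (\<Sum>b\<in>Basis. 2 * (LINT x|lebesgue_on U. (weak_pderiv U b f x - weak_pderiv U b v x)\<^sup>2)
         + 2 * (LINT x|lebesgue_on U. (weak_pderiv U b g x - weak_pderiv U b v x)\<^sup>2))"
    by (intro sum_mono le H1_square_integrable assms)
  moreover note le[OF H1_square_integrable(1)[OF assms(2)] H1_square_integrable(1)[OF assms(3)] H1_square_integrable(1)[OF assms(4)]]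
  ultimately show ?thesis
    unfolding H[OF assms(2,3)] H[OF assms(2,4)] H[OF assms(3,4)] sum.distrib sum_distrib_left[symmetric]
    by (simp add: algebra_simps)
qed

text \<open>Formulated for smooth functions, for which the trace is plain restriction. The extension
  to \<open>H1\<close> is \<open>face_trace_limit\<close>.\<close>

definition trace_bound :: "plane set \<Rightarrow> plane set \<Rightarrow> real \<Rightarrow> bool" where
  "trace_bound E e C \<longleftrightarrow> (\<forall>\<phi>. smooth \<phi> \<longrightarrow> square_integrable (arc_measure e) \<phi> \<and>
     (LINT x|arc_measure e. (\<phi> x)\<^sup>2) \<le> C * (H1_norm E \<phi>)\<^sup>2)"

lemma trace_bound_nonneg:
  assumes "trace_bound E e C" obtains C' where "C' \<ge> 0" "trace_bound E e C'"
proof -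
  have "trace_bound E e (max C 0)"
    unfolding trace_bound_def
  proof (intro allI impI conjI)
    fix \<phi> assume "smooth \<phi>"
    with assms show "square_integrable (arc_measure e) \<phi>" by (auto simp: trace_bound_def)
    have "(LINT x|arc_measure e. (\<phi> x)\<^sup>2) \<le> C * (H1_norm E \<phi>)\<^sup>2"
      using assms \<open>smooth \<phi>\<close> by (auto simp: trace_bound_def)
    also have "\<dots> \<le> max C 0 * (H1_norm E \<phi>)\<^sup>2" by (intro mult_right_mono) auto
    finally show "(LINT x|arc_measure e. (\<phi> x)\<^sup>2) \<le> max C 0 * (H1_norm E \<phi>)\<^sup>2" .
  qed
  then show thesis using that by (meson max.cobounded2)
qed

text \<open>The trace bound makes restrictions of an H1-convergent sequence Cauchy in L2 of the
  face, so some trace exists. The chosen trace has its own approximating sequence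
  \<open>\<psi>\<close>; the bound applied to the differences of the two sequences shows that
  \<open>\<phi>\<close> leads to the same limit. Every smooth approximation may hence be used, in
  particular one shared by two cells.\<close>

theorem face_trace_limit:
  assumes E: "open E" "bounded E" and C: "trace_bound E e C" and v: "v \<in> H1 E"
    and \<phi>: "\<And>n. smooth (\<phi> n)" and lim: "(\<lambda>n. H1_norm E (\<lambda>x. \<phi> n x - v x)) \<longlonglongrightarrow> 0"
  shows "square_integrable (arc_measure e) (face_trace E e v)"
    and "(\<lambda>n. LINT x|arc_measure e. (\<phi> n x - face_trace E e v x)\<^sup>2) \<longlonglongrightarrow> 0"
proof -
  let ?M = "arc_measure e"
  obtain C' where C': "C' \<ge> 0" "trace_bound E e C'" using trace_bound_nonneg[OF C] by blast
  have sq: "square_integrable ?M f" if "smooth f" for f using C that by (auto simp: trace_bound_def)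
  have bound: "(LINT x|?M. (f x - g x)\<^sup>2) \<le> C' * (2 * (H1_norm E (\<lambda>x. f x - v x))\<^sup>2 + 2 * (H1_norm E (\<lambda>x. g x - v x))\<^sup>2)"
    if "smooth f" "smooth g" for f g
  proof -
    have "(LINT x|?M. (f x - g x)\<^sup>2) \<le> C' * (H1_norm E (\<lambda>x. f x - g x))\<^sup>2"
      using C'(2) smooth_diff[OF that] by (auto simp: trace_bound_def)
    also have "\<dots> \<le> C' * (2 * (H1_norm E (\<lambda>x. f x - v x))\<^sup>2 + 2 * (H1_norm E (\<lambda>x. g x - v x))\<^sup>2)"
      using C'(1) by (intro mult_left_mono H1_norm_power2_diff_le[OF E(1)] smooth_H1 E that v)
    finally show ?thesis .
  qed
  have "\<exists>t. has_trace E e v t"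
  proof -
    \<comment> \<open>Scaled so that the squared distance of two restrictions is at most the mean of
      two values of \<open>a\<close>; small values along a subsequence then give the rate required
      by \<open>L2_complete\<close>.\<close>
    define a where "a n = C' * (4 * (H1_norm E (\<lambda>x. \<phi> n x - v x))\<^sup>2)" for n
    have "(\<lambda>n. C' * (4 * (H1_norm E (\<lambda>x. \<phi> n x - v x))\<^sup>2)) \<longlonglongrightarrow> C' * (4 * 0\<^sup>2)"
      by (intro tendsto_intros lim)
    then have "a \<longlonglongrightarrow> 0" by (simp add: a_def[abs_def])
    then have ev: "\<forall>\<^sub>F n in sequentially. a n < (1/8) ^ k" for k by (rule order_tendstoD(2)) simp
    have "\<exists>n>m. a n < (1/8) ^ k" for m k
      using eventually_conj[OF ev[of k] eventually_gt_at_top[of m]] by (auto dest!: eventually_happens)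
    then have step: "\<exists>n. n > m \<and> a n < (1/8) ^ k" for m k by blast
    obtain s where s: "\<And>k. a (s k) < (1/8) ^ k" "\<And>k. s (Suc k) > s k"
      using dependent_nat_choice[of "\<lambda>k n. a n < (1/8) ^ k" "\<lambda>k m n. n > m"] step by metis
    have "strict_mono s" using s(2) by (rule strict_monoI_Suc)
    have "(LINT x|?M. (\<phi> (s (Suc k)) x - \<phi> (s k) x)\<^sup>2) \<le> (1/8) ^ k" for k
    proof -
      have "(LINT x|?M. (\<phi> (s (Suc k)) x - \<phi> (s k) x)\<^sup>2) \<le> a (s (Suc k)) / 2 + a (s k) / 2"
        using bound[OF \<phi> \<phi>, of "s (Suc k)" "s k"] by (simp add: a_def algebra_simps)
      also have "\<dots> \<le> (1/8) ^ k" using s(1)[of k] s(1)[of "Suc k"] power_decreasing[of k "Suc k" "1/8::real"] by linarith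
      finally show ?thesis .
    qed
    then obtain t where t: "square_integrable ?M t" "(\<lambda>k. LINT x|?M. (\<phi> (s k) x - t x)\<^sup>2) \<longlonglongrightarrow> 0"
      using L2_complete[of ?M "\<lambda>k. \<phi> (s k)"] sq \<phi> by blast
    have "(\<lambda>k. H1_norm E (\<lambda>x. \<phi> (s k) x - v x)) \<longlonglongrightarrow> 0"
      using LIMSEQ_subseq_LIMSEQ[OF lim \<open>strict_mono s\<close>] by (simp add: o_def)
    then show ?thesis unfolding has_trace_def using v t \<phi> by (intro exI[of _ t]) (auto intro!: exI[of _ "\<lambda>k. \<phi> (s k)"])
  qed
  then have "has_trace E e v (face_trace E e v)" unfolding face_trace_def by (rule someI_ex)
  then obtain \<psi> where t: "square_integrable ?M (face_trace E e v)" and \<psi>: "\<And>n. smooth (\<psi> n)"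
    and \<psi>_lim: "(\<lambda>n. H1_norm E (\<lambda>x. \<psi> n x - v x)) \<longlonglongrightarrow> 0"
    and \<psi>_t: "(\<lambda>n. LINT x|?M. (\<psi> n x - face_trace E e v x)\<^sup>2) \<longlonglongrightarrow> 0"
    unfolding has_trace_def by blast
  show "square_integrable ?M (face_trace E e v)" by (fact t)
  show "(\<lambda>n. LINT x|?M. (\<phi> n x - face_trace E e v x)\<^sup>2) \<longlonglongrightarrow> 0"
  proof (rule tendsto_sandwich[where f="\<lambda>_. 0"])
    let ?t = "face_trace E e v"
    let ?B = "\<lambda>n. 2 * (C' * (2 * (H1_norm E (\<lambda>x. \<phi> n x - v x))\<^sup>2 + 2 * (H1_norm E (\<lambda>x. \<psi> n x - v x))\<^sup>2))
       + 2 * (LINT x|?M. (\<psi> n x - ?t x)\<^sup>2)"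
    have "?B \<longlonglongrightarrow> 2 * (C' * (2 * 0\<^sup>2 + 2 * 0\<^sup>2)) + 2 * 0"
      by (intro tendsto_intros lim \<psi>_lim \<psi>_t)
    then show "?B \<longlonglongrightarrow> 0" by simp
    show "\<forall>\<^sub>F n in sequentially. (LINT x|?M. (\<phi> n x - ?t x)\<^sup>2) \<le> ?B n"
    proof (rule always_eventually, rule allI)
      fix n
      note sqs = square_integrable_diff[OF sq[OF \<phi>] t, of n] square_integrable_diff[OF sq[OF \<phi>] sq[OF \<psi>], of n n]
        square_integrable_diff[OF sq[OF \<psi>] t, of n]
      have "(LINT x|?M. (\<phi> n x - ?t x)\<^sup>2) \<le> (LINT x|?M. 2 * (\<phi> n x - \<psi> n x)\<^sup>2 + 2 * (\<psi> n x - ?t x)\<^sup>2)"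
      proof (rule integral_mono)
        show "(\<phi> n x - ?t x)\<^sup>2 \<le> 2 * (\<phi> n x - \<psi> n x)\<^sup>2 + 2 * (\<psi> n x - ?t x)\<^sup>2" for x
          using power2_sum_le[of "\<phi> n x - \<psi> n x" "\<psi> n x - ?t x"] by simp
      qed (use sqs in \<open>auto simp: square_integrable_def\<close>)
      also have "\<dots> = 2 * (LINT x|?M. (\<phi> n x - \<psi> n x)\<^sup>2) + 2 * (LINT x|?M. (\<psi> n x - ?t x)\<^sup>2)"
        using sqs by (simp add: square_integrable_def)
      also have "\<dots> \<le> ?B n" using bound[OF \<phi> \<psi>, of n n] by simp
      finally show "(LINT x|?M. (\<phi> n x - ?t x)\<^sup>2) \<le> ?B n" .
    qed
  qed auto
qed

lemma weighted_face_trace_limit: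
  assumes E: "open E" "bounded E" and C: "trace_bound E e C" and v: "v \<in> H1 E"
    and \<phi>: "\<And>n. smooth (\<phi> n)" and lim: "(\<lambda>n. H1_norm E (\<lambda>x. \<phi> n x - v x)) \<longlonglongrightarrow> 0"
    and \<omega>: "square_integrable (arc_measure e) \<omega>"
  shows "(\<lambda>n. LINT x|arc_measure e. \<omega> x * \<phi> n x) \<longlonglongrightarrow> (LINT x|arc_measure e. \<omega> x * face_trace E e v x)"
proof -
  let ?M = "arc_measure e" and ?t = "face_trace E e v"
  note t = face_trace_limit[OF assms(1-6)]
  have sq: "square_integrable ?M (\<phi> n)" for n using C \<phi> by (auto simp: trace_bound_def)
  have "(\<lambda>n. (LINT x|?M. \<omega> x * \<phi> n x) - (LINT x|?M. \<omega> x * ?t x)) \<longlonglongrightarrow> 0"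
  proof (rule Lim_null_comparison)
    have "(\<lambda>n. sqrt (LINT x|?M. (\<omega> x)\<^sup>2) * sqrt (LINT x|?M. (\<phi> n x - ?t x)\<^sup>2)) \<longlonglongrightarrow> sqrt (LINT x|?M. (\<omega> x)\<^sup>2) * sqrt 0"
      by (intro tendsto_intros t)
    then show "(\<lambda>n. sqrt (LINT x|?M. (\<omega> x)\<^sup>2) * sqrt (LINT x|?M. (\<phi> n x - ?t x)\<^sup>2)) \<longlonglongrightarrow> 0" by simp
    have "(LINT x|?M. \<omega> x * \<phi> n x) - (LINT x|?M. \<omega> x * ?t x) = (LINT x|?M. \<omega> x * (\<phi> n x - ?t x))" for n
      using square_integrable_mult[OF \<omega> sq] square_integrable_mult[OF \<omega> t(1)] by (simp add: right_diff_distrib)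
    then show "\<forall>\<^sub>F n in sequentially. norm ((LINT x|?M. \<omega> x * \<phi> n x) - (LINT x|?M. \<omega> x * ?t x))
        \<le> sqrt (LINT x|?M. (\<omega> x)\<^sup>2) * sqrt (LINT x|?M. (\<phi> n x - ?t x)\<^sup>2)"
      using square_integral_Cauchy_Schwarz[OF \<omega> square_integrable_diff[OF sq t(1)]] by simp
  qed
  then show ?thesis by (rule LIM_zero_cancel)
qed

section \<open>The divergence theorem on a right triangle\<close>

abbreviation cutoff :: "real \<Rightarrow> real" where "cutoff \<equiv> flat_exp 1"
abbreviation cutoff_deriv :: "real \<Rightarrow> real" where "cutoff_deriv \<equiv> flat_exp (flat_exp_step 1)"

lemma cutoff_deriv_eq: "cutoff_deriv x = (if x > 0 then (1 / x)\<^sup>2 * exp (- (1 / x)) else 0)"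
  by (simp add: flat_exp_def flat_exp_step_def power2_eq_square)

lemma cutoff_deriv_nonneg: "0 \<le> cutoff_deriv x"
  by (simp add: cutoff_deriv_eq)

lemma flat_exp_continuous: "continuous_on S (flat_exp p)"
  by (intro continuous_at_imp_continuous_on ballI DERIV_isCont[OF flat_exp_has_derivative])

lemma flat_exp_measurable [measurable]: "flat_exp p \<in> borel_measurable borel"
  by (intro borel_measurable_continuous_onI flat_exp_continuous)

lemma cutoff_tendsto_1: "(cutoff \<longlongrightarrow> 1) at_top"
proof -
  have "((\<lambda>x::real. exp (- (1 / x))) \<longlongrightarrow> 1) at_top" by real_asymp
  then show ?thesis
    by (rule Lim_transform_eventually)
       (use eventually_gt_at_top[of 0] in eventually_elim, simp add: flat_exp_def)
qed

lemma integrable_cutoff_deriv: "integrable lborel cutoff_deriv" "(LINT x|lborel. cutoff_deriv x) = 1"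
proof -
  have "(\<integral>\<^sup>+x. ennreal (cutoff_deriv x) * indicator {0..} x \<partial>lborel) = ennreal (1 - cutoff 0)"
    by (rule nn_integral_FTC_atLeast) (auto intro: cutoff_deriv_nonneg cutoff_tendsto_1 flat_exp_has_derivative)
  moreover have "(\<lambda>x. ennreal (cutoff_deriv x) * indicator {0..} x) = (\<lambda>x. ennreal (cutoff_deriv x))"
    by (auto simp: fun_eq_iff cutoff_deriv_eq indicator_def)
  ultimately have nn: "(\<integral>\<^sup>+x. ennreal (cutoff_deriv x) \<partial>lborel) = ennreal 1" by (simp add: flat_exp_def)
  show "integrable lborel cutoff_deriv"
    using nn by (intro integrableI_nonneg) (auto simp: cutoff_deriv_nonneg)
  show "(LINT x|lborel. cutoff_deriv x) = 1"
    using nn by (subst integral_eq_nn_integral) (auto simp: cutoff_deriv_nonneg)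
qed

lemma cutoff_seq_tendsto_1:
  assumes "x > 0" shows "(\<lambda>n. cutoff (real (Suc n) * x + d)) \<longlonglongrightarrow> 1"
proof (rule filterlim_compose[OF cutoff_tendsto_1])
  show "filterlim (\<lambda>n. real (Suc n) * x + d) at_top sequentially" using assms by real_asymp
qed

text \<open>The derivative of \<open>cutoff (n p)\<close> has integral one and concentrates on the line \<open>p = 0\<close>.\<close>

lemma boundary_layer_limit:
  fixes g :: "plane \<Rightarrow> real" and c \<alpha> \<kappa> Q :: real
  assumes g [measurable]: "g \<in> borel_measurable borel" and B: "\<And>z. \<bar>g z\<bar> \<le> B"
    and supp: "\<And>p q. q \<notin> {0..Q} \<Longrightarrow> g (p, q) = 0"
    and cont: "\<And>q. 0 < q \<Longrightarrow> q < Q \<Longrightarrow> ((\<lambda>p. g (p, q)) \<longlongrightarrow> g (0, q)) (at_right 0)"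
    and pos: "\<And>q. 0 < q \<Longrightarrow> q < Q \<Longrightarrow> c - \<kappa> * q > 0"
  shows "(\<lambda>n. LINT q|lborel. LINT p|lborel. g (p, q) * (real (Suc n) * cutoff_deriv (real (Suc n) * p)) * cutoff (real (Suc n) * q)
      * cutoff (real (Suc n) * (c - \<alpha> * p - \<kappa> * q) - 1)) \<longlonglongrightarrow> (LINT q|lborel. g (0, q))"
proof -
  let ?N = "\<lambda>n. real (Suc n)"
  define I where "I n q = (LINT p|lborel. g (p, q) * (?N n * cutoff_deriv (?N n * p)) * cutoff (?N n * q)
      * cutoff (?N n * (c - \<alpha> * p - \<kappa> * q) - 1))" for n q
  \<comment> \<open>The integrand after the substitution p = x / n, whose Jacobian absorbs the
    factor in front of the derivative. In the last cutoff the fixed shift - \<alpha> x - 1 is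
    harmless against the diverging term.\<close>
  define k where "k n q x = g (x / ?N n, q) * cutoff_deriv x * cutoff (?N n * q)
      * cutoff (?N n * (c - \<kappa> * q) + (- \<alpha> * x - 1))" for n q x
  have [measurable]: "g \<in> borel_measurable (borel \<Otimes>\<^sub>M borel)" by (simp add: borel_prod)
  have [measurable]: "k n q \<in> borel_measurable borel" for n q unfolding k_def by measurable
  have I_k: "I n q = (LINT x|lborel. k n q x)" for n q
  proof -
    have "I n q = \<bar>1 / ?N n\<bar> *\<^sub>R (LINT x|lborel. g (0 + 1 / ?N n * x, q) * (?N n * cutoff_deriv (?N n * (0 + 1 / ?N n * x))) * cutoff (?N n * q)
      * cutoff (?N n * (c - \<alpha> * (0 + 1 / ?N n * x) - \<kappa> * q) - 1))"
      unfolding I_def by (rule lborel_integral_real_affine) simp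
    also have "\<dots> = (LINT x|lborel. 1 / ?N n * (g (0 + 1 / ?N n * x, q) * (?N n * cutoff_deriv (?N n * (0 + 1 / ?N n * x))) * cutoff (?N n * q)
      * cutoff (?N n * (c - \<alpha> * (0 + 1 / ?N n * x) - \<kappa> * q) - 1)))"
      by (simp only: integral_mult_right_zero real_scaleR_def) simp
    also have "\<dots> = (LINT x|lborel. k n q x)"
    proof (rule Bochner_Integration.integral_cong[OF refl])
      fix x
      have "?N n * (c - \<alpha> * (0 + 1 / ?N n * x) - \<kappa> * q) - 1 = ?N n * (c - \<kappa> * q) + (- \<alpha> * x - 1)"
        by (simp add: field_simps)
      then have eq: "cutoff (?N n * (c - \<alpha> * (0 + 1 / ?N n * x) - \<kappa> * q) - 1) = cutoff (?N n * (c - \<kappa> * q) + (- \<alpha> * x - 1))"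
        by (rule arg_cong)
      show "1 / ?N n * (g (0 + 1 / ?N n * x, q) * (?N n * cutoff_deriv (?N n * (0 + 1 / ?N n * x))) * cutoff (?N n * q)
        * cutoff (?N n * (c - \<alpha> * (0 + 1 / ?N n * x) - \<kappa> * q) - 1)) = k n q x"
        unfolding k_def eq by simp
    qed
    finally show ?thesis .
  qed
  have k_bound: "\<bar>k n q x\<bar> \<le> B * cutoff_deriv x" for n q x
  proof -
    have "\<bar>k n q x\<bar> = (\<bar>g (x / ?N n, q)\<bar> * cutoff_deriv x) * (cutoff (?N n * q) * cutoff (?N n * (c - \<kappa> * q) + (- \<alpha> * x - 1)))"
      unfolding k_def by (simp add: abs_mult cutoff_deriv_nonneg flat_exp_1)
    also have "\<dots> \<le> (B * cutoff_deriv x) * 1"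
      using order_trans[OF abs_ge_zero B]
      by (intro mult_mono mult_le_one mult_nonneg_nonneg flat_exp_1 B order_refl cutoff_deriv_nonneg) auto
    finally show ?thesis by simp
  qed
  have int_w: "integrable lborel (\<lambda>x. B * cutoff_deriv x)" using integrable_cutoff_deriv(1) by simp
  have k_int: "integrable lborel (k n q)" for n q
    by (rule Bochner_Integration.integrable_bound[OF int_w]) (use k_bound[of n q] in \<open>auto intro: order_trans[OF _ abs_ge_self]\<close>)
  have I_bound: "\<bar>I n q\<bar> \<le> B" for n q
  proof -
    have "\<bar>I n q\<bar> \<le> (LINT x|lborel. \<bar>k n q x\<bar>)" unfolding I_k by (rule integral_abs_bound)
    also have "\<dots> \<le> (LINT x|lborel. B * cutoff_deriv x)"
      using k_int int_w k_bound by (intro integral_mono) auto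
    also have "\<dots> = B" using integrable_cutoff_deriv by simp
    finally show ?thesis .
  qed
  have I_supp: "I n q = 0" if "q \<notin> {0..Q}" for n q using supp[OF that] by (simp add: I_def)
  have I_lim: "(\<lambda>n. I n q) \<longlonglongrightarrow> g (0, q)" if q: "0 < q" "q < Q" for q
  proof -
    have "(\<lambda>n. LINT x|lborel. k n q x) \<longlonglongrightarrow> (LINT x|lborel. g (0, q) * cutoff_deriv x)"
    proof (rule integral_dominated_convergence[OF _ _ int_w])
      show "AE x in lborel. (\<lambda>n. k n q x) \<longlonglongrightarrow> g (0, q) * cutoff_deriv x"
      proof (rule AE_I2)
        fix x :: real
        show "(\<lambda>n. k n q x) \<longlonglongrightarrow> g (0, q) * cutoff_deriv x"
        proof (cases "x > 0")
          case True
          have "(\<lambda>n. x / ?N n) \<longlonglongrightarrow> 0" by real_asymp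
          then have "filterlim (\<lambda>n. x / ?N n) (at_right 0) sequentially"
            unfolding filterlim_at using True by auto
          then have "(\<lambda>n. g (x / ?N n, q)) \<longlonglongrightarrow> g (0, q)" by (rule filterlim_compose[OF cont[OF q]])
          then have "(\<lambda>n. k n q x) \<longlonglongrightarrow> g (0, q) * cutoff_deriv x * 1 * 1"
            unfolding k_def using cutoff_seq_tendsto_1[OF q(1), of 0] cutoff_seq_tendsto_1[OF pos[OF q]]
            by (intro tendsto_mult tendsto_const) auto
          then show ?thesis by simp
        next
          case False
          then show ?thesis by (simp add: k_def cutoff_deriv_eq)
        qed
      qed
    qed (use k_bound in auto)
    then show ?thesis unfolding I_k using integrable_cutoff_deriv by simp
  qed
  have I_meas: "I n \<in> borel_measurable lborel" for n
    unfolding I_def by measurable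
  have "(\<lambda>n. LINT q|lborel. I n q) \<longlonglongrightarrow> (LINT q|lborel. g (0, q))"
  proof (rule integral_dominated_convergence[where w="\<lambda>q. B * indicator {0..Q} q"])
    have "AE q in lborel. q \<noteq> 0" "AE q in lborel. q \<noteq> Q" by (rule AE_lborel_singleton)+
    then show "AE q in lborel. (\<lambda>n. I n q) \<longlonglongrightarrow> g (0, q)"
    proof eventually_elim
      fix q assume "q \<noteq> 0" "q \<noteq> Q"
      then consider "0 < q \<and> q < Q" | "q \<notin> {0..Q}" by force
      then show "(\<lambda>n. I n q) \<longlonglongrightarrow> g (0, q)"
        by cases (use I_lim I_supp supp in auto)
    qed
    show "AE q in lborel. norm (I n q) \<le> B * indicator {0..Q} q" for n
      using I_bound[of n] I_supp[of _ n] by (intro AE_I2) (auto simp: indicator_def)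
    show "integrable lborel (\<lambda>q. B * indicator {0..Q} q)"
      by (intro integrable_mult_right integrable_real_indicator) (auto simp: emeasure_lborel_Icc_eq)
  qed (use I_meas in auto)
  then show ?thesis by (simp only: I_def)
qed

lemma tendsto_indicator_times_continuous:
  fixes X :: "'a::metric_space \<Rightarrow> real"
  assumes "continuous_on K X" "z \<in> K" "(\<gamma> \<longlongrightarrow> z) F" "\<forall>\<^sub>F p in F. \<gamma> p \<in> K"
  shows "((\<lambda>p. indicator K (\<gamma> p) * X (\<gamma> p)) \<longlongrightarrow> indicator K z * X z) F"
proof -
  have "((\<lambda>p. X (\<gamma> p)) \<longlongrightarrow> X z) F"
    using assms(1,2) assms(4,3) unfolding continuous_on_eq_continuous_within
    by (intro continuous_within_tendsto_compose[of z K X \<gamma> F]) auto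
  then have "((\<lambda>p. indicator K (\<gamma> p) * X (\<gamma> p)) \<longlongrightarrow> X z) F"
    by (rule Lim_transform_eventually) (use assms(4) in \<open>eventually_elim, simp\<close>)
  then show ?thesis using assms(2) by simp
qed

text \<open>With y = n \<rho> - 1 the left side is n \<rho> times the derivative of the cutoff: the
  gradient of the layer paired with a factor decaying like \<rho>. In q = 1 / y it is (q + q^2)
  exp(-q), and the quadratic Taylor bound of exp gives 4.\<close>

lemma layer_weight_le: "(y + 1) * cutoff_deriv y \<le> 4"
proof (cases "y > 0")
  case True
  define q where "q = 1 / y"
  have q: "q > 0" using True by (simp add: q_def)
  have "(y + 1) * cutoff_deriv y = (q + q\<^sup>2) * exp (- q)"
    using True by (simp add: cutoff_deriv_eq q_def power2_eq_square field_simps)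
  also have "\<dots> = (q + q\<^sup>2) / exp q" by (simp add: exp_minus field_simps)
  also have "\<dots> \<le> 4"
  proof -
    have "q + q\<^sup>2 \<le> 4 * exp q"
      using exp_lower_Taylor_quadratic[of q] q zero_le_power2[of q] by linarith
    then show ?thesis by (simp add: divide_le_eq)
  qed
  finally show ?thesis .
qed (simp add: cutoff_deriv_eq)

lemma layer_weight_tendsto: "((\<lambda>y. (y + 1) * cutoff_deriv y) \<longlongrightarrow> 0) at_top"
proof -
  have "((\<lambda>y::real. (y + 1) * ((1 / y)\<^sup>2 * exp (- (1 / y)))) \<longlongrightarrow> 0) at_top" by real_asymp
  then show ?thesis
    by (rule Lim_transform_eventually)
       (use eventually_gt_at_top[of 0] in \<open>eventually_elim, simp add: cutoff_deriv_eq\<close>)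
qed

text \<open>Arranged so that the derivative of the third factor occurs with coefficients - t and 1,
  a normal direction of the hypotenuse, next to one layer term for a leg.\<close>

lemma pderiv_cutoff_product:
  fixes k :: real
  shows "pderiv_dir (1, 0) (\<lambda>z. flat_exp p (\<alpha> + (k, 0) \<bullet> z) * flat_exp p (\<beta> + (0, - k) \<bullet> z) * flat_exp p (\<delta> + (- k * t, k) \<bullet> z)) z
      = k * flat_exp (flat_exp_step p) (\<alpha> + (k, 0) \<bullet> z) * flat_exp p (\<beta> + (0, - k) \<bullet> z) * flat_exp p (\<delta> + (- k * t, k) \<bullet> z)
       - t * (flat_exp p (\<alpha> + (k, 0) \<bullet> z) * flat_exp p (\<beta> + (0, - k) \<bullet> z) * (k * flat_exp (flat_exp_step p) (\<delta> + (- k * t, k) \<bullet> z)))"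
    "pderiv_dir (0, 1) (\<lambda>z. flat_exp p (\<alpha> + (k, 0) \<bullet> z) * flat_exp p (\<beta> + (0, - k) \<bullet> z) * flat_exp p (\<delta> + (- k * t, k) \<bullet> z)) z
      = flat_exp p (\<alpha> + (k, 0) \<bullet> z) * flat_exp p (\<beta> + (0, - k) \<bullet> z) * (k * flat_exp (flat_exp_step p) (\<delta> + (- k * t, k) \<bullet> z))
       - flat_exp p (\<alpha> + (k, 0) \<bullet> z) * (k * flat_exp (flat_exp_step p) (\<beta> + (0, - k) \<bullet> z)) * flat_exp p (\<delta> + (- k * t, k) \<bullet> z)"
  by (subst pderiv_dir_mult[OF smooth_mult[OF smooth_flat_exp smooth_flat_exp] smooth_flat_exp], subst pderiv_dir_mult[OF smooth_flat_exp smooth_flat_exp],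
      subst (1 2 3) pderiv_dir_flat_exp, simp)+

text \<open>The triangle has its right angle at the upper left corner \<open>(a, b)\<close>, vertical leg \<open>c\<close>,
  horizontal leg \<open>c / t\<close> and a hypotenuse of slope \<open>t\<close>, on which \<open>\<rho>\<close> vanishes.\<close>

locale corner_triangle =
  fixes a b t c :: real
  assumes t_pos: "t > 0" and c_pos: "c > 0"
begin

text \<open>Vertical distance above the hypotenuse. Measuring vertically keeps the formula affine
  and lets a point be moved straight down onto the hypotenuse.\<close>

definition \<rho> :: "plane \<Rightarrow> real" where "\<rho> z = c - (b - snd z) - t * (fst z - a)"
definition Tri :: "plane set" where "Tri = {z. a < fst z \<and> snd z < b \<and> 0 < \<rho> z}"
definition cTri :: "plane set" where "cTri = {z. a \<le> fst z \<and> snd z \<le> b \<and> 0 \<le> \<rho> z}"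

lemma open_Tri: "open Tri"
  unfolding Tri_def \<rho>_def by (intro open_Collect_conj open_Collect_less continuous_intros)

lemma Tri_subset_cTri: "Tri \<subseteq> cTri" by (auto simp: Tri_def cTri_def)

lemma cTri_bounds:
  assumes "z \<in> cTri"
  shows "a \<le> fst z" "fst z \<le> a + c / t" "b - c \<le> snd z" "snd z \<le> b" "\<rho> z \<le> c"
proof -
  have z: "0 \<le> fst z - a" "0 \<le> b - snd z" "0 \<le> c - (b - snd z) - t * (fst z - a)"
    using assms by (auto simp: cTri_def \<rho>_def)
  have "0 \<le> t * (fst z - a)" using z(1) t_pos by simp
  then show "a \<le> fst z" "b - c \<le> snd z" "snd z \<le> b" "\<rho> z \<le> c" using z by (auto simp: \<rho>_def)
  have "t * (fst z - a) \<le> c" using z by linarith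
  then have "fst z - a \<le> c / t" using t_pos by (simp add: le_divide_eq mult.commute)
  then show "fst z \<le> a + c / t" by simp
qed

lemma cTri_subset_cbox: "cTri \<subseteq> cbox (a, b - c) (a + c / t, b)"
proof
  fix z assume "z \<in> cTri"
  from cTri_bounds[OF this] show "z \<in> cbox (a, b - c) (a + c / t, b)"
    by (cases z) (simp add: cbox_Pair_eq)
qed

lemma bounded_cTri: "bounded cTri"
  using bounded_subset[OF bounded_cbox cTri_subset_cbox] .

lemma bounded_Tri: "bounded Tri"
  using bounded_subset[OF bounded_cTri Tri_subset_cTri] .

lemma closed_cTri: "closed cTri"
  unfolding cTri_def \<rho>_def by (intro closed_Collect_conj closed_Collect_le continuous_intros)

lemma compact_cTri: "compact cTri"
  using closed_cTri bounded_cTri by (simp add: compact_eq_bounded_closed)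

text \<open>Only the last factor is shifted by 1. The support thus stays at distance 1 / (n + 1) in
  \<open>\<rho>\<close> from the hypotenuse, which may lie on the boundary of the domain, but
  extends up to the legs.\<close>

definition bump :: "nat \<Rightarrow> plane \<Rightarrow> real" where
  "bump n z = cutoff (real (Suc n) * (fst z - a)) * cutoff (real (Suc n) * (b - snd z)) * cutoff (real (Suc n) * \<rho> z - 1)"

lemma bump_factors:
  "real (Suc n) * (fst z - a) = - real (Suc n) * a + (real (Suc n), 0) \<bullet> z"
  "real (Suc n) * (b - snd z) = real (Suc n) * b + (0, - real (Suc n)) \<bullet> z"
  "real (Suc n) * \<rho> z - 1 = (real (Suc n) * (c - b + t * a) - 1) + (- real (Suc n) * t, real (Suc n)) \<bullet> z"
  by (auto simp: \<rho>_def inner_prod_def algebra_simps)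

lemma smooth_bump: "smooth (bump n)"
  unfolding bump_def bump_factors by (intro smooth_mult smooth_flat_exp)

lemma pderiv_bump:
  "pderiv_dir (1, 0) (bump n) z =
     real (Suc n) * cutoff_deriv (real (Suc n) * (fst z - a)) * cutoff (real (Suc n) * (b - snd z)) * cutoff (real (Suc n) * \<rho> z - 1)
     - t * (cutoff (real (Suc n) * (fst z - a)) * cutoff (real (Suc n) * (b - snd z)) * (real (Suc n) * cutoff_deriv (real (Suc n) * \<rho> z - 1)))"
  "pderiv_dir (0, 1) (bump n) z =
     cutoff (real (Suc n) * (fst z - a)) * cutoff (real (Suc n) * (b - snd z)) * (real (Suc n) * cutoff_deriv (real (Suc n) * \<rho> z - 1))
     - cutoff (real (Suc n) * (fst z - a)) * (real (Suc n) * cutoff_deriv (real (Suc n) * (b - snd z))) * cutoff (real (Suc n) * \<rho> z - 1)"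
  unfolding bump_def bump_factors by (rule pderiv_cutoff_product)+

lemma bump_support: "bump n z \<noteq> 0 \<Longrightarrow> z \<in> Tri" "bump n z \<noteq> 0 \<Longrightarrow> \<rho> z \<ge> 1 / real (Suc n)"
proof -
  assume nz: "bump n z \<noteq> 0"
  have "real (Suc n) * (fst z - a) > 0" "real (Suc n) * (b - snd z) > 0" and r: "real (Suc n) * \<rho> z - 1 > 0"
    using nz by (auto simp: bump_def flat_exp_def split: if_splits)
  then have "fst z > a" "snd z < b" by (simp_all add: zero_less_mult_iff)
  moreover have "\<rho> z > 1 / real (Suc n)" using r by (simp add: divide_less_eq mult.commute)
  moreover have "\<rho> z > 0" using calculation(3) by (rule less_trans[rotated]) simp
  ultimately show "z \<in> Tri" "\<rho> z \<ge> 1 / real (Suc n)" unfolding Tri_def by (simp_all del: of_nat_Suc)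
qed

lemma bump_bounds: "0 \<le> bump n z" "bump n z \<le> 1"
  unfolding bump_def by (intro mult_nonneg_nonneg mult_le_one flat_exp_1)+

lemma bump_tendsto: "z \<in> Tri \<Longrightarrow> (\<lambda>n. bump n z) \<longlonglongrightarrow> 1"
proof -
  assume z: "z \<in> Tri"
  have "(\<lambda>n. bump n z) \<longlonglongrightarrow> 1 * 1 * 1"
    unfolding bump_def
    using cutoff_seq_tendsto_1[of "fst z - a" 0] cutoff_seq_tendsto_1[of "b - snd z" 0] cutoff_seq_tendsto_1[of "\<rho> z" "-1"] z
    by (intro tendsto_mult) (auto simp: Tri_def)
  then show ?thesis by simp
qed

text \<open>The field is tested with \<open>bump n\<close>. The layer terms at the legs produce the boundary integrals.
  At the hypotenuse the two layer terms combine to \<open>X2 - t X1 = O(\<rho>)\<close>, which compensates the factor \<open>n\<close>.\<close>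

lemma triangle_divergence:
  assumes X1: "continuous_on cTri X1" and X2: "continuous_on cTri X2"
    and ramp: "\<And>z. z \<in> cTri \<Longrightarrow> \<bar>X2 z - t * X1 z\<bar> \<le> C * \<rho> z"
    and d: "integrable (lebesgue_on Tri) d"
    and weak: "\<And>\<psi> K. smooth \<psi> \<Longrightarrow> compact K \<Longrightarrow> K \<subseteq> cTri \<inter> {z. 0 < \<rho> z} \<Longrightarrow> (\<And>z. \<psi> z \<noteq> 0 \<Longrightarrow> z \<in> K) \<Longrightarrow>
      (\<And>z. z \<notin> Tri \<Longrightarrow> \<psi> z = 0 \<and> pderiv_dir (1, 0) \<psi> z = 0 \<and> pderiv_dir (0, 1) \<psi> z = 0) \<Longrightarrow>
      (LINT z|lebesgue_on Tri. pderiv_dir (1, 0) \<psi> z * X1 z + pderiv_dir (0, 1) \<psi> z * X2 z) = - (LINT z|lebesgue_on Tri. \<psi> z * d z)"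
  shows "(LINT z|lebesgue_on Tri. d z)
    = (LINT u|lborel. indicator {0..c / t} u * X2 (a + u, b)) - (LINT s|lborel. indicator {0..c} s * X1 (a, b - s))"
proof -
  let ?N = "\<lambda>n. real (Suc n)"
  \<comment> \<open>Extension by zero, so that iterated integrals run over the whole plane.\<close>
  define Y1 where "Y1 z = indicator cTri z * X1 z" for z
  define Y2 where "Y2 z = indicator cTri z * X2 z" for z
  have cT [measurable]: "cTri \<in> sets borel" using closed_cTri by simp
  have Y_meas: "Y1 \<in> borel_measurable borel" "Y2 \<in> borel_measurable borel"
    using borel_measurable_continuous_on_indicator[OF cT X1] borel_measurable_continuous_on_indicator[OF cT X2]
    by (auto simp: Y1_def[abs_def] Y2_def[abs_def])
  note [measurable] = Y_meas
  have [measurable]: "\<rho> \<in> borel_measurable borel"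
    unfolding \<rho>_def by (intro borel_measurable_continuous_onI continuous_intros)
  have \<rho>_cont: "continuous_on UNIV \<rho>" unfolding \<rho>_def by (intro continuous_intros)
  have fac: "(\<lambda>z. flat_exp p (k * (fst z - a))) \<in> borel_measurable borel"
      "(\<lambda>z. flat_exp p (k * (b - snd z))) \<in> borel_measurable borel" "(\<lambda>z. flat_exp p (k * \<rho> z - 1)) \<in> borel_measurable borel" for p k
    by (intro borel_measurable_continuous_onI continuous_on_compose2[OF flat_exp_continuous[of UNIV]]
        continuous_intros \<rho>_cont subset_UNIV)+
  obtain B1 where B1: "\<And>z. \<bar>Y1 z\<bar> \<le> B1"
  proof -
    obtain B where "\<And>z. z \<in> cTri \<Longrightarrow> norm (X1 z) \<le> B"
      using compact_imp_bounded[OF compact_continuous_image[OF X1 compact_cTri]] unfolding bounded_iff by auto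
    then have "\<bar>Y1 z\<bar> \<le> max B 0" for z by (cases "z \<in> cTri") (auto simp: Y1_def le_max_iff_disj)
    then show thesis using that by blast
  qed
  obtain B2 where B2: "\<And>z. \<bar>Y2 z\<bar> \<le> B2"
  proof -
    obtain B where "\<And>z. z \<in> cTri \<Longrightarrow> norm (X2 z) \<le> B"
      using compact_imp_bounded[OF compact_continuous_image[OF X2 compact_cTri]] unfolding bounded_iff by auto
    then have "\<bar>Y2 z\<bar> \<le> max B 0" for z by (cases "z \<in> cTri") (auto simp: Y2_def le_max_iff_disj)
    then show thesis using that by blast
  qed
  \<comment> \<open>\<open>A\<close>, \<open>B\<close> and \<open>D\<close> collect the layer terms
    at the left leg, at the top leg and at the hypotenuse.\<close>
  define A where "A n z = Y1 z * (?N n * cutoff_deriv (?N n * (fst z - a))) * cutoff (?N n * (b - snd z)) * cutoff (?N n * \<rho> z - 1)" for n z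
  define B where "B n z = Y2 z * (?N n * cutoff_deriv (?N n * (b - snd z))) * cutoff (?N n * (fst z - a)) * cutoff (?N n * \<rho> z - 1)" for n z
  define D where "D n z = (Y2 z - t * Y1 z) * (cutoff (?N n * (fst z - a)) * cutoff (?N n * (b - snd z)) * (?N n * cutoff_deriv (?N n * \<rho> z - 1)))" for n z
  have int_c: "integrable lborel (\<lambda>z. k * indicator cTri z)" for k :: real
    using emeasure_bounded_finite[OF bounded_cTri] by (intro integrable_mult_right integrable_real_indicator) auto
  have h'_le: "cutoff_deriv y \<le> 4" for y
    using layer_weight_le[of y] cutoff_deriv_nonneg[of y] 
    by (cases "y > 0") (auto simp: cutoff_deriv_eq[of y] distrib_right intro: order_trans[rotated])
  have A_int: "integrable lborel (A n)" for n
  proof (rule Bochner_Integration.integrable_bound[OF int_c[of "B1 * (?N n * 4)"]])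
    have "A n \<in> borel_measurable borel"
      unfolding A_def by (intro borel_measurable_times borel_measurable_const Y_meas fac)
    then show "A n \<in> borel_measurable lborel" by simp
    have "\<bar>A n z\<bar> \<le> B1 * (?N n * 4) * 1 * 1" for z
      unfolding A_def abs_mult using order_trans[OF abs_ge_zero B1]
      by (intro mult_mono B1) (auto simp: flat_exp_1 h'_le cutoff_deriv_nonneg intro!: mult_nonneg_nonneg)
    moreover have "A n z = 0" if "z \<notin> cTri" for z using that by (simp add: A_def Y1_def)
    ultimately show "AE z in lborel. norm (A n z) \<le> norm (B1 * (?N n * 4) * indicator cTri z)"
      by (intro AE_I2) (auto simp: indicator_def intro: order_trans[OF _ abs_ge_self])
  qed
  have B_int: "integrable lborel (B n)" for n
  proof (rule Bochner_Integration.integrable_bound[OF int_c[of "B2 * (?N n * 4)"]])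
    have "B n \<in> borel_measurable borel"
      unfolding B_def by (intro borel_measurable_times borel_measurable_const Y_meas fac)
    then show "B n \<in> borel_measurable lborel" by simp
    have "\<bar>B n z\<bar> \<le> B2 * (?N n * 4) * 1 * 1" for z
      unfolding B_def abs_mult using order_trans[OF abs_ge_zero B2]
      by (intro mult_mono B2) (auto simp: flat_exp_1 h'_le cutoff_deriv_nonneg intro!: mult_nonneg_nonneg)
    moreover have "B n z = 0" if "z \<notin> cTri" for z using that by (simp add: B_def Y2_def)
    ultimately show "AE z in lborel. norm (B n z) \<le> norm (B2 * (?N n * 4) * indicator cTri z)"
      by (intro AE_I2) (auto simp: indicator_def intro: order_trans[OF _ abs_ge_self])
  qed
  have "D n \<in> borel_measurable borel" for n
    unfolding D_def by (intro borel_measurable_times borel_measurable_diff borel_measurable_const Y_meas fac)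
  then have D_meas: "D n \<in> borel_measurable lborel" for n by simp
  \<comment> \<open>The factor n \<rho> is written as (n \<rho> - 1) + 1 to match the layer weight,
    which is bounded and tends to 0.\<close>
  have D_eq: "\<bar>D n z\<bar> \<le> \<bar>C\<bar> * indicator cTri z * (((?N n * \<rho> z - 1) + 1) * cutoff_deriv (?N n * \<rho> z - 1))" for n z
  proof (cases "z \<in> cTri")
    case True
    have "\<bar>D n z\<bar> \<le> (\<bar>C\<bar> * \<rho> z) * (1 * 1 * (?N n * cutoff_deriv (?N n * \<rho> z - 1)))"
      unfolding D_def abs_mult
    proof (intro mult_mono)
      show "\<bar>Y2 z - t * Y1 z\<bar> \<le> \<bar>C\<bar> * \<rho> z"
        using ramp[OF True] True mult_right_mono[OF abs_ge_self[of C], of "\<rho> z"] by (auto simp: Y1_def Y2_def cTri_def)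
    qed (use True in \<open>auto simp: flat_exp_1 cutoff_deriv_nonneg cTri_def intro!: mult_nonneg_nonneg\<close>)
    then show ?thesis using True by (simp add: algebra_simps)
  qed (simp add: D_def Y1_def Y2_def)
  have D_bound: "\<bar>D n z\<bar> \<le> 4 * \<bar>C\<bar> * indicator cTri z" for n z
  proof -
    have "\<bar>D n z\<bar> \<le> \<bar>C\<bar> * indicator cTri z * 4"
      by (rule order_trans[OF D_eq]) (intro mult_left_mono layer_weight_le, simp)
    then show ?thesis by (simp add: mult_ac)
  qed
  have D_int: "integrable lborel (D n)" for n
    using D_bound D_meas by (intro Bochner_Integration.integrable_bound[OF int_c[of "4 * \<bar>C\<bar>"]]) (auto intro: order_trans[OF _ abs_ge_self])
  have D_lim: "(\<lambda>n. LINT z|lborel. D n z) \<longlonglongrightarrow> 0"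
  proof -
    have "(\<lambda>n. LINT z|lborel. D n z) \<longlonglongrightarrow> (LINT z|(lborel :: plane measure). 0)"
    proof (rule integral_dominated_convergence[OF _ _ int_c[of "4 * \<bar>C\<bar>"]])
      show "AE z in lborel. (\<lambda>n. D n z) \<longlonglongrightarrow> 0"
      proof (rule AE_I2)
        fix z
        show "(\<lambda>n. D n z) \<longlonglongrightarrow> 0"
        proof (cases "\<rho> z > 0")
          case True
          then have "filterlim (\<lambda>n. ?N n * \<rho> z - 1) at_top sequentially" by real_asymp
          then have "(\<lambda>n. ((?N n * \<rho> z - 1) + 1) * cutoff_deriv (?N n * \<rho> z - 1)) \<longlonglongrightarrow> 0"
            by (rule filterlim_compose[OF layer_weight_tendsto])
          then have "(\<lambda>n. \<bar>C\<bar> * indicator cTri z * (((?N n * \<rho> z - 1) + 1) * cutoff_deriv (?N n * \<rho> z - 1))) \<longlonglongrightarrow> \<bar>C\<bar> * indicator cTri z * 0"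
            by (intro tendsto_mult tendsto_const)
          then show ?thesis using D_eq by (intro Lim_null_comparison[of "\<lambda>n. D n z"]) auto
        next
          case False
          then have "?N n * \<rho> z - 1 \<le> 0" for n using mult_nonneg_nonpos[of "?N n" "\<rho> z"] by simp
          then have "D n z = 0" for n by (simp add: D_def cutoff_deriv_eq not_less[symmetric])
          then show ?thesis by simp
        qed
      qed
    qed (use D_bound D_meas in auto)
    then show ?thesis by simp
  qed
  \<comment> \<open>Coordinates adapted to a leg: the component \<open>p\<close> is the distance
    from the leg, \<open>q\<close> the position along it, counted from the right angle.\<close>
  define g1 where "g1 z = Y1 (a + fst z, b - snd z)" for z
  define g2 where "g2 z = Y2 (a + snd z, b - fst z)" for z
  have g_meas: "g1 \<in> borel_measurable borel" "g2 \<in> borel_measurable borel"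
    unfolding g1_def g2_def
    by (intro measurable_compose[OF borel_measurable_continuous_onI Y_meas(1)]
          measurable_compose[OF borel_measurable_continuous_onI Y_meas(2)] continuous_intros)+
  have \<rho>_left: "\<rho> (a + p, b - q) = c - t * p - 1 * q" for p q by (simp add: \<rho>_def)
  have \<rho>_top: "\<rho> (a + q, b - p) = c - 1 * p - t * q" for p q by (simp add: \<rho>_def)
  have A_iter: "(LINT z|lborel. A n z) = (LINT q|lborel. LINT p|lborel. g1 (p, q) * (?N n * cutoff_deriv (?N n * p)) * cutoff (?N n * q) * cutoff (?N n * (c - t * p - 1 * q) - 1))" for n
  proof -
    have "(LINT z|lborel. A n z) = (LINT y|lborel. LINT x|lborel. A n (x, y))"
      using lborel_pair.integral_snd[of "\<lambda>x y. A n (x, y)"] A_int[of n] by (simp add: lborel_prod)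
    also have "\<dots> = (LINT y|lborel. LINT p|lborel. A n (a + p, y))"
      using lborel_integral_real_affine[of 1 "\<lambda>x. A n (x, _)" a] by simp
    also have "\<dots> = (LINT q|lborel. LINT p|lborel. A n (a + p, b - q))"
      using lborel_integral_real_affine[of "-1" "\<lambda>y. LINT p|lborel. A n (a + p, y)" b] by simp
    finally show ?thesis unfolding A_def \<rho>_left g1_def by simp
  qed
  have B_iter: "(LINT z|lborel. B n z) = (LINT q|lborel. LINT p|lborel. g2 (p, q) * (?N n * cutoff_deriv (?N n * p)) * cutoff (?N n * q) * cutoff (?N n * (c - 1 * p - t * q) - 1))" for n
  proof -
    have "(LINT z|lborel. B n z) = (LINT x|lborel. LINT y|lborel. B n (x, y))"
      using lborel_pair.integral_fst'[of "B n"] B_int[of n] by (simp add: lborel_prod)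
    also have "\<dots> = (LINT x|lborel. LINT p|lborel. B n (x, b - p))"
      using lborel_integral_real_affine[of "-1" "\<lambda>y. B n (_, y)" b] by simp
    also have "\<dots> = (LINT q|lborel. LINT p|lborel. B n (a + q, b - p))"
      using lborel_integral_real_affine[of 1 "\<lambda>x. LINT p|lborel. B n (x, b - p)" a] by simp
    finally show ?thesis unfolding B_def \<rho>_top g2_def by simp
  qed
  have in_left: "(a + p, b - q) \<in> cTri \<longleftrightarrow> 0 \<le> p \<and> 0 \<le> q \<and> q + t * p \<le> c" for p q
    by (auto simp: cTri_def \<rho>_def)
  have A_lim: "(\<lambda>n. LINT z|lborel. A n z) \<longlonglongrightarrow> (LINT q|lborel. g1 (0, q))"
    unfolding A_iter
  proof (rule boundary_layer_limit[OF g_meas(1), where B=B1 and Q=c])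
    show "g1 (p, q) = 0" if "q \<notin> {0..c}" for p q
    proof -
      have "(a + p, b - q) \<notin> cTri"
        using cTri_bounds[of "(a + p, b - q)"] that by auto
      then show ?thesis by (simp add: g1_def Y1_def)
    qed
    show "((\<lambda>p. g1 (p, q)) \<longlongrightarrow> g1 (0, q)) (at_right 0)" if q: "0 < q" "q < c" for q
      unfolding g1_def Y1_def
    proof (rule tendsto_indicator_times_continuous[OF X1])
      show "((\<lambda>p. (a + fst (p, q), b - snd (p, q))) \<longlongrightarrow> (a + fst (0, q), b - snd (0, q))) (at_right 0)"
        by (auto intro!: tendsto_eq_intros)
      have "\<forall>\<^sub>F p in at_right 0. p < (c - q) / t"
        using q t_pos by (intro eventually_at_rightI[of 0 "(c - q) / t"]) auto
      with eventually_at_right_less[of 0] show "\<forall>\<^sub>F p in at_right 0. (a + fst (p, q), b - snd (p, q)) \<in> cTri"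
        unfolding fst_conv snd_conv in_left
        by eventually_elim (use q t_pos in \<open>simp add: field_simps\<close>)
    qed (use q in \<open>simp add: in_left[of 0, simplified]\<close>)
  qed (auto simp: g1_def B1)
  have B_lim: "(\<lambda>n. LINT z|lborel. B n z) \<longlonglongrightarrow> (LINT q|lborel. g2 (0, q))"
    unfolding B_iter
  proof (rule boundary_layer_limit[OF g_meas(2), where B=B2 and Q="c / t"])
    show "g2 (p, q) = 0" if "q \<notin> {0..c / t}" for p q
    proof -
      have "(a + q, b - p) \<notin> cTri"
        using cTri_bounds[of "(a + q, b - p)"] that by auto
      then show ?thesis by (simp add: g2_def Y2_def)
    qed
    show "((\<lambda>p. g2 (p, q)) \<longlongrightarrow> g2 (0, q)) (at_right 0)" if q: "0 < q" "q < c / t" for q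
      unfolding g2_def Y2_def
    proof (rule tendsto_indicator_times_continuous[OF X2])
      have qt: "t * q < c" using q t_pos by (simp add: less_divide_eq mult.commute)
      show "((\<lambda>p. (a + snd (p, q), b - fst (p, q))) \<longlongrightarrow> (a + snd (0, q), b - fst (0, q))) (at_right 0)"
        by (auto intro!: tendsto_eq_intros)
      have "\<forall>\<^sub>F p in at_right 0. p < c - t * q"
        using qt by (intro eventually_at_rightI[of 0 "c - t * q"]) auto
      with eventually_at_right_less[of 0] show "\<forall>\<^sub>F p in at_right 0. (a + snd (p, q), b - fst (p, q)) \<in> cTri"
        by eventually_elim (use q in \<open>simp add: in_left\<close>)
      show "(a + snd (0, q), b - fst (0, q)) \<in> cTri" using q qt in_left[of q 0] by simp
    qed
    show "0 < c - t * q" if "0 < q" "q < c / t" for q using that t_pos by (simp add: less_divide_eq mult.commute)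
  qed (auto simp: g2_def B2)
  have g1_0: "g1 (0, q) = indicator {0..c} q * X1 (a, b - q)" for q
    using in_left[of 0 q] by (auto simp: g1_def Y1_def indicator_def)
  have g2_0: "g2 (0, q) = indicator {0..c / t} q * X2 (a + q, b)" for q
    using in_left[of q 0] t_pos by (auto simp: g2_def Y2_def indicator_def field_simps)
  \<comment> \<open>\<open>B\<close> enters with the opposite sign because the cutoff at the top leg
    decreases in the second coordinate; this is the sign of the outer normal there.\<close>
  have ABD: "(LINT z|lebesgue_on Tri. bump n z * d z) = - ((LINT z|lborel. A n z) - (LINT z|lborel. B n z) + (LINT z|lborel. D n z))" for n
  proof -
    let ?K = "cTri \<inter> {z. 1 / ?N n \<le> \<rho> z}"
    have "closed {z. 1 / ?N n \<le> \<rho> z}" unfolding \<rho>_def by (intro closed_Collect_le continuous_intros)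
    then have K: "compact ?K" by (rule compact_Int_closed[OF compact_cTri])
    have K_sub: "?K \<subseteq> cTri \<inter> {z. 0 < \<rho> z}" by (auto intro: less_le_trans[of 0 "1 / ?N n"])
    have F: "pderiv_dir (1, 0) (bump n) z * Y1 z + pderiv_dir (0, 1) (bump n) z * Y2 z = A n z - B n z + D n z" for z
      unfolding pderiv_bump A_def B_def D_def by (simp add: algebra_simps)
    have zero': "A n z - B n z + D n z = 0" if "z \<notin> Tri" for z
    proof (cases "z \<in> cTri")
      case True
      then have "fst z = a \<or> snd z = b \<or> \<rho> z = 0" using that by (auto simp: Tri_def cTri_def)
      then show ?thesis by (auto simp: A_def B_def D_def flat_exp_def)
    next
      case False
      then show ?thesis by (simp add: A_def B_def D_def Y1_def Y2_def)
    qed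
    have "- (LINT z|lebesgue_on Tri. bump n z * d z)
      = (LINT z|lebesgue_on Tri. pderiv_dir (1, 0) (bump n) z * X1 z + pderiv_dir (0, 1) (bump n) z * X2 z)"
    proof (rule weak[symmetric, OF smooth_bump K K_sub])
      show "z \<in> ?K" if "bump n z \<noteq> 0" for z using bump_support[OF that] Tri_subset_cTri by auto
      show "bump n z = 0 \<and> pderiv_dir (1, 0) (bump n) z = 0 \<and> pderiv_dir (0, 1) (bump n) z = 0" if "z \<notin> Tri" for z
      proof -
        have "?N n * (fst z - a) \<le> 0 \<or> ?N n * (b - snd z) \<le> 0 \<or> ?N n * \<rho> z - 1 \<le> 0"
          using that mult_nonneg_nonpos[of "?N n"] unfolding Tri_def by (smt (verit) mem_Collect_eq of_nat_0_le_iff)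
        then show ?thesis unfolding pderiv_bump bump_def by (auto simp: flat_exp_def)
      qed
    qed
    also have "\<dots> = (LINT z|lebesgue_on Tri. A n z - B n z + D n z)"
    proof (rule Bochner_Integration.integral_cong[OF refl])
      fix z assume "z \<in> space (lebesgue_on Tri)"
      then have "z \<in> cTri" using Tri_subset_cTri by (auto simp: space_restrict_space)
      then show "pderiv_dir (1, 0) (bump n) z * X1 z + pderiv_dir (0, 1) (bump n) z * X2 z = A n z - B n z + D n z"
        unfolding F[symmetric] by (simp add: Y1_def Y2_def)
    qed
    also have "\<dots> = (LINT z|lborel. A n z - B n z + D n z)"
      using open_Tri zero' A_int B_int D_int by (intro integral_lebesgue_on_UNIV_borel) (auto dest!: borel_measurable_integrable)
    also have "\<dots> = (LINT z|lborel. A n z) - (LINT z|lborel. B n z) + (LINT z|lborel. D n z)"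
      using A_int B_int D_int by simp
    finally show ?thesis by simp
  qed
  have "(\<lambda>n. LINT z|lebesgue_on Tri. bump n z * d z) \<longlonglongrightarrow> - ((LINT q|lborel. g1 (0, q)) - (LINT q|lborel. g2 (0, q)) + 0)"
    unfolding ABD by (intro tendsto_intros A_lim B_lim D_lim)
  moreover have "(\<lambda>n. LINT z|lebesgue_on Tri. bump n z * d z) \<longlonglongrightarrow> (LINT z|lebesgue_on Tri. d z)"
  proof (rule integral_dominated_convergence[where w="\<lambda>z. \<bar>d z\<bar>"])
    show "(\<lambda>z. bump n z * d z) \<in> borel_measurable (lebesgue_on Tri)" for n
      by (rule borel_measurable_times[OF measurable_restrict_space1[OF smooth_lebesgue_measurable[OF smooth_bump]] borel_measurable_integrable[OF d]])
    show "AE z in lebesgue_on Tri. (\<lambda>n. bump n z * d z) \<longlonglongrightarrow> d z"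
    proof (rule AE_I2)
      fix z assume "z \<in> space (lebesgue_on Tri)"
      then have "(\<lambda>n. bump n z * d z) \<longlonglongrightarrow> 1 * d z"
        by (intro tendsto_mult bump_tendsto tendsto_const) (simp add: space_restrict_space)
      then show "(\<lambda>n. bump n z * d z) \<longlonglongrightarrow> d z" by simp
    qed
    show "AE z in lebesgue_on Tri. norm (bump n z * d z) \<le> \<bar>d z\<bar>" for n
      by (intro AE_I2) (simp add: abs_mult bump_bounds mult_left_le_one_le)
  qed (use d in auto)
  ultimately have "(LINT z|lebesgue_on Tri. d z) = - ((LINT q|lborel. g1 (0, q)) - (LINT q|lborel. g2 (0, q)) + 0)"
    by (rule LIMSEQ_unique[rotated])
  then show ?thesis unfolding g1_0 g2_0 by simp
qed

end

section \<open>Line integrals along the legs\<close>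

lemma linepath_measurable:
  "(\<lambda>s. linepath a b (s / d)) \<in> restrict_space lborel {0..d} \<rightarrow>\<^sub>M restrict_space borel (closed_segment a (b::plane))" if "d > 0"
proof (rule measurable_restrict_space2)
  show "(\<lambda>s. linepath a b (s / d)) \<in> space (restrict_space lborel {0..d}) \<rightarrow> closed_segment a b"
    using that by (auto simp: space_restrict_space linepath_in_path)
  have "continuous_on UNIV (\<lambda>s. linepath a b (s / d))"
    unfolding linepath_def using that by (intro continuous_intros) auto
  then have "(\<lambda>s. linepath a b (s / d)) \<in> borel_measurable borel" by (rule borel_measurable_continuous_onI)
  then show "(\<lambda>s. linepath a b (s / d)) \<in> borel_measurable (restrict_space lborel {0..d})"
    by (intro measurable_restrict_space1) simp
qed

lemma emeasure_segment_measure: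
  assumes A: "A \<in> sets (restrict_space borel (closed_segment a (b::plane)))"
  shows "emeasure (segment_measure a b) A = ennreal (dist a b) * (\<integral>\<^sup>+x. indicator {x \<in> {0..1}. linepath a b x \<in> A} x \<partial>lborel)"
    "{x \<in> {0..1}. linepath a b x \<in> A} \<in> sets borel"
proof -
  note m = linepath_measurable[of 1 a b, simplified]
  have S: "linepath a b -` A \<inter> space (restrict_space lborel {0..1}) = {x \<in> {0..1}. linepath a b x \<in> A}"
    by (auto simp: space_restrict_space)
  have "linepath a b -` A \<inter> space (restrict_space lborel {0..1}) \<in> sets (restrict_space lborel {0..1})"
    using m A by (rule measurable_sets)
  then show b: "{x \<in> {0..1}. linepath a b x \<in> A} \<in> sets borel"
    unfolding S by (subst (asm) sets_restrict_space_iff) auto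
  show "emeasure (segment_measure a b) A = ennreal (dist a b) * (\<integral>\<^sup>+x. indicator {x \<in> {0..1}. linepath a b x \<in> A} x \<partial>lborel)"
    unfolding segment_measure_def emeasure_scale_measure emeasure_distr[OF m A] S
    using b by (subst emeasure_restrict_space) auto
qed

text \<open>Reparametrisation by arc length. For the reversed segment the substitution is 1 - s / d,
  so both orientations produce one measure.\<close>

lemma segment_measure_distr:
  fixes a b :: plane
  assumes "a \<noteq> b"
  defines "D \<equiv> distr (restrict_space lborel {0..dist a b}) (restrict_space borel (closed_segment a b)) (\<lambda>s. linepath a b (s / dist a b))"
  shows "segment_measure a b = D" "segment_measure b a = D"
proof -
  let ?d = "dist a b"
  have d: "?d > 0" using assms by simp
  have cs: "closed_segment b a = closed_segment a b" by (rule closed_segment_commute)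
  have eD: "emeasure D A = (\<integral>\<^sup>+x. indicator {x \<in> {0..?d}. linepath a b (x / ?d) \<in> A} x \<partial>lborel)"
    if A: "A \<in> sets (restrict_space borel (closed_segment a b))" for A
  proof -
    note m = linepath_measurable[OF d, of a b]
    have S: "(\<lambda>s. linepath a b (s / ?d)) -` A \<inter> space (restrict_space lborel {0..?d}) = {x \<in> {0..?d}. linepath a b (x / ?d) \<in> A}"
      by (auto simp: space_restrict_space)
    have "(\<lambda>s. linepath a b (s / ?d)) -` A \<inter> space (restrict_space lborel {0..?d}) \<in> sets (restrict_space lborel {0..?d})"
      using m A by (rule measurable_sets)
    then have b: "{x \<in> {0..?d}. linepath a b (x / ?d) \<in> A} \<in> sets borel"
      unfolding S by (subst (asm) sets_restrict_space_iff) auto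
    then show ?thesis unfolding D_def emeasure_distr[OF m A] S by (subst emeasure_restrict_space) auto
  qed
  have scale: "ennreal ?d * (ennreal \<bar>1 / ?d\<bar> * x) = x" and scale': "ennreal ?d * (ennreal \<bar>- 1 / ?d\<bar> * x) = x" for x
    using d by (simp_all add: mult.assoc[symmetric] ennreal_mult[symmetric])
  show "segment_measure a b = D"
  proof (rule measure_eqI)
    show "sets (segment_measure a b) = sets D" by (simp add: segment_measure_def D_def)
    fix A assume "A \<in> sets (segment_measure a b)"
    then have A: "A \<in> sets (restrict_space borel (closed_segment a b))" by (simp add: segment_measure_def)
    note e = emeasure_segment_measure[OF A]
    have "emeasure (segment_measure a b) A = (\<integral>\<^sup>+x. indicator {x \<in> {0..1}. linepath a b x \<in> A} (0 + 1 / ?d * x) \<partial>lborel)"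
      unfolding e(1) using e(2) d by (subst nn_integral_real_affine[where c="1 / ?d" and t=0]) (simp_all only: scale, auto)
    also have "\<dots> = emeasure D A" unfolding eD[OF A]
      using d by (intro nn_integral_cong) (auto simp: indicator_def field_simps)
    finally show "emeasure (segment_measure a b) A = emeasure D A" .
  qed
  show "segment_measure b a = D"
  proof (rule measure_eqI)
    show "sets (segment_measure b a) = sets D" by (simp add: segment_measure_def D_def cs)
    fix A assume "A \<in> sets (segment_measure b a)"
    then have A: "A \<in> sets (restrict_space borel (closed_segment b a))" by (simp add: segment_measure_def)
    note e = emeasure_segment_measure[OF A]
    have "emeasure (segment_measure b a) A = (\<integral>\<^sup>+x. indicator {x \<in> {0..1}. linepath b a x \<in> A} (1 + - 1 / ?d * x) \<partial>lborel)"
      unfolding e(1) dist_commute[of b a] using e(2) d by (subst nn_integral_real_affine[where c="- 1 / ?d" and t=1]) (simp_all only: scale', auto)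
    also have "\<dots> = emeasure D A" unfolding eD[OF A[unfolded cs]]
    proof (intro nn_integral_cong)
      fix x
      have "linepath b a (1 + - 1 / ?d * x) = linepath a b (x / ?d)" by (simp add: linepath_def algebra_simps)
      then show "(indicator {x \<in> {0..1}. linepath b a x \<in> A} (1 + - 1 / ?d * x) :: ennreal) = indicator {x \<in> {0..?d}. linepath a b (x / ?d) \<in> A} x"
        using d by (auto simp: indicator_def field_simps)
    qed
    finally show "emeasure (segment_measure b a) A = emeasure D A" .
  qed
qed

text \<open>A segment determines its end points up to order, so the choice inside
  \<open>arc_measure\<close> is harmless.\<close>

lemma arc_measure_segment:
  fixes a b :: plane
  assumes "a \<noteq> b"
  shows "arc_measure (closed_segment a b) = distr (restrict_space lborel {0..dist a b}) (restrict_space borel (closed_segment a b)) (\<lambda>s. linepath a b (s / dist a b))"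
proof -
  define p where "p = (SOME p. closed_segment a b = closed_segment (fst p) (snd p))"
  have "closed_segment a b = closed_segment (fst p) (snd p)"
    unfolding p_def by (rule someI[of _ "(a, b)"]) simp
  then have "{fst p, snd p} = {a, b}" by (metis closed_segment_eq)
  then have "fst p = a \<and> snd p = b \<or> fst p = b \<and> snd p = a" by (metis doubleton_eq_iff)
  then show ?thesis
    unfolding arc_measure_def Let_def p_def[symmetric] using segment_measure_distr[OF assms] by auto
qed

lemma
  fixes a b :: plane and f :: "plane \<Rightarrow> real"
  assumes "a \<noteq> b" "f \<in> borel_measurable (restrict_space borel (closed_segment a b))"
  shows integral_arc_measure: "(LINT x|arc_measure (closed_segment a b). f x)
      = (LINT s|lborel. indicator {0..dist a b} s * f (linepath a b (s / dist a b)))"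
    and integrable_arc_measure: "integrable (arc_measure (closed_segment a b)) f
      \<longleftrightarrow> integrable lborel (\<lambda>s. indicator {0..dist a b} s * f (linepath a b (s / dist a b)))"
proof -
  have d: "dist a b > 0" using assms by simp
  note m = linepath_measurable[OF d, of a b]
  show "(LINT x|arc_measure (closed_segment a b). f x) = (LINT s|lborel. indicator {0..dist a b} s * f (linepath a b (s / dist a b)))"
    unfolding arc_measure_segment[OF assms(1)] integral_distr[OF m assms(2)] by (subst integral_restrict_space) auto
  show "integrable (arc_measure (closed_segment a b)) f \<longleftrightarrow> integrable lborel (\<lambda>s. indicator {0..dist a b} s * f (linepath a b (s / dist a b)))"
    unfolding arc_measure_segment[OF assms(1)] integrable_distr_eq[OF m assms(2)] by (subst integrable_restrict_space) auto
qed

lemma sets_arc_measure: "a \<noteq> b \<Longrightarrow> sets (arc_measure (closed_segment a (b::plane))) = sets (restrict_space borel (closed_segment a b))"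
  by (simp add: arc_measure_segment)

lemma space_arc_measure: "a \<noteq> b \<Longrightarrow> space (arc_measure (closed_segment a (b::plane))) = closed_segment a b"
  by (simp add: arc_measure_segment space_restrict_space)

lemma continuous_on_segment_measurable:
  fixes f :: "plane \<Rightarrow> real"
  assumes "continuous_on (closed_segment a b) f"
  shows "f \<in> borel_measurable (restrict_space borel (closed_segment a b))"
  using assms by (rule borel_measurable_continuous_on_restrict)

lemma square_integrable_arc_measure:
  fixes f :: "plane \<Rightarrow> real"
  assumes "a \<noteq> b" "continuous_on (closed_segment a b) f"
  shows "square_integrable (arc_measure (closed_segment a b)) f" "integrable (arc_measure (closed_segment a b)) f"
proof -
  have d: "dist a b > 0" using assms by simp
  have i: "integrable (arc_measure (closed_segment a b)) g" if g: "continuous_on (closed_segment a b) g" for g :: "plane \<Rightarrow> real"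
  proof -
    have "continuous_on {0..dist a b} (\<lambda>s. g (linepath a b (s / dist a b)))"
    proof (rule continuous_on_compose2[OF g])
      show "continuous_on {0..dist a b} (\<lambda>s. linepath a b (s / dist a b))"
        unfolding linepath_def using d by (intro continuous_intros) auto
      show "(\<lambda>s. linepath a b (s / dist a b)) ` {0..dist a b} \<subseteq> closed_segment a b"
        using d by (auto intro!: linepath_in_path)
    qed
    then have "integrable lborel (\<lambda>s. indicator {0..dist a b} s *\<^sub>R g (linepath a b (s / dist a b)))"
      by (intro borel_integrable_compact) auto
    then show ?thesis using integrable_arc_measure[OF assms(1) continuous_on_segment_measurable[OF g]] by simp
  qed
  show "integrable (arc_measure (closed_segment a b)) f" by (rule i[OF assms(2)])
  have "integrable (arc_measure (closed_segment a b)) (\<lambda>x. (f x)\<^sup>2)" by (rule i) (intro continuous_intros assms)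
  moreover have "f \<in> borel_measurable (arc_measure (closed_segment a b))"
    using continuous_on_segment_measurable[OF assms(2)] measurable_cong_sets[OF sets_arc_measure[OF assms(1)] refl] by blast
  ultimately show "square_integrable (arc_measure (closed_segment a b)) f" by (simp add: square_integrable_def)
qed

context corner_triangle begin

definition left_edge where "left_edge = closed_segment (a, b) (a, b - c)"
definition top_edge where "top_edge = closed_segment (a, b) (a + c / t, b)"

lemma left_eq: "left_edge = {z. fst z = a \<and> b - c \<le> snd z \<and> snd z \<le> b}"
  unfolding left_edge_def using c_pos by (auto simp: closed_segment_PairD closed_segment_same_fst closed_segment_eq_real_ivl)

lemma top_eq: "top_edge = {z. snd z = b \<and> a \<le> fst z \<and> fst z \<le> a + c / t}"
  unfolding top_edge_def using c_pos t_pos by (auto simp: closed_segment_same_snd closed_segment_eq_real_ivl)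

lemma left_subset: "left_edge \<subseteq> cTri" and top_subset: "top_edge \<subseteq> cTri"
  using c_pos t_pos by (auto simp: left_eq top_eq cTri_def \<rho>_def field_simps)

lemma left_neq: "(a, b) \<noteq> (a, b - c)" and top_neq: "(a, b) \<noteq> (a + c / t, b)"
  using c_pos t_pos by auto

lemma dist_left: "dist (a, b) (a, b - c) = c" and dist_top: "dist (a, b) (a + c / t, b) = c / t"
  using c_pos t_pos by (auto simp: dist_prod_def dist_real_def)

lemma integral_left:
  fixes f :: "plane \<Rightarrow> real"
  assumes "continuous_on left_edge f"
  shows "(LINT z|arc_measure left_edge. f z) = (LINT s|lborel. indicator {0..c} s * f (a, b - s))"
proof -
  have "linepath (a, b) (a, b - c) (s / c) = (a, b - s)" for s
    using c_pos by (simp add: linepath_def prod_eq_iff algebra_simps)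
  then show ?thesis
    using integral_arc_measure[OF left_neq continuous_on_segment_measurable[of _ _ f]] assms
    unfolding left_edge_def[symmetric] dist_left by simp
qed

lemma integral_top:
  fixes f :: "plane \<Rightarrow> real"
  assumes "continuous_on top_edge f"
  shows "(LINT z|arc_measure top_edge. f z) = (LINT u|lborel. indicator {0..c / t} u * f (a + u, b))"
proof -
  have "linepath (a, b) (a + c / t, b) (u / (c / t)) = (a + u, b)" for u
    using c_pos t_pos by (simp add: linepath_def prod_eq_iff field_simps)
  then show ?thesis
    using integral_arc_measure[OF top_neq continuous_on_segment_measurable[of _ _ f]] assms
    unfolding top_edge_def[symmetric] dist_top by simp
qed

end

section \<open>Trace inequalities\<close>

lemma lborel_integral_reflect:
  fixes f :: "plane \<Rightarrow> real"
  assumes f: "f \<in> borel_measurable borel" and rs: "\<bar>r\<bar> = 1" "\<bar>s\<bar> = 1"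
  shows "(LINT z|lborel. f (p + diag r s z)) = (LINT z|lborel. f z)"
proof -
  have eq: "(\<lambda>x. p + (\<Sum>j\<in>Basis. ((diag r s j \<bullet> j) * (x \<bullet> j)) *\<^sub>R j)) = (\<lambda>x. p + diag r s x)"
    by (auto simp: sum_Basis_plane diag_def inner_prod_def fun_eq_iff)
  have "(lborel :: plane measure) = density (distr lborel borel (\<lambda>x. p + (\<Sum>j\<in>Basis. ((diag r s j \<bullet> j) * (x \<bullet> j)) *\<^sub>R j))) (\<lambda>_. (\<Prod>j\<in>Basis. \<bar>diag r s j \<bullet> j\<bar>))"
    by (rule lborel_affine_euclidean) (use rs in \<open>auto simp: Basis_plane diag_def\<close>)
  also have "(\<Prod>j\<in>(Basis :: plane set). \<bar>diag r s j \<bullet> j\<bar>) = 1"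
    using rs by (simp add: Basis_plane diag_def)
  finally have l: "(lborel :: plane measure) = distr lborel borel (\<lambda>x. p + diag r s x)"
    unfolding eq by (simp add: density_1)
  have m: "(\<lambda>x. p + diag r s x) \<in> borel_measurable lborel"
    unfolding diag_def by (simp, intro borel_measurable_continuous_onI continuous_intros)
  show ?thesis by (subst (2) l) (simp add: integral_distr[OF m f])
qed

lemma continuous_reflect: "continuous_on S (\<lambda>z. p + diag r s z)"
  unfolding diag_def by (intro continuous_intros)

text \<open>An involutive reflection preserves area and carries \<open>T\<close> onto a part of
  \<open>N\<close>; nonnegativity of \<open>g\<close> pays for the rest of \<open>N\<close>.\<close>

lemma integral_reflect_le:
  fixes g :: "plane \<Rightarrow> real"
  assumes T: "open T" "bounded T" and N: "open N" "bounded N"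
    and rs: "\<bar>r\<bar> = 1" "\<bar>s\<bar> = 1" and inv: "\<And>z. p + diag r s (p + diag r s z) = z"
    and sub: "\<And>z. z \<in> T \<Longrightarrow> p + diag r s z \<in> N"
    and g: "continuous_on UNIV g" "\<And>z. 0 \<le> g z"
  shows "(LINT z|lebesgue_on T. g (p + diag r s z)) \<le> (LINT z|lebesgue_on N. g z)"
proof -
  have to_lborel: "(LINT z|lebesgue_on U. f z) = (LINT z|lborel. indicator U z * f z)" and int_ind: "integrable lborel (\<lambda>z. indicator U z * f z)"
    if U: "open U" "bounded U" and f: "continuous_on UNIV f" for U and f :: "plane \<Rightarrow> real"
  proof -
    have fm: "f \<in> borel_measurable borel" using f by (rule borel_measurable_continuous_onI)
    have m: "(\<lambda>z. indicator U z * f z) \<in> borel_measurable borel"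
      using U fm by (intro borel_measurable_times borel_measurable_indicator) auto
    have "(LINT z|lebesgue_on U. f z) = (LINT z|lebesgue. indicator U z * f z)"
      using U by (subst integral_restrict_space) auto
    also have "\<dots> = (LINT z|lborel. indicator U z * f z)" using m by (intro integral_completion) simp
    finally show "(LINT z|lebesgue_on U. f z) = (LINT z|lborel. indicator U z * f z)" .
    have "integrable lborel (\<lambda>z. indicator (closure U) z *\<^sub>R f z)"
      using U by (intro borel_integrable_compact continuous_on_subset[OF f]) auto
    then have "integrable lborel (\<lambda>z. indicator U z *\<^sub>R (indicator (closure U) z *\<^sub>R f z))"
      by (rule integrable_mult_indicator[rotated]) (use U in auto)
    moreover have "indicator U z *\<^sub>R (indicator (closure U) z *\<^sub>R f z) = indicator U z * f z" for z
      using closure_subset[of U] by (auto simp: indicator_def)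
    then have "(\<lambda>z. indicator U z *\<^sub>R (indicator (closure U) z *\<^sub>R f z)) = (\<lambda>z. indicator U z * f z)" by (rule ext)
    ultimately show "integrable lborel (\<lambda>z. indicator U z * f z)" by (simp only:)
  qed
  let ?R = "\<lambda>z. p + diag r s z"
  let ?RT = "?R -` T"
  have RT: "open ?RT" using T(1) continuous_reflect[of UNIV p r s] by (rule open_vimage)
  have RT_N: "?RT \<subseteq> N" using sub inv by (metis subsetI vimageE)
  have "(LINT z|lebesgue_on T. g (?R z)) = (LINT z|lborel. indicator T z * g (?R z))"
    by (rule to_lborel[OF T]) (intro continuous_on_compose2[OF g(1)] continuous_reflect, simp)
  also have "\<dots> = (LINT z|lborel. indicator ?RT (?R z) * g (?R z))"
    by (intro Bochner_Integration.integral_cong) (auto simp: indicator_def inv)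
  also have "\<dots> = (LINT z|lborel. indicator ?RT z * g z)"
    by (rule lborel_integral_reflect[OF borel_measurable_times[OF borel_measurable_indicator
          borel_measurable_continuous_onI[OF g(1)]] rs]) (use RT in simp)
  also have "\<dots> \<le> (LINT z|lborel. indicator N z * g z)"
    using RT_N g(2) int_ind[OF RT bounded_subset[OF N(2) RT_N] g(1)] int_ind[OF N g(1)]
    by (intro integral_mono) (auto simp: indicator_def)
  also have "\<dots> = (LINT z|lebesgue_on N. g z)" by (rule to_lborel[OF N g(1), symmetric])
  finally show ?thesis .
qed

text \<open>The reflected function agrees with \<open>\<phi>\<close> on the face, which is fixed
  pointwise, and its partial derivatives differ only in sign. Its norm on \<open>T\<close> is the
  norm of \<open>\<phi>\<close> on the mirror image of \<open>T\<close>.\<close>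

lemma trace_bound_reflect:
  assumes T: "open T" "bounded T" and N: "open N" "bounded N"
    and rs: "\<bar>r\<bar> = 1" "\<bar>s\<bar> = 1" and inv: "\<And>z. p + diag r s (p + diag r s z) = z"
    and sub: "\<And>z. z \<in> T \<Longrightarrow> p + diag r s z \<in> N"
    and fixed: "\<And>z. z \<in> space (arc_measure e) \<Longrightarrow> p + diag r s z = z"
    and tb: "trace_bound T e C" and C: "C \<ge> 0"
  shows "trace_bound N e C"
  unfolding trace_bound_def
proof (intro allI impI conjI)
  fix \<phi> assume \<phi>: "smooth \<phi>"
  show "square_integrable (arc_measure e) \<phi>" using tb \<phi> by (auto simp: trace_bound_def)
  let ?\<phi> = "\<lambda>z. \<phi> (p + diag r s z)"
  have sm: "smooth ?\<phi>" by (rule smooth_compose_diag[OF \<phi>])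
  have "(LINT x|arc_measure e. (\<phi> x)\<^sup>2) = (LINT x|arc_measure e. (?\<phi> x)\<^sup>2)"
    using fixed by (intro Bochner_Integration.integral_cong) auto
  also have "\<dots> \<le> C * (H1_norm T ?\<phi>)\<^sup>2" using tb sm by (auto simp: trace_bound_def)
  also have "\<dots> \<le> C * (H1_norm N \<phi>)\<^sup>2"
  proof (intro mult_left_mono C power_mono H1_norm_nonneg)
    have le: "(LINT z|lebesgue_on T. (g (p + diag r s z))\<^sup>2) \<le> (LINT z|lebesgue_on N. (g z)\<^sup>2)" if "smooth g" for g
      using smooth_continuous_on[OF smooth_power2[OF that]] by (intro integral_reflect_le[OF T N rs inv sub, where g="\<lambda>z. (g z)\<^sup>2"]) auto
    have "(pderiv_dir b ?\<phi> z)\<^sup>2 = (pderiv_dir b \<phi> (p + diag r s z))\<^sup>2" if "b \<in> Basis" for b z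
    proof -
      have "(diag r s b \<bullet> b)\<^sup>2 = 1" using that rs by (auto simp: Basis_plane diag_def power2_eq_1_iff)
      then show ?thesis unfolding pderiv_dir_compose_diag[OF \<phi> that] power_mult_distrib by simp
    qed
    then have "(LINT z|lebesgue_on T. (pderiv_dir b ?\<phi> z)\<^sup>2) \<le> (LINT z|lebesgue_on N. (pderiv_dir b \<phi> z)\<^sup>2)" if "b \<in> Basis" for b
      using le[OF smooth_pderiv_dir[OF \<phi> that]] that by simp
    then show "H1_norm T ?\<phi> \<le> H1_norm N \<phi>"
      unfolding H1_norm_smooth[OF T sm] H1_norm_smooth[OF N \<phi>]
      by (intro real_sqrt_le_mono add_mono sum_mono le[OF \<phi>])
  qed
  finally show "(LINT x|arc_measure e. (\<phi> x)\<^sup>2) \<le> C * (H1_norm N \<phi>)\<^sup>2" .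
qed

context corner_triangle begin

lemma smooth_continuous_cTri: "smooth f \<Longrightarrow> continuous_on cTri f"
  by (rule smooth_continuous_on)

text \<open>For smooth fields the required weak identity is integration by parts over the plane. It
  localises to the triangle because the test functions there vanish outside together with their
  derivatives.\<close>

lemma smooth_divergence:
  assumes X1: "smooth X1" and X2: "smooth X2"
    and ramp: "\<And>z. z \<in> cTri \<Longrightarrow> \<bar>X2 z - t * X1 z\<bar> \<le> C * \<rho> z"
  shows "(LINT z|lebesgue_on Tri. pderiv_dir (1, 0) X1 z + pderiv_dir (0, 1) X2 z)
    = (LINT z|arc_measure top_edge. X2 z) - (LINT z|arc_measure left_edge. X1 z)"
proof -
  have e: "(1, 0) \<in> (Basis :: plane set)" "(0, 1) \<in> (Basis :: plane set)" by (auto simp: Basis_plane)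
  note sm = smooth_pderiv_dir[OF X1 e(1)] smooth_pderiv_dir[OF X2 e(2)]
  have "(LINT z|lebesgue_on Tri. pderiv_dir (1, 0) X1 z + pderiv_dir (0, 1) X2 z)
    = (LINT u|lborel. indicator {0..c / t} u * X2 (a + u, b)) - (LINT s|lborel. indicator {0..c} s * X1 (a, b - s))"
  proof (rule triangle_divergence[OF smooth_continuous_cTri[OF X1] smooth_continuous_cTri[OF X2] ramp])
    have "square_integrable (lebesgue_on Tri) (\<lambda>z. 1)"
      using open_Tri bounded_Tri by (intro square_integrable_continuous) auto
    moreover have "square_integrable (lebesgue_on Tri) (\<lambda>z. pderiv_dir (1, 0) X1 z + pderiv_dir (0, 1) X2 z)"
      using open_Tri bounded_Tri by (intro square_integrable_continuous smooth_continuous_on smooth_add sm) auto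
    ultimately show "integrable (lebesgue_on Tri) (\<lambda>z. pderiv_dir (1, 0) X1 z + pderiv_dir (0, 1) X2 z)"
      using square_integrable_mult by fastforce
    fix \<psi> K assume \<psi>: "smooth \<psi>" and K: "compact K" "\<And>z. \<psi> z \<noteq> 0 \<Longrightarrow> z \<in> K"
      and zero: "\<And>z. z \<notin> Tri \<Longrightarrow> \<psi> z = 0 \<and> pderiv_dir (1, 0) \<psi> z = 0 \<and> pderiv_dir (0, 1) \<psi> z = 0"
    have tf: "test_function UNIV \<psi>" by (rule test_functionI[OF \<psi> K(1) subset_UNIV K(2)])
    note p1 = test_function_pderiv_dir[OF tf e(1)] and p2 = test_function_pderiv_dir[OF tf e(2)]
    note l = locally_integrable_continuous[OF smooth_continuous_on[of _ UNIV]]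
    note i = integrable_test_function_mult[OF open_UNIV p1 l[OF X1]] integrable_test_function_mult[OF open_UNIV p2 l[OF X2]]
      integrable_test_function_mult[OF open_UNIV tf l[OF sm(1)]] integrable_test_function_mult[OF open_UNIV tf l[OF sm(2)]]
    have w: "(LINT z|lebesgue_on UNIV. pderiv_dir (1, 0) \<psi> z * X1 z) = - (LINT z|lebesgue_on UNIV. \<psi> z * pderiv_dir (1, 0) X1 z)"
      "(LINT z|lebesgue_on UNIV. pderiv_dir (0, 1) \<psi> z * X2 z) = - (LINT z|lebesgue_on UNIV. \<psi> z * pderiv_dir (0, 1) X2 z)"
      using has_weak_pderiv_smooth[OF open_UNIV X1 e(1)] has_weak_pderiv_smooth[OF open_UNIV X2 e(2)] tf
      unfolding has_weak_pderiv_def by auto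
    have Tl: "Tri \<in> sets lebesgue" using open_Tri by simp
    have "(LINT z|lebesgue_on Tri. pderiv_dir (1, 0) \<psi> z * X1 z + pderiv_dir (0, 1) \<psi> z * X2 z)
      = (LINT z|lebesgue_on UNIV. pderiv_dir (1, 0) \<psi> z * X1 z + pderiv_dir (0, 1) \<psi> z * X2 z)"
      using Tl zero by (intro integral_lebesgue_on_supported[symmetric]) auto
    also have "\<dots> = - (LINT z|lebesgue_on UNIV. \<psi> z * (pderiv_dir (1, 0) X1 z + pderiv_dir (0, 1) X2 z))"
      using i w by (simp add: distrib_left)
    also have "(LINT z|lebesgue_on UNIV. \<psi> z * (pderiv_dir (1, 0) X1 z + pderiv_dir (0, 1) X2 z))
      = (LINT z|lebesgue_on Tri. \<psi> z * (pderiv_dir (1, 0) X1 z + pderiv_dir (0, 1) X2 z))"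
      using Tl zero by (intro integral_lebesgue_on_supported) auto
    finally show "(LINT z|lebesgue_on Tri. pderiv_dir (1, 0) \<psi> z * X1 z + pderiv_dir (0, 1) \<psi> z * X2 z)
      = - (LINT z|lebesgue_on Tri. \<psi> z * (pderiv_dir (1, 0) X1 z + pderiv_dir (0, 1) X2 z))" .
  qed
  then show ?thesis
    unfolding integral_top[OF smooth_continuous_on[OF X2]] integral_left[OF smooth_continuous_on[OF X1]] .
qed

text \<open>The divergence theorem for \<open>\<phi>\<^sup>2 l\<close>, where \<open>l\<close> is an affine field tangential to the hypotenuse.\<close>

lemma trace_identity:
  assumes \<phi>: "smooth \<phi>"
    and ramp: "\<And>z. z \<in> cTri \<Longrightarrow> (\<kappa> + snd z) - t * (\<alpha> + fst z) = \<rho> z"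
    and l1: "\<And>z. z \<in> cTri \<Longrightarrow> \<bar>\<alpha> + fst z\<bar> \<le> c / t" and l2: "\<And>z. z \<in> cTri \<Longrightarrow> \<bar>\<kappa> + snd z\<bar> \<le> c"
  shows "(LINT z|arc_measure top_edge. (\<phi> z)\<^sup>2 * (\<kappa> + snd z)) - (LINT z|arc_measure left_edge. (\<phi> z)\<^sup>2 * (\<alpha> + fst z))
    \<le> (2 + c / t + c) * (H1_norm Tri \<phi>)\<^sup>2"
proof -
  have e: "(1, 0) \<in> (Basis :: plane set)" "(0, 1) \<in> (Basis :: plane set)" by (auto simp: Basis_plane)
  define l1 where "l1 = (\<lambda>z::plane. \<alpha> + (1, 0) \<bullet> z)"
  define l2 where "l2 = (\<lambda>z::plane. \<kappa> + (0, 1) \<bullet> z)"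
  have l_eq: "l1 z = \<alpha> + fst z" "l2 z = \<kappa> + snd z" for z by (auto simp: l1_def l2_def inner_prod_def)
  have sl: "smooth l1" "smooth l2" unfolding l1_def l2_def by (rule smooth_affine)+
  let ?p1 = "pderiv_dir (1, 0) \<phi>" and ?p2 = "pderiv_dir (0, 1) \<phi>"
  have sp: "smooth ?p1" "smooth ?p2" using smooth_pderiv_dir[OF \<phi>] e by auto
  have sq: "smooth (\<lambda>z. (\<phi> z)\<^sup>2)" by (rule smooth_power2[OF \<phi>])
  have X: "smooth (\<lambda>z. (\<phi> z)\<^sup>2 * l1 z)" "smooth (\<lambda>z. (\<phi> z)\<^sup>2 * l2 z)" by (rule smooth_mult[OF sq sl(1)] smooth_mult[OF sq sl(2)])+
  have d_sq: "pderiv_dir b (\<lambda>z. (\<phi> z)\<^sup>2) z = 2 * \<phi> z * pderiv_dir b \<phi> z" for b z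
    unfolding power2_eq_square pderiv_dir_mult[OF \<phi> \<phi>] by simp
  have d1: "pderiv_dir (1, 0) (\<lambda>z. (\<phi> z)\<^sup>2 * l1 z) z = (\<phi> z)\<^sup>2 + 2 * \<phi> z * ?p1 z * l1 z" for z
    unfolding pderiv_dir_mult[OF sq sl(1)] d_sq by (simp add: l1_def pderiv_dir_affine)
  have d2: "pderiv_dir (0, 1) (\<lambda>z. (\<phi> z)\<^sup>2 * l2 z) z = (\<phi> z)\<^sup>2 + 2 * \<phi> z * ?p2 z * l2 z" for z
    unfolding pderiv_dir_mult[OF sq sl(2)] d_sq by (simp add: l2_def pderiv_dir_affine)
  obtain B where B: "\<And>z. z \<in> cTri \<Longrightarrow> norm ((\<phi> z)\<^sup>2) \<le> B"
    using compact_imp_bounded[OF compact_continuous_image[OF smooth_continuous_cTri[OF sq] compact_cTri]]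
    unfolding bounded_iff by auto
  have "(LINT z|arc_measure top_edge. (\<phi> z)\<^sup>2 * l2 z) - (LINT z|arc_measure left_edge. (\<phi> z)\<^sup>2 * l1 z)
    = (LINT z|lebesgue_on Tri. ((\<phi> z)\<^sup>2 + 2 * \<phi> z * ?p1 z * l1 z) + ((\<phi> z)\<^sup>2 + 2 * \<phi> z * ?p2 z * l2 z))"
    unfolding d1[symmetric] d2[symmetric]
  proof (rule smooth_divergence[OF X, symmetric])
    fix z assume z: "z \<in> cTri"
    have "(\<phi> z)\<^sup>2 * l2 z - t * ((\<phi> z)\<^sup>2 * l1 z) = (\<phi> z)\<^sup>2 * \<rho> z"
      using ramp[OF z] by (simp add: l_eq algebra_simps flip: ramp[OF z])
    moreover have "\<rho> z \<ge> 0" using z by (simp add: cTri_def)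
    ultimately show "\<bar>(\<phi> z)\<^sup>2 * l2 z - t * ((\<phi> z)\<^sup>2 * l1 z)\<bar> \<le> B * \<rho> z"
      using B[OF z] by (simp add: abs_mult mult_right_mono)
  qed
  \<comment> \<open>The affine field has divergence 2. The cross terms are split by 2 x y <= x^2 +
    y^2, with \<open>c / t\<close> and \<open>c\<close> bounding the two components of the
    field.\<close>
  also have "\<dots> \<le> (LINT z|lebesgue_on Tri. (2 + c / t + c) * ((\<phi> z)\<^sup>2 + (?p1 z)\<^sup>2 + (?p2 z)\<^sup>2))"
  proof (rule integral_mono)
    have int: "integrable (lebesgue_on Tri) f" if "smooth f" for f
    proof -
      have "square_integrable (lebesgue_on Tri) (\<lambda>z. 1)" "square_integrable (lebesgue_on Tri) f"
        using open_Tri bounded_Tri smooth_continuous_on[OF that] by (auto intro!: square_integrable_continuous)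
      then show ?thesis using square_integrable_mult by fastforce
    qed
    show "integrable (lebesgue_on Tri) (\<lambda>z. ((\<phi> z)\<^sup>2 + 2 * \<phi> z * ?p1 z * l1 z) + ((\<phi> z)\<^sup>2 + 2 * \<phi> z * ?p2 z * l2 z))"
      by (intro int smooth_add smooth_mult sq sp sl \<phi> smooth_const)
    show "integrable (lebesgue_on Tri) (\<lambda>z. (2 + c / t + c) * ((\<phi> z)\<^sup>2 + (?p1 z)\<^sup>2 + (?p2 z)\<^sup>2))"
      by (intro int smooth_cmult smooth_add smooth_power2 sp \<phi>)
    fix z assume "z \<in> space (lebesgue_on Tri)"
    then have z: "z \<in> cTri" using Tri_subset_cTri by (auto simp: space_restrict_space)
    have "2 * \<phi> z * ?p1 z * l1 z \<le> (c / t) * ((\<phi> z)\<^sup>2 + (?p1 z)\<^sup>2)"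
    proof -
      have "2 * \<phi> z * ?p1 z * l1 z \<le> \<bar>2 * \<phi> z * ?p1 z\<bar> * \<bar>l1 z\<bar>" by (metis abs_ge_self abs_mult)
      also have "\<dots> \<le> ((\<phi> z)\<^sup>2 + (?p1 z)\<^sup>2) * (c / t)"
        using l1[OF z] sum_squares_bound[of "\<bar>\<phi> z\<bar>" "\<bar>?p1 z\<bar>"] by (intro mult_mono) (auto simp: l_eq abs_mult)
      finally show ?thesis by (simp add: mult.commute)
    qed
    moreover have "2 * \<phi> z * ?p2 z * l2 z \<le> c * ((\<phi> z)\<^sup>2 + (?p2 z)\<^sup>2)"
    proof -
      have "2 * \<phi> z * ?p2 z * l2 z \<le> \<bar>2 * \<phi> z * ?p2 z\<bar> * \<bar>l2 z\<bar>" by (metis abs_ge_self abs_mult)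
      also have "\<dots> \<le> ((\<phi> z)\<^sup>2 + (?p2 z)\<^sup>2) * c"
        using l2[OF z] sum_squares_bound[of "\<bar>\<phi> z\<bar>" "\<bar>?p2 z\<bar>"] by (intro mult_mono) (auto simp: l_eq abs_mult)
      finally show ?thesis by (simp add: mult.commute)
    qed
    moreover have "0 \<le> (c / t) * (?p2 z)\<^sup>2" "0 \<le> c * (?p1 z)\<^sup>2" "0 \<le> (?p1 z)\<^sup>2" "0 \<le> (?p2 z)\<^sup>2"
      using c_pos t_pos by auto
    ultimately show "((\<phi> z)\<^sup>2 + 2 * \<phi> z * ?p1 z * l1 z) + ((\<phi> z)\<^sup>2 + 2 * \<phi> z * ?p2 z * l2 z) \<le> (2 + c / t + c) * ((\<phi> z)\<^sup>2 + (?p1 z)\<^sup>2 + (?p2 z)\<^sup>2)"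
      unfolding distrib_right distrib_left by linarith
  qed
  also have "\<dots> = (2 + c / t + c) * (H1_norm Tri \<phi>)\<^sup>2"
  proof -
    have Tl: "Tri \<in> sets lebesgue" using open_Tri by simp
    have i: "integrable (lebesgue_on Tri) (\<lambda>z. (f z)\<^sup>2)" if "smooth f" for f
      using square_integrable_continuous[OF smooth_continuous_on[OF that] bounded_Tri Tl] by (simp add: square_integrable_def)
    have "(H1_norm Tri \<phi>)\<^sup>2 = (LINT x|lebesgue_on Tri. (\<phi> x)\<^sup>2) + (\<Sum>b\<in>Basis. LINT x|lebesgue_on Tri. (pderiv_dir b \<phi> x)\<^sup>2)"
      unfolding H1_norm_smooth[OF open_Tri bounded_Tri \<phi>] by (intro real_sqrt_pow2 add_nonneg_nonneg sum_nonneg) auto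
    then show ?thesis using i[OF \<phi>] i[OF sp(1)] i[OF sp(2)] by (simp add: sum_Basis_plane)
  qed
  finally show ?thesis by (simp add: l_eq)
qed

lemma space_arc_left [simp]: "space (arc_measure left_edge) = left_edge" and space_arc_top [simp]: "space (arc_measure top_edge) = top_edge"
  unfolding left_edge_def top_edge_def using space_arc_measure[OF left_neq] space_arc_measure[OF top_neq] by auto

lemma mem_leftD: "z \<in> left_edge \<Longrightarrow> fst z = a" and mem_topD: "z \<in> top_edge \<Longrightarrow> snd z = b"
  by (auto simp: left_eq top_eq)

text \<open>The field is the position relative to the vertex opposite this leg. Being radial it is
  tangential to the two other edges, and its horizontal component on the leg is the constant - c /
  t, whose size is divided out.\<close>

lemma trace_bound_left: "trace_bound Tri left_edge (t / c * (2 + c / t + c))"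
  unfolding trace_bound_def
proof (intro allI impI conjI)
  fix \<phi> assume \<phi>: "smooth \<phi>"
  show "square_integrable (arc_measure left_edge) \<phi>"
    unfolding left_edge_def by (rule square_integrable_arc_measure[OF left_neq smooth_continuous_on[OF \<phi>]])
  have "(LINT z|arc_measure top_edge. (\<phi> z)\<^sup>2 * (- b + snd z)) = (LINT z|arc_measure top_edge. 0)"
    by (intro Bochner_Integration.integral_cong refl) (simp add: mem_topD)
  moreover have "(LINT z|arc_measure left_edge. (\<phi> z)\<^sup>2 * (- (a + c / t) + fst z)) = (LINT z|arc_measure left_edge. (- (c / t)) * (\<phi> z)\<^sup>2)"
    by (intro Bochner_Integration.integral_cong refl) (simp add: mem_leftD algebra_simps)
  moreover have "(LINT z|arc_measure top_edge. (\<phi> z)\<^sup>2 * (- b + snd z)) - (LINT z|arc_measure left_edge. (\<phi> z)\<^sup>2 * (- (a + c / t) + fst z))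
    \<le> (2 + c / t + c) * (H1_norm Tri \<phi>)\<^sup>2"
  proof (rule trace_identity[OF \<phi>])
    fix z assume "z \<in> cTri"
    note bd = cTri_bounds[OF this]
    show "(- b + snd z) - t * (- (a + c / t) + fst z) = \<rho> z" using t_pos by (simp add: \<rho>_def algebra_simps)
    show "\<bar>- (a + c / t) + fst z\<bar> \<le> c / t" "\<bar>- b + snd z\<bar> \<le> c" using bd by auto
  qed
  ultimately have "c / t * (LINT z|arc_measure left_edge. (\<phi> z)\<^sup>2) \<le> (2 + c / t + c) * (H1_norm Tri \<phi>)\<^sup>2" by simp
  then have "t / c * (c / t * (LINT z|arc_measure left_edge. (\<phi> z)\<^sup>2)) \<le> t / c * ((2 + c / t + c) * (H1_norm Tri \<phi>)\<^sup>2)"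
    using c_pos t_pos by (intro mult_left_mono) auto
  then show "(LINT z|arc_measure left_edge. (\<phi> z)\<^sup>2) \<le> t / c * (2 + c / t + c) * (H1_norm Tri \<phi>)\<^sup>2"
    using c_pos t_pos by (simp add: mult.assoc)
qed

text \<open>Radial field from the lower vertex \<open>(a, b - c)\<close>; its vertical component on
  the top leg is \<open>c\<close>.\<close>

lemma trace_bound_top: "trace_bound Tri top_edge (1 / c * (2 + c / t + c))"
  unfolding trace_bound_def
proof (intro allI impI conjI)
  fix \<phi> assume \<phi>: "smooth \<phi>"
  show "square_integrable (arc_measure top_edge) \<phi>"
    unfolding top_edge_def by (rule square_integrable_arc_measure[OF top_neq smooth_continuous_on[OF \<phi>]])
  have "(LINT z|arc_measure left_edge. (\<phi> z)\<^sup>2 * (- a + fst z)) = (LINT z|arc_measure left_edge. 0)"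
    by (intro Bochner_Integration.integral_cong refl) (simp add: mem_leftD)
  moreover have "(LINT z|arc_measure top_edge. (\<phi> z)\<^sup>2 * (- (b - c) + snd z)) = (LINT z|arc_measure top_edge. c * (\<phi> z)\<^sup>2)"
    by (intro Bochner_Integration.integral_cong refl) (simp add: mem_topD algebra_simps)
  moreover have "(LINT z|arc_measure top_edge. (\<phi> z)\<^sup>2 * (- (b - c) + snd z)) - (LINT z|arc_measure left_edge. (\<phi> z)\<^sup>2 * (- a + fst z))
    \<le> (2 + c / t + c) * (H1_norm Tri \<phi>)\<^sup>2"
  proof (rule trace_identity[OF \<phi>])
    fix z assume "z \<in> cTri"
    note bd = cTri_bounds[OF this]
    show "(- (b - c) + snd z) - t * (- a + fst z) = \<rho> z" by (simp add: \<rho>_def algebra_simps)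
    show "\<bar>- a + fst z\<bar> \<le> c / t" "\<bar>- (b - c) + snd z\<bar> \<le> c" using bd by auto
  qed
  ultimately have "c * (LINT z|arc_measure top_edge. (\<phi> z)\<^sup>2) \<le> (2 + c / t + c) * (H1_norm Tri \<phi>)\<^sup>2" by simp
  then show "(LINT z|arc_measure top_edge. (\<phi> z)\<^sup>2) \<le> 1 / c * (2 + c / t + c) * (H1_norm Tri \<phi>)\<^sup>2"
    using c_pos by (simp add: field_simps)
qed

text \<open>The reflection of the triangle in its leg lies in the neighbouring cell, so the constant carries over.\<close>

lemma trace_bound_left_neighbour:
  assumes "open N" "bounded N" "\<And>x y. (x, y) \<in> Tri \<Longrightarrow> (2 * a - x, y) \<in> N"
  shows "trace_bound N left_edge (t / c * (2 + c / t + c))"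
proof (rule trace_bound_reflect[OF open_Tri bounded_Tri assms(1,2), where p="(2 * a, 0)" and r="-1" and s=1])
  show "(2 * a, 0) + diag (-1) 1 z \<in> N" if "z \<in> Tri" for z
    using assms(3)[of "fst z" "snd z"] that by (simp add: diag_def)
  show "(2 * a, 0) + diag (-1) 1 z = z" if "z \<in> space (arc_measure left_edge)" for z
    using mem_leftD[of z] that by (simp add: diag_def prod_eq_iff)
  show "trace_bound Tri left_edge (t / c * (2 + c / t + c))" by (rule trace_bound_left)
qed (use c_pos t_pos in \<open>simp_all add: diag_def prod_eq_iff\<close>)

lemma trace_bound_top_neighbour:
  assumes "open N" "bounded N" "\<And>x y. (x, y) \<in> Tri \<Longrightarrow> (x, 2 * b - y) \<in> N"
  shows "trace_bound N top_edge (1 / c * (2 + c / t + c))"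
proof (rule trace_bound_reflect[OF open_Tri bounded_Tri assms(1,2), where p="(0, 2 * b)" and r=1 and s="-1"])
  show "(0, 2 * b) + diag 1 (-1) z \<in> N" if "z \<in> Tri" for z
    using assms(3)[of "fst z" "snd z"] that by (simp add: diag_def)
  show "(0, 2 * b) + diag 1 (-1) z = z" if "z \<in> space (arc_measure top_edge)" for z
    using mem_topD[of z] that by (simp add: diag_def prod_eq_iff)
  show "trace_bound Tri top_edge (1 / c * (2 + c / t + c))" by (rule trace_bound_top)
qed (use c_pos t_pos in \<open>simp_all add: diag_def prod_eq_iff\<close>)

lemma closure_Tri_subset: "closure Tri \<subseteq> cTri"
  by (rule closure_minimal[OF Tri_subset_cTri closed_cTri])

lemma Tri_sets [simp]: "Tri \<in> sets lebesgue"
  using open_Tri by simp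

lemma square_integrable_Tri:
  fixes f :: "plane \<Rightarrow> real"
  shows "continuous_on cTri f \<Longrightarrow> square_integrable (lebesgue_on Tri) f"
  by (rule square_integrable_continuous[OF continuous_on_subset[OF _ closure_Tri_subset] bounded_Tri Tri_sets])

lemma integrable_Tri:
  fixes f :: "plane \<Rightarrow> real"
  assumes "continuous_on cTri f" shows "integrable (lebesgue_on Tri) f"
  using square_integrable_mult[OF square_integrable_Tri[OF assms] square_integrable_Tri[of "\<lambda>_. 1"]] by simp

end

section \<open>Flow across a triangle\<close>

text \<open>The legs, apart from their end points on the hypotenuse, belong to
  \<open>\<Omega>\<close>, so test functions in \<open>\<Omega>\<close> can reach them. The
  hypotenuse itself is only known to lie in the closure.\<close>

locale triangle_flow = corner_triangle +
  fixes \<Omega> :: "plane set" and \<beta> :: "plane \<Rightarrow> plane" and M :: real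
  assumes \<Omega>: "open \<Omega>" and interior_subset: "cTri \<inter> {z. 0 < \<rho> z} \<subseteq> \<Omega>" and cTri_closure: "cTri \<subseteq> closure \<Omega>"
    and Lipschitz: "M-lipschitz_on (closure \<Omega>) \<beta>"
    and div: "has_weak_divergence \<Omega> \<beta> (\<lambda>x. 0)"
    and tangential: "\<And>z. z \<in> cTri \<Longrightarrow> \<rho> z = 0 \<Longrightarrow> snd (\<beta> z) = t * fst (\<beta> z)"
begin

lemma Tri_subset: "Tri \<subseteq> \<Omega>"
  using interior_subset Tri_subset_cTri by (auto simp: Tri_def)

lemma continuous_\<beta>: "continuous_on cTri \<beta>"
  using lipschitz_on_continuous_on[OF Lipschitz] cTri_closure by (rule continuous_on_subset)

text \<open>Moving \<open>z\<close> down by \<open>\<rho> z\<close> lands on the hypotenuse, where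
  the normal velocity is zero; the Lipschitz bound is spent once on each component.\<close>

lemma normal_velocity_bound:
  assumes z: "z \<in> cTri" shows "\<bar>snd (\<beta> z) - t * fst (\<beta> z)\<bar> \<le> (1 + t) * M * \<rho> z"
proof -
  define z' where "z' = (fst z, snd z - \<rho> z)"
  have r: "\<rho> z \<ge> 0" using z by (simp add: cTri_def)
  have \<rho>': "\<rho> z' = 0" by (simp add: z'_def \<rho>_def)
  have z': "z' \<in> cTri" using z r \<rho>' by (simp add: cTri_def z'_def)
  have "dist (\<beta> z) (\<beta> z') \<le> M * dist z z'"
    by (rule lipschitz_onD[OF Lipschitz]) (use z z' cTri_closure in blast)+
  also have "dist z z' = \<rho> z" using r by (cases z) (simp add: z'_def dist_Pair_Pair dist_real_def)
  finally have d: "norm (\<beta> z - \<beta> z') \<le> M * \<rho> z" by (simp add: dist_norm)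
  have "snd (\<beta> z) - t * fst (\<beta> z) = snd (\<beta> z - \<beta> z') - t * fst (\<beta> z - \<beta> z')"
    using tangential[OF z' \<rho>'] by (simp add: algebra_simps)
  also have "\<bar>\<dots>\<bar> \<le> \<bar>snd (\<beta> z - \<beta> z')\<bar> + t * \<bar>fst (\<beta> z - \<beta> z')\<bar>"
    using abs_triangle_ineq4[of "snd (\<beta> z - \<beta> z')" "t * fst (\<beta> z - \<beta> z')"] t_pos by (simp add: abs_mult)
  also have "\<dots> \<le> M * \<rho> z + t * (M * \<rho> z)"
    using d abs_fst_le_norm[of "\<beta> z - \<beta> z'"] abs_snd_le_norm[of "\<beta> z - \<beta> z'"] t_pos
    by (intro add_mono mult_left_mono) auto
  finally show ?thesis by (simp add: algebra_simps)
qed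

text \<open>The divergence theorem for \<open>\<phi>\<close> times \<open>\<beta>\<close>. The weak
  divergence of \<open>\<beta>\<close> is tested with the product of \<open>\<phi>\<close> and a
  cutoff, and the product rule moves the gradient of \<open>\<phi>\<close> to the right-hand
  side.\<close>

lemma flux_identity:
  assumes \<phi>: "smooth \<phi>"
  shows "(LINT z|lebesgue_on Tri. pderiv_dir (1, 0) \<phi> z * fst (\<beta> z) + pderiv_dir (0, 1) \<phi> z * snd (\<beta> z))
    = (LINT z|arc_measure top_edge. snd (\<beta> z) * \<phi> z) - (LINT z|arc_measure left_edge. fst (\<beta> z) * \<phi> z)"
proof -
  have e: "(1, 0) \<in> (Basis :: plane set)" "(0, 1) \<in> (Basis :: plane set)" by (auto simp: Basis_plane)
  note sp = smooth_pderiv_dir[OF \<phi> e(1)] smooth_pderiv_dir[OF \<phi> e(2)]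
  have c: "continuous_on cTri (\<lambda>z. fst (\<beta> z))" "continuous_on cTri (\<lambda>z. snd (\<beta> z))"
    by (intro continuous_intros continuous_\<beta>)+
  have cont: "continuous_on cTri (\<lambda>z. fst (\<beta> z) * \<phi> z)" "continuous_on cTri (\<lambda>z. snd (\<beta> z) * \<phi> z)"
    "continuous_on cTri (\<lambda>z. pderiv_dir (1, 0) \<phi> z * fst (\<beta> z) + pderiv_dir (0, 1) \<phi> z * snd (\<beta> z))"
    by (intro continuous_intros c smooth_continuous_on \<phi> sp)+
  obtain B where B: "\<And>z. z \<in> cTri \<Longrightarrow> norm (\<phi> z) \<le> B"
    using compact_imp_bounded[OF compact_continuous_image[OF smooth_continuous_cTri[OF \<phi>] compact_cTri]]
    unfolding bounded_iff by auto
  have "(LINT z|lebesgue_on Tri. pderiv_dir (1, 0) \<phi> z * fst (\<beta> z) + pderiv_dir (0, 1) \<phi> z * snd (\<beta> z))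
    = (LINT u|lborel. indicator {0..c / t} u * (snd (\<beta> (a + u, b)) * \<phi> (a + u, b)))
      - (LINT s|lborel. indicator {0..c} s * (fst (\<beta> (a, b - s)) * \<phi> (a, b - s)))"
  proof (rule triangle_divergence[OF cont(1,2)])
    fix z assume z: "z \<in> cTri"
    have "\<bar>snd (\<beta> z) * \<phi> z - t * (fst (\<beta> z) * \<phi> z)\<bar> = \<bar>snd (\<beta> z) - t * fst (\<beta> z)\<bar> * \<bar>\<phi> z\<bar>"
      by (simp add: abs_mult[symmetric] algebra_simps)
    also have "\<dots> \<le> ((1 + t) * M * \<rho> z) * B"
      using B[OF z] order_trans[OF abs_ge_zero normal_velocity_bound[OF z]]
      by (intro mult_mono normal_velocity_bound[OF z]) auto
    finally show "\<bar>snd (\<beta> z) * \<phi> z - t * (fst (\<beta> z) * \<phi> z)\<bar> \<le> ((1 + t) * M * B) * \<rho> z" by (simp add: mult_ac)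
  next
    show "integrable (lebesgue_on Tri) (\<lambda>z. pderiv_dir (1, 0) \<phi> z * fst (\<beta> z) + pderiv_dir (0, 1) \<phi> z * snd (\<beta> z))"
      by (rule integrable_Tri[OF cont(3)])
  next
    fix \<psi> K assume \<psi>: "smooth \<psi>" and K: "compact K" "K \<subseteq> cTri \<inter> {z. 0 < \<rho> z}" "\<And>z. \<psi> z \<noteq> 0 \<Longrightarrow> z \<in> K"
      and zero: "\<And>z. z \<notin> Tri \<Longrightarrow> \<psi> z = 0 \<and> pderiv_dir (1, 0) \<psi> z = 0 \<and> pderiv_dir (0, 1) \<psi> z = 0"
    let ?\<psi> = "\<lambda>z. \<phi> z * \<psi> z"
    \<comment> \<open>The support touches the legs but avoids the hypotenuse, which is exactly what
      places it inside \<open>\<Omega>\<close>.\<close>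
    have "test_function \<Omega> \<psi>"
      using K(2) interior_subset by (intro test_functionI[OF \<psi> K(1) _ K(3)]) auto
    then have tf: "test_function \<Omega> ?\<psi>" by (rule test_function_mult[OF _ \<phi>])
    have d: "pderiv_dir b ?\<psi> z = \<phi> z * pderiv_dir b \<psi> z + pderiv_dir b \<phi> z * \<psi> z" for b z
      by (rule pderiv_dir_mult[OF \<phi> \<psi>])
    note s\<psi> = smooth_pderiv_dir[OF \<psi> e(1)] smooth_pderiv_dir[OF \<psi> e(2)]
    have "(LINT z|lebesgue_on \<Omega>. (\<Sum>b\<in>Basis. pderiv_dir b ?\<psi> z * (\<beta> z \<bullet> b))) = - (LINT z|lebesgue_on \<Omega>. ?\<psi> z * 0)"
      using div tf unfolding has_weak_divergence_def by blast
    then have "0 = (LINT z|lebesgue_on \<Omega>. (\<Sum>b\<in>Basis. pderiv_dir b ?\<psi> z * (\<beta> z \<bullet> b)))" by simp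
    also have "\<dots> = (LINT z|lebesgue_on Tri. (\<Sum>b\<in>Basis. pderiv_dir b ?\<psi> z * (\<beta> z \<bullet> b)))"
      using \<Omega> Tri_subset zero by (intro integral_lebesgue_on_supported) (auto simp: sum_Basis_plane d)
    also have "\<dots> = (LINT z|lebesgue_on Tri. (pderiv_dir (1, 0) \<psi> z * (fst (\<beta> z) * \<phi> z) + pderiv_dir (0, 1) \<psi> z * (snd (\<beta> z) * \<phi> z))
        + \<psi> z * (pderiv_dir (1, 0) \<phi> z * fst (\<beta> z) + pderiv_dir (0, 1) \<phi> z * snd (\<beta> z)))"
      by (intro Bochner_Integration.integral_cong refl) (simp add: sum_Basis_plane d inner_prod_def algebra_simps)
    also have "\<dots> = (LINT z|lebesgue_on Tri. pderiv_dir (1, 0) \<psi> z * (fst (\<beta> z) * \<phi> z) + pderiv_dir (0, 1) \<psi> z * (snd (\<beta> z) * \<phi> z))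
        + (LINT z|lebesgue_on Tri. \<psi> z * (pderiv_dir (1, 0) \<phi> z * fst (\<beta> z) + pderiv_dir (0, 1) \<phi> z * snd (\<beta> z)))"
      by (intro Bochner_Integration.integral_add integrable_Tri continuous_on_add continuous_on_mult smooth_continuous_on s\<psi> \<psi> c \<phi> sp)
    finally show "(LINT z|lebesgue_on Tri. pderiv_dir (1, 0) \<psi> z * (fst (\<beta> z) * \<phi> z) + pderiv_dir (0, 1) \<psi> z * (snd (\<beta> z) * \<phi> z))
        = - (LINT z|lebesgue_on Tri. \<psi> z * (pderiv_dir (1, 0) \<phi> z * fst (\<beta> z) + pderiv_dir (0, 1) \<phi> z * snd (\<beta> z)))"
      by linarith
  qed
  then show ?thesis
    unfolding integral_top[OF continuous_on_subset[OF cont(2) top_subset]] integral_left[OF continuous_on_subset[OF cont(1) left_subset]] .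
qed

lemma flux_balance: "(LINT z|arc_measure top_edge. snd (\<beta> z)) = (LINT z|arc_measure left_edge. fst (\<beta> z))"
  using flux_identity[OF smooth_const[of 1]] by simp

lemma square_integrable_left: "continuous_on cTri f \<Longrightarrow> square_integrable (arc_measure left_edge) (f :: plane \<Rightarrow> real)"
  and square_integrable_top: "continuous_on cTri f \<Longrightarrow> square_integrable (arc_measure top_edge) (f :: plane \<Rightarrow> real)"
  using square_integrable_arc_measure(1)[OF left_neq, of f] square_integrable_arc_measure(1)[OF top_neq, of f]
    continuous_on_subset[OF _ left_subset, of f] continuous_on_subset[OF _ top_subset, of f]
  by (simp_all add: left_edge_def top_edge_def)

text \<open>\<open>E1\<close> and \<open>E2\<close> are any open sets on which traces on the legs
  are controlled: the triangle itself or the cell across the leg. One global approximation of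
  \<open>v\<close> converges on all of them, so the smooth identity passes to the limit whichever
  sides the traces come from.\<close>

theorem cell_estimate:
  assumes dom: "convex \<Omega>" "bounded \<Omega>" and v: "v \<in> H1 \<Omega>"
    and B: "\<And>z. z \<in> cTri \<Longrightarrow> norm (\<beta> z) \<le> B"
    and sign: "(\<forall>z\<in>left_edge. 0 \<le> fst (\<beta> z)) \<and> (\<forall>z\<in>top_edge. 0 \<le> snd (\<beta> z)) \<or> (\<forall>z\<in>left_edge. fst (\<beta> z) \<le> 0) \<and> (\<forall>z\<in>top_edge. snd (\<beta> z) \<le> 0)"
    and E1: "open E1" "E1 \<subseteq> \<Omega>" "trace_bound E1 left_edge C1" and E2: "open E2" "E2 \<subseteq> \<Omega>" "trace_bound E2 top_edge C2"
  shows "\<bar>(LINT z|arc_measure left_edge. \<bar>fst (\<beta> z)\<bar> * face_trace E1 left_edge v z) - (LINT z|arc_measure top_edge. \<bar>snd (\<beta> z)\<bar> * face_trace E2 top_edge v z)\<bar>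
    \<le> B * sqrt (measure lebesgue Tri) * sqrt (\<Sum>b\<in>Basis. LINT z|lebesgue_on Tri. (weak_pderiv \<Omega> b v z)\<^sup>2)"
proof -
  have e: "(1, 0) \<in> (Basis :: plane set)" "(0, 1) \<in> (Basis :: plane set)" by (auto simp: Basis_plane)
  have c: "continuous_on cTri (\<lambda>z. fst (\<beta> z))" "continuous_on cTri (\<lambda>z. snd (\<beta> z))"
    "continuous_on cTri (\<lambda>z. \<bar>fst (\<beta> z)\<bar>)" "continuous_on cTri (\<lambda>z. \<bar>snd (\<beta> z)\<bar>)"
    by (intro continuous_intros continuous_\<beta>)+
  have "(a + c / (4 * t), b - c / 4) \<in> Tri" using c_pos t_pos by (simp add: Tri_def \<rho>_def)
  then have ne: "\<Omega> \<noteq> {}" using Tri_subset by auto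
  obtain \<phi> where \<phi>: "\<And>n. smooth (\<phi> n)" and lim: "(\<lambda>n. H1_norm \<Omega> (\<lambda>x. \<phi> n x - v x)) \<longlonglongrightarrow> 0"
    using smooth_dense_H1[OF \<Omega> dom ne v] by blast
  have lim_sub: "(\<lambda>n. H1_norm E (\<lambda>x. \<phi> n x - v x)) \<longlonglongrightarrow> 0" if "open E" "E \<subseteq> \<Omega>" for E
  proof (rule tendsto_sandwich[OF _ _ tendsto_const lim])
    show "\<forall>\<^sub>F n in sequentially. H1_norm E (\<lambda>x. \<phi> n x - v x) \<le> H1_norm \<Omega> (\<lambda>x. \<phi> n x - v x)"
      by (intro always_eventually allI H1_norm_subset_le \<Omega> that H1_diff smooth_H1 dom \<phi> v)
  qed (simp add: H1_norm_nonneg)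
  have L: "(\<lambda>n. LINT z|arc_measure left_edge. \<bar>fst (\<beta> z)\<bar> * \<phi> n z) \<longlonglongrightarrow> (LINT z|arc_measure left_edge. \<bar>fst (\<beta> z)\<bar> * face_trace E1 left_edge v z)"
    by (rule weighted_face_trace_limit[OF E1(1) bounded_subset[OF dom(2) E1(2)] E1(3) H1_subset[OF \<Omega> E1(1,2) v] \<phi> lim_sub[OF E1(1,2)] square_integrable_left[OF c(3)]])
  have T: "(\<lambda>n. LINT z|arc_measure top_edge. \<bar>snd (\<beta> z)\<bar> * \<phi> n z) \<longlonglongrightarrow> (LINT z|arc_measure top_edge. \<bar>snd (\<beta> z)\<bar> * face_trace E2 top_edge v z)"
    by (rule weighted_face_trace_limit[OF E2(1) bounded_subset[OF dom(2) E2(2)] E2(3) H1_subset[OF \<Omega> E2(1,2) v] \<phi> lim_sub[OF E2(1,2)] square_integrable_top[OF c(4)]])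
  define p1 where "p1 = weak_pderiv \<Omega> (1, 0) v"
  define p2 where "p2 = weak_pderiv \<Omega> (0, 1) v"
  have \<Omega>l: "\<Omega> \<in> sets lebesgue" using \<Omega> by simp
  have p_sq: "square_integrable (lebesgue_on Tri) p1" "square_integrable (lebesgue_on Tri) p2"
    unfolding p1_def p2_def
    using square_integrable_subset[OF H1_square_integrable(2)[OF v] \<Omega>l Tri_sets Tri_subset] e by auto
  have \<beta>_sq: "square_integrable (lebesgue_on Tri) (\<lambda>z. fst (\<beta> z))" "square_integrable (lebesgue_on Tri) (\<lambda>z. snd (\<beta> z))"
    by (intro square_integrable_Tri c)+
  define I where "I = (LINT z|lebesgue_on Tri. p1 z * fst (\<beta> z) + p2 z * snd (\<beta> z))"
  have grad_lim: "(\<lambda>n. LINT z|lebesgue_on Tri. pderiv_dir b (\<phi> n) z * w z) \<longlonglongrightarrow> (LINT z|lebesgue_on Tri. weak_pderiv \<Omega> b v z * w z)"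
    if b: "b \<in> Basis" and w: "square_integrable (lebesgue_on Tri) w" for b w
  proof -
    let ?p = "weak_pderiv \<Omega> b v"
    have psq: "square_integrable (lebesgue_on Tri) ?p"
      by (rule square_integrable_subset[OF H1_square_integrable(2)[OF v b] \<Omega>l Tri_sets Tri_subset])
    have dsq: "square_integrable (lebesgue_on Tri) (pderiv_dir b (\<phi> n))" for n
      by (intro square_integrable_Tri smooth_continuous_on smooth_pderiv_dir \<phi> b)
    note diff = square_integrable_diff[OF dsq psq]
    have le: "sqrt (LINT z|lebesgue_on Tri. (pderiv_dir b (\<phi> n) z - ?p z)\<^sup>2) \<le> H1_norm \<Omega> (\<lambda>x. \<phi> n x - v x)" for n
    proof -
      have sqO: "square_integrable (lebesgue_on \<Omega>) (\<lambda>z. pderiv_dir b (\<phi> n) z - weak_pderiv \<Omega> b v z)" if "b \<in> Basis" for b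
        by (intro square_integrable_diff[OF square_integrable_continuous H1_square_integrable(2)[OF v that]]
            smooth_continuous_on smooth_pderiv_dir \<phi> that dom \<Omega>l)
      have H: "H1_norm \<Omega> (\<lambda>x. \<phi> n x - v x) = sqrt ((LINT x|lebesgue_on \<Omega>. (\<phi> n x - v x)\<^sup>2)
        + (\<Sum>b\<in>Basis. LINT x|lebesgue_on \<Omega>. (pderiv_dir b (\<phi> n) x - weak_pderiv \<Omega> b v x)\<^sup>2))"
        by (intro H1_norm_eq[OF \<Omega>] has_weak_pderiv_diff[OF \<Omega>] has_weak_pderiv_smooth[OF \<Omega> \<phi>] H1_has_weak_pderiv[OF v] sqO)
      have "(LINT z|lebesgue_on Tri. (pderiv_dir b (\<phi> n) z - ?p z)\<^sup>2) \<le> (LINT z|lebesgue_on \<Omega>. (pderiv_dir b (\<phi> n) z - ?p z)\<^sup>2)"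
        using sqO[OF b] by (intro integral_subset_mono \<Omega>l Tri_sets Tri_subset) (auto simp: square_integrable_def)
      also have "\<dots> \<le> (\<Sum>b\<in>Basis. LINT x|lebesgue_on \<Omega>. (pderiv_dir b (\<phi> n) x - weak_pderiv \<Omega> b v x)\<^sup>2)"
        using b by (intro member_le_sum) auto
      also have "\<dots> \<le> (LINT x|lebesgue_on \<Omega>. (\<phi> n x - v x)\<^sup>2) + (\<Sum>b\<in>Basis. LINT x|lebesgue_on \<Omega>. (pderiv_dir b (\<phi> n) x - weak_pderiv \<Omega> b v x)\<^sup>2)"
        by simp
      finally show ?thesis unfolding H by (rule real_sqrt_le_mono)
    qed
    have "(\<lambda>n. (LINT z|lebesgue_on Tri. pderiv_dir b (\<phi> n) z * w z) - (LINT z|lebesgue_on Tri. ?p z * w z)) \<longlonglongrightarrow> 0"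
    proof (rule Lim_null_comparison)
      show "(\<lambda>n. H1_norm \<Omega> (\<lambda>x. \<phi> n x - v x) * sqrt (LINT z|lebesgue_on Tri. (w z)\<^sup>2)) \<longlonglongrightarrow> 0"
        by (rule tendsto_mult_left_zero[OF lim])
      have "norm ((LINT z|lebesgue_on Tri. pderiv_dir b (\<phi> n) z * w z) - (LINT z|lebesgue_on Tri. ?p z * w z))
        \<le> H1_norm \<Omega> (\<lambda>x. \<phi> n x - v x) * sqrt (LINT z|lebesgue_on Tri. (w z)\<^sup>2)" for n
      proof -
        have "(LINT z|lebesgue_on Tri. pderiv_dir b (\<phi> n) z * w z) - (LINT z|lebesgue_on Tri. ?p z * w z)
          = (LINT z|lebesgue_on Tri. (pderiv_dir b (\<phi> n) z - ?p z) * w z)"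
          using square_integrable_mult[OF dsq w] square_integrable_mult[OF psq w] by (simp add: left_diff_distrib)
        also have "\<bar>\<dots>\<bar> \<le> sqrt (LINT z|lebesgue_on Tri. (pderiv_dir b (\<phi> n) z - ?p z)\<^sup>2) * sqrt (LINT z|lebesgue_on Tri. (w z)\<^sup>2)"
          by (rule square_integral_Cauchy_Schwarz[OF diff w])
        also have "\<dots> \<le> H1_norm \<Omega> (\<lambda>x. \<phi> n x - v x) * sqrt (LINT z|lebesgue_on Tri. (w z)\<^sup>2)"
          by (intro mult_right_mono le) simp
        finally show ?thesis by simp
      qed
      then show "\<forall>\<^sub>F n in sequentially. norm ((LINT z|lebesgue_on Tri. pderiv_dir b (\<phi> n) z * w z) - (LINT z|lebesgue_on Tri. ?p z * w z))
        \<le> H1_norm \<Omega> (\<lambda>x. \<phi> n x - v x) * sqrt (LINT z|lebesgue_on Tri. (w z)\<^sup>2)" by simp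
    qed
    then show ?thesis by (rule LIM_zero_cancel)
  qed
  have ints: "integrable (lebesgue_on Tri) (\<lambda>z. p1 z * fst (\<beta> z))" "integrable (lebesgue_on Tri) (\<lambda>z. p2 z * snd (\<beta> z))"
    by (intro square_integrable_mult p_sq \<beta>_sq)+
  have I_lim: "(\<lambda>n. LINT z|lebesgue_on Tri. pderiv_dir (1, 0) (\<phi> n) z * fst (\<beta> z) + pderiv_dir (0, 1) (\<phi> n) z * snd (\<beta> z)) \<longlonglongrightarrow> I"
  proof -
    have "(LINT z|lebesgue_on Tri. pderiv_dir (1, 0) (\<phi> n) z * fst (\<beta> z) + pderiv_dir (0, 1) (\<phi> n) z * snd (\<beta> z))
      = (LINT z|lebesgue_on Tri. pderiv_dir (1, 0) (\<phi> n) z * fst (\<beta> z)) + (LINT z|lebesgue_on Tri. pderiv_dir (0, 1) (\<phi> n) z * snd (\<beta> z))" for n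
      by (intro Bochner_Integration.integral_add integrable_Tri continuous_on_mult smooth_continuous_on smooth_pderiv_dir \<phi> e c)
    moreover have "I = (LINT z|lebesgue_on Tri. p1 z * fst (\<beta> z)) + (LINT z|lebesgue_on Tri. p2 z * snd (\<beta> z))"
      unfolding I_def by (rule Bochner_Integration.integral_add[OF ints])
    ultimately show ?thesis
      using tendsto_add[OF grad_lim[OF e(1) \<beta>_sq(1)] grad_lim[OF e(2) \<beta>_sq(2)]] unfolding p1_def p2_def by simp
  qed
  \<comment> \<open>In either sign pattern the absolute values flip both leg integrals or neither,
    so only an overall sign is lost.\<close>
  have abs_eq: "\<bar>(LINT z|arc_measure left_edge. \<bar>fst (\<beta> z)\<bar> * \<phi> n z) - (LINT z|arc_measure top_edge. \<bar>snd (\<beta> z)\<bar> * \<phi> n z)\<bar>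
     = \<bar>LINT z|lebesgue_on Tri. pderiv_dir (1, 0) (\<phi> n) z * fst (\<beta> z) + pderiv_dir (0, 1) (\<phi> n) z * snd (\<beta> z)\<bar>" for n
    using sign
  proof
    assume s: "(\<forall>z\<in>left_edge. 0 \<le> fst (\<beta> z)) \<and> (\<forall>z\<in>top_edge. 0 \<le> snd (\<beta> z))"
    have "(LINT z|arc_measure left_edge. \<bar>fst (\<beta> z)\<bar> * \<phi> n z) = (LINT z|arc_measure left_edge. fst (\<beta> z) * \<phi> n z)"
      "(LINT z|arc_measure top_edge. \<bar>snd (\<beta> z)\<bar> * \<phi> n z) = (LINT z|arc_measure top_edge. snd (\<beta> z) * \<phi> n z)"
      using s by (auto intro!: Bochner_Integration.integral_cong)
    then show ?thesis unfolding flux_identity[OF \<phi>] by simp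
  next
    assume s: "(\<forall>z\<in>left_edge. fst (\<beta> z) \<le> 0) \<and> (\<forall>z\<in>top_edge. snd (\<beta> z) \<le> 0)"
    have "(LINT z|arc_measure left_edge. \<bar>fst (\<beta> z)\<bar> * \<phi> n z) = (LINT z|arc_measure left_edge. - (fst (\<beta> z) * \<phi> n z))"
      "(LINT z|arc_measure top_edge. \<bar>snd (\<beta> z)\<bar> * \<phi> n z) = (LINT z|arc_measure top_edge. - (snd (\<beta> z) * \<phi> n z))"
      using s by (intro Bochner_Integration.integral_cong refl, simp)+
    then show ?thesis unfolding flux_identity[OF \<phi>] by simp
  qed
  have "(\<lambda>n. \<bar>(LINT z|arc_measure left_edge. \<bar>fst (\<beta> z)\<bar> * \<phi> n z) - (LINT z|arc_measure top_edge. \<bar>snd (\<beta> z)\<bar> * \<phi> n z)\<bar>) \<longlonglongrightarrow> \<bar>I\<bar>"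
    unfolding abs_eq by (intro tendsto_rabs I_lim)
  moreover have "(\<lambda>n. \<bar>(LINT z|arc_measure left_edge. \<bar>fst (\<beta> z)\<bar> * \<phi> n z) - (LINT z|arc_measure top_edge. \<bar>snd (\<beta> z)\<bar> * \<phi> n z)\<bar>) \<longlonglongrightarrow>
     \<bar>(LINT z|arc_measure left_edge. \<bar>fst (\<beta> z)\<bar> * face_trace E1 left_edge v z) - (LINT z|arc_measure top_edge. \<bar>snd (\<beta> z)\<bar> * face_trace E2 top_edge v z)\<bar>"
    by (intro tendsto_rabs tendsto_diff L T)
  ultimately have "\<bar>(LINT z|arc_measure left_edge. \<bar>fst (\<beta> z)\<bar> * face_trace E1 left_edge v z) - (LINT z|arc_measure top_edge. \<bar>snd (\<beta> z)\<bar> * face_trace E2 top_edge v z)\<bar> = \<bar>I\<bar>"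
    by (rule LIMSEQ_unique[rotated])
  also have "\<bar>I\<bar> \<le> B * sqrt (measure lebesgue Tri) * sqrt (\<Sum>b\<in>Basis. LINT z|lebesgue_on Tri. (weak_pderiv \<Omega> b v z)\<^sup>2)"
  proof -
    \<comment> \<open>The length of the gradient. Cauchy-Schwarz is used pointwise in the plane and
      once more against the constant 1, which yields the square root of the area.\<close>
    define G where "G z = sqrt ((p1 z)\<^sup>2 + (p2 z)\<^sup>2)" for z
    have pm: "p1 \<in> borel_measurable (lebesgue_on Tri)" "p2 \<in> borel_measurable (lebesgue_on Tri)"
      using p_sq by (auto simp: square_integrable_def)
    have G: "square_integrable (lebesgue_on Tri) G"
      unfolding square_integrable_def G_def using p_sq pm by (auto simp: square_integrable_def)
    have one: "square_integrable (lebesgue_on Tri) (\<lambda>z. 1)" by (rule square_integrable_Tri) simp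
    have G_int: "integrable (lebesgue_on Tri) (\<lambda>z. 1 * G z)" by (rule square_integrable_mult[OF one G])
    have B0: "B \<ge> 0"
    proof -
      have "(a, b) \<in> cTri" using c_pos by (simp add: cTri_def \<rho>_def)
      then show ?thesis using order_trans[OF norm_ge_zero B] by blast
    qed
    have "\<bar>I\<bar> \<le> (LINT z|lebesgue_on Tri. \<bar>p1 z * fst (\<beta> z) + p2 z * snd (\<beta> z)\<bar>)"
      unfolding I_def by (rule integral_abs_bound)
    also have "\<dots> \<le> (LINT z|lebesgue_on Tri. B * (1 * G z))"
    proof (rule integral_mono)
      fix z assume "z \<in> space (lebesgue_on Tri)"
      then have z: "z \<in> cTri" using Tri_subset_cTri by (auto simp: space_restrict_space)
      have "\<bar>(p1 z, p2 z) \<bullet> \<beta> z\<bar> \<le> norm (p1 z, p2 z) * norm (\<beta> z)" by (rule Cauchy_Schwarz_ineq2)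
      also have "\<dots> \<le> norm (p1 z, p2 z) * B" by (intro mult_left_mono B z) simp
      finally show "\<bar>p1 z * fst (\<beta> z) + p2 z * snd (\<beta> z)\<bar> \<le> B * (1 * G z)"
        by (simp add: inner_prod_def norm_Pair G_def mult.commute)
    qed (use ints G_int in auto)
    also have "\<dots> = B * (LINT z|lebesgue_on Tri. 1 * G z)" by (rule integral_mult_right_zero)
    also have "\<dots> \<le> B * (sqrt (LINT z|lebesgue_on Tri. 1\<^sup>2) * sqrt (LINT z|lebesgue_on Tri. (G z)\<^sup>2))"
      using order_trans[OF abs_ge_self square_integral_Cauchy_Schwarz[OF one G]] by (intro mult_left_mono B0)
    also have "(LINT z|lebesgue_on Tri. 1\<^sup>2) = measure lebesgue Tri"
      by (simp add: measure_restrict_space space_restrict_space)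
    also have "(LINT z|lebesgue_on Tri. (G z)\<^sup>2) = (LINT z|lebesgue_on Tri. (p1 z)\<^sup>2 + (p2 z)\<^sup>2)"
      by (simp add: G_def)
    also have "\<dots> = (\<Sum>b\<in>Basis. LINT z|lebesgue_on Tri. (weak_pderiv \<Omega> b v z)\<^sup>2)"
      unfolding sum_Basis_plane p1_def[symmetric] p2_def[symmetric]
      using p_sq by (intro Bochner_Integration.integral_add) (auto simp: square_integrable_def)
    finally show ?thesis by (simp add: mult.assoc)
  qed
  finally show ?thesis .
qed

end

section \<open>Geometry of the cut mesh\<close>

text \<open>A supporting line cuts out a face, and a face of a convex hull is spanned by generators.
  A face containing two points needs two of them. The lemma serves to count vertices of a cut
  cell.\<close>

lemma two_points_on_supporting_line:
  fixes C :: "'a::euclidean_space set"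
  assumes "finite C" and le: "\<And>z. z \<in> convex hull C \<Longrightarrow> l \<bullet> z \<le> m"
    and p: "p \<in> convex hull C" "l \<bullet> p = m" and q: "q \<in> convex hull C" "l \<bullet> q = m" and "p \<noteq> q"
  shows "card (C \<inter> {z. l \<bullet> z = m}) \<ge> 2"
proof -
  let ?F = "convex hull C \<inter> {z. l \<bullet> z = m}"
  have "?F face_of convex hull C"
    by (rule face_of_Int_supporting_hyperplane_le[OF convex_convex_hull le])
  then obtain S where S: "S \<subseteq> C" "?F = convex hull S"
    using face_of_convex_hull_subset[OF finite_imp_compact[OF assms(1)]] by metis
  have "S \<subseteq> ?F" unfolding S(2) by (rule hull_subset)
  then have sub: "S \<subseteq> C \<inter> {z. l \<bullet> z = m}" using S(1) by blast
  have "p \<in> convex hull S" "q \<in> convex hull S" using p q S(2) by auto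
  then have "\<not> card S \<le> 1"
    using \<open>p \<noteq> q\<close> finite_subset[OF S(1) assms(1)]
    by (metis card_le_Suc0_iff_eq One_nat_def convex_hull_eq_empty convex_hull_singleton empty_iff insert_iff
        equals0I subsetI subset_singleton_iff singletonD)
  then show ?thesis using card_mono[OF _ sub] assms(1) by auto
qed

text \<open>Two distinct points of the face fix the unit normal up to sign, and one point of the
  cell fixes the sign; the description in \<open>outer_normal\<close> is therefore unique.\<close>

lemma outer_normal_eqI:
  fixes n :: plane
  assumes n: "norm n = 1" and perp: "\<And>x y. x \<in> e \<Longrightarrow> y \<in> e \<Longrightarrow> n \<bullet> (y - x) = 0"
    and out: "\<And>x y. x \<in> e \<Longrightarrow> y \<in> E \<Longrightarrow> n \<bullet> (y - x) < 0"
    and pq: "p \<in> e" "q \<in> e" "p \<noteq> q" and r: "r \<in> E"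
  shows "outer_normal E e = n"
  unfolding outer_normal_def
proof (rule the_equality)
  show "norm n = 1 \<and> (\<forall>x\<in>e. \<forall>y\<in>e. n \<bullet> (y - x) = 0) \<and> (\<forall>x\<in>e. \<forall>y\<in>E. n \<bullet> (y - x) < 0)"
    using assms by blast
  fix m :: plane assume m: "norm m = 1 \<and> (\<forall>x\<in>e. \<forall>y\<in>e. m \<bullet> (y - x) = 0) \<and> (\<forall>x\<in>e. \<forall>y\<in>E. m \<bullet> (y - x) < 0)"
  obtain w1 w2 where w: "q - p = (w1, w2)" by (cases "q - p")
  obtain n1 n2 where nn: "n = (n1, n2)" by (cases n)
  obtain m1 m2 where mm: "m = (m1, m2)" by (cases m)
  have w0: "w1 \<noteq> 0 \<or> w2 \<noteq> 0" using w pq(3) by (auto simp: zero_prod_def[symmetric])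
  have "n \<bullet> (q - p) = 0" "m \<bullet> (q - p) = 0" using perp[OF pq(1,2)] m pq by auto
  then have 1: "n1 * w1 + n2 * w2 = 0" "m1 * w1 + m2 * w2 = 0" unfolding w nn mm by auto
  have "(n1 * m2 - n2 * m1) * w1 = 0" "(n1 * m2 - n2 * m1) * w2 = 0" using 1 by algebra+
  then have det: "n1 * m2 - n2 * m1 = 0" using w0 by auto
  have unit: "n1\<^sup>2 + n2\<^sup>2 = 1" "m1\<^sup>2 + m2\<^sup>2 = 1"
    using n m unfolding nn mm norm_Pair by (auto simp: real_sqrt_eq_1_iff)
  have "(n1 * m1 + n2 * m2)\<^sup>2 = 1" using det unit by algebra
  then have "n1 * m1 + n2 * m2 = 1 \<or> n1 * m1 + n2 * m2 = -1" by (simp add: power2_eq_1_iff)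
  then show "m = n"
  proof
    assume "n1 * m1 + n2 * m2 = 1"
    then have "(n1 - m1)\<^sup>2 + (n2 - m2)\<^sup>2 = 0" using unit by (simp add: power2_eq_square algebra_simps)
    then show ?thesis unfolding nn mm by (simp add: sum_power2_eq_zero_iff)
  next
    assume "n1 * m1 + n2 * m2 = -1"
    then have "(n1 + m1)\<^sup>2 + (n2 + m2)\<^sup>2 = 0" using unit by (simp add: power2_eq_square algebra_simps)
    then have "m = - n" unfolding nn mm by (auto simp: sum_power2_eq_zero_iff)
    moreover have "m \<bullet> (r - p) < 0" "n \<bullet> (r - p) < 0" using m out pq r by auto
    ultimately show ?thesis by simp
  qed
qed

lemma measure_lebesgue_open_pos:
  assumes "open S" "bounded S" "S \<noteq> {}"
  shows "measure lebesgue S > 0"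
proof -
  have "S \<in> lmeasurable" using assms by (simp add: lmeasurable_open)
  then have "measure lebesgue S \<noteq> 0" using open_not_negligible[OF assms(1,3)] negligible_iff_measure by blast
  then show ?thesis using measure_nonneg[of lebesgue S] by linarith
qed

locale ramp_mesh =
  fixes L x0 \<gamma> h :: real and N :: nat
  assumes L_pos: "0 < L" and x0: "0 < x0" "x0 < L" and \<gamma>: "0 < \<gamma>" "\<gamma> < pi / 2" and ramp_height: "(L - x0) * tan \<gamma> < L"
    and h_pos: "0 < h" and L_eq: "L = real N * h"
begin

abbreviation "\<Omega> \<equiv> ramp_domain L x0 \<gamma>"
abbreviation "T \<equiv> cut_mesh \<Omega> h N"
definition height :: "plane \<Rightarrow> real" where "height z = snd z - (fst z - x0) * tan \<gamma>"

lemma tan_pos: "tan \<gamma> > 0" using \<gamma> by (rule tan_gt_zero)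

lemma cos_pos: "cos \<gamma> > 0" using \<gamma> by (intro cos_gt_zero_pi) auto

lemma \<Omega>_eq: "\<Omega> = box (0, 0) (L, L) \<inter> {z. height z > 0}"
  by (auto simp: ramp_domain_def height_def box_plane)

lemma height_halfspace: "{z. height z > 0} = {z. (- tan \<gamma>, 1) \<bullet> z > - x0 * tan \<gamma>}"
  "{z. height z \<ge> 0} = {z. (- tan \<gamma>, 1) \<bullet> z \<ge> - x0 * tan \<gamma>}"
  by (auto simp: height_def algebra_simps)

lemma open_height: "open {z. height z > 0}" and convex_height: "convex {z. height z > 0}"
  unfolding height_halfspace by (rule open_halfspace_gt convex_halfspace_gt)+

text \<open>Closure commutes with intersection for open convex sets that meet. If they do not meet,
  the right-hand side may still contain boundary points.\<close>

lemma closure_box_height: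
  assumes "box a b \<inter> {z. height z > 0} \<noteq> {}"
  shows "closure (box a b \<inter> {z. height z > 0}) = cbox a b \<inter> {z. height z \<ge> 0}"
proof -
  have "closure (box a b \<inter> {z. height z > 0}) = closure (box a b) \<inter> closure {z. height z > 0}"
    using assms rel_interior_open[OF open_box[of a b]] rel_interior_open[OF open_height]
    by (intro closure_Int_convex convex_height convex_box) simp
  also have "closure {z. height z > 0} = {z. height z \<ge> 0}"
    unfolding height_halfspace by (rule closure_halfspace_gt) (simp add: zero_prod_def)
  also have "closure (box a b) = cbox a b" using assms by (intro closure_box) auto
  finally show ?thesis .
qed

lemma open_\<Omega>: "open \<Omega>" and convex_\<Omega>: "convex \<Omega>" and bounded_\<Omega>: "bounded \<Omega>"
  unfolding \<Omega>_eq by (auto intro: open_Int open_height convex_Int convex_box convex_height bounded_subset[OF bounded_box])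

lemma background_cell_eq: "background_cell h i j = box (real i * h, real j * h) (real i * h + h, real j * h + h)"
  by (simp add: background_cell_def algebra_simps)

lemma grid_le: "i < N \<Longrightarrow> real i * h + h \<le> L"
proof -
  assume "i < N"
  then have "(real i + 1) * h \<le> real N * h" using h_pos by (intro mult_right_mono) auto
  then show ?thesis by (simp add: L_eq algebra_simps)
qed

text \<open>Inside the grid the bounds of the big square hold automatically, so a cell is a box cut
  by one half plane.\<close>

lemma cell_eq:
  assumes "i < N" "j < N"
  shows "background_cell h i j \<inter> \<Omega> = box (real i * h, real j * h) (real i * h + h, real j * h + h) \<inter> {z. height z > 0}"
proof -
  have nn: "0 \<le> real i * h" "0 \<le> real j * h" using h_pos by auto
  show ?thesis
    using grid_le[OF assms(1)] grid_le[OF assms(2)] unfolding background_cell_eq \<Omega>_eq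
    by (auto simp: box_plane intro: le_less_trans[OF nn(1)] le_less_trans[OF nn(2)])
qed

lemma cellD:
  assumes "E \<in> T"
  obtains i j where "i < N" "j < N" "E = box (real i * h, real j * h) (real i * h + h, real j * h + h) \<inter> {z. height z > 0}"
    "E = background_cell h i j \<inter> \<Omega>" "E \<noteq> {}"
  using assms cell_eq unfolding cut_mesh_def by fastforce

lemma cellI:
  assumes "i < N" "j < N" "z \<in> box (real i * h, real j * h) (real i * h + h, real j * h + h)" "height z > 0"
  shows "background_cell h i j \<inter> \<Omega> \<in> T"
proof -
  have "measure lebesgue (background_cell h i j \<inter> \<Omega>) > 0"
  proof (rule measure_lebesgue_open_pos)
    show "background_cell h i j \<inter> \<Omega> \<noteq> {}" using assms(3,4) unfolding cell_eq[OF assms(1,2)] by blast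
    show "open (background_cell h i j \<inter> \<Omega>)" unfolding cell_eq[OF assms(1,2)] by (intro open_Int open_box open_height)
    show "bounded (background_cell h i j \<inter> \<Omega>)" using bounded_\<Omega> by (rule bounded_subset) auto
  qed
  then show ?thesis unfolding cut_mesh_def using assms by blast
qed

lemma finite_T: "finite T"
proof -
  have "T \<subseteq> (\<lambda>(i, j). background_cell h i j \<inter> \<Omega>) ` ({..<N} \<times> {..<N})"
    unfolding cut_mesh_def by auto
  then show ?thesis by (rule finite_subset) auto
qed

lemma open_cell: "E \<in> T \<Longrightarrow> open E" and cell_subset: "E \<in> T \<Longrightarrow> E \<subseteq> \<Omega>"
  by (auto elim!: cellD simp: open_Int open_height)

lemma grid_unique:
  assumes "real i * h < x" "x < real i * h + h" "real k * h < x" "x < real k * h + h"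
  shows "i = k"
proof -
  have "real i * h < (real k + 1) * h" "real k * h < (real i + 1) * h" using assms by (simp_all add: algebra_simps)
  then have "real i < real k + 1" "real k < real i + 1" using h_pos by auto
  then show ?thesis by linarith
qed

lemma cells_disjoint:
  assumes "E \<in> T" "E' \<in> T" "z \<in> E" "z \<in> E'" shows "E = E'"
proof -
  obtain i j where E: "E = box (real i * h, real j * h) (real i * h + h, real j * h + h) \<inter> {z. height z > 0}" using cellD[OF assms(1)] by metis
  obtain i' j' where E': "E' = box (real i' * h, real j' * h) (real i' * h + h, real j' * h + h) \<inter> {z. height z > 0}" using cellD[OF assms(2)] by metis
  have "i = i'" by (rule grid_unique[of _ "fst z"]) (use assms(3,4) E E' in \<open>auto simp: box_plane\<close>)
  moreover have "j = j'" by (rule grid_unique[of _ "snd z"]) (use assms(3,4) E E' in \<open>auto simp: box_plane\<close>)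
  ultimately show ?thesis using E E' by simp
qed

text \<open>Vertex counting. If the lower left corner lay above the ramp, both horizontal sides of
  the box would contain two points of the closed cell and hence two vertices each, four in total.
  The upper right corner is excluded in the same way with the vertical sides.\<close>

lemma triangle_cell_corners:
  assumes E: "E = box (a, b - h) (a + h, b) \<inter> {z. height z > 0}" "E \<noteq> {}" and simplex: "2 simplex (closure E)"
  shows "height (a, b) > 0" "height (a, b - h) \<le> 0" "height (a + h, b) \<le> 0"
proof -
  have cl: "closure E = cbox (a, b - h) (a + h, b) \<inter> {z. height z \<ge> 0}"
    using closure_box_height E by simp
  obtain z where z: "z \<in> E" using E(2) by blast
  have "a < fst z" "snd z < b" "height z > 0" using z by (auto simp: E(1) box_plane)
  then show pos: "height (a, b) > 0"
    using mult_strict_right_mono[OF \<open>a < fst z\<close> tan_pos] by (simp add: height_def left_diff_distrib)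
  obtain C where C: "finite C" "card C = 3" "closure E = convex hull C"
    using simplex unfolding simplex_def by (metis aff_independent_finite int_eq_iff_numeral one_plus_numeral semiring_norm(3) Num.of_nat_simps(5) add.commute)
  have in_cl: "(x, y) \<in> closure E \<longleftrightarrow> a \<le> x \<and> x \<le> a + h \<and> b - h \<le> y \<and> y \<le> b \<and> height (x, y) \<ge> 0" for x y
    unfolding cl by (auto simp: cbox_Pair_eq)
  have contra: False
    if l: "\<And>z. z \<in> closure E \<Longrightarrow> l \<bullet> z \<le> m" "\<And>z. z \<in> closure E \<Longrightarrow> l' \<bullet> z \<le> m'" and disj: "\<And>z. l \<bullet> z = m \<Longrightarrow> l' \<bullet> z \<noteq> m'"
      and p: "p \<in> closure E" "l \<bullet> p = m" "q \<in> closure E" "l \<bullet> q = m" "p \<noteq> q"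
      and p': "p' \<in> closure E" "l' \<bullet> p' = m'" "q' \<in> closure E" "l' \<bullet> q' = m'" "p' \<noteq> q'" for l l' m m' and p q p' q' :: plane
  proof -
    have "card (C \<inter> {z. l \<bullet> z = m}) \<ge> 2" "card (C \<inter> {z. l' \<bullet> z = m'}) \<ge> 2"
      using two_points_on_supporting_line[OF C(1)] l p p' unfolding C(3) by blast+
    moreover have "card (C \<inter> {z. l \<bullet> z = m}) + card (C \<inter> {z. l' \<bullet> z = m'}) = card (C \<inter> {z. l \<bullet> z = m} \<union> C \<inter> {z. l' \<bullet> z = m'})"
      using C(1) disj by (intro card_Un_disjoint[symmetric]) auto
    moreover have "\<dots> \<le> card C" using C(1) by (intro card_mono) auto
    ultimately show False using C(2) by linarith
  qed
  show "height (a, b - h) \<le> 0"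
  proof (rule ccontr)
    assume "\<not> height (a, b - h) \<le> 0"
    then have H: "height (a, b - h) > 0" by simp
    \<comment> \<open>A step to the right by \<epsilon> lowers the height by \<epsilon> tan
      \<gamma>, so the shifted points stay on or above the ramp.\<close>
    define \<epsilon> where "\<epsilon> = min h (height (a, b - h) / tan \<gamma>)"
    have \<epsilon>: "\<epsilon> > 0" "\<epsilon> \<le> h" using H h_pos tan_pos by (auto simp: \<epsilon>_def)
    have "\<epsilon> \<le> height (a, b - h) / tan \<gamma>" by (simp add: \<epsilon>_def)
    then have "\<epsilon> * tan \<gamma> \<le> height (a, b - h)" using tan_pos by (simp add: le_divide_eq)
    then have 1: "height (a + \<epsilon>, b - h) \<ge> 0" by (simp add: height_def algebra_simps)
    then have 2: "height (a + \<epsilon>, b) \<ge> 0" using h_pos by (simp add: height_def)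
    show False
    proof (rule contra[of "(0, 1)" b "(0, -1)" "h - b" "(a, b)" "(a + \<epsilon>, b)" "(a, b - h)" "(a + \<epsilon>, b - h)"])
    qed (use \<epsilon> 1 2 H pos h_pos in \<open>auto simp: in_cl\<close>)
  qed
  show "height (a + h, b) \<le> 0"
  proof (rule ccontr)
    assume "\<not> height (a + h, b) \<le> 0"
    then have H: "height (a + h, b) > 0" by simp
    define \<epsilon> where "\<epsilon> = min h (height (a + h, b))"
    have \<epsilon>: "\<epsilon> > 0" "\<epsilon> \<le> h" using H h_pos by (auto simp: \<epsilon>_def)
    have 1: "height (a + h, b - \<epsilon>) \<ge> 0" by (simp add: height_def \<epsilon>_def min_def)
    have "h * tan \<gamma> > 0" using h_pos tan_pos by simp
    then have 2: "height (a, b - \<epsilon>) \<ge> 0" using 1 by (simp add: height_def algebra_simps)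
    show False
    proof (rule contra[of "(-1, 0)" "- a" "(1, 0)" "a + h" "(a, b)" "(a, b - \<epsilon>)" "(a + h, b)" "(a + h, b - \<epsilon>)"])
    qed (use \<epsilon> 1 2 H pos h_pos in \<open>auto simp: in_cl\<close>)
  qed
qed

end

section \<open>Edges, outer normals and leg integrals of the triangle\<close>

context corner_triangle begin

definition hypotenuse where "hypotenuse = closed_segment (a, b - c) (a + c / t, b)"

lemma convex_cTri: "convex cTri"
proof -
  have "cTri = {z. (-1, 0) \<bullet> z \<le> - a} \<inter> {z. (0, 1) \<bullet> z \<le> b} \<inter> {z. (- t, 1) \<bullet> z \<ge> b - c - t * a}"
    by (auto simp: cTri_def \<rho>_def algebra_simps)
  then show ?thesis by (simp add: convex_Int convex_halfspace_le convex_halfspace_ge)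
qed

lemma cTri_hull: "cTri = convex hull {(a, b), (a, b - c), (a + c / t, b)}"
proof
  show "cTri \<subseteq> convex hull {(a, b), (a, b - c), (a + c / t, b)}"
  proof
    fix z assume z: "z \<in> cTri"
    \<comment> \<open>Barycentric coordinates: each is the normalised distance to the edge opposite
      its vertex.\<close>
    define u where "u = \<rho> z / c"
    define v where "v = (b - snd z) / c"
    define w where "w = (fst z - a) * t / c"
    have "0 \<le> u" "0 \<le> v" "0 \<le> w" using z c_pos t_pos by (auto simp: u_def v_def w_def cTri_def)
    moreover have sum: "u + v + w = 1" using c_pos by (simp add: u_def v_def w_def \<rho>_def field_simps)
    moreover have "z = u *\<^sub>R (a, b) + v *\<^sub>R (a, b - c) + w *\<^sub>R (a + c / t, b)"
    proof (rule prod_eqI)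
      have "fst (u *\<^sub>R (a, b) + v *\<^sub>R (a, b - c) + w *\<^sub>R (a + c / t, b)) = (u + v + w) * a + w * (c / t)" by (simp add: algebra_simps)
      also have "\<dots> = fst z" unfolding sum using c_pos t_pos by (simp add: w_def)
      finally show "fst z = fst (u *\<^sub>R (a, b) + v *\<^sub>R (a, b - c) + w *\<^sub>R (a + c / t, b))" ..
      have "snd (u *\<^sub>R (a, b) + v *\<^sub>R (a, b - c) + w *\<^sub>R (a + c / t, b)) = (u + v + w) * b - v * c" by (simp add: algebra_simps)
      also have "\<dots> = snd z" unfolding sum using c_pos by (simp add: v_def)
      finally show "snd z = snd (u *\<^sub>R (a, b) + v *\<^sub>R (a, b - c) + w *\<^sub>R (a + c / t, b))" ..
    qed
    ultimately show "z \<in> convex hull {(a, b), (a, b - c), (a + c / t, b)}" unfolding convex_hull_3 by blast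
  qed
  have "{(a, b), (a, b - c), (a + c / t, b)} \<subseteq> cTri"
    using c_pos t_pos by (auto simp: cTri_def \<rho>_def)
  then show "convex hull {(a, b), (a, b - c), (a + c / t, b)} \<subseteq> cTri"
    using convex_cTri by (rule hull_minimal)
qed

lemma corners_independent: "\<not> affine_dependent {(a, b), (a, b - c), (a + c / t, b)}"
proof -
  have "independent {(0, - c), (c / t, 0)}"
    using c_pos t_pos by (intro pairwise_orthogonal_independent) (auto simp: pairwise_def orthogonal_def zero_prod_def)
  moreover have "(\<lambda>x. - (a, b) + x) ` {(a, b - c), (a + c / t, b)} = {(0, - c), (c / t, 0)}" by simp
  moreover have "(a, b) \<notin> {(a, b - c), (a + c / t, b)}" using c_pos t_pos by auto
  ultimately show ?thesis using affine_dependent_iff_dependent[of "(a, b)" "{(a, b - c), (a + c / t, b)}"] by (simp add: dependent_def[symmetric])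
qed

text \<open>Faces of a simplex are the hulls of subsets of its vertices, and dimension one selects
  the pairs.\<close>

lemma edges_cTri: "e edge_of cTri \<longleftrightarrow> e \<in> {left_edge, top_edge, hypotenuse}"
proof -
  let ?A = "(a, b)" and ?P = "(a, b - c)" and ?Q = "(a + c / t, b)"
  have distinct: "?A \<noteq> ?P" "?A \<noteq> ?Q" "?P \<noteq> ?Q" using c_pos t_pos by auto
  have sub: "S \<subseteq> {?A, ?P, ?Q} \<Longrightarrow> aff_dim (convex hull S) = int (card S) - 1" for S
    using affine_independent_subset[OF corners_independent] by (simp add: aff_dim_convex_hull aff_dim_affine_independent)
  have hulls: "convex hull {?A, ?P} = left_edge" "convex hull {?A, ?Q} = top_edge" "convex hull {?P, ?Q} = hypotenuse"
    by (simp_all add: left_edge_def top_edge_def hypotenuse_def segment_convex_hull)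
  show ?thesis
  proof
    assume e: "e edge_of cTri"
    then obtain S where S: "S \<subseteq> {?A, ?P, ?Q}" "e = convex hull S"
      unfolding edge_of_def cTri_hull using face_of_convex_hull_affine_independent[OF corners_independent] by blast
    have "card S = 2" using e sub[OF S(1)] unfolding edge_of_def S(2) by simp
    then obtain p q where "S = {p, q}" "p \<noteq> q" by (auto simp: card_2_iff)
    then have "S = {?A, ?P} \<or> S = {?A, ?Q} \<or> S = {?P, ?Q}" using S(1) by blast
    then show "e \<in> {left_edge, top_edge, hypotenuse}" using S(2) hulls by auto
  next
    have edge: "(convex hull S) edge_of cTri" if "S \<subseteq> {?A, ?P, ?Q}" "card S = 2" for S
      unfolding edge_of_def using face_of_convex_hull_affine_independent[OF corners_independent] sub[OF that(1)] that
      unfolding cTri_hull by auto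
    assume "e \<in> {left_edge, top_edge, hypotenuse}"
    then show "e edge_of cTri" unfolding hulls[symmetric] using edge distinct by auto
  qed
qed

lemma Tri_nonempty: "(a + c / (4 * t), b - c / 4) \<in> Tri"
  using c_pos t_pos by (simp add: Tri_def \<rho>_def)

lemma outer_normal_left: "outer_normal Tri left_edge = (-1, 0)"
proof (rule outer_normal_eqI[where p="(a, b)" and q="(a, b - c)"])
  show "(-1, 0) \<bullet> (y - x) = 0" if "x \<in> left_edge" "y \<in> left_edge" for x y
    using mem_leftD[OF that(1)] mem_leftD[OF that(2)] by (simp add: inner_prod_def)
  show "(-1, 0) \<bullet> (y - x) < 0" if "x \<in> left_edge" "y \<in> Tri" for x y
    using mem_leftD[OF that(1)] that(2) by (simp add: inner_prod_def Tri_def)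
qed (use c_pos Tri_nonempty in \<open>auto simp: left_edge_def\<close>)

lemma outer_normal_top: "outer_normal Tri top_edge = (0, 1)"
proof (rule outer_normal_eqI[where p="(a, b)" and q="(a + c / t, b)"])
  show "(0, 1) \<bullet> (y - x) = 0" if "x \<in> top_edge" "y \<in> top_edge" for x y
    using mem_topD[OF that(1)] mem_topD[OF that(2)] by (simp add: inner_prod_def)
  show "(0, 1) \<bullet> (y - x) < 0" if "x \<in> top_edge" "y \<in> Tri" for x y
    using mem_topD[OF that(1)] that(2) by (simp add: inner_prod_def Tri_def)
qed (use c_pos t_pos Tri_nonempty in \<open>auto simp: top_edge_def\<close>)

lemma hypotenuse_subset: "hypotenuse \<subseteq> cTri \<inter> {z. \<rho> z = 0}"
proof -
  have "convex {z. \<rho> z = 0}"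
  proof -
    have "{z. \<rho> z = 0} = {z. (- t, 1) \<bullet> z = b - c - t * a}" by (auto simp: \<rho>_def algebra_simps)
    then show ?thesis by (simp add: convex_hyperplane)
  qed
  then show ?thesis unfolding hypotenuse_def using c_pos t_pos
    by (intro closed_segment_subset convex_Int convex_cTri) (auto simp: cTri_def \<rho>_def)
qed

lemma outer_normal_hypotenuse: "outer_normal Tri hypotenuse = (1 / sqrt (t\<^sup>2 + 1)) *\<^sub>R (t, -1)"
proof (rule outer_normal_eqI[where p="(a, b - c)" and q="(a + c / t, b)"])
  have pos: "sqrt (t\<^sup>2 + 1) > 0" by (simp add: add_nonneg_pos)
  have eq: "(1 / sqrt (t\<^sup>2 + 1)) *\<^sub>R (t, -1) \<bullet> (y - x) = - (\<rho> y - \<rho> x) / sqrt (t\<^sup>2 + 1)" for x y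
    by (simp add: \<rho>_def inner_prod_def algebra_simps add_divide_distrib diff_divide_distrib)
  show "(1 / sqrt (t\<^sup>2 + 1)) *\<^sub>R (t, -1) \<bullet> (y - x) = 0" if "x \<in> hypotenuse" "y \<in> hypotenuse" for x y
  proof -
    have "\<rho> x = 0" "\<rho> y = 0" using that hypotenuse_subset by blast+
    then show ?thesis unfolding eq by simp
  qed
  show "(1 / sqrt (t\<^sup>2 + 1)) *\<^sub>R (t, -1) \<bullet> (y - x) < 0" if "x \<in> hypotenuse" "y \<in> Tri" for x y
  proof -
    have "\<rho> x = 0" "\<rho> y > 0" using that hypotenuse_subset by (blast, simp add: Tri_def)
    then show ?thesis unfolding eq using pos by (intro divide_neg_pos) auto
  qed
  have "norm (t, -1 :: real) = sqrt (t\<^sup>2 + 1)" by (simp add: norm_Pair)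
  then show "norm ((1 / sqrt (t\<^sup>2 + 1)) *\<^sub>R (t, -1 :: real)) = 1" unfolding norm_scaleR using pos by simp
qed (use c_pos t_pos Tri_nonempty in \<open>auto simp: hypotenuse_def\<close>)

lemma rel_interior_left: "rel_interior left_edge = open_segment (a, b) (a, b - c)"
  by (simp only: left_edge_def rel_interior_closed_segment left_neq if_False)

lemma rel_interior_top: "rel_interior top_edge = open_segment (a, b) (a + c / t, b)"
  by (simp only: top_edge_def rel_interior_closed_segment top_neq if_False)

lemma closure_rel_interior_left: "closure (rel_interior left_edge) = left_edge"
  unfolding rel_interior_left by (simp only: left_edge_def closure_open_segment left_neq if_False)

lemma closure_rel_interior_top: "closure (rel_interior top_edge) = top_edge"
  unfolding rel_interior_top by (simp only: top_edge_def closure_open_segment top_neq if_False)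

text \<open>Signs of the normal velocity are prescribed on relative interiors only; continuity
  carries the weak inequality to the end points.\<close>

lemma nonneg_on_left:
  fixes g :: "plane \<Rightarrow> real"
  assumes "continuous_on left_edge g" "\<And>z. z \<in> rel_interior left_edge \<Longrightarrow> 0 \<le> g z" "z \<in> left_edge"
  shows "0 \<le> g z"
  using continuous_ge_on_closure[of "rel_interior left_edge" g z 0] assms by (simp add: closure_rel_interior_left)

lemma nonneg_on_top:
  fixes g :: "plane \<Rightarrow> real"
  assumes "continuous_on top_edge g" "\<And>z. z \<in> rel_interior top_edge \<Longrightarrow> 0 \<le> g z" "z \<in> top_edge"
  shows "0 \<le> g z"
  using continuous_ge_on_closure[of "rel_interior top_edge" g z 0] assms by (simp add: closure_rel_interior_top)

lemma interval_integral_pos: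
  fixes g :: "real \<Rightarrow> real"
  assumes "integrable lborel (\<lambda>s. indicator {0..d} s * g s)" "d > 0" "\<And>s. s \<in> {0..d} \<Longrightarrow> 0 \<le> g s" "\<And>s. 0 < s \<Longrightarrow> s < d \<Longrightarrow> g s > 0"
  shows "(LINT s|lborel. indicator {0..d} s * g s) > 0"
proof -
  have nn: "0 \<le> indicator {0..d} s * g s" for s using assms(3) by (simp add: indicator_def)
  have "(LINT s|lborel. indicator {0..d} s * g s) \<noteq> 0"
  proof
    assume "(LINT s|lborel. indicator {0..d} s * g s) = 0"
    then have "AE s in lborel. indicator {0..d} s * g s = 0"
      using integral_nonneg_eq_0_iff_AE[OF assms(1)] nn by simp
    then have "AE s in lborel. s \<notin> {0<..<d}"
      by eventually_elim (use assms(4) in \<open>force simp: indicator_def\<close>)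
    then have "emeasure lborel {0<..<d} = 0"
      by (subst (asm) AE_iff_measurable[of "{0<..<d}"]) auto
    then show False using assms(2) by simp
  qed
  moreover have "(LINT s|lborel. indicator {0..d} s * g s) \<ge> 0" using nn by simp
  ultimately show ?thesis by linarith
qed

lemma mem_rel_interior_left: "0 < s \<Longrightarrow> s < c \<Longrightarrow> (a, b - s) \<in> rel_interior left_edge"
  unfolding rel_interior_left in_segment using c_pos
  by (intro conjI exI[of _ "s / c"]) (auto simp: field_simps)

lemma mem_rel_interior_top: "0 < u \<Longrightarrow> u < c / t \<Longrightarrow> (a + u, b) \<in> rel_interior top_edge"
  unfolding rel_interior_top in_segment using c_pos t_pos
  by (intro conjI exI[of _ "u * t / c"]) (auto simp: field_simps)

lemma integral_left_pos:
  fixes g :: "plane \<Rightarrow> real"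
  assumes g: "continuous_on left_edge g" "\<And>z. z \<in> rel_interior left_edge \<Longrightarrow> 0 < g z"
  shows "(LINT z|arc_measure left_edge. g z) > 0"
  unfolding integral_left[OF g(1)]
proof (rule interval_integral_pos[OF _ c_pos])
  have "linepath (a, b) (a, b - c) (s / c) = (a, b - s)" for s
    using c_pos by (simp add: linepath_def prod_eq_iff algebra_simps)
  then show "integrable lborel (\<lambda>s. indicator {0..c} s * g (a, b - s))"
    using square_integrable_arc_measure(2)[OF left_neq g(1)[unfolded left_edge_def]]
      integrable_arc_measure[OF left_neq continuous_on_segment_measurable[OF g(1)[unfolded left_edge_def]]]
    unfolding dist_left by simp
  show "0 \<le> g (a, b - s)" if "s \<in> {0..c}" for s
    by (rule nonneg_on_left[OF g(1)]) (use g(2) that in \<open>auto simp: left_eq less_imp_le\<close>)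
  show "g (a, b - s) > 0" if "0 < s" "s < c" for s using g(2) mem_rel_interior_left[OF that] .
qed

lemma integral_top_pos:
  fixes g :: "plane \<Rightarrow> real"
  assumes g: "continuous_on top_edge g" "\<And>z. z \<in> rel_interior top_edge \<Longrightarrow> 0 < g z"
  shows "(LINT z|arc_measure top_edge. g z) > 0"
  unfolding integral_top[OF g(1)]
proof (rule interval_integral_pos)
  have "linepath (a, b) (a + c / t, b) (u / (c / t)) = (a + u, b)" for u
    using c_pos t_pos by (simp add: linepath_def prod_eq_iff field_simps)
  then show "integrable lborel (\<lambda>u. indicator {0..c / t} u * g (a + u, b))"
    using square_integrable_arc_measure(2)[OF top_neq g(1)[unfolded top_edge_def]]
      integrable_arc_measure[OF top_neq continuous_on_segment_measurable[OF g(1)[unfolded top_edge_def]]]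
    unfolding dist_top by simp
  show "0 \<le> g (a + u, b)" if "u \<in> {0..c / t}" for u
    by (rule nonneg_on_top[OF g(1)]) (use g(2) that in \<open>auto simp: top_eq less_imp_le\<close>)
  show "g (a + u, b) > 0" if "0 < u" "u < c / t" for u using g(2) mem_rel_interior_top[OF that] .
qed (use c_pos t_pos in simp)

end

section \<open>Triangular cut cells and their neighbours\<close>

locale ramp_flow = ramp_mesh +
  fixes \<beta> :: "plane \<Rightarrow> plane" and M :: real
  assumes Lip: "M-lipschitz_on (closure \<Omega>) \<beta>"
    and div: "has_weak_divergence \<Omega> \<beta> (\<lambda>x. 0)"
    and no_penetration: "\<forall>x\<in>ramp L x0 \<gamma>. \<beta> x \<bullet> (sin \<gamma>, - cos \<gamma>) = 0"
    and no_stagnation: "\<forall>x\<in>ramp L x0 \<gamma>. \<beta> x \<noteq> 0"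
    and constant_sign: "\<forall>E\<in>T. \<forall>e\<in>cell_faces E. \<exists>s. \<forall>x\<in>rel_interior e. sgn (\<beta> x \<bullet> outer_normal E e) = s"

locale cut_cell = ramp_flow +
  fixes i j :: nat
  assumes ij: "i < N" "j < N"
    and cell: "background_cell h i j \<inter> \<Omega> \<in> T"
    and simplex: "2 simplex (closure (background_cell h i j \<inter> \<Omega>))"
begin

definition "a = real i * h"
definition "b = real j * h + h"
definition "c = height (a, b)"
abbreviation "E \<equiv> background_cell h i j \<inter> \<Omega>"

lemma E_box: "E = box (a, b - h) (a + h, b) \<inter> {z. height z > 0}"
  using cell_eq[OF ij] by (simp add: a_def b_def)

lemma E_nonempty: "E \<noteq> {}"
  using cell by (auto elim: cellD)

lemma corners: "c > 0" "height (a, b - h) \<le> 0" "height (a + h, b) \<le> 0"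
  using triangle_cell_corners[OF E_box E_nonempty simplex] by (auto simp: c_def)

lemma c_le: "c \<le> h" "c \<le> h * tan \<gamma>"
  using corners(2,3) by (auto simp: c_def height_def algebra_simps)

lemma c_div_le: "c / tan \<gamma> \<le> h"
  using c_le(2) tan_pos by (simp add: divide_le_eq)

text \<open>The ramp starts at \<open>x0\<close>, which is positive, so in the first column every
  lower left corner lies above its line. Hence a column \<open>i - 1\<close> exists.\<close>

lemma a_pos: "a > 0" and i_pos: "i \<ge> 1"
proof -
  show "i \<ge> 1"
  proof (rule ccontr)
    assume "\<not> i \<ge> 1"
    then have "a = 0" unfolding a_def by simp
    then have "x0 * tan \<gamma> \<le> - (real j * h)" using corners(2) by (simp add: height_def b_def)
    moreover have "x0 * tan \<gamma> > 0" "real j * h \<ge> 0" using x0 tan_pos h_pos by auto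
    ultimately show False by linarith
  qed
  then show "a > 0" using h_pos by (simp add: a_def)
qed

text \<open>The ramp leaves the square below its upper right corner, so no triangle touches the top
  side and a row \<open>j + 1\<close> exists.\<close>

lemma b_less: "b < L" and j_less: "j + 1 < N"
proof -
  show "j + 1 < N"
  proof (rule ccontr)
    assume "\<not> j + 1 < N"
    then have "j + 1 = N" using ij by simp
    then have b: "b = L" using L_eq by (auto simp: b_def algebra_simps)
    have "(a + h - x0) * tan \<gamma> \<le> (L - x0) * tan \<gamma>"
      using grid_le[OF ij(1)] tan_pos by (intro mult_right_mono) (auto simp: a_def)
    then have "height (a + h, b) > 0" using ramp_height b by (simp add: height_def)
    then show False using corners(3) by simp
  qed
  then have "real (j + 1) < real N" by simp
  then have "real (j + 1) * h < real N * h" using h_pos by (intro mult_strict_right_mono) auto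
  then show "b < L" using L_eq by (simp add: b_def algebra_simps)
qed

sublocale tri: corner_triangle a b "tan \<gamma>" c
  by unfold_locales (use tan_pos corners in auto)

lemma \<rho>_height: "tri.\<rho> z = height z"
  unfolding tri.\<rho>_def unfolding c_def height_def by (simp add: algebra_simps)

lemma cTri_cases:
  assumes "z \<in> tri.cTri"
  shows "a \<le> fst z" "fst z \<le> a + h" "b - h \<le> snd z" "snd z \<le> b" "height z \<ge> 0"
  using tri.cTri_bounds[OF assms] c_le(1) c_div_le assms by (auto simp: tri.cTri_def \<rho>_height)

text \<open>The legs are no longer than \<open>h\<close>, so two sides of the background square are
  implied by the other constraints. This identifies the cell with the triangle.\<close>

lemma below_diagonal:
  assumes "a \<le> fst z" "snd z \<le> b" "height z > 0"
  shows "fst z < a + h" "snd z > b - h"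
proof -
  have "(fst z - a) * tan \<gamma> \<ge> 0" using assms(1) tan_pos by simp
  moreover have eq: "c = height z + (b - snd z) + (fst z - a) * tan \<gamma>" by (simp add: c_def height_def algebra_simps)
  ultimately show "snd z > b - h" using assms(3) c_le(1) by linarith
  have "(fst z - a) * tan \<gamma> < h * tan \<gamma>" using eq assms(2,3) c_le(2) by linarith
  then show "fst z < a + h" using tan_pos by simp
qed

lemma E_Tri: "E = tri.Tri"
proof -
  have "z \<in> box (a, b - h) (a + h, b) \<inter> {z. height z > 0} \<longleftrightarrow> z \<in> tri.Tri" for z
    unfolding tri.Tri_def using below_diagonal[of z] by (auto simp: box_plane \<rho>_height)
  then show ?thesis unfolding E_box by blast
qed

lemma closure_E: "closure E = tri.cTri"
proof -
  have "closure E = cbox (a, b - h) (a + h, b) \<inter> {z. height z \<ge> 0}"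
    unfolding E_box by (rule closure_box_height) (use E_box E_nonempty in simp)
  also have "\<dots> = tri.cTri"
  proof
    show "tri.cTri \<subseteq> cbox (a, b - h) (a + h, b) \<inter> {z. height z \<ge> 0}"
    proof
      fix z assume "z \<in> tri.cTri"
      from cTri_cases[OF this] show "z \<in> cbox (a, b - h) (a + h, b) \<inter> {z. height z \<ge> 0}"
        by (cases z) (simp add: cbox_Pair_eq)
    qed
  qed (auto simp: cbox_Pair_eq tri.cTri_def \<rho>_height)
  finally show ?thesis .
qed

lemma Tri_interior: "tri.cTri \<inter> {z. 0 < tri.\<rho> z} \<subseteq> \<Omega>"
proof
  fix z assume "z \<in> tri.cTri \<inter> {z. 0 < tri.\<rho> z}"
  then have z: "z \<in> tri.cTri" "height z > 0" by (auto simp: \<rho>_height)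
  note bd = cTri_cases[OF z(1)] below_diagonal[OF cTri_cases(1)[OF z(1)] cTri_cases(4)[OF z(1)] z(2)]
  have "a + h \<le> L" "b - h \<ge> 0" using grid_le[OF ij(1)] h_pos by (auto simp: a_def b_def)
  then show "z \<in> \<Omega>" unfolding \<Omega>_eq using bd a_pos b_less z(2) by (auto simp: box_plane)
qed

lemma cTri_closure_\<Omega>: "tri.cTri \<subseteq> closure \<Omega>"
  using closure_mono[of E \<Omega>] unfolding closure_E by auto

lemma ramp_point:
  assumes "z \<in> tri.cTri" "tri.\<rho> z = 0" shows "z \<in> ramp L x0 \<gamma>"
proof -
  have h0: "height z = 0" using assms(2) by (simp add: \<rho>_height)
  then have "z \<notin> \<Omega>" by (simp add: \<Omega>_eq)
  then have "z \<in> frontier \<Omega>" using assms(1) cTri_closure_\<Omega> open_\<Omega> by (auto simp: frontier_def interior_open)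
  then show ?thesis using h0 by (cases z) (simp add: ramp_def height_def)
qed

lemma tangential: "z \<in> tri.cTri \<Longrightarrow> tri.\<rho> z = 0 \<Longrightarrow> snd (\<beta> z) = tan \<gamma> * fst (\<beta> z)"
proof -
  assume "z \<in> tri.cTri" "tri.\<rho> z = 0"
  then have "\<beta> z \<bullet> (sin \<gamma>, - cos \<gamma>) = 0" using no_penetration ramp_point by blast
  then have "fst (\<beta> z) * sin \<gamma> = snd (\<beta> z) * cos \<gamma>" by (simp add: inner_prod_def)
  then show ?thesis using cos_pos by (simp add: tan_def field_simps)
qed

sublocale tri: triangle_flow a b "tan \<gamma>" c \<Omega> \<beta> M
  by unfold_locales (use open_\<Omega> Tri_interior cTri_closure_\<Omega> Lip div tangential in auto)

lemma faces: "cell_faces E = {tri.left_edge, tri.top_edge, tri.hypotenuse}"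
  unfolding cell_faces_def closure_E using tri.edges_cTri by auto

lemma normals: "outer_normal E tri.left_edge = (-1, 0)" "outer_normal E tri.top_edge = (0, 1)"
  unfolding E_Tri by (rule tri.outer_normal_left tri.outer_normal_top)+

lemma hypotenuse_flux: "x \<in> tri.hypotenuse \<Longrightarrow> \<beta> x \<bullet> outer_normal E tri.hypotenuse = 0"
proof -
  assume "x \<in> tri.hypotenuse"
  then have "x \<in> tri.cTri" "tri.\<rho> x = 0" using tri.hypotenuse_subset by auto
  then have "snd (\<beta> x) = tan \<gamma> * fst (\<beta> x)" by (rule tangential)
  then show ?thesis unfolding E_Tri tri.outer_normal_hypotenuse by (simp add: inner_prod_def)
qed

lemma \<beta>_left: "continuous_on tri.left_edge (\<lambda>z. fst (\<beta> z))" and \<beta>_top: "continuous_on tri.top_edge (\<lambda>z. snd (\<beta> z))"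
  using continuous_on_subset[OF tri.continuous_\<beta> tri.left_subset] continuous_on_subset[OF tri.continuous_\<beta> tri.top_subset]
  by (auto intro: continuous_intros)

lemma rel_interiors_nonempty:
  obtains x1 x2 x3 where "x1 \<in> rel_interior tri.left_edge" "x2 \<in> rel_interior tri.top_edge" "x3 \<in> rel_interior tri.hypotenuse"
proof -
  have "rel_interior tri.left_edge \<noteq> {}" "rel_interior tri.top_edge \<noteq> {}" "rel_interior tri.hypotenuse \<noteq> {}"
    by (simp_all add: tri.left_edge_def tri.top_edge_def tri.hypotenuse_def rel_interior_eq_empty)
  then show thesis using that by blast
qed

text \<open>The two signs agree: both are constant, no flux crosses the hypotenuse, and the fluxes through the legs
  balance. Neither vanishes, because \<open>\<beta>\<close> would then be zero at an end point of the hypotenuse.\<close>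

lemma signs:
  "(\<forall>z\<in>rel_interior tri.left_edge. fst (\<beta> z) > 0) \<and> (\<forall>z\<in>rel_interior tri.top_edge. snd (\<beta> z) > 0) \<or>
   (\<forall>z\<in>rel_interior tri.left_edge. fst (\<beta> z) < 0) \<and> (\<forall>z\<in>rel_interior tri.top_edge. snd (\<beta> z) < 0)"
proof -
  note sign_E = bspec[OF constant_sign cell]
  have mem: "tri.left_edge \<in> cell_faces E" "tri.top_edge \<in> cell_faces E" unfolding faces by simp_all
  obtain s1 where "\<And>x. x \<in> rel_interior tri.left_edge \<Longrightarrow> sgn (\<beta> x \<bullet> outer_normal E tri.left_edge) = s1"
    using bspec[OF sign_E mem(1)] by blast
  then have "\<And>x. x \<in> rel_interior tri.left_edge \<Longrightarrow> sgn (- fst (\<beta> x)) = s1"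
    unfolding normals by (simp add: inner_prod_def)
  then have s1: "\<And>x. x \<in> rel_interior tri.left_edge \<Longrightarrow> sgn (fst (\<beta> x)) = - s1"
    unfolding sgn_minus by fastforce
  obtain s2 where "\<And>x. x \<in> rel_interior tri.top_edge \<Longrightarrow> sgn (\<beta> x \<bullet> outer_normal E tri.top_edge) = s2"
    using bspec[OF sign_E mem(2)] by blast
  then have s2: "\<And>x. x \<in> rel_interior tri.top_edge \<Longrightarrow> sgn (snd (\<beta> x)) = s2"
    unfolding normals by (simp add: inner_prod_def)
  let ?l = "LINT z|arc_measure tri.left_edge. fst (\<beta> z)" and ?t = "LINT z|arc_measure tri.top_edge. snd (\<beta> z)"
  have neg_l: "?l < 0" if "\<And>x. x \<in> rel_interior tri.left_edge \<Longrightarrow> fst (\<beta> x) < 0"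
    using tri.integral_left_pos[of "\<lambda>z. - fst (\<beta> z)"] that \<beta>_left by (simp add: continuous_on_minus)
  have neg_t: "?t < 0" if "\<And>x. x \<in> rel_interior tri.top_edge \<Longrightarrow> snd (\<beta> x) < 0"
    using tri.integral_top_pos[of "\<lambda>z. - snd (\<beta> z)"] that \<beta>_top by (simp add: continuous_on_minus)
  have zero_l: "\<forall>x\<in>tri.left_edge. fst (\<beta> x) = 0" if "\<And>x. x \<in> rel_interior tri.left_edge \<Longrightarrow> fst (\<beta> x) = 0"
  proof
    fix x assume x: "x \<in> tri.left_edge"
    have "0 \<le> fst (\<beta> x)" by (rule tri.nonneg_on_left[OF \<beta>_left _ x]) (simp add: that)
    moreover have "0 \<le> - fst (\<beta> x)" by (rule tri.nonneg_on_left[OF continuous_on_minus[OF \<beta>_left] _ x]) (simp add: that)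
    ultimately show "fst (\<beta> x) = 0" by simp
  qed
  have zero_t: "\<forall>x\<in>tri.top_edge. snd (\<beta> x) = 0" if "\<And>x. x \<in> rel_interior tri.top_edge \<Longrightarrow> snd (\<beta> x) = 0"
  proof
    fix x assume x: "x \<in> tri.top_edge"
    have "0 \<le> snd (\<beta> x)" by (rule tri.nonneg_on_top[OF \<beta>_top _ x]) (simp add: that)
    moreover have "0 \<le> - snd (\<beta> x)" by (rule tri.nonneg_on_top[OF continuous_on_minus[OF \<beta>_top] _ x]) (simp add: that)
    ultimately show "snd (\<beta> x) = 0" by simp
  qed
  \<comment> \<open>Excluding zero on the left leg suffices: its lower end point lies on the ramp,
    where tangency would make \<open>\<beta>\<close> vanish altogether. The top leg then has nonzero
    flux by balance.\<close>
  have not_zero: "\<not> (\<forall>x\<in>rel_interior tri.left_edge. fst (\<beta> x) = 0)"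
  proof
    assume "\<forall>x\<in>rel_interior tri.left_edge. fst (\<beta> x) = 0"
    then have "\<forall>x\<in>tri.left_edge. fst (\<beta> x) = 0" using zero_l by blast
    moreover have P: "(a, b - c) \<in> tri.left_edge" by (simp add: tri.left_edge_def)
    ultimately have "fst (\<beta> (a, b - c)) = 0" by blast
    moreover have P': "(a, b - c) \<in> tri.cTri" "tri.\<rho> (a, b - c) = 0" using P tri.left_subset by (auto simp: tri.\<rho>_def)
    ultimately have "\<beta> (a, b - c) = 0" using tangential[OF P'] by (simp add: prod_eq_iff)
    then show False using no_stagnation ramp_point[OF P'] by blast
  qed
  obtain x1 x2 where x1: "x1 \<in> rel_interior tri.left_edge" and x2: "x2 \<in> rel_interior tri.top_edge"
    by (rule rel_interiors_nonempty)
  have "s1 \<noteq> 0" using not_zero s1 by (auto simp: sgn_0_0)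
  have cases1: "sgn y = - s1 \<Longrightarrow> sgn x = - s1 \<Longrightarrow> (x > 0 \<longleftrightarrow> y > 0) \<and> (x < 0 \<longleftrightarrow> y < 0)" for x y :: real
    by (auto simp: sgn_if split: if_splits)
  have cases2: "sgn y = s2 \<Longrightarrow> sgn x = s2 \<Longrightarrow> (x > 0 \<longleftrightarrow> y > 0) \<and> (x < 0 \<longleftrightarrow> y < 0)" for x y :: real
    by (auto simp: sgn_if split: if_splits)
  have l_cases: "(\<forall>x\<in>rel_interior tri.left_edge. fst (\<beta> x) > 0) \<or> (\<forall>x\<in>rel_interior tri.left_edge. fst (\<beta> x) < 0)"
    using s1 s1[OF x1] \<open>s1 \<noteq> 0\<close> cases1 by (metis linorder_neqE_linordered_idom neg_equal_0_iff_equal sgn_0)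
  have t_cases: "(\<forall>x\<in>rel_interior tri.top_edge. snd (\<beta> x) > 0) \<or> (\<forall>x\<in>rel_interior tri.top_edge. snd (\<beta> x) < 0) \<or> (\<forall>x\<in>rel_interior tri.top_edge. snd (\<beta> x) = 0)"
    using s2 s2[OF x2] cases2 by (metis linorder_neqE_linordered_idom)
  from l_cases show ?thesis
  proof
    assume l: "\<forall>x\<in>rel_interior tri.left_edge. fst (\<beta> x) > 0"
    then have "?l > 0" using tri.integral_left_pos[OF \<beta>_left] by blast
    then have t: "?t > 0" using tri.flux_balance by simp
    then have "\<not> (\<forall>x\<in>rel_interior tri.top_edge. snd (\<beta> x) < 0)" using neg_t by force
    moreover have "\<not> (\<forall>x\<in>rel_interior tri.top_edge. snd (\<beta> x) = 0)"
    proof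
      assume "\<forall>x\<in>rel_interior tri.top_edge. snd (\<beta> x) = 0"
      then have "\<forall>x\<in>tri.top_edge. snd (\<beta> x) = 0" using zero_t by blast
      then have "?t = (LINT z|arc_measure tri.top_edge. 0)" by (intro Bochner_Integration.integral_cong) auto
      then show False using t by simp
    qed
    ultimately show ?thesis using l t_cases by blast
  next
    assume l: "\<forall>x\<in>rel_interior tri.left_edge. fst (\<beta> x) < 0"
    then have "?l < 0" using neg_l by blast
    then have t: "?t < 0" using tri.flux_balance by simp
    then have "\<not> (\<forall>x\<in>rel_interior tri.top_edge. snd (\<beta> x) > 0)" using tri.integral_top_pos[OF \<beta>_top] by force
    moreover have "\<not> (\<forall>x\<in>rel_interior tri.top_edge. snd (\<beta> x) = 0)"
    proof
      assume "\<forall>x\<in>rel_interior tri.top_edge. snd (\<beta> x) = 0"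
      then have "\<forall>x\<in>tri.top_edge. snd (\<beta> x) = 0" using zero_t by blast
      then have "?t = (LINT z|arc_measure tri.top_edge. 0)" by (intro Bochner_Integration.integral_cong) auto
      then show False using t by simp
    qed
    ultimately show ?thesis using l t_cases by blast
  qed
qed

lemma edges_distinct: "tri.left_edge \<noteq> tri.top_edge"
proof
  assume eq: "tri.left_edge = tri.top_edge"
  have "(a, b - c) \<in> tri.left_edge" by (simp add: tri.left_edge_def)
  then show False using corners unfolding eq tri.top_eq by simp
qed

text \<open>The definite descriptions are resolved by elimination: one leg has the wrong sign and
  the hypotenuse carries no normal velocity. The signs are recorded in weak form on the closed legs,
  as \<open>cell_estimate\<close> expects them.\<close>

lemma in_out_faces:
  "inflow_face \<beta> E = tri.left_edge \<and> outflow_face \<beta> E = tri.top_edge \<and> (\<forall>z\<in>tri.left_edge. 0 \<le> fst (\<beta> z)) \<and> (\<forall>z\<in>tri.top_edge. 0 \<le> snd (\<beta> z)) \<or>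
   inflow_face \<beta> E = tri.top_edge \<and> outflow_face \<beta> E = tri.left_edge \<and> (\<forall>z\<in>tri.left_edge. fst (\<beta> z) \<le> 0) \<and> (\<forall>z\<in>tri.top_edge. snd (\<beta> z) \<le> 0)"
proof -
  obtain x1 x2 x3 where x: "x1 \<in> rel_interior tri.left_edge" "x2 \<in> rel_interior tri.top_edge" "x3 \<in> rel_interior tri.hypotenuse"
    by (rule rel_interiors_nonempty)
  have h3: "\<beta> x3 \<bullet> outer_normal E tri.hypotenuse = 0"
    using hypotenuse_flux rel_interior_subset x(3) by blast
  have n1: "\<beta> z \<bullet> outer_normal E tri.left_edge = - fst (\<beta> z)" and n2: "\<beta> z \<bullet> outer_normal E tri.top_edge = snd (\<beta> z)" for z
    unfolding normals by (simp_all add: inner_prod_def)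
  from signs show ?thesis
  proof
    assume s: "(\<forall>z\<in>rel_interior tri.left_edge. fst (\<beta> z) > 0) \<and> (\<forall>z\<in>rel_interior tri.top_edge. snd (\<beta> z) > 0)"
    have "inflow_face \<beta> E = tri.left_edge" unfolding inflow_face_def
    proof (rule the_equality)
      show "tri.left_edge \<in> cell_faces E \<and> (\<forall>x\<in>rel_interior tri.left_edge. \<beta> x \<bullet> outer_normal E tri.left_edge < 0)"
        using s by (simp add: faces n1)
      fix e assume e: "e \<in> cell_faces E \<and> (\<forall>x\<in>rel_interior e. \<beta> x \<bullet> outer_normal E e < 0)"
      have "e \<noteq> tri.top_edge" using e x(2) s n2[of x2] by force
      moreover have "e \<noteq> tri.hypotenuse" using e x(3) h3 by force
      ultimately show "e = tri.left_edge" using e faces by blast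
    qed
    moreover have "outflow_face \<beta> E = tri.top_edge" unfolding outflow_face_def
    proof (rule the_equality)
      show "tri.top_edge \<in> cell_faces E \<and> (\<forall>x\<in>rel_interior tri.top_edge. \<beta> x \<bullet> outer_normal E tri.top_edge > 0)"
        using s by (simp add: faces n2)
      fix e assume e: "e \<in> cell_faces E \<and> (\<forall>x\<in>rel_interior e. \<beta> x \<bullet> outer_normal E e > 0)"
      have "e \<noteq> tri.left_edge" using e x(1) s n1[of x1] by force
      moreover have "e \<noteq> tri.hypotenuse" using e x(3) h3 by force
      ultimately show "e = tri.top_edge" using e faces by blast
    qed
    moreover have "\<forall>z\<in>tri.left_edge. 0 \<le> fst (\<beta> z)" "\<forall>z\<in>tri.top_edge. 0 \<le> snd (\<beta> z)"
      using tri.nonneg_on_left[OF \<beta>_left] tri.nonneg_on_top[OF \<beta>_top] s less_imp_le by blast+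
    ultimately show ?thesis by blast
  next
    assume s: "(\<forall>z\<in>rel_interior tri.left_edge. fst (\<beta> z) < 0) \<and> (\<forall>z\<in>rel_interior tri.top_edge. snd (\<beta> z) < 0)"
    have "outflow_face \<beta> E = tri.left_edge" unfolding outflow_face_def
    proof (rule the_equality)
      show "tri.left_edge \<in> cell_faces E \<and> (\<forall>x\<in>rel_interior tri.left_edge. \<beta> x \<bullet> outer_normal E tri.left_edge > 0)"
        using s by (simp add: faces n1)
      fix e assume e: "e \<in> cell_faces E \<and> (\<forall>x\<in>rel_interior e. \<beta> x \<bullet> outer_normal E e > 0)"
      have "e \<noteq> tri.top_edge" using e x(2) s n2[of x2] by force
      moreover have "e \<noteq> tri.hypotenuse" using e x(3) h3 by force
      ultimately show "e = tri.left_edge" using e faces by blast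
    qed
    moreover have "inflow_face \<beta> E = tri.top_edge" unfolding inflow_face_def
    proof (rule the_equality)
      show "tri.top_edge \<in> cell_faces E \<and> (\<forall>x\<in>rel_interior tri.top_edge. \<beta> x \<bullet> outer_normal E tri.top_edge < 0)"
        using s by (simp add: faces n2)
      fix e assume e: "e \<in> cell_faces E \<and> (\<forall>x\<in>rel_interior e. \<beta> x \<bullet> outer_normal E e < 0)"
      have "e \<noteq> tri.left_edge" using e x(1) s n1[of x1] by force
      moreover have "e \<noteq> tri.hypotenuse" using e x(3) h3 by force
      ultimately show "e = tri.top_edge" using e faces by blast
    qed
    moreover have "\<forall>z\<in>tri.left_edge. fst (\<beta> z) \<le> 0"
    proof
      fix z assume z: "z \<in> tri.left_edge"
      have "0 \<le> - fst (\<beta> z)"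
        by (rule tri.nonneg_on_left[OF continuous_on_minus[OF \<beta>_left] _ z]) (use s in \<open>simp add: less_imp_le\<close>)
      then show "fst (\<beta> z) \<le> 0" by simp
    qed
    moreover have "\<forall>z\<in>tri.top_edge. snd (\<beta> z) \<le> 0"
    proof
      fix z assume z: "z \<in> tri.top_edge"
      have "0 \<le> - snd (\<beta> z)"
        by (rule tri.nonneg_on_top[OF continuous_on_minus[OF \<beta>_top] _ z]) (use s in \<open>simp add: less_imp_le\<close>)
      then show "snd (\<beta> z) \<le> 0" by simp
    qed
    ultimately show ?thesis by blast
  qed
qed

end

context ramp_mesh begin

lemma closure_cell_subset:
  assumes "i < N" "j < N"
  shows "closure (background_cell h i j \<inter> \<Omega>) \<subseteq> cbox (real i * h, real j * h) (real i * h + h, real j * h + h)"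
proof -
  have "background_cell h i j \<inter> \<Omega> \<subseteq> cbox (real i * h, real j * h) (real i * h + h, real j * h + h)"
    unfolding cell_eq[OF assms] using box_subset_cbox by blast
  then show ?thesis by (rule closure_minimal) (rule closed_cbox)
qed

end

section \<open>The cells across the two legs\<close>

context cut_cell begin

definition "N_left = background_cell h (i - 1) j \<inter> \<Omega>"
definition "N_top = background_cell h i (j + 1) \<inter> \<Omega>"

lemma N_left_box: "N_left = box (a - h, b - h) (a, b) \<inter> {z. height z > 0}"
proof -
  have "real (i - 1) * h = a - h" using i_pos by (simp add: a_def algebra_simps of_nat_diff)
  then show ?thesis unfolding N_left_def using cell_eq[of "i - 1" j] ij by (simp add: b_def)
qed

lemma N_top_box: "N_top = box (a, b) (a + h, b + h) \<inter> {z. height z > 0}"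
proof -
  have "real (j + 1) * h = b" by (simp add: b_def algebra_simps)
  then show ?thesis unfolding N_top_def using cell_eq[OF ij(1) j_less] by (simp add: a_def)
qed

lemma Tri_bounds:
  assumes "(x, y) \<in> tri.Tri"
  shows "a < x" "x < a + h" "b - h < y" "y < b" "height (x, y) > 0"
  using assms unfolding E_Tri[symmetric] E_box by (auto simp: box_plane)

lemma reflect_left: "(x, y) \<in> tri.Tri \<Longrightarrow> (2 * a - x, y) \<in> N_left"
proof -
  assume "(x, y) \<in> tri.Tri"
  note bd = Tri_bounds[OF this]
  have "(2 * a - x - x0) * tan \<gamma> \<le> (x - x0) * tan \<gamma>" using bd(1) tan_pos by (intro mult_right_mono) auto
  then have "height (2 * a - x, y) > 0" using bd(5) by (simp add: height_def)
  then show ?thesis unfolding N_left_box using bd by (auto simp: box_plane)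
qed

lemma reflect_top: "(x, y) \<in> tri.Tri \<Longrightarrow> (x, 2 * b - y) \<in> N_top"
proof -
  assume "(x, y) \<in> tri.Tri"
  note bd = Tri_bounds[OF this]
  have "height (x, 2 * b - y) > 0" using bd(4,5) by (simp add: height_def)
  then show ?thesis unfolding N_top_box using bd by (auto simp: box_plane)
qed

text \<open>The mirror image of an interior point of the triangle lies in the neighbouring
  background cell and above the ramp, so that cell is not degenerate.\<close>

lemma N_left_cell: "N_left \<in> T" and N_top_cell: "N_top \<in> T"
proof -
  note p = tri.Tri_nonempty
  note l = reflect_left[OF p] and u = reflect_top[OF p]
  show "N_left \<in> T"
    unfolding N_left_def by (rule cellI[where z="(2 * a - (a + c / (4 * tan \<gamma>)), b - c / 4)"])
      (use l ij in \<open>auto simp: N_left_def background_cell_eq \<Omega>_eq\<close>)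
  show "N_top \<in> T"
    unfolding N_top_def by (rule cellI[where z="(a + c / (4 * tan \<gamma>), 2 * b - (b - c / 4))"])
      (use u ij j_less in \<open>auto simp: N_top_def background_cell_eq \<Omega>_eq\<close>)
qed

lemma E_neq: "N_left \<noteq> E" "N_top \<noteq> E"
proof -
  note p = tri.Tri_nonempty
  have "(a + c / (4 * tan \<gamma>), b - c / 4) \<in> E" using p E_Tri by simp
  moreover have "(a + c / (4 * tan \<gamma>), b - c / 4) \<notin> N_left" "(a + c / (4 * tan \<gamma>), b - c / 4) \<notin> N_top"
    unfolding N_left_box N_top_box using corners(1) tan_pos by (auto simp: box_plane divide_less_0_iff)
  ultimately show "N_left \<noteq> E" "N_top \<noteq> E" by blast+
qed

lemma height_on_left: "fst z = a \<Longrightarrow> height z = snd z - (b - c)"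
  by (simp add: height_def c_def)

lemma aff_dim_edges: "aff_dim tri.left_edge = 1" "aff_dim tri.top_edge = 1"
  unfolding tri.left_edge_def tri.top_edge_def segment_convex_hull aff_dim_convex_hull
  using tri.left_neq tri.top_neq by (simp_all add: aff_dim_2)

text \<open>The leg is a full side of the neighbour: on the line through it the height is the
  distance from \<open>b - c\<close>, so the ramp cuts that side exactly at the lower end point of
  the leg.\<close>

lemma left_face_N: "tri.left_edge \<in> cell_faces N_left"
proof -
  have cl: "closure N_left = cbox (a - h, b - h) (a, b) \<inter> {z. height z \<ge> 0}"
    unfolding N_left_box using reflect_left[OF tri.Tri_nonempty] N_left_box by (intro closure_box_height) blast
  have "tri.left_edge = closure N_left \<inter> {z. (1, 0) \<bullet> z = a}"
  proof (rule set_eqI)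
    fix z
    show "z \<in> tri.left_edge \<longleftrightarrow> z \<in> closure N_left \<inter> {z. (1, 0) \<bullet> z = a}"
      unfolding cl tri.left_eq using height_on_left[of z] c_le(1) corners(1) h_pos
      by (cases z) (auto simp: cbox_Pair_eq)
  qed
  moreover have "closure N_left \<inter> {z. (1, 0) \<bullet> z = a} face_of closure N_left"
  proof (rule face_of_Int_supporting_hyperplane_le)
    show "convex (closure N_left)"
      unfolding N_left_box by (intro convex_closure convex_Int convex_box convex_height)
    show "(1, 0) \<bullet> x \<le> a" if "x \<in> closure N_left" for x using that unfolding cl by (cases x) (auto simp: cbox_Pair_eq)
  qed
  ultimately show ?thesis unfolding cell_faces_def edge_of_def using aff_dim_edges(1) by simp
qed

lemma top_face_N: "tri.top_edge \<in> cell_faces N_top"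
proof -
  have cl: "closure N_top = cbox (a, b) (a + h, b + h) \<inter> {z. height z \<ge> 0}"
    unfolding N_top_box using reflect_top[OF tri.Tri_nonempty] N_top_box by (intro closure_box_height) blast
  have "tri.top_edge = closure N_top \<inter> {z. (0, -1) \<bullet> z = - b}"
  proof (rule set_eqI)
    fix z
    have "snd z = b \<Longrightarrow> height z = c - (fst z - a) * tan \<gamma>" by (simp add: height_def c_def algebra_simps)
    then have "snd z = b \<Longrightarrow> height z \<ge> 0 \<longleftrightarrow> fst z \<le> a + c / tan \<gamma>"
      using pos_le_divide_eq[OF tan_pos, of "fst z - a" c] by auto
    then show "z \<in> tri.top_edge \<longleftrightarrow> z \<in> closure N_top \<inter> {z. (0, -1) \<bullet> z = - b}"
      unfolding cl tri.top_eq using c_div_le h_pos by (cases z) (auto simp: cbox_Pair_eq)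
  qed
  moreover have "closure N_top \<inter> {z. (0, -1) \<bullet> z = - b} face_of closure N_top"
  proof (rule face_of_Int_supporting_hyperplane_le)
    show "convex (closure N_top)"
      unfolding N_top_box by (intro convex_closure convex_Int convex_box convex_height)
    show "(0, -1) \<bullet> x \<le> - b" if "x \<in> closure N_top" for x using that unfolding cl by (cases x) (auto simp: cbox_Pair_eq)
  qed
  ultimately show ?thesis unfolding cell_faces_def edge_of_def using aff_dim_edges(2) by simp
qed

lemma grid_cancel: "real m * h \<le> real n * h \<longleftrightarrow> m \<le> n" "real m * h < real n * h \<longleftrightarrow> m < n"
  using h_pos by auto

text \<open>Both end points lie in one closed grid square. Their abscissa leaves two columns, and
  the positive length of the leg leaves one row.\<close>

lemma cells_at_left:
  assumes "E' \<in> T" "tri.left_edge \<in> cell_faces E'" shows "E' = E \<or> E' = N_left"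
proof -
  obtain k l where kl: "k < N" "l < N" "E' = background_cell h k l \<inter> \<Omega>" using cellD[OF assms(1)] by metis
  have "tri.left_edge \<subseteq> closure E'"
    using assms(2) unfolding cell_faces_def edge_of_def by (auto dest: face_of_imp_subset)
  also have "\<dots> \<subseteq> cbox (real k * h, real l * h) (real k * h + h, real l * h + h)"
    unfolding kl(3) by (rule closure_cell_subset[OF kl(1,2)])
  finally have "(a, b) \<in> cbox (real k * h, real l * h) (real k * h + h, real l * h + h)"
    "(a, b - c) \<in> cbox (real k * h, real l * h) (real k * h + h, real l * h + h)"
    by (auto simp: tri.left_edge_def)
  then have "real k * h \<le> a" "a \<le> real (k + 1) * h" "real l * h \<le> b - c" "b \<le> real (l + 1) * h"
    by (auto simp: cbox_Pair_eq algebra_simps)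
  moreover have "b = real (j + 1) * h" by (simp add: b_def algebra_simps)
  moreover have "b - c < b" using corners(1) by simp
  ultimately have "k \<le> i" "i \<le> k + 1" "l < j + 1" "j + 1 \<le> l + 1"
    using grid_cancel[of k i] grid_cancel[of i "k + 1"] grid_cancel[of l "j + 1"] grid_cancel[of "j + 1" "l + 1"]
    unfolding a_def by auto
  then have "l = j" "k = i \<or> k = i - 1" by auto
  then show ?thesis unfolding kl(3) N_left_def by auto
qed

lemma cells_at_top:
  assumes "E' \<in> T" "tri.top_edge \<in> cell_faces E'" shows "E' = E \<or> E' = N_top"
proof -
  obtain k l where kl: "k < N" "l < N" "E' = background_cell h k l \<inter> \<Omega>" using cellD[OF assms(1)] by metis
  have "tri.top_edge \<subseteq> closure E'"
    using assms(2) unfolding cell_faces_def edge_of_def by (auto dest: face_of_imp_subset)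
  also have "\<dots> \<subseteq> cbox (real k * h, real l * h) (real k * h + h, real l * h + h)"
    unfolding kl(3) by (rule closure_cell_subset[OF kl(1,2)])
  finally have "(a, b) \<in> cbox (real k * h, real l * h) (real k * h + h, real l * h + h)"
    "(a + c / tan \<gamma>, b) \<in> cbox (real k * h, real l * h) (real k * h + h, real l * h + h)"
    by (auto simp: tri.top_edge_def)
  then have "real k * h \<le> a" "a + c / tan \<gamma> \<le> real (k + 1) * h" "real l * h \<le> b" "b \<le> real (l + 1) * h"
    by (auto simp: cbox_Pair_eq algebra_simps)
  moreover have "b = real (j + 1) * h" by (simp add: b_def algebra_simps)
  moreover have "a < a + c / tan \<gamma>" using corners(1) tan_pos by simp
  ultimately have "k \<le> i" "i < k + 1" "l \<le> j + 1" "j + 1 \<le> l + 1"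
    using grid_cancel[of k i] grid_cancel[of i "k + 1"] grid_cancel[of l "j + 1"] grid_cancel[of "j + 1" "l + 1"]
    unfolding a_def by auto
  then have "k = i" "l = j \<or> l = j + 1" by auto
  then show ?thesis unfolding kl(3) N_top_def by auto
qed

lemma neighbor_left: "neighbor T E tri.left_edge = N_left"
  unfolding neighbor_def using N_left_cell E_neq(1) left_face_N cells_at_left by (intro the_equality) blast+

lemma neighbor_top: "neighbor T E tri.top_edge = N_top"
  unfolding neighbor_def using N_top_cell E_neq(2) top_face_N cells_at_top by (intro the_equality) blast+

lemma outer_normal_N_left: "outer_normal N_left tri.left_edge = (1, 0)"
proof (rule outer_normal_eqI[where p="(a, b)" and q="(a, b - c)"])
  show "(1, 0) \<bullet> (y - x) = 0" if "x \<in> tri.left_edge" "y \<in> tri.left_edge" for x y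
    using tri.mem_leftD[OF that(1)] tri.mem_leftD[OF that(2)] by (simp add: inner_prod_def)
  show "(1, 0) \<bullet> (y - x) < 0" if "x \<in> tri.left_edge" "y \<in> N_left" for x y
    using tri.mem_leftD[OF that(1)] that(2) by (simp add: inner_prod_def N_left_box box_plane)
qed (use corners(1) reflect_left[OF tri.Tri_nonempty] in \<open>auto simp: tri.left_edge_def\<close>)

lemma outer_normal_N_top: "outer_normal N_top tri.top_edge = (0, -1)"
proof (rule outer_normal_eqI[where p="(a, b)" and q="(a + c / tan \<gamma>, b)"])
  show "(0, -1) \<bullet> (y - x) = 0" if "x \<in> tri.top_edge" "y \<in> tri.top_edge" for x y
    using tri.mem_topD[OF that(1)] tri.mem_topD[OF that(2)] by (simp add: inner_prod_def)
  show "(0, -1) \<bullet> (y - x) < 0" if "x \<in> tri.top_edge" "y \<in> N_top" for x y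
    using tri.mem_topD[OF that(1)] that(2) by (simp add: inner_prod_def N_top_box box_plane)
qed (use corners(1) tan_pos reflect_top[OF tri.Tri_nonempty] in \<open>auto simp: tri.top_edge_def\<close>)

section \<open>Fluxes, weighted means and jumps on the legs\<close>

abbreviation "F_left \<equiv> LINT z|arc_measure tri.left_edge. \<bar>fst (\<beta> z)\<bar>"
abbreviation "F_top \<equiv> LINT z|arc_measure tri.top_edge. \<bar>snd (\<beta> z)\<bar>"

lemma fluxes: "flux \<beta> E tri.left_edge = F_left" "flux \<beta> N_left tri.left_edge = F_left"
  "flux \<beta> E tri.top_edge = F_top" "flux \<beta> N_top tri.top_edge = F_top"
  unfolding flux_def normals outer_normal_N_left outer_normal_N_top by (simp_all add: inner_prod_def)

lemma means:
  "weighted_mean \<beta> v E tri.left_edge = (LINT z|arc_measure tri.left_edge. \<bar>fst (\<beta> z)\<bar> * face_trace E tri.left_edge v z) / F_left"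
  "weighted_mean \<beta> v N_left tri.left_edge = (LINT z|arc_measure tri.left_edge. \<bar>fst (\<beta> z)\<bar> * face_trace N_left tri.left_edge v z) / F_left"
  "weighted_mean \<beta> v E tri.top_edge = (LINT z|arc_measure tri.top_edge. \<bar>snd (\<beta> z)\<bar> * face_trace E tri.top_edge v z) / F_top"
  "weighted_mean \<beta> v N_top tri.top_edge = (LINT z|arc_measure tri.top_edge. \<bar>snd (\<beta> z)\<bar> * face_trace N_top tri.top_edge v z) / F_top"
  unfolding weighted_mean_def fluxes normals outer_normal_N_left outer_normal_N_top by (simp_all add: inner_prod_def)

text \<open>Every cell having this leg as a face has a horizontal normal on it; the jump reduces to
  one scalar.\<close>

lemma jump_left: "snd (jump T \<beta> w tri.left_edge) = 0"
proof -
  have "snd (outer_normal E' tri.left_edge) = 0" if "E' \<in> T" "tri.left_edge \<in> cell_faces E'" for E'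
    using cells_at_left[OF that] normals outer_normal_N_left by auto
  then show ?thesis unfolding jump_def snd_sum by (intro sum.neutral) auto
qed

lemma jump_top: "fst (jump T \<beta> w tri.top_edge) = 0"
proof -
  have "fst (outer_normal E' tri.top_edge) = 0" if "E' \<in> T" "tri.top_edge \<in> cell_faces E'" for E'
    using cells_at_top[OF that] normals outer_normal_N_top by auto
  then show ?thesis unfolding jump_def fst_sum by (intro sum.neutral) auto
qed

text \<open>On each leg the normal velocity keeps one sign, so absolute values may be taken outside
  the integral, where \<open>flux_balance\<close> applies.\<close>

lemma F_eq:
  "F_left = F_top" "F_left > 0" "\<bar>LINT z|arc_measure tri.left_edge. fst (\<beta> z)\<bar> = F_left" "\<bar>LINT z|arc_measure tri.top_edge. snd (\<beta> z)\<bar> = F_top"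
proof -
  let ?l = "LINT z|arc_measure tri.left_edge. fst (\<beta> z)" and ?t = "LINT z|arc_measure tri.top_edge. snd (\<beta> z)"
  have "?l = F_left \<and> ?t = F_top \<or> - ?l = F_left \<and> - ?t = F_top"
    using in_out_faces
  proof
    assume "inflow_face \<beta> E = tri.left_edge \<and> outflow_face \<beta> E = tri.top_edge \<and> (\<forall>z\<in>tri.left_edge. 0 \<le> fst (\<beta> z)) \<and> (\<forall>z\<in>tri.top_edge. 0 \<le> snd (\<beta> z))"
    then have "?l = F_left" "?t = F_top" by (auto intro!: Bochner_Integration.integral_cong)
    then show ?thesis by blast
  next
    assume s: "inflow_face \<beta> E = tri.top_edge \<and> outflow_face \<beta> E = tri.left_edge \<and> (\<forall>z\<in>tri.left_edge. fst (\<beta> z) \<le> 0) \<and> (\<forall>z\<in>tri.top_edge. snd (\<beta> z) \<le> 0)"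
    have "(LINT z|arc_measure tri.left_edge. - fst (\<beta> z)) = F_left" "(LINT z|arc_measure tri.top_edge. - snd (\<beta> z)) = F_top"
      using s by (intro Bochner_Integration.integral_cong refl, simp)+
    then show ?thesis by simp
  qed
  moreover have "F_left \<ge> 0" "F_top \<ge> 0" by simp_all
  ultimately show "F_left = F_top" "\<bar>?l\<bar> = F_left" "\<bar>?t\<bar> = F_top" using tri.flux_balance by linarith+
  have "continuous_on tri.left_edge (\<lambda>z. \<bar>fst (\<beta> z)\<bar>)" by (intro continuous_intros \<beta>_left)
  then show "F_left > 0" by (rule tri.integral_left_pos) (use signs in force)
qed

text \<open>Means and jump are constants in the integral, which therefore equals, up to sign, mean
  difference times flux times jump. As both legs have the same flux, multiplying by it clears the
  denominators of both means and leaves the quantity of \<open>cell_estimate\<close>. The inflow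
  trace is taken from the neighbour, the outflow trace from the cell.\<close>

theorem cell_bound:
  assumes v: "v \<in> H1 \<Omega>" and B: "\<And>z. z \<in> closure \<Omega> \<Longrightarrow> norm (\<beta> z) \<le> B"
  shows "inflow_face \<beta> E \<noteq> outflow_face \<beta> E" "flux \<beta> E (inflow_face \<beta> E) > 0"
    "flux \<beta> E (outflow_face \<beta> E) = flux \<beta> E (inflow_face \<beta> E)"
    "\<bar>LINT x|arc_measure (outflow_face \<beta> E). (mean_in T \<beta> v E - weighted_mean \<beta> v E (outflow_face \<beta> E)) * (\<beta> x \<bullet> jump T \<beta> w (outflow_face \<beta> E))\<bar>
      \<le> B * sqrt (measure lebesgue E) * sqrt (\<Sum>b\<in>Basis. LINT z|lebesgue_on E. (weak_pderiv \<Omega> b v z)\<^sup>2)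
        * sqrt (jump T \<beta> w (outflow_face \<beta> E) \<bullet> jump T \<beta> w (outflow_face \<beta> E))"
proof -
  let ?G = "B * sqrt (measure lebesgue E) * sqrt (\<Sum>b\<in>Basis. LINT z|lebesgue_on E. (weak_pderiv \<Omega> b v z)\<^sup>2)"
  have est: "\<bar>(LINT z|arc_measure tri.left_edge. \<bar>fst (\<beta> z)\<bar> * face_trace E1 tri.left_edge v z) - (LINT z|arc_measure tri.top_edge. \<bar>snd (\<beta> z)\<bar> * face_trace E2 tri.top_edge v z)\<bar> \<le> ?G"
    if "open E1" "E1 \<subseteq> \<Omega>" "trace_bound E1 tri.left_edge C1" "open E2" "E2 \<subseteq> \<Omega>" "trace_bound E2 tri.top_edge C2" for E1 E2 C1 C2
    unfolding E_Tri
  proof (rule tri.cell_estimate[OF convex_\<Omega> bounded_\<Omega> v _ _ that])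
    show "norm (\<beta> z) \<le> B" if "z \<in> tri.cTri" for z using that cTri_closure_\<Omega> by (intro B) blast
    show "(\<forall>z\<in>tri.left_edge. 0 \<le> fst (\<beta> z)) \<and> (\<forall>z\<in>tri.top_edge. 0 \<le> snd (\<beta> z)) \<or> (\<forall>z\<in>tri.left_edge. fst (\<beta> z) \<le> 0) \<and> (\<forall>z\<in>tri.top_edge. snd (\<beta> z) \<le> 0)"
      using in_out_faces by blast
  qed
  have oE: "open E" "E \<subseteq> \<Omega>" using open_cell[OF cell] by auto
  have oL: "open N_left" "N_left \<subseteq> \<Omega>" "bounded N_left" using open_cell[OF N_left_cell] cell_subset[OF N_left_cell] bounded_\<Omega> bounded_subset by blast+
  have oT: "open N_top" "N_top \<subseteq> \<Omega>" "bounded N_top" using open_cell[OF N_top_cell] cell_subset[OF N_top_cell] bounded_\<Omega> bounded_subset by blast+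
  note tE = tri.trace_bound_left[folded E_Tri] tri.trace_bound_top[folded E_Tri]
  note tL = tri.trace_bound_left_neighbour[OF oL(1,3) reflect_left]
  note tT = tri.trace_bound_top_neighbour[OF oT(1,3) reflect_top]
  note F = F_eq
  have "inflow_face \<beta> E \<noteq> outflow_face \<beta> E \<and> flux \<beta> E (inflow_face \<beta> E) > 0 \<and> flux \<beta> E (outflow_face \<beta> E) = flux \<beta> E (inflow_face \<beta> E) \<and>
    \<bar>LINT x|arc_measure (outflow_face \<beta> E). (mean_in T \<beta> v E - weighted_mean \<beta> v E (outflow_face \<beta> E)) * (\<beta> x \<bullet> jump T \<beta> w (outflow_face \<beta> E))\<bar>
      \<le> ?G * sqrt (jump T \<beta> w (outflow_face \<beta> E) \<bullet> jump T \<beta> w (outflow_face \<beta> E))"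
    using in_out_faces
  proof
    assume "inflow_face \<beta> E = tri.left_edge \<and> outflow_face \<beta> E = tri.top_edge \<and> (\<forall>z\<in>tri.left_edge. 0 \<le> fst (\<beta> z)) \<and> (\<forall>z\<in>tri.top_edge. 0 \<le> snd (\<beta> z))"
    then have f: "inflow_face \<beta> E = tri.left_edge" "outflow_face \<beta> E = tri.top_edge" by auto
    define k where "k = snd (jump T \<beta> w tri.top_edge)"
    have j: "jump T \<beta> w tri.top_edge = (0, k)" using jump_top[of w] by (simp add: k_def prod_eq_iff)
    let ?m = "weighted_mean \<beta> v N_left tri.left_edge - weighted_mean \<beta> v E tri.top_edge"
    have "(LINT x|arc_measure tri.top_edge. ?m * (\<beta> x \<bullet> (0, k))) = (LINT x|arc_measure tri.top_edge. (?m * k) * snd (\<beta> x))"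
      by (intro Bochner_Integration.integral_cong refl) (simp add: inner_prod_def)
    also have "\<dots> = (?m * k) * (LINT x|arc_measure tri.top_edge. snd (\<beta> x))" by (rule integral_mult_right_zero)
    finally have int: "(LINT x|arc_measure tri.top_edge. ?m * (\<beta> x \<bullet> (0, k))) = (?m * k) * (LINT x|arc_measure tri.top_edge. snd (\<beta> x))" .
    have "\<bar>LINT x|arc_measure tri.top_edge. ?m * (\<beta> x \<bullet> (0, k))\<bar> = (\<bar>?m\<bar> * F_top) * \<bar>k\<bar>"
      unfolding int abs_mult F(4) by (simp only: mult_ac)
    also have "\<bar>?m\<bar> * F_top = \<bar>?m * F_top\<bar>" using F(1,2) by (simp add: abs_mult)
    also have "?m * F_top = (LINT z|arc_measure tri.left_edge. \<bar>fst (\<beta> z)\<bar> * face_trace N_left tri.left_edge v z) - (LINT z|arc_measure tri.top_edge. \<bar>snd (\<beta> z)\<bar> * face_trace E tri.top_edge v z)"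
      using F(1,2) by (simp add: means left_diff_distrib)
    also have "\<bar>\<dots>\<bar> * \<bar>k\<bar> \<le> ?G * \<bar>k\<bar>" by (rule mult_right_mono[OF est[OF oL(1,2) tL oE tE(2)] abs_ge_zero])
    finally show ?thesis unfolding f mean_in_def neighbor_left j fluxes using F edges_distinct by simp
  next
    assume "inflow_face \<beta> E = tri.top_edge \<and> outflow_face \<beta> E = tri.left_edge \<and> (\<forall>z\<in>tri.left_edge. fst (\<beta> z) \<le> 0) \<and> (\<forall>z\<in>tri.top_edge. snd (\<beta> z) \<le> 0)"
    then have f: "inflow_face \<beta> E = tri.top_edge" "outflow_face \<beta> E = tri.left_edge" by auto
    define k where "k = fst (jump T \<beta> w tri.left_edge)"
    have j: "jump T \<beta> w tri.left_edge = (k, 0)" using jump_left[of w] by (simp add: k_def prod_eq_iff)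
    let ?m = "weighted_mean \<beta> v N_top tri.top_edge - weighted_mean \<beta> v E tri.left_edge"
    have "(LINT x|arc_measure tri.left_edge. ?m * (\<beta> x \<bullet> (k, 0))) = (LINT x|arc_measure tri.left_edge. (?m * k) * fst (\<beta> x))"
      by (intro Bochner_Integration.integral_cong refl) (simp add: inner_prod_def)
    also have "\<dots> = (?m * k) * (LINT x|arc_measure tri.left_edge. fst (\<beta> x))" by (rule integral_mult_right_zero)
    finally have int: "(LINT x|arc_measure tri.left_edge. ?m * (\<beta> x \<bullet> (k, 0))) = (?m * k) * (LINT x|arc_measure tri.left_edge. fst (\<beta> x))" .
    have "\<bar>LINT x|arc_measure tri.left_edge. ?m * (\<beta> x \<bullet> (k, 0))\<bar> = (\<bar>?m\<bar> * F_left) * \<bar>k\<bar>"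
      unfolding int abs_mult F(3) by (simp only: mult_ac)
    also have "\<bar>?m\<bar> * F_left = \<bar>?m * F_left\<bar>" using F(2) by (simp add: abs_mult)
    also have "?m * F_left = - ((LINT z|arc_measure tri.left_edge. \<bar>fst (\<beta> z)\<bar> * face_trace E tri.left_edge v z) - (LINT z|arc_measure tri.top_edge. \<bar>snd (\<beta> z)\<bar> * face_trace N_top tri.top_edge v z))"
      using F(1,2) by (simp add: means left_diff_distrib)
    also have "\<bar>\<dots>\<bar> * \<bar>k\<bar> \<le> ?G * \<bar>k\<bar>" unfolding abs_minus_cancel by (rule mult_right_mono[OF est[OF oE tE(1) oT(1,2) tT] abs_ge_zero])
    finally show ?thesis unfolding f mean_in_def neighbor_top j fluxes using F edges_distinct by simp
  qed
  then show "inflow_face \<beta> E \<noteq> outflow_face \<beta> E" "flux \<beta> E (inflow_face \<beta> E) > 0"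
    "flux \<beta> E (outflow_face \<beta> E) = flux \<beta> E (inflow_face \<beta> E)"
    "\<bar>LINT x|arc_measure (outflow_face \<beta> E). (mean_in T \<beta> v E - weighted_mean \<beta> v E (outflow_face \<beta> E)) * (\<beta> x \<bullet> jump T \<beta> w (outflow_face \<beta> E))\<bar>
      \<le> ?G * sqrt (jump T \<beta> w (outflow_face \<beta> E) \<bullet> jump T \<beta> w (outflow_face \<beta> E))"
    by blast+
qed

end

section \<open>The bound on the stabilization term\<close>

context ramp_mesh begin

text \<open>Cells are disjoint, so at each point at most one indicator of the sum is
  nonzero.\<close>

lemma sum_cell_integrals_le:
  fixes f :: "plane \<Rightarrow> real"
  assumes f: "integrable (lebesgue_on \<Omega>) f" "\<And>z. 0 \<le> f z" and S: "S \<subseteq> T"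
  shows "(\<Sum>E\<in>S. LINT z|lebesgue_on E. f z) \<le> (LINT z|lebesgue_on \<Omega>. f z)"
proof -
  have fin: "finite S" using finite_T S by (rule finite_subset[rotated])
  have \<Omega>l: "\<Omega> \<in> sets lebesgue" using open_\<Omega> by simp
  have El: "E \<in> sets lebesgue" "E \<subseteq> \<Omega>" if "E \<in> S" for E using open_cell cell_subset S that by auto
  have i\<Omega>: "integrable lebesgue (\<lambda>z. indicator \<Omega> z * f z)" using f(1) \<Omega>l by (simp add: integrable_restrict_space)
  have iE: "integrable lebesgue (\<lambda>z. indicator E z * f z)" if "E \<in> S" for E
    using integrable_lebesgue_on_subset[OF f(1) El(1)[OF that] \<Omega>l El(2)[OF that]] El(1)[OF that] by (simp add: integrable_restrict_space)
  have "(\<Sum>E\<in>S. LINT z|lebesgue_on E. f z) = (\<Sum>E\<in>S. LINT z|lebesgue. indicator E z * f z)"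
    using El(1) by (intro sum.cong refl) (simp add: integral_restrict_space)
  also have "\<dots> = (LINT z|lebesgue. (\<Sum>E\<in>S. indicator E z * f z))"
    using iE by (intro Bochner_Integration.integral_sum[symmetric])
  also have "\<dots> \<le> (LINT z|lebesgue. indicator \<Omega> z * f z)"
  proof (rule integral_mono)
    show "integrable lebesgue (\<lambda>z. \<Sum>E\<in>S. indicator E z * f z)" using iE by (intro Bochner_Integration.integrable_sum)
    fix z
    show "(\<Sum>E\<in>S. indicator E z * f z) \<le> indicator \<Omega> z * f z"
    proof (cases "\<exists>E\<in>S. z \<in> E")
      case True
      then obtain E where E: "E \<in> S" "z \<in> E" by blast
      have "(\<Sum>E'\<in>S. indicator E' z * f z) = (\<Sum>E'\<in>{E}. indicator E' z * f z)"
        using E S fin cells_disjoint[of _ E z] by (intro sum.mono_neutral_right) (auto simp: indicator_def)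
      then show ?thesis using E El(2)[OF E(1)] by (simp add: subsetD)
    next
      case False
      then have "(\<Sum>E\<in>S. indicator E z * f z) = 0" by (intro sum.neutral) auto
      then show ?thesis using f(2) by (simp add: indicator_def)
    qed
  qed (rule i\<Omega>)
  also have "\<dots> = (LINT z|lebesgue_on \<Omega>. f z)" using \<Omega>l by (simp add: integral_restrict_space)
  finally show ?thesis .
qed

end

theorem lemma4p1:
  fixes L x0 \<gamma> h \<tau> :: real and N :: nat
    and \<Omega> :: "(real \<times> real) set" and T :: "(real \<times> real) set set"
    and \<beta> :: "real \<times> real \<Rightarrow> real \<times> real"
    and v w :: "real \<times> real \<Rightarrow> real"
  assumes "0 < L" and "0 < x0" and "x0 < L"
    and "0 < \<gamma>" and "\<gamma> < pi / 2" and "(L - x0) * tan \<gamma> < L"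
    and "\<Omega> = ramp_domain L x0 \<gamma>"
    and "0 < h" and "L = real N * h"
    and "T = cut_mesh \<Omega> h N"
    and "\<exists>C. C-lipschitz_on (closure \<Omega>) \<beta>"
    and "has_weak_divergence \<Omega> \<beta> (\<lambda>x. 0)"
    and "\<forall>x\<in>ramp L x0 \<gamma>. \<beta> x \<bullet> (sin \<gamma>, - cos \<gamma>) = 0"
    and "\<forall>x\<in>ramp L x0 \<gamma>. \<beta> x \<noteq> 0"
    and "\<forall>E\<in>T. \<forall>e\<in>cell_faces E. \<exists>s. \<forall>x\<in>rel_interior e. sgn (\<beta> x \<bullet> outer_normal E e) = s"
    and "0 < \<tau>"
    and "\<forall>E\<in>stab_cells T h \<beta>. inflow_face \<beta> E \<notin> boundary_faces \<Omega> T
           \<and> outflow_face \<beta> E \<notin> boundary_faces \<Omega> T"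
    and "v \<in> H1 \<Omega>" and "w \<in> piecewise_constant \<Omega> T"
  shows "\<bar>stabilization T h \<tau> \<beta> v w\<bar>
    \<le> sqrt (\<tau> * h) * W1inf_norm \<Omega> \<beta> * H1_norm \<Omega> v * beta_seminorm \<Omega> T h \<tau> \<beta> w"
proof -
  obtain M where M: "M-lipschitz_on (closure \<Omega>) \<beta>" using assms(11) by blast
  interpret ramp_flow L x0 \<gamma> h N \<beta> M
    by unfold_locales (use assms M in simp_all)
  have \<Omega>_def: "\<Omega> = ramp_domain L x0 \<gamma>" and T_def: "T = cut_mesh (ramp_domain L x0 \<gamma>) h N"
    using assms by auto
  have v: "v \<in> H1 (ramp_domain L x0 \<gamma>)" using assms(18) \<Omega>_def by simp
  note bnd = bounded_\<Omega>[folded \<Omega>_def]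
  define B where "B = W1inf_norm \<Omega> \<beta>"
  have B: "norm (\<beta> z) \<le> B" if "z \<in> closure \<Omega>" for z
  proof -
    have "compact ((\<lambda>z. norm (\<beta> z)) ` closure \<Omega>)"
      using bnd lipschitz_on_continuous_on[OF M]
      by (intro compact_continuous_image continuous_intros) (simp_all add: compact_closure)
    then have "norm (\<beta> z) \<le> (SUP x\<in>closure \<Omega>. norm (\<beta> x))"
      by (intro cSUP_upper that bounded_imp_bdd_above compact_imp_bounded)
    then show ?thesis unfolding B_def W1inf_norm_def by simp
  qed
  let ?S = "stab_cells T h \<beta>"
  define \<alpha> where "\<alpha> = capacity \<tau> h \<beta>"
  define F where "F E = flux \<beta> E (outflow_face \<beta> E)" for E
  define J where "J E = jump T \<beta> w (outflow_face \<beta> E)" for E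
  define G where "G E = sqrt (\<Sum>b\<in>Basis. LINT z|lebesgue_on E. (weak_pderiv \<Omega> b v z)\<^sup>2)" for E
  have S_T: "?S \<subseteq> T" by (auto simp: stab_cells_def)
  have facts: "inflow_face \<beta> E \<noteq> outflow_face \<beta> E \<and> F E > 0 \<and> flux \<beta> E (inflow_face \<beta> E) = F E \<and>
      \<bar>LINT x|arc_measure (outflow_face \<beta> E). (mean_in T \<beta> v E - weighted_mean \<beta> v E (outflow_face \<beta> E)) * (\<beta> x \<bullet> J E)\<bar>
       \<le> B * sqrt (measure lebesgue E) * G E * sqrt (J E \<bullet> J E)" if E: "E \<in> ?S" for E
  proof -
    have ET: "E \<in> cut_mesh (ramp_domain L x0 \<gamma>) h N" and sE: "2 simplex (closure E)"
      using E T_def by (auto simp: stab_cells_def)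
    obtain k l where kl: "k < N" "l < N" "E = background_cell h k l \<inter> ramp_domain L x0 \<gamma>"
      using cellD[OF ET] by metis
    interpret cut_cell L x0 \<gamma> h N \<beta> M k l
      by unfold_locales (use kl ET sE in simp_all)
    note cb = cell_bound[OF v B[unfolded \<Omega>_def], folded kl(3) T_def \<Omega>_def]
    show ?thesis unfolding F_def J_def G_def using cb by simp
  qed
  have \<alpha>_bounds: "0 \<le> \<alpha> E" "\<alpha> E \<le> 1" if "E \<in> ?S" for E
    using facts[OF that] assms(8,16) by (auto simp: \<alpha>_def capacity_def)
  have B0: "B \<ge> 0"
  proof -
    have "\<Omega> \<noteq> {}"
    proof -
      \<comment> \<open>Left of the foot of the ramp the ramp line is below zero, so this point is
        in the domain for every angle.\<close>
      have "(x0 / 2, L / 2) \<in> \<Omega>"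
        using L_pos x0 mult_pos_pos[of "x0 / 2" "tan \<gamma>"] tan_pos
        by (simp add: \<Omega>_def ramp_domain_def less_le_trans[of _ 0])
      then show ?thesis by blast
    qed
    then obtain z where "z \<in> closure \<Omega>" using closure_subset[of \<Omega>] by blast
    from order_trans[OF norm_ge_zero B[OF this]] show ?thesis .
  qed
  have G0: "0 \<le> G E" for E unfolding G_def by (intro real_sqrt_ge_zero sum_nonneg) simp
  have summand: "\<bar>(1 - \<alpha> E) * (LINT x|arc_measure (outflow_face \<beta> E).
       (mean_in T \<beta> v E - weighted_mean \<beta> v E (outflow_face \<beta> E)) * (\<beta> x \<bullet> J E))\<bar>
     \<le> sqrt (\<tau> * h) * B * (G E * sqrt (\<alpha> E * F E * (J E \<bullet> J E)))" if E: "E \<in> ?S" for E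
  \<comment> \<open>At full capacity the factor \<open>1 - \<alpha> E\<close> removes the summand.
    Otherwise the minimum in \<open>capacity\<close> is its first argument, which trades area for
    flux; \<open>1 - \<alpha> E\<close> is then bounded by 1.\<close>
  proof (cases "\<alpha> E = 1")
    case True
    have "0 \<le> sqrt (\<tau> * h) * B * (G E * sqrt (\<alpha> E * F E * (J E \<bullet> J E)))"
      using facts[OF E] \<alpha>_bounds[OF E] B0 G0 assms(8,16) by (intro mult_nonneg_nonneg real_sqrt_ge_zero) auto
    then show ?thesis using True by simp
  next
    case False
    then have "\<alpha> E = measure lebesgue E / (\<tau> * h * F E)"
      using facts[OF E] by (auto simp: \<alpha>_def capacity_def min_def split: if_splits)
    then have m: "measure lebesgue E = \<tau> * h * (\<alpha> E * F E)"
      using facts[OF E] assms(8,16) by (simp add: field_simps)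
    have "\<bar>(1 - \<alpha> E) * (LINT x|arc_measure (outflow_face \<beta> E).
       (mean_in T \<beta> v E - weighted_mean \<beta> v E (outflow_face \<beta> E)) * (\<beta> x \<bullet> J E))\<bar>
       \<le> 1 * (B * sqrt (measure lebesgue E) * G E * sqrt (J E \<bullet> J E))"
      unfolding abs_mult using facts[OF E] \<alpha>_bounds[OF E] by (intro mult_mono) auto
    also have "\<dots> = sqrt (\<tau> * h) * B * (G E * sqrt (\<alpha> E * F E * (J E \<bullet> J E)))"
      unfolding m real_sqrt_mult by (simp add: mult_ac)
    finally show ?thesis .
  qed
  have "\<bar>stabilization T h \<tau> \<beta> v w\<bar> \<le> (\<Sum>E\<in>?S. \<bar>(1 - \<alpha> E) * (LINT x|arc_measure (outflow_face \<beta> E).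
       (mean_in T \<beta> v E - weighted_mean \<beta> v E (outflow_face \<beta> E)) * (\<beta> x \<bullet> J E))\<bar>)"
    unfolding stabilization_def \<alpha>_def J_def by (rule sum_abs)
  also have "\<dots> \<le> (\<Sum>E\<in>?S. sqrt (\<tau> * h) * B * (G E * sqrt (\<alpha> E * F E * (J E \<bullet> J E))))"
    by (rule sum_mono[OF summand])
  also have "\<dots> = sqrt (\<tau> * h) * B * (\<Sum>E\<in>?S. G E * sqrt (\<alpha> E * F E * (J E \<bullet> J E)))"
    by (simp add: sum_distrib_left)
  also have "\<dots> \<le> sqrt (\<tau> * h) * B * (H1_norm \<Omega> v * beta_seminorm \<Omega> T h \<tau> \<beta> w)"
  proof (rule mult_left_mono)
    have W0: "0 \<le> \<alpha> E * F E * (J E \<bullet> J E)" if "E \<in> ?S" for E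
      using facts[OF that] \<alpha>_bounds[OF that] by (intro mult_nonneg_nonneg) auto
    have "(\<Sum>E\<in>?S. G E * sqrt (\<alpha> E * F E * (J E \<bullet> J E))) \<le> (\<Sum>E\<in>?S. \<bar>G E\<bar> * \<bar>sqrt (\<alpha> E * F E * (J E \<bullet> J E))\<bar>)"
      using G0 W0 by (intro sum_mono) simp
    also have "\<dots> \<le> L2_set G ?S * L2_set (\<lambda>E. sqrt (\<alpha> E * F E * (J E \<bullet> J E))) ?S"
      by (rule L2_set_mult_ineq)
    also have "\<dots> \<le> H1_norm \<Omega> v * beta_seminorm \<Omega> T h \<tau> \<beta> w"
    proof (rule mult_mono)
      have "(\<Sum>E\<in>?S. (G E)\<^sup>2) = (\<Sum>E\<in>?S. \<Sum>b\<in>Basis. LINT z|lebesgue_on E. (weak_pderiv \<Omega> b v z)\<^sup>2)"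
        unfolding G_def by (intro sum.cong refl real_sqrt_pow2 sum_nonneg) simp
      also have "\<dots> = (\<Sum>b\<in>Basis. \<Sum>E\<in>?S. LINT z|lebesgue_on E. (weak_pderiv \<Omega> b v z)\<^sup>2)" by (rule sum.swap)
      also have "\<dots> \<le> (\<Sum>b\<in>Basis. LINT z|lebesgue_on \<Omega>. (weak_pderiv \<Omega> b v z)\<^sup>2)"
      proof (rule sum_mono)
        fix b :: plane assume b: "b \<in> Basis"
        have "integrable (lebesgue_on \<Omega>) (\<lambda>z. (weak_pderiv \<Omega> b v z)\<^sup>2)"
          using H1_square_integrable(2)[OF assms(18) b] by (simp add: square_integrable_def)
        then show "(\<Sum>E\<in>?S. LINT z|lebesgue_on E. (weak_pderiv \<Omega> b v z)\<^sup>2) \<le> (LINT z|lebesgue_on \<Omega>. (weak_pderiv \<Omega> b v z)\<^sup>2)"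
          using sum_cell_integrals_le[of "\<lambda>z. (weak_pderiv \<Omega> b v z)\<^sup>2" ?S] S_T unfolding \<Omega>_def T_def by simp
      qed
      also have "\<dots> \<le> (LINT z|lebesgue_on \<Omega>. (v z)\<^sup>2) + (\<Sum>b\<in>Basis. LINT z|lebesgue_on \<Omega>. (weak_pderiv \<Omega> b v z)\<^sup>2)" by simp
      finally show "L2_set G ?S \<le> H1_norm \<Omega> v" unfolding L2_set_def H1_norm_def by (rule real_sqrt_le_mono)
      show "L2_set (\<lambda>E. sqrt (\<alpha> E * F E * (J E \<bullet> J E))) ?S \<le> beta_seminorm \<Omega> T h \<tau> \<beta> w"
        unfolding L2_set_def beta_seminorm_def
      proof (rule real_sqrt_le_mono)
        have fl: "0 \<le> flux \<beta> E e" for E e unfolding flux_def by simp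
        have "(\<Sum>E\<in>?S. (sqrt (\<alpha> E * F E * (J E \<bullet> J E)))\<^sup>2) = (\<Sum>E\<in>?S. \<alpha> E * F E * (J E \<bullet> J E))"
          using W0 by (intro sum.cong refl real_sqrt_pow2)
        also have "\<dots> \<le> (\<Sum>E\<in>?S. capacity \<tau> h \<beta> E * (\<Sum>e\<in>{inflow_face \<beta> E, outflow_face \<beta> E}. flux \<beta> E e * (jump T \<beta> w e \<bullet> jump T \<beta> w e))
           + (1 - capacity \<tau> h \<beta> E) * flux \<beta> E (outflow_face \<beta> E) * (mean_out T \<beta> w E - mean_in T \<beta> w E)\<^sup>2)"
        proof (rule sum_mono)
          fix E assume E: "E \<in> ?S"
          \<comment> \<open>Of the seminorm only the outflow jump of each stabilized cell is kept;
            all remaining contributions are nonnegative.\<close>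
          have "F E * (J E \<bullet> J E) \<le> (\<Sum>e\<in>{inflow_face \<beta> E, outflow_face \<beta> E}. flux \<beta> E e * (jump T \<beta> w e \<bullet> jump T \<beta> w e))"
            unfolding F_def J_def using fl
            by (intro member_le_sum[of "outflow_face \<beta> E" _ "\<lambda>e. flux \<beta> E e * (jump T \<beta> w e \<bullet> jump T \<beta> w e)"]) auto
          then have "\<alpha> E * (F E * (J E \<bullet> J E)) \<le> \<alpha> E * (\<Sum>e\<in>{inflow_face \<beta> E, outflow_face \<beta> E}. flux \<beta> E e * (jump T \<beta> w e \<bullet> jump T \<beta> w e))"
            using \<alpha>_bounds(1)[OF E] by (rule mult_left_mono)
          moreover have "0 \<le> (1 - \<alpha> E) * flux \<beta> E (outflow_face \<beta> E) * (mean_out T \<beta> w E - mean_in T \<beta> w E)\<^sup>2"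
            using \<alpha>_bounds(2)[OF E] fl by (intro mult_nonneg_nonneg) auto
          ultimately show "\<alpha> E * F E * (J E \<bullet> J E) \<le> capacity \<tau> h \<beta> E * (\<Sum>e\<in>{inflow_face \<beta> E, outflow_face \<beta> E}. flux \<beta> E e * (jump T \<beta> w e \<bullet> jump T \<beta> w e))
           + (1 - capacity \<tau> h \<beta> E) * flux \<beta> E (outflow_face \<beta> E) * (mean_out T \<beta> w E - mean_in T \<beta> w E)\<^sup>2"
            unfolding \<alpha>_def by (simp only: mult.assoc)
        qed
        finally have "(\<Sum>E\<in>?S. (sqrt (\<alpha> E * F E * (J E \<bullet> J E)))\<^sup>2) \<le> (\<Sum>E\<in>?S. capacity \<tau> h \<beta> E * (\<Sum>e\<in>{inflow_face \<beta> E, outflow_face \<beta> E}. flux \<beta> E e * (jump T \<beta> w e \<bullet> jump T \<beta> w e))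
           + (1 - capacity \<tau> h \<beta> E) * flux \<beta> E (outflow_face \<beta> E) * (mean_out T \<beta> w E - mean_in T \<beta> w E)\<^sup>2)" .
        moreover have "0 \<le> (\<Sum>e\<in>non_io_faces \<Omega> T h \<beta>. face_flux T \<beta> e * (jump T \<beta> w e \<bullet> jump T \<beta> w e))"
          using fl by (intro sum_nonneg mult_nonneg_nonneg) (auto simp: face_flux_def)
        ultimately show "(\<Sum>E\<in>?S. (sqrt (\<alpha> E * F E * (J E \<bullet> J E)))\<^sup>2)
          \<le> (\<Sum>e\<in>non_io_faces \<Omega> T h \<beta>. face_flux T \<beta> e * (jump T \<beta> w e \<bullet> jump T \<beta> w e)) +
          (\<Sum>E\<in>?S. capacity \<tau> h \<beta> E * (\<Sum>e\<in>{inflow_face \<beta> E, outflow_face \<beta> E}. flux \<beta> E e * (jump T \<beta> w e \<bullet> jump T \<beta> w e))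
           + (1 - capacity \<tau> h \<beta> E) * flux \<beta> E (outflow_face \<beta> E) * (mean_out T \<beta> w E - mean_in T \<beta> w E)\<^sup>2)"
          by simp
      qed
    qed (auto simp: H1_norm_nonneg L2_set_nonneg)
    finally show "(\<Sum>E\<in>?S. G E * sqrt (\<alpha> E * F E * (J E \<bullet> J E))) \<le> H1_norm \<Omega> v * beta_seminorm \<Omega> T h \<tau> \<beta> w" .
  qed (use B0 assms(8,16) in simp)
  finally show ?thesis unfolding B_def by (simp only: mult.assoc)
qed

end
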